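(* Let $\mathbb{F}$ be an algebraically closed field of characteristic zero and let $\Gamma_5$ be the fine grading, with universal group $G_5=\mathbb{Z}_2^5\times\mathbb{Z}$, on the Lie algebra $L$ of type $E_6$ described in the context. Identify the Weyl group $\mathcal{W}(\Gamma_5)$ with a subgroup of $\mathrm{Aut}(G_5)$, and elements of $\mathrm{Aut}(G_5)$ with their matrices (by columns, in $1+4+1$ blocks) relative to the canonical basis of $G_5$. Then $\mathcal{W}(\Gamma_5)$ coincides with the set $$\left\{\begin{pmatrix}\bar1&(a\ \ b\ \ c\ \ d)&e\\0&A&\kappa(A)\\0&0&\pm1\end{pmatrix}\;\middle|\; A\in\mathrm{Sp}_4(\mathbb{Z}_2),\ a,b,c,d,e\in\mathbb{Z}_2\right\},$$ where $\mathrm{Sp}_4(\mathbb{Z}_2)=\{A\in\mathrm{Mat}_{4\times4}(\mathbb{Z}_2)\mid ACA^t=C\}$ for $$C=\begin{pmatrix}\bar0&\bar1&\bar1&\bar1\\\bar1&\bar0&\bar1&\bar1\\\bar1&\bar1&\bar0&\bar1\\\bar1&\bar1&\bar1&\bar0\end{pmatrix},$$ $\kappa_0(a_1,a_2,a_3,a_4)=\bar0$ if $|\{i\mid a_i=\bar1\}|\in\{1,2\}$ and $\kappa_0(a_1,a_2,a_3,a_4)=\bar1$ if $|\{i\mid a_i=\bar1\}|\in\{3,4\}$, and for $A=(a_{ij})$, $\kappa(A)$ is the column in $\mathbb{Z}_2^4$ whose $i$-th entry is $\kappa_0(a_{i1},a_{i2},a_{i3},a_{i4})$. Therefore $\ma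thcal{W}(\Gamma_5)\cong(\mathrm{Sp}_4(\mathbb{Z}_2)\times\mathbb{Z}_2)\ltimes\mathbb{Z}_2^5$.
   Context: **Gradings.** For an abelian group $G$, a $G$-grading on an algebra $A$ is a decomposition $\Gamma: A=\bigoplus_{g\in G}A_g$ with $A_gA_h\subseteq A_{g+h}$; $\mathrm{Supp}\,\Gamma=\{g:A_g\ne0\}$. It is fine if it has no proper refinement (a decomposition graded by some abelian group whose components are contained in components of $\Gamma$, some properly). The universal group of $\Gamma$ is the abelian group $G$ realizing $\Gamma$ such that for any other realization over a group $H$ there is a unique homomorphism $G\to H$ restricting to the identity on the support. $\mathrm{Aut}(\Gamma)$ is the group of algebra automorphisms permuting the components, $\mathrm{Stab}(\Gamma)$ the subgroup fixing every component, and $\mathcal{W}(\Gamma)=\mathrm{Aut}(\Gamma)/\mathrm{Stab}(\Gamma)$. Each $f\in\mathrm{Aut}(\Gamma)$ induces $\alpha_f\in\mathrm{Aut}(G)$ ($G$ universal) with $f(A_s)=A_{\alpha_f(s)}$ for $s\in\mathrm{Supp}\,\Gamma$, which identifies $\mathcal{W}(\Gamma)$ with a subgroup of $\mathrm{Aut}(G)$. For $G=\mathbb{Z}_p^m\times\mathbb{Z}^n$, the matrix of $\alpha\in\mathrm{Aut}(G)$ has as $j$-th column the coordinates of the image of the $j$-th canonical basis element; its first $m$ rows have entries in $\mathbb{Z}_p$ and the last $n$ rows in $\mathbb{Z}$. **The Lie algebra $L$.** $V$ is a 6-dimensional vector space over $\mathbb{F}$ with basis $e_1,\dots,e_6$ and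 dual basis $e_1^*,\dots,e_6^*$. $L=L_{-2}\oplus L_{-1}\oplus L_0\oplus L_1\oplus L_2$ with $L_0=\mathfrak{gl}(V)$, $L_1=\bigwedge^3V$, $L_2=\bigwedge^6V$, $L_{-1}=\bigwedge^3V^*$, $L_{-2}=\bigwedge^6V^*$. $L_0$ is a subalgebra acting naturally on the other pieces, and for $u,v\in L_1$, $f,g\in L_{-1}$, $u'\in L_2$, $f'\in L_{-2}$: $[u,v]=\alpha_{1,1}u\wedge v$, $[f,g]=\alpha_{-1,-1}f\wedge g$, $[u,f']=\alpha_{1,-2}\,u\lrcorner f'$, $[u',f]=\alpha_{-1,2}\,u'\llcorner f$, $[u,f]=\alpha_{1,-1}\psi_{f,u}+\beta_1\langle u,f\rangle\mathrm{id}_V$, $[u',f']=\alpha_{2,-2}\psi_{f',u'}+\beta_2\langle u',f'\rangle\mathrm{id}_V$. Here $\langle u_1\wedge\cdots\wedge u_n,f_1\wedge\cdots\wedge f_n\rangle=\det(f_i(u_j))$; $u\lrcorner f'\in L_{-1}$ and $u'\llcorner f\in L_1$ are determined by $\langle w,u\lrcorner f'\rangle=\langle w\wedge u,f'\rangle$ for $w\in L_1$ and $\langle u'\llcorner f,h\rangle=\langle u',f\wedge h\rangle$ for $h\in L_{-1}$; $\psi_{f,u}\in\mathfrak{sl}(V)$ is determined by $\mathrm{tr}(g\psi_{f,u})=\langle g\cdot u,f\rangle$ for all $g\in\mathfrak{sl}(V)$; and the scalars $\alpha_{ij},\beta_i\in\mathbb{F}^\times$ are fixed so that $L$ is a Lie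 algebra of type $E_6$ (such scalars exist). **Automorphisms.** $T_1=\{f_\alpha\mid\alpha\in\mathbb{F}^\times\}$ with $f_\alpha|_{L_n}=\alpha^n\mathrm{id}$. Fix $\mathbf{i}\in\mathbb{F}$ with $\mathbf{i}^2=-1$. $\theta\in\mathrm{Aut}(L)$ is given by $\theta(e_{\sigma(1)}\wedge e_{\sigma(2)}\wedge e_{\sigma(3)})=\mathrm{sg}(\sigma)\,\mathbf{i}\,e_{\sigma(4)}\wedge e_{\sigma(5)}\wedge e_{\sigma(6)}$, $\theta(e^*_{\sigma(1)}\wedge e^*_{\sigma(2)}\wedge e^*_{\sigma(3)})=-\mathrm{sg}(\sigma)\,\mathbf{i}\,e^*_{\sigma(4)}\wedge e^*_{\sigma(5)}\wedge e^*_{\sigma(6)}$ for $\sigma\in S_6$, $\theta(\alpha I_6+A)=\alpha I_6-A^t$ for $\alpha\in\mathbb{F}$, $A\in\mathfrak{sl}(V)$ (matrices in the basis $e_i$), and $\theta|_{L_2\oplus L_{-2}}=-\mathrm{id}$. For $\varphi\in\mathrm{GL}(V)$, $\widetilde\varphi\in\mathrm{Aut}(L)$ is the natural action: $\varphi$ on each factor in $\bigwedge V$, $h\mapsto h\varphi^{-1}$ on each factor in $\bigwedge V^*$, and $F\mapsto\varphi F\varphi^{-1}$ on $L_0$. $f_{ij}$ is the diagonal matrix with $-1$ in positions $i,j$ and $1$ elsewhere. **The grading $\Gamma_5$** is produced by $P_5=\langle\theta,\widetilde f_{12},\widetilde f_{13},\widetilde f_{14},\widetilde f_{15}\rangle\cdot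 T_1$: a homogeneous element of degree $(\bar k_0;\bar k_1,\bar k_2,\bar k_3,\bar k_4;n)\in\mathbb{Z}_2\times\mathbb{Z}_2^4\times\mathbb{Z}$ is an element of $L_n$ on which $\theta$ acts as $(-1)^{k_0}$ and $\widetilde f_{1,i+1}$ acts as $(-1)^{k_i}$ for $i=1,2,3,4$. *)

theory Defs
  imports
    "HOL-Analysis.Determinants"
    "HOL-Algebra.Coset"
    "HOL-Algebra.Bij"
    "HOL-Combinatorics.Permutations"
    "HOL-Computational_Algebra.Polynomial"
    "HOL-Library.Z2"
begin

section \<open>Lie algebras\<close>

text \<open>An algebra lives on a subset of an ambient type, so that it may be a proper subspace of a
  type of coordinate tuples.\<close>

record ('f, 'v) alg =
  acar :: "'v set"
  ascl :: "'f \<Rightarrow> 'v \<Rightarrow> 'v"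
  aprd :: "'v \<Rightarrow> 'v \<Rightarrow> 'v"

definition lie_algebra :: "('f::field, 'v::ab_group_add) alg \<Rightarrow> bool" where
  "lie_algebra A \<longleftrightarrow>
     vector_space (ascl A) \<and> module.subspace (ascl A) (acar A) \<and>
     (\<forall>x\<in>acar A. \<forall>y\<in>acar A. aprd A x y \<in> acar A) \<and>
     (\<forall>x\<in>acar A. \<forall>y\<in>acar A. \<forall>z\<in>acar A.
        aprd A (x + y) z = aprd A x z + aprd A y z \<and>
        aprd A z (x + y) = aprd A z x + aprd A z y) \<and>
     (\<forall>c. \<forall>x\<in>acar A. \<forall>y\<in>acar A.
        aprd A (ascl A c x) y = ascl A c (aprd A x y) \<and>
        aprd A x (ascl A c y) = ascl A c (aprd A x y)) \<and>
     (\<forall>x\<in>acar A. aprd A x x = 0) \<and>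
     (\<forall>x\<in>acar A. \<forall>y\<in>acar A. \<forall>z\<in>acar A.
        aprd A x (aprd A y z) + aprd A y (aprd A z x) + aprd A z (aprd A x y) = 0)"

definition finite_dim :: "('f::field, 'v::ab_group_add) alg \<Rightarrow> bool" where
  "finite_dim A \<longleftrightarrow> (\<exists>B. finite B \<and> acar A = module.span (ascl A) B)"

definition lie_ideal :: "('f::field, 'v::ab_group_add) alg \<Rightarrow> 'v set \<Rightarrow> bool" where
  "lie_ideal A I \<longleftrightarrow> I \<subseteq> acar A \<and> module.subspace (ascl A) I \<and>
     (\<forall>x\<in>acar A. \<forall>y\<in>I. aprd A x y \<in> I)"

definition simple_lie_algebra :: "('f::field, 'v::ab_group_add) alg \<Rightarrow> bool" where
  "simple_lie_algebra A \<longleftrightarrow> lie_algebra A \<and>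
     (\<exists>x\<in>acar A. \<exists>y\<in>acar A. aprd A x y \<noteq> 0) \<and>
     (\<forall>I. lie_ideal A I \<longrightarrow> I = {0} \<or> I = acar A)"

definition cartan_subalgebra :: "('f::field, 'v::ab_group_add) alg \<Rightarrow> 'v set \<Rightarrow> bool" where
  "cartan_subalgebra A H \<longleftrightarrow>
     H \<subseteq> acar A \<and> module.subspace (ascl A) H \<and> (\<forall>x\<in>H. \<forall>y\<in>H. aprd A x y \<in> H) \<and>
     (\<exists>n. \<forall>xs y. length xs = n \<longrightarrow> set xs \<subseteq> H \<longrightarrow> y \<in> H \<longrightarrow> foldr (aprd A) xs y = 0) \<and>
     {x\<in>acar A. \<forall>h\<in>H. aprd A x h \<in> H} = H"

definition root_space :: "('f::field, 'v::ab_group_add) alg \<Rightarrow> 'v set \<Rightarrow> ('v \<Rightarrow> 'f) \<Rightarrow> 'v set" where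
  "root_space A H l = {x\<in>acar A. \<forall>h\<in>H. aprd A h x = ascl A (l h) x}"

definition roots :: "('f::field, 'v::ab_group_add) alg \<Rightarrow> 'v set \<Rightarrow> ('v \<Rightarrow> 'f) set" where
  "roots A H = {l \<in> extensional H.
     (\<forall>h\<in>H. \<forall>k\<in>H. l (h + k) = l h + l k) \<and> (\<forall>c. \<forall>h\<in>H. l (ascl A c h) = c * l h) \<and>
     (\<exists>h\<in>H. l h \<noteq> 0) \<and> root_space A H l \<noteq> {0}}"

definition root_base ::
    "('f::field, 'v::ab_group_add) alg \<Rightarrow> 'v set \<Rightarrow> nat \<Rightarrow> (nat \<Rightarrow> 'v \<Rightarrow> 'f) \<Rightarrow> bool" where
  "root_base A H r a \<longleftrightarrow>
     (\<forall>i\<in>{1..r}. a i \<in> roots A H) \<and>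
     (\<forall>c. (\<forall>h\<in>H. (\<Sum>i=1..r. c i * a i h) = 0) \<longrightarrow> (\<forall>i\<in>{1..r}. c i = 0)) \<and>
     (\<forall>l\<in>roots A H. \<exists>m::nat \<Rightarrow> nat.
        (\<forall>h\<in>H. l h = (\<Sum>i=1..r. of_nat (m i) * a i h)) \<or>
        (\<forall>h\<in>H. l h = - (\<Sum>i=1..r. of_nat (m i) * a i h)))"

text \<open>The witness \<open>t\<close> below is the coroot of \<open>a i\<close>: it lies in
  \<open>[L\<^sub>a, L\<^sub>-\<^sub>a]\<close> and \<open>a i t = 2\<close>.\<close>

definition simple_of_cartan_type ::
    "nat \<Rightarrow> (nat \<Rightarrow> nat \<Rightarrow> int) \<Rightarrow> ('f::field, 'v::ab_group_add) alg \<Rightarrow> bool" where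
  "simple_of_cartan_type r C A \<longleftrightarrow> simple_lie_algebra A \<and> finite_dim A \<and>
     (\<exists>H a. cartan_subalgebra A H \<and> root_base A H r a \<and>
       (\<forall>i\<in>{1..r}. \<exists>x\<in>root_space A H (a i). \<exists>y\<in>root_space A H (\<lambda>h. - a i h). \<exists>t.
          t = aprd A x y \<and> t \<in> H \<and> a i t = 2 \<and> (\<forall>j\<in>{1..r}. a j t = of_int (C i j))))"

definition cartan_matrix_E6 :: "nat \<Rightarrow> nat \<Rightarrow> int" where
  "cartan_matrix_E6 i j = (if i = j then 2
     else if {i, j} \<in> {{1,3}, {3,4}, {4,5}, {5,6}, {2,4}} then -1 else 0)"

definition lie_algebra_of_type_E6 :: "('f::field, 'v::ab_group_add) alg \<Rightarrow> bool" where
  "lie_algebra_of_type_E6 A \<longleftrightarrow> simple_of_cartan_type 6 cartan_matrix_E6 A"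


section \<open>Gradings and their Weyl groups\<close>

definition is_grading ::
    "('g, 'b) monoid_scheme \<Rightarrow> ('f::field, 'v::ab_group_add) alg \<Rightarrow> ('g \<Rightarrow> 'v set) \<Rightarrow> bool" where
  "is_grading G A \<Gamma> \<longleftrightarrow> comm_group G \<and>
     (\<forall>g\<in>carrier G. \<Gamma> g \<subseteq> acar A \<and> module.subspace (ascl A) (\<Gamma> g)) \<and>
     (\<forall>x\<in>acar A. \<exists>!c. (\<forall>g\<in>carrier G. c g \<in> \<Gamma> g) \<and> (\<forall>g. g \<notin> carrier G \<longrightarrow> c g = 0) \<and>
        finite {g. c g \<noteq> 0} \<and> x = (\<Sum>g | c g \<noteq> 0. c g)) \<and>
     (\<forall>g\<in>carrier G. \<forall>h\<in>carrier G. \<forall>x\<in>\<Gamma> g. \<forall>y\<in>\<Gamma> h. aprd A x y \<in> \<Gamma> (g \<otimes>\<^bsub>G\<^esub> h))"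

definition Supp :: "('g, 'b) monoid_scheme \<Rightarrow> ('g \<Rightarrow> 'v::zero set) \<Rightarrow> 'g set" where
  "Supp G \<Gamma> = {g\<in>carrier G. \<Gamma> g \<noteq> {0}}"

definition components :: "('g, 'b) monoid_scheme \<Rightarrow> ('g \<Rightarrow> 'v::zero set) \<Rightarrow> 'v set set" where
  "components G \<Gamma> = \<Gamma> ` Supp G \<Gamma>"

text \<open>HOL cannot quantify over types inside a formula.  The grading groups ranging over "all abelian
  groups" are those carried by subsets of \<open>'h\<close>; leaving \<open>'h\<close> a type variable of a theorem
  gives the full strength.\<close>

definition fine_grading ::
    "'h itself \<Rightarrow> ('g, 'b) monoid_scheme \<Rightarrow> ('f::field, 'v::ab_group_add) alg \<Rightarrow>
     ('g \<Rightarrow> 'v set) \<Rightarrow> bool" where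
  "fine_grading _ G A \<Gamma> \<longleftrightarrow> is_grading G A \<Gamma> \<and>
     \<not> (\<exists>(H::'h monoid) \<Delta>. is_grading H A \<Delta> \<and>
          (\<forall>D\<in>components H \<Delta>. \<exists>C\<in>components G \<Gamma>. D \<subseteq> C) \<and>
          (\<exists>D\<in>components H \<Delta>. \<exists>C\<in>components G \<Gamma>. D \<subset> C))"

definition is_universal_group ::
    "'h itself \<Rightarrow> ('g, 'b) monoid_scheme \<Rightarrow> ('f::field, 'v::ab_group_add) alg \<Rightarrow>
     ('g \<Rightarrow> 'v set) \<Rightarrow> bool" where
  "is_universal_group _ G A \<Gamma> \<longleftrightarrow> is_grading G A \<Gamma> \<and>
     (\<forall>(H::'h monoid) \<Delta>. is_grading H A \<Delta> \<longrightarrow> components H \<Delta> = components G \<Gamma> \<longrightarrow>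
        (\<exists>!\<phi>. \<phi> \<in> extensional (carrier G) \<and> \<phi> \<in> hom G H \<and>
              (\<forall>s\<in>Supp G \<Gamma>. \<Delta> (\<phi> s) = \<Gamma> s)))"

definition alg_aut :: "('f, 'v::plus) alg \<Rightarrow> ('v \<Rightarrow> 'v) set" where
  "alg_aut A = {f \<in> Bij (acar A).
     (\<forall>x\<in>acar A. \<forall>y\<in>acar A. f (x + y) = f x + f y) \<and>
     (\<forall>c. \<forall>x\<in>acar A. f (ascl A c x) = ascl A c (f x)) \<and>
     (\<forall>x\<in>acar A. \<forall>y\<in>acar A. f (aprd A x y) = aprd A (f x) (f y))}"

definition Aut_grading ::
    "('g, 'b) monoid_scheme \<Rightarrow> ('f, 'v::ab_group_add) alg \<Rightarrow> ('g \<Rightarrow> 'v set) \<Rightarrow> ('v \<Rightarrow> 'v) set" where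
  "Aut_grading G A \<Gamma> = {f \<in> alg_aut A. (\<lambda>X. f ` X) ` components G \<Gamma> = components G \<Gamma>}"

definition Stab_grading ::
    "('g, 'b) monoid_scheme \<Rightarrow> ('f, 'v::ab_group_add) alg \<Rightarrow> ('g \<Rightarrow> 'v set) \<Rightarrow> ('v \<Rightarrow> 'v) set" where
  "Stab_grading G A \<Gamma> = {f \<in> alg_aut A. \<forall>X\<in>components G \<Gamma>. f ` X = X}"

definition weyl_group ::
    "('g, 'b) monoid_scheme \<Rightarrow> ('f, 'v::ab_group_add) alg \<Rightarrow> ('g \<Rightarrow> 'v set) \<Rightarrow>
     ('v \<Rightarrow> 'v) set monoid" where
  "weyl_group G A \<Gamma> =
     (BijGroup (acar A) \<lparr>carrier := Aut_grading G A \<Gamma>\<rparr>) Mod Stab_grading G A \<Gamma>"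

definition induces ::
    "('g, 'b) monoid_scheme \<Rightarrow> ('g \<Rightarrow> 'v::zero set) \<Rightarrow> ('v \<Rightarrow> 'v) \<Rightarrow> ('g \<Rightarrow> 'g) \<Rightarrow> bool" where
  "induces G \<Gamma> f \<phi> \<longleftrightarrow> \<phi> \<in> auto G \<and> (\<forall>s\<in>Supp G \<Gamma>. f ` \<Gamma> s = \<Gamma> (\<phi> s))"

definition weyl_embedding ::
    "('g, 'b) monoid_scheme \<Rightarrow> ('g \<Rightarrow> 'v::zero set) \<Rightarrow> ('v \<Rightarrow> 'v) set \<Rightarrow> 'g \<Rightarrow> 'g" where
  "weyl_embedding G \<Gamma> w = (THE \<phi>. \<forall>f\<in>w. induces G \<Gamma> f \<phi>)"


section \<open>The exterior algebra\<close>

text \<open>\<open>\<And>V\<close> for \<open>V = 'f ^ 'n\<close> in coordinates: \<open>x $ S\<close> is the coefficient of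
  \<open>e\<^sub>S = e\<^sub>i \<and> e\<^sub>j \<and> \<dots>\<close>, where \<open>S = {i < j < \<dots>}\<close>.  The order on \<open>'n\<close> only fixes the
  signs of the basis vectors \<open>e\<^sub>S\<close>; for the index type \<open>6\<close>, where \<open>6 = 0\<close>, it is
  \<open>6 < 1 < 2 < 3 < 4 < 5\<close>.  The same type serves for \<open>\<And>V*\<close>, with respect to the dual basis.\<close>

definition ext_sign :: "'n::linorder set \<Rightarrow> 'n set \<Rightarrow> 'f::comm_ring_1" where
  "ext_sign S T = (-1) ^ card {(s, t). s \<in> S \<and> t \<in> T \<and> t < s}"

definition wedge ::
    "'f::comm_ring_1 ^ ('n::{finite,linorder} set) \<Rightarrow> 'f ^ ('n set) \<Rightarrow> 'f ^ ('n set)" where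
  "wedge x y = (\<chi> U. \<Sum>S\<in>Pow U. ext_sign S (U - S) * x $ S * y $ (U - S))"

definition ext_vec :: "'f::comm_ring_1 ^ 'n::{finite,linorder} \<Rightarrow> 'f ^ ('n set)" where
  "ext_vec v = (\<Sum>i\<in>UNIV. v $ i *s axis {i} 1)"

definition wedge_list :: "('f::comm_ring_1 ^ 'n::{finite,linorder}) list \<Rightarrow> 'f ^ ('n set)" where
  "wedge_list vs = foldr (\<lambda>v. wedge (ext_vec v)) vs (axis {} 1)"

definition ext_pow :: "nat \<Rightarrow> ('f::comm_ring_1 ^ ('n::{finite,linorder} set)) set" where
  "ext_pow k = {x. \<forall>S. x $ S \<noteq> 0 \<longrightarrow> card S = k}"

abbreviation basis_vec :: "'n::{finite,linorder} \<Rightarrow> 'f::comm_ring_1 ^ 'n::{finite,linorder}" where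
  "basis_vec i \<equiv> axis i 1"

text \<open>Linear extensions of \<open>\<phi>(v\<^sub>1 \<and> \<dots> \<and> v\<^sub>k) = \<phi>v\<^sub>1 \<and> \<dots> \<and> \<phi>v\<^sub>k\<close> and of
  \<open>A(v\<^sub>1 \<and> \<dots> \<and> v\<^sub>k) = \<Sum>\<^sub>j v\<^sub>1 \<and> \<dots> \<and> Av\<^sub>j \<and> \<dots> \<and> v\<^sub>k\<close>.\<close>

definition ext_map ::
    "'f::comm_ring_1 ^ 'n::{finite,linorder} ^ 'n::{finite,linorder} \<Rightarrow> 'f ^ ('n set) \<Rightarrow> 'f ^ ('n set)" where
  "ext_map \<phi> x =
     (\<Sum>S\<in>UNIV. x $ S *s wedge_list (map (\<lambda>i. \<phi> *v basis_vec i) (sorted_list_of_set S)))"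

definition ext_der ::
    "'f::comm_ring_1 ^ 'n::{finite,linorder} ^ 'n::{finite,linorder} \<Rightarrow> 'f ^ ('n set) \<Rightarrow> 'f ^ ('n set)" where
  "ext_der A x = (\<Sum>S\<in>UNIV. x $ S *s (\<Sum>j<card S. wedge_list
     ((map basis_vec (sorted_list_of_set S))[j := A *v basis_vec (sorted_list_of_set S ! j)])))"

text \<open>The bases \<open>(e\<^sub>S)\<close> and \<open>(e\<^sub>S*)\<close> are dual to each other under
  \<open>\<langle>u\<^sub>1 \<and> \<dots> \<and> u\<^sub>k, f\<^sub>1 \<and> \<dots> \<and> f\<^sub>k\<rangle> = det (f\<^sub>i (u\<^sub>j))\<close>.\<close>

definition pairing ::
    "'f::comm_ring_1 ^ ('n::{finite,linorder} set) \<Rightarrow> 'f ^ ('n set) \<Rightarrow> 'f" where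
  "pairing x f = (\<Sum>S\<in>UNIV. x $ S * f $ S)"

text \<open>The contragredient actions on \<open>V*\<close>: the coordinates of \<open>h \<circ> \<phi>\<^sup>-\<^sup>1\<close> and of
  \<open>- h \<circ> A\<close> in the dual basis.\<close>

definition dual_map :: "'f::comm_ring_1 ^ 'n ^ 'n \<Rightarrow> 'f ^ 'n ^ 'n" where
  "dual_map \<phi> = transpose (matrix_inv \<phi>)"

definition dual_der :: "'f::comm_ring_1 ^ 'n ^ 'n \<Rightarrow> 'f ^ 'n ^ 'n" where
  "dual_der A = - transpose A"


section \<open>The Lie algebra \<open>L\<close>\<close>

type_synonym 'f ext6 = "'f ^ (6 set)"

text \<open>Tuples list the components in \<open>L\<^sub>-\<^sub>2, L\<^sub>-\<^sub>1, L\<^sub>0, L\<^sub>1, L\<^sub>2\<close>, in this order.\<close>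

type_synonym 'f e6 = "'f ext6 \<times> 'f ext6 \<times> ('f ^ 6 ^ 6) \<times> 'f ext6 \<times> 'f ext6"

definition mat_scale :: "'f::times \<Rightarrow> 'f ^ 'n ^ 'm \<Rightarrow> 'f ^ 'n ^ 'm" where
  "mat_scale c A = (\<chi> i j. c * A $ i $ j)"

definition rcontract :: "'f::field ext6 \<Rightarrow> 'f ext6 \<Rightarrow> 'f ext6" where
  "rcontract u f' = (THE h. h \<in> ext_pow 3 \<and>
     (\<forall>w\<in>ext_pow 3. pairing w h = pairing (wedge w u) f'))"

definition lcontract :: "'f::field ext6 \<Rightarrow> 'f ext6 \<Rightarrow> 'f ext6" where
  "lcontract u' f = (THE w. w \<in> ext_pow 3 \<and>
     (\<forall>h\<in>ext_pow 3. pairing w h = pairing u' (wedge f h)))"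

definition psi :: "'f::field ext6 \<Rightarrow> 'f ext6 \<Rightarrow> 'f ^ 6 ^ 6" where
  "psi f u = (THE B. trace B = 0 \<and>
     (\<forall>g. trace g = 0 \<longrightarrow> trace (g ** B) = pairing (ext_der g u) f))"

definition e6_carrier :: "'f::field e6 set" where
  "e6_carrier = {(f', f, A, u, u').
     f' \<in> ext_pow 6 \<and> f \<in> ext_pow 3 \<and> u \<in> ext_pow 3 \<and> u' \<in> ext_pow 6}"

definition e6_part :: "int \<Rightarrow> 'f::field e6 set" where
  "e6_part n = {(f', f, A, u, u') \<in> e6_carrier.
     (f' \<noteq> 0 \<longrightarrow> n = -2) \<and> (f \<noteq> 0 \<longrightarrow> n = -1) \<and> (A \<noteq> 0 \<longrightarrow> n = 0) \<and>
     (u \<noteq> 0 \<longrightarrow> n = 1) \<and> (u' \<noteq> 0 \<longrightarrow> n = 2)}"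

fun e6_scale :: "'f::field \<Rightarrow> 'f e6 \<Rightarrow> 'f e6" where
  "e6_scale c (f', f, A, u, u') = (c *s f', c *s f, mat_scale c A, c *s u, c *s u')"

fun e6_bracket :: "(int \<Rightarrow> int \<Rightarrow> 'f) \<Rightarrow> (int \<Rightarrow> 'f) \<Rightarrow> 'f::field e6 \<Rightarrow> 'f e6 \<Rightarrow> 'f e6" where
  "e6_bracket \<alpha> \<beta> (f', f, A, u, u') (g', g, B, v, v') =
    (ext_der (dual_der A) g' - ext_der (dual_der B) f'
       + \<alpha> (-1) (-1) *s wedge f g,
     ext_der (dual_der A) g - ext_der (dual_der B) f
       + \<alpha> 1 (-2) *s (rcontract u g' - rcontract v f'),
     A ** B - B ** A
       + mat_scale (\<alpha> 1 (-1)) (psi g u - psi f v)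
       + mat (\<beta> 1 * (pairing u g - pairing v f))
       + mat_scale (\<alpha> 2 (-2)) (psi g' u' - psi f' v')
       + mat (\<beta> 2 * (pairing u' g' - pairing v' f')),
     ext_der A v - ext_der B u
       + \<alpha> (-1) 2 *s (lcontract u' g - lcontract v' f),
     ext_der A v' - ext_der B u'
       + \<alpha> 1 1 *s wedge u v)"

definition e6_algebra ::
    "(int \<Rightarrow> int \<Rightarrow> 'f) \<Rightarrow> (int \<Rightarrow> 'f) \<Rightarrow> ('f::field, 'f e6) alg" where
  "e6_algebra \<alpha> \<beta> = \<lparr>acar = e6_carrier, ascl = e6_scale, aprd = e6_bracket \<alpha> \<beta>\<rparr>"

definition e6_scalars :: "(int \<Rightarrow> int \<Rightarrow> 'f::field) \<Rightarrow> (int \<Rightarrow> 'f) \<Rightarrow> bool" where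
  "e6_scalars \<alpha> \<beta> \<longleftrightarrow>
     \<alpha> 1 1 \<noteq> 0 \<and> \<alpha> (-1) (-1) \<noteq> 0 \<and> \<alpha> 1 (-2) \<noteq> 0 \<and> \<alpha> (-1) 2 \<noteq> 0 \<and>
     \<alpha> 1 (-1) \<noteq> 0 \<and> \<alpha> 2 (-2) \<noteq> 0 \<and> \<beta> 1 \<noteq> 0 \<and> \<beta> 2 \<noteq> 0 \<and>
     lie_algebra_of_type_E6 (e6_algebra \<alpha> \<beta>)"


section \<open>The grading \<open>\<Gamma>\<^sub>5\<close>\<close>

definition is_theta :: "'f::field \<Rightarrow> ('f e6 \<Rightarrow> 'f e6) \<Rightarrow> bool" where
  "is_theta \<iota> \<theta> \<longleftrightarrow> \<theta> \<in> extensional e6_carrier \<and>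
     (\<forall>x\<in>e6_carrier. \<forall>y\<in>e6_carrier. \<theta> (x + y) = \<theta> x + \<theta> y) \<and>
     (\<forall>c. \<forall>x\<in>e6_carrier. \<theta> (e6_scale c x) = e6_scale c (\<theta> x)) \<and>
     (\<forall>\<sigma>. \<sigma> permutes (UNIV :: 6 set) \<longrightarrow>
        \<theta> (0, 0, 0, wedge_list [basis_vec (\<sigma> 1), basis_vec (\<sigma> 2), basis_vec (\<sigma> 3)], 0) =
          (0, 0, 0, (of_int (sign \<sigma>) * \<iota>) *s
             wedge_list [basis_vec (\<sigma> 4), basis_vec (\<sigma> 5), basis_vec (\<sigma> 6)], 0) \<and>
        \<theta> (0, wedge_list [basis_vec (\<sigma> 1), basis_vec (\<sigma> 2), basis_vec (\<sigma> 3)], 0, 0, 0) =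
          (0, (- of_int (sign \<sigma>) * \<iota>) *s
             wedge_list [basis_vec (\<sigma> 4), basis_vec (\<sigma> 5), basis_vec (\<sigma> 6)], 0, 0, 0)) \<and>
     (\<forall>a A. trace A = 0 \<longrightarrow>
        \<theta> (0, 0, mat a + A, 0, 0) = (0, 0, mat a - transpose A, 0, 0)) \<and>
     (\<forall>f'\<in>ext_pow 6. \<forall>u'\<in>ext_pow 6. \<theta> (f', 0, 0, 0, u') = (- f', 0, 0, 0, - u'))"

definition theta :: "'f::field \<Rightarrow> 'f e6 \<Rightarrow> 'f e6" where
  "theta \<iota> = (THE \<theta>. is_theta \<iota> \<theta>)"

fun tilde :: "'f::field ^ 6 ^ 6 \<Rightarrow> 'f e6 \<Rightarrow> 'f e6" where
  "tilde \<phi> (f', f, A, u, u') =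
     (ext_map (dual_map \<phi>) f', ext_map (dual_map \<phi>) f, \<phi> ** A ** matrix_inv \<phi>,
      ext_map \<phi> u, ext_map \<phi> u')"

definition f_diag :: "6 \<Rightarrow> 6 \<Rightarrow> 'f::field ^ 6 ^ 6" where
  "f_diag i j = (\<chi> a b. if a = b then (if a = i \<or> a = j then -1 else 1) else 0)"

definition bit_sign :: "bit \<Rightarrow> 'f::field" where
  "bit_sign k = (if k = 1 then -1 else 1)"

definition additive_group :: "'a::ab_group_add monoid" where
  "additive_group = \<lparr>carrier = UNIV, monoid.mult = (+), one = 0\<rparr>"

type_synonym g5 = "bit \<times> (bit ^ 4) \<times> int"

abbreviation G5 :: "g5 monoid" where
  "G5 \<equiv> additive_group"

fun Gamma5 :: "'f::field \<Rightarrow> g5 \<Rightarrow> 'f e6 set" where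
  "Gamma5 \<iota> (k0, k, n) = {x \<in> e6_part n.
     theta \<iota> x = e6_scale (bit_sign k0) x \<and>
     tilde (f_diag 1 2) x = e6_scale (bit_sign (k $ 1)) x \<and>
     tilde (f_diag 1 3) x = e6_scale (bit_sign (k $ 2)) x \<and>
     tilde (f_diag 1 4) x = e6_scale (bit_sign (k $ 3)) x \<and>
     tilde (f_diag 1 5) x = e6_scale (bit_sign (k $ 4)) x}"


section \<open>The matrix description\<close>

text \<open>A matrix in \<open>1 + 4 + 1\<close> blocks is a triple of block rows: the first five rows have entries
  in \<open>\<int>\<^sub>2\<close>, the last one in \<open>\<int>\<close>.\<close>

type_synonym block_mat =
  "(bit \<times> (bit ^ 4) \<times> bit) \<times> ((bit ^ 4) \<times> (bit ^ 4 ^ 4) \<times> (bit ^ 4)) \<times> (int \<times> (int ^ 4) \<times> int)"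

definition block_matrix :: "(g5 \<Rightarrow> g5) \<Rightarrow> block_mat" where
  "block_matrix \<phi> =
    (let a = \<phi> (1, 0, 0); b = (\<lambda>j. \<phi> (0, axis j 1, 0)); c = \<phi> (0, 0, 1) in
     ((fst a,       (\<chi> j. fst (b j)),                fst c),
      (fst (snd a), (\<chi> i j. fst (snd (b j)) $ i),    fst (snd c)),
      (snd (snd a), (\<chi> j. snd (snd (b j))),          snd (snd c))))"

definition C4 :: "bit ^ 4 ^ 4" where
  "C4 = (\<chi> i j. if i = j then 0 else 1)"

definition Sp4 :: "(bit ^ 4 ^ 4) set" where
  "Sp4 = {A. A ** C4 ** transpose A = C4}"

text \<open>The value \<open>0\<close> at the zero row is a dummy: no matrix in \<open>Sp4\<close> has a zero row.\<close>

definition kappa0 :: "bit ^ 4 \<Rightarrow> bit" where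
  "kappa0 a = (if card {i. a $ i = 1} \<in> {3, 4} then 1 else 0)"

definition kappa :: "bit ^ 4 ^ 4 \<Rightarrow> bit ^ 4" where
  "kappa A = (\<chi> i. kappa0 (A $ i))"

definition Sp4_group :: "(bit ^ 4 ^ 4) monoid" where
  "Sp4_group = \<lparr>carrier = Sp4, monoid.mult = (**), one = mat 1\<rparr>"

text \<open>\<open>K \<ltimes> N\<close> for an action \<open>\<rho>\<close> of \<open>K\<close> on \<open>N\<close> by automorphisms.\<close>

definition semidirect_product ::
    "('k, 'a) monoid_scheme \<Rightarrow> ('n, 'b) monoid_scheme \<Rightarrow> ('k \<Rightarrow> 'n \<Rightarrow> 'n) \<Rightarrow> ('k \<times> 'n) monoid" where
  "semidirect_product K N \<rho> =
     \<lparr>carrier = carrier K \<times> carrier N,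
      monoid.mult = (\<lambda>(k, x) (l, y). (k \<otimes>\<^bsub>K\<^esub> l, x \<otimes>\<^bsub>N\<^esub> \<rho> k y)),
      one = (\<one>\<^bsub>K\<^esub>, \<one>\<^bsub>N\<^esub>)\<rparr>"

end

theory Submission
  imports Defs
begin

text \<open>In coordinates \<open>\<theta>\<close> acts on \<open>L\<^sub>\<plusminus>\<^sub>1\<close> as a multiple of the Hodge star, and the degree of
  \<open>e\<^sub>S\<close> with respect to the \<open>f\<^sub>1\<^sub>i\<close> depends only on the class of \<open>S\<close> up to complement.  All
  components are lines, except for the traceless diagonal matrices in degree \<open>(1, 0, 0)\<close>.  A group
  grading with smaller components would still separate the matrices \<open>E\<^sub>i\<^sub>j \<plusminus> E\<^sub>j\<^sub>i\<close>, whose brackets force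
  the diagonal matrices into one degree; hence fineness, and the products of nonzero components
  present the universal group.

  An induced automorphism of \<open>G\<^sub>5\<close> fixes \<open>(1, 0, 0)\<close> and permutes the degrees \<open>(k\<^sub>0, k, \<plusminus>1)\<close> of the
  support, which are those with \<open>q(k) = \<Sum>\<^sub>i\<^sub><\<^sub>j k\<^sub>i k\<^sub>j = 1\<close>.  As \<open>C\<close> is the polarization of \<open>q\<close>, the
  linear part \<open>A\<close> is symplectic, and the translation part is the only \<open>c\<close> with
  \<open>q(A k + c) = q(k)\<close>, namely \<open>\<kappa>(A)\<close>.  Conversely, a rotation by a right angle in the plane of
  \<open>e\<^sub>i\<close> and \<open>e\<^sub>j\<close>, written as a polynomial in \<open>ad X\<close>, induces the transvection at the class of
  \<open>{i, j}\<close>; these generate the symplectic group, two such rotations differ by the shifts of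
  \<open>k\<^sub>0\<close>, and the exchange of \<open>L\<^sub>n\<close> with \<open>L\<^sub>-\<^sub>n\<close> gives the sign.\<close>

section \<open>Coordinates in the exterior algebra\<close>

text \<open>That \<open>L\<close> is a Lie algebra is part of the hypothesis
  \<open>e6_scalars\<close>, and the proof exploits this: the commutator rule for
  \<open>ext_der\<close>, its adjoint under \<open>pairing\<close>, its commutation with the star,
  the trace on the top power and the relation between the scalars are all read off from components
  of the Jacobi identity. Only diagonal matrices are applied to the \<open>e_S\<close> by direct
  computation; off-diagonal matrix units are controlled by weights and sl2 relations, so their signs
  on basis vectors never appear. The obstacle is to produce automorphisms from non-diagonal
  matrices, where functoriality of \<open>ext_map\<close> would require those signs. Quarter turns
  avoid it: if X^3 = -X both on V and on 3-vectors, then 1 + X + X^2 plays the role of exp(pi X / 2)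
  in both representations, and their compatibility is an identity between polynomials in ad X. The
  square of a quarter turn is some \<open>f_diag i j\<close>, which also makes \<open>tilde\<close>
  of that matrix an automorphism. The index 6 is 0 in the type \<open>6\<close>. It is the base
  point of the classes, with \<open>cl 0 = 0\<close>, and therefore often needs separate
  treatment.\<close>

lemma axis_scale: "c *s axis S a = axis S (c * a :: 'f::comm_ring_1)"
  by (simp add: vec_eq_iff axis_def)

lemma axis_zero [simp]: "axis S (0::'f::comm_ring_1) = 0"
  by (simp add: vec_eq_iff axis_def)

lemma axis_expansion: "(\<Sum>S\<in>UNIV. axis S (x $ S)) = (x :: 'f::comm_ring_1 ^ 'n)"
  by (simp add: vec_eq_iff axis_def if_distrib cong: if_cong)

lemma ext_vec_axis: "ext_vec (axis i c) = axis {i} (c::'f::comm_ring_1)"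
proof -
  have "ext_vec (axis i c) = (\<Sum>j\<in>UNIV. if j = i then axis {i} c else 0)"
    unfolding ext_vec_def by (intro sum.cong refl) (auto simp: vec_eq_iff axis_def)
  then show ?thesis by simp
qed

lemma ext_vec_add: "ext_vec (v + w) = ext_vec v + ext_vec w"
  by (simp add: ext_vec_def vec_eq_iff algebra_simps sum.distrib)

lemma ext_vec_scale: "ext_vec (c *s v) = c *s ext_vec v"
  by (simp add: ext_vec_def vec_eq_iff sum_distrib_left algebra_simps)

lemma wedge_add_left: "wedge (x + y) z = wedge x z + wedge y z"
  by (simp add: wedge_def vec_eq_iff algebra_simps sum.distrib)

lemma wedge_add_right: "wedge z (x + y) = wedge z x + wedge z y"
  by (simp add: wedge_def vec_eq_iff algebra_simps sum.distrib)

lemma wedge_scale_left: "wedge (c *s x) y = c *s wedge x y"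
  by (simp add: wedge_def vec_eq_iff sum_distrib_left algebra_simps)

lemma wedge_scale_right: "wedge x (c *s y) = c *s wedge x y"
  by (simp add: wedge_def vec_eq_iff sum_distrib_left algebra_simps)

lemma wedge_axis:
  "wedge (axis S a) (axis T b) =
    (if S \<inter> T = {} then axis (S \<union> T) (ext_sign S T * a * (b::'f::comm_ring_1)) else 0)"
proof -
  have "wedge (axis S a) (axis T b) $ U =
      (if S \<inter> T = {} \<and> U = S \<union> T then ext_sign S T * a * b else 0)" for U
  proof -
    have "wedge (axis S a) (axis T b) $ U =
        (\<Sum>R\<in>Pow U. if R = S then ext_sign S (U - S) * a * (if U - S = T then b else 0) else 0)"
      unfolding wedge_def axis_def vec_lambda_beta by (rule sum.cong) auto
    also have "\<dots> = (if S \<in> Pow U then ext_sign S (U - S) * a * (if U - S = T then b else 0) else 0)"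
      by (simp add: sum.delta' sum.delta)
    also have "\<dots> = (if S \<inter> T = {} \<and> U = S \<union> T then ext_sign S T * a * b else 0)"
      by auto
    finally show ?thesis .
  qed
  then show ?thesis by (simp add: vec_eq_iff axis_def)
qed

lemma wedge_list_Cons: "wedge_list (v # vs) = wedge (ext_vec v) (wedge_list vs)"
  by (simp add: wedge_list_def)

lemma wedge_list_Nil: "wedge_list [] = axis {} 1"
  by (simp add: wedge_list_def)

lemma wedge_list_update_add:
  "j < length vs \<Longrightarrow> wedge_list (vs[j := v + w]) = wedge_list (vs[j := v]) + wedge_list (vs[j := w])"
proof (induction vs arbitrary: j)
  case (Cons a vs)
  then show ?case
    by (cases j) (simp_all add: wedge_list_Cons ext_vec_add wedge_add_left wedge_add_right)
qed simp

lemma wedge_list_update_scale: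
  "j < length vs \<Longrightarrow> wedge_list (vs[j := c *s v]) = c *s wedge_list (vs[j := v])"
proof (induction vs arbitrary: j)
  case (Cons a vs)
  then show ?case
    by (cases j) (simp_all add: wedge_list_Cons ext_vec_scale wedge_scale_left wedge_scale_right)
qed simp

lemma ext_sign_eq_1: "(\<And>s t. s \<in> S \<Longrightarrow> t \<in> T \<Longrightarrow> \<not> t < s) \<Longrightarrow> ext_sign S T = 1"
proof -
  assume "\<And>s t. s \<in> S \<Longrightarrow> t \<in> T \<Longrightarrow> \<not> t < s"
  then have "{(s, t). s \<in> S \<and> t \<in> T \<and> t < s} = {}" by auto
  then show ?thesis by (simp only: ext_sign_def card.empty power_0)
qed

lemma wedge_list_sorted_wrt:
  "sorted_wrt (<) xs \<Longrightarrow>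
    wedge_list (map (\<lambda>i. axis i (c i)) xs) = axis (set xs) (\<Prod>i\<in>set xs. c i :: 'f::comm_ring_1)"
proof (induction xs)
  case (Cons x xs)
  have "ext_sign {x} (set xs) = (1::'f)"
    using Cons.prems by (intro ext_sign_eq_1) auto
  moreover have "x \<notin> set xs" using Cons.prems by auto
  ultimately show ?case
    using Cons by (simp add: wedge_list_Cons ext_vec_axis wedge_axis)
qed (simp add: wedge_list_Nil)

lemma sorted_wrt_sorted_list_of_set: "sorted_wrt (<) (sorted_list_of_set S)"
  by (simp add: strict_sorted_list_of_set)

lemma wedge_list_sorted_list_of_set:
  fixes S :: "'n::{finite,linorder} set"
  shows "wedge_list (map (\<lambda>i. axis i (c i)) (sorted_list_of_set S))
    = axis S (\<Prod>i\<in>S. c i :: 'f::comm_ring_1)"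
  using wedge_list_sorted_wrt[OF sorted_wrt_sorted_list_of_set[of S], of c] by simp

section \<open>Derivations, diagonal matrices and the pairing\<close>

definition slot_der ::
    "'f::comm_ring_1 ^ 'n::{finite,linorder} ^ 'n::{finite,linorder} \<Rightarrow> 'n set \<Rightarrow> 'f ^ ('n set)" where
  "slot_der A S = (\<Sum>j<card S. wedge_list
     ((map basis_vec (sorted_list_of_set S))[j := A *v basis_vec (sorted_list_of_set S ! j)]))"

lemma ext_der_slot: "ext_der A x = (\<Sum>S\<in>UNIV. x $ S *s slot_der A S)"
  by (simp add: ext_der_def slot_der_def)

lemma slot_der_add: "slot_der (A + B) S = slot_der A S + slot_der B S"
  unfolding slot_der_def sum.distrib[symmetric]
  by (intro sum.cong refl) (simp add: matrix_vector_mult_add_rdistrib wedge_list_update_add)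

lemma mat_scale_vector: "mat_scale c A *v x = c *s (A *v x :: 'f::comm_ring_1 ^ 'n)"
  by (simp add: vec_eq_iff mat_scale_def matrix_vector_mult_def sum_distrib_left algebra_simps)

lemma slot_der_scale: "slot_der (mat_scale c A) S = c *s slot_der A S"
proof -
  have "slot_der (mat_scale c A) S = (\<Sum>j<card S. c *s wedge_list
     ((map basis_vec (sorted_list_of_set S))[j := A *v basis_vec (sorted_list_of_set S ! j)]))"
    unfolding slot_der_def
    by (intro sum.cong refl) (simp add: mat_scale_vector wedge_list_update_scale)
  then show ?thesis by (simp add: slot_der_def vec_eq_iff sum_distrib_left)
qed

lemma ext_der_add_left: "ext_der (A + B) x = ext_der A x + ext_der B x"
  by (simp add: ext_der_slot slot_der_add sum.distrib vec_eq_iff algebra_simps)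

lemma ext_der_scale_left: "ext_der (mat_scale c A) x = c *s ext_der A x"
  by (simp add: ext_der_slot slot_der_scale vec_eq_iff sum_distrib_left algebra_simps)

lemma ext_der_add_right: "ext_der A (x + y) = ext_der A x + ext_der A y"
  by (simp add: ext_der_slot sum.distrib vec_eq_iff algebra_simps)

lemma ext_der_scale_right: "ext_der A (c *s x) = c *s ext_der A x"
  by (simp add: ext_der_slot vec_eq_iff sum_distrib_left algebra_simps)

lemma ext_der_zero_right [simp]: "ext_der A 0 = 0"
  using ext_der_scale_right[of A 0 0] by simp

lemma ext_der_zero_left [simp]: "ext_der 0 x = 0"
  using ext_der_add_left[of 0 0 x] by simp

lemma ext_der_minus_left: "ext_der (- A) x = - ext_der A x"
  using ext_der_add_left[of "- A" A x] by (simp add: eq_neg_iff_add_eq_0)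

lemma ext_der_minus_right: "ext_der A (- x) = - ext_der A x"
  using ext_der_add_right[of A "- x" x] by (simp add: eq_neg_iff_add_eq_0)

lemma ext_der_diff_left: "ext_der (A - B) x = ext_der A x - ext_der B x"
  using ext_der_add_left[of "A - B" B x] by simp

lemma ext_der_diff_right: "ext_der A (x - y) = ext_der A x - ext_der A y"
  using ext_der_add_right[of A "x - y" y] by simp

lemma ext_der_sum_left: "ext_der (\<Sum>i\<in>I. F i) x = (\<Sum>i\<in>I. ext_der (F i) x)"
  by (induction I rule: infinite_finite_induct) (simp_all add: ext_der_add_left)

lemma ext_der_sum_right: "ext_der A (\<Sum>i\<in>I. F i) = (\<Sum>i\<in>I. ext_der A (F i))"
  by (induction I rule: infinite_finite_induct) (simp_all add: ext_der_add_right)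

definition diag_mat :: "('n \<Rightarrow> 'f::zero) \<Rightarrow> 'f ^ 'n ^ 'n" where
  "diag_mat d = (\<chi> i j. if i = j then d i else 0)"

lemma diag_mat_axis: "diag_mat d *v axis i c = axis i (d i * c :: 'f::comm_ring_1)"
proof -
  have "(diag_mat d *v axis i c) $ k = (\<Sum>j\<in>UNIV. if j = i then (if k = i then d i * c else 0) else 0)" for k
    unfolding diag_mat_def matrix_vector_mult_def axis_def vec_lambda_beta by (rule sum.cong) auto
  then show ?thesis by (simp add: vec_eq_iff axis_def)
qed

text \<open>Replacing a slot by its image only rescales it, so every summand is a multiple of
  \<open>e_S\<close>, and the eigenvalues add up to the weight of \<open>S\<close>.\<close>

lemma slot_der_diag: "slot_der (diag_mat d) S = axis S (\<Sum>i\<in>S. d i :: 'f::comm_ring_1)"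
proof -
  let ?xs = "sorted_list_of_set S"
  have "wedge_list ((map basis_vec ?xs)[j := diag_mat d *v basis_vec (?xs ! j)])
      = axis S (d (?xs ! j))" if "j < card S" for j
  proof -
    have "(map basis_vec ?xs)[j := diag_mat d *v basis_vec (?xs ! j)]
        = map (\<lambda>i. axis i (if i = ?xs ! j then d i else 1)) ?xs"
      using that by (intro nth_equalityI)
        (auto simp: diag_mat_axis nth_list_update nth_eq_iff_index_eq)
    then have "wedge_list ((map basis_vec ?xs)[j := diag_mat d *v basis_vec (?xs ! j)])
        = axis S (\<Prod>i\<in>S. if i = ?xs ! j then d i else 1)"
      by (simp only: wedge_list_sorted_list_of_set)
    moreover have "?xs ! j \<in> S"
      using that nth_mem[of j ?xs] by simp
    ultimately show ?thesis by (simp add: prod.delta)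
  qed
  then have "slot_der (diag_mat d) S = (\<Sum>j<card S. axis S (d (?xs ! j)))"
    by (simp add: slot_der_def)
  also have "\<dots> = axis S (\<Sum>j<length ?xs. d (?xs ! j))"
    by (simp add: vec_eq_iff axis_def)
  also have "(\<Sum>j<length ?xs. d (?xs ! j)) = (\<Sum>i\<in>S. d i)"
    using sum_list_sum_nth[of "map d ?xs"] sum_list_distinct_conv_sum_set[of ?xs d]
    by (simp add: atLeast0LessThan)
  finally show ?thesis .
qed

lemma ext_der_diag: "ext_der (diag_mat d) x $ S = (\<Sum>i\<in>S. d i) * (x $ S :: 'f::comm_ring_1)"
proof -
  have "ext_der (diag_mat d) x $ S = (\<Sum>T\<in>UNIV. if T = S then (\<Sum>i\<in>S. d i) * x $ S else 0)"
    unfolding ext_der_slot slot_der_diag sum_component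
    by (intro sum.cong refl) (auto simp: axis_def)
  then show ?thesis by simp
qed

lemma ext_map_diag: "ext_map (diag_mat d) x $ S = (\<Prod>i\<in>S. d i) * (x $ S :: 'f::comm_ring_1)"
proof -
  have "ext_map (diag_mat d) x $ S = (\<Sum>T\<in>UNIV. if T = S then (\<Prod>i\<in>S. d i) * x $ S else 0)"
    unfolding ext_map_def diag_mat_axis wedge_list_sorted_list_of_set sum_component
    by (intro sum.cong refl) (auto simp: axis_def)
  then show ?thesis by simp
qed

lemma pairing_add_left: "pairing (x + y) f = pairing x f + pairing y f"
  and pairing_add_right: "pairing x (f + g) = pairing x f + pairing x g"
  and pairing_scale_left: "pairing (c *s x) f = c * pairing x f"
  and pairing_scale_right: "pairing x (c *s f) = c * pairing x f"
  and pairing_minus_left: "pairing (- x) f = - pairing x f"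
  and pairing_minus_right: "pairing x (- f) = - pairing x f"
  and pairing_diff_left: "pairing (x - y) f = pairing x f - pairing y f"
  and pairing_diff_right: "pairing x (f - g) = pairing x f - pairing x g"
  and pairing_zero_left [simp]: "pairing 0 f = 0"
  and pairing_zero_right [simp]: "pairing x 0 = 0"
  by (simp_all add: pairing_def algebra_simps sum.distrib sum_distrib_left sum_negf sum_subtractf)

lemma pairing_commute: "pairing x f = pairing f x"
  by (simp add: pairing_def mult.commute)

lemma pairing_axis_left: "pairing (axis S c) f = c * f $ S"
  by (simp add: pairing_def axis_def if_distrib if_distribR cong: if_cong)

lemma pairing_axis_right: "pairing x (axis S c) = x $ S * c"
  by (simp add: pairing_commute[of x] pairing_axis_left mult.commute)

lemma ext_sign_sq: "ext_sign S T * ext_sign S T = 1"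
  by (simp add: ext_sign_def power_add[symmetric] mult_2[symmetric])

text \<open>Each pair in \<open>S \<times> T\<close> is an inversion for exactly one of the two
  orders, so the two inversion counts add up to the size of the product.\<close>

lemma ext_sign_swap:
  fixes S T :: "'n::{finite,linorder} set"
  assumes "S \<inter> T = {}"
  shows "ext_sign S T * ext_sign T S = (-1 :: 'f::comm_ring_1) ^ (card S * card T)"
proof -
  let ?P = "{(s, t). s \<in> S \<and> t \<in> T \<and> t < s}" and ?Q = "{(s, t). s \<in> T \<and> t \<in> S \<and> t < s}"
  have "card S * card T = card (S \<times> T)" by simp
  also have "S \<times> T = ?P \<union> prod.swap ` ?Q"
  proof (intro Set.set_eqI iffI)
    fix p assume "p \<in> S \<times> T"
    then obtain s t where p: "p = (s, t)" "s \<in> S" "t \<in> T" by blast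
    then have "s \<noteq> t" using assms by blast
    then consider "t < s" | "s < t" by force
    then show "p \<in> ?P \<union> prod.swap ` ?Q"
    proof cases
      case 2
      then have "(t, s) \<in> ?Q" using p by simp
      then show ?thesis using p(1) by (intro UnI2 image_eqI[of _ _ "(t, s)"]) simp_all
    qed (use p in simp)
  qed auto
  also have "card \<dots> = card ?P + card (prod.swap ` ?Q)"
    by (rule card_Un_disjoint) auto
  also have "card (prod.swap ` ?Q) = card ?Q"
    by (intro card_image) simp
  finally show ?thesis by (simp add: ext_sign_def power_add)
qed

section \<open>Index sets of size six\<close>

lemma UNIV_6: "(UNIV :: 6 set) = {0, 1, 2, 3, 4, 5}"
proof -
  have "card {0, 1, 2, 3, 4, 5 :: 6} = card (UNIV :: 6 set)" by simp
  then show ?thesis by (intro card_subset_eq[symmetric]) simp_all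
qed

lemma forall_6: "(\<forall>i::6. P i) \<longleftrightarrow> P 0 \<and> P 1 \<and> P 2 \<and> P 3 \<and> P 4 \<and> P 5"
proof -
  have "(\<forall>i::6. P i) \<longleftrightarrow> (\<forall>i\<in>UNIV. P i)" by simp
  then show ?thesis by (simp add: UNIV_6)
qed

lemma card_num6: "card (UNIV :: 6 set) = 6" by simp

lemma card_Compl_6: "card (- S :: 6 set) = 6 - card S"
  using card_Diff_subset[of S UNIV] by (simp add: Compl_eq_Diff_UNIV)

abbreviation ext3 :: "('f::comm_ring_1) ext6 set" where "ext3 \<equiv> ext_pow 3"
abbreviation ext6 :: "('f::comm_ring_1) ext6 set" where "ext6 \<equiv> ext_pow 6"

lemma ext_pow_iff: "x \<in> ext_pow k \<longleftrightarrow> (\<forall>S. card S \<noteq> k \<longrightarrow> x $ S = 0)"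
  by (auto simp: ext_pow_def)

lemma ext_pow_add: "x \<in> ext_pow k \<Longrightarrow> y \<in> ext_pow k \<Longrightarrow> x + y \<in> ext_pow k"
  and ext_pow_scale: "x \<in> ext_pow k \<Longrightarrow> c *s x \<in> ext_pow k"
  and ext_pow_minus: "x \<in> ext_pow k \<Longrightarrow> - x \<in> ext_pow k"
  and ext_pow_diff: "x \<in> ext_pow k \<Longrightarrow> y \<in> ext_pow k \<Longrightarrow> x - y \<in> ext_pow k"
  and ext_pow_zero [simp]: "0 \<in> ext_pow k"
  by (auto simp: ext_pow_iff)

lemmas ext_pow_closed = ext_pow_add ext_pow_scale ext_pow_minus ext_pow_diff

lemma axis_ext_pow: "card S = k \<Longrightarrow> axis S c \<in> ext_pow k"
  by (auto simp: ext_pow_def axis_def split: if_splits)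

lemma ext3_nth: "x \<in> ext3 \<Longrightarrow> card S \<noteq> 3 \<Longrightarrow> x $ S = 0"
  by (auto simp: ext_pow_def)

lemma ext6_nth: "x \<in> ext6 \<Longrightarrow> S \<noteq> UNIV \<Longrightarrow> x $ S = (0 :: 'f::comm_ring_1)"
proof -
  assume "x \<in> ext6" "S \<noteq> UNIV"
  moreover have "card S \<noteq> 6"
    using \<open>S \<noteq> UNIV\<close> card_subset_eq[of UNIV S] by auto
  ultimately show ?thesis by (auto simp: ext_pow_def)
qed

lemma ext6_eq: "x \<in> ext6 \<longleftrightarrow> x = axis UNIV (x $ UNIV :: 'f::comm_ring_1)"
proof
  assume "x \<in> ext6"
  then show "x = axis UNIV (x $ UNIV)"
    by (auto simp: vec_eq_iff axis_def ext6_nth)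
next
  assume "x = axis UNIV (x $ UNIV)"
  then show "x \<in> ext6" by (metis axis_ext_pow card_num6)
qed

section \<open>The Hodge star, contractions and \<open>\<theta>\<close> in coordinates\<close>

text \<open>The Hodge star, with the sign convention that makes the wedge of 3-vectors
  \<open>u\<close> and \<open>v\<close> the pairing of \<open>u\<close> with \<open>star v\<close>
  times the top vector.\<close>

definition star :: "'f::comm_ring_1 ext6 \<Rightarrow> 'f ext6" where
  "star x = (\<chi> T. ext_sign T (- T) * x $ (- T))"

lemma star_nth: "star x $ T = ext_sign T (- T) * x $ (- T)"
  by (simp add: star_def)

lemma star_add: "star (x + y) = star x + star y"
  and star_scale: "star (c *s x) = c *s star x"
  and star_minus: "star (- x) = - star x"
  and star_diff: "star (x - y) = star x - star y"
  and star_zero [simp]: "star 0 = 0"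
  by (simp_all add: star_def vec_eq_iff algebra_simps)

lemma star_ext3: "x \<in> ext3 \<Longrightarrow> star x \<in> ext3"
  by (auto simp: ext_pow_iff star_nth card_Compl_6)

lemma wedge_ext3:
  assumes "u \<in> ext3" "v \<in> ext3"
  shows "wedge u v = axis UNIV (pairing u (star v) :: 'f::comm_ring_1)"
proof -
  have "wedge u v $ U = 0" if "U \<noteq> UNIV" for U
  proof -
    have "card U \<noteq> 6" using that card_subset_eq[of UNIV U] by auto
    then have "u $ S * v $ (U - S) = 0" if "S \<subseteq> U" for S
      using assms that card_Diff_subset[of S U] card_mono[of U S]
      by (cases "card S = 3"; cases "card (U - S) = 3") (auto simp: ext3_nth)
    then show ?thesis
      unfolding wedge_def vec_lambda_beta by (intro sum.neutral) (simp add: mult.assoc)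
  qed
  moreover have "wedge u v $ UNIV = pairing u (star v)"
    by (simp add: wedge_def pairing_def star_nth Compl_eq_Diff_UNIV mult_ac)
  ultimately show ?thesis by (simp add: vec_eq_iff axis_def)
qed

text \<open>The two complementary signs multiply to (-1)^9. Together with \<iota> squared = -1 this
  is what makes \<theta> an involution.\<close>

lemma star_star:
  assumes "x \<in> ext3"
  shows "star (star x) = - (x :: 'f::comm_ring_1 ext6)"
proof -
  have "star (star x) $ T = - x $ T" for T
  proof (cases "card T = 3")
    case True
    then have "ext_sign T (- T) * ext_sign (- T) T = (-1 :: 'f)"
      by (simp add: ext_sign_swap card_Compl_6)
    then show ?thesis by (simp add: star_nth mult.assoc[symmetric])
  qed (use assms in \<open>simp add: star_nth ext3_nth\<close>)
  then show ?thesis by (simp add: vec_eq_iff)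
qed

text \<open>Every sign occurs squared, and complementation permutes the index sets.\<close>

lemma pairing_star_star: "pairing (star x) (star y) = pairing x y"
proof -
  have "pairing (star x) (star y) =
      (\<Sum>T\<in>UNIV. (ext_sign T (- T) * ext_sign T (- T)) * (x $ (- T) * y $ (- T)))"
    unfolding pairing_def star_nth by (simp add: mult_ac)
  also have "\<dots> = (\<Sum>T\<in>UNIV. x $ (- T) * y $ (- T))"
    by (simp add: ext_sign_sq)
  also have "\<dots> = pairing x y"
    unfolding pairing_def
    by (rule sum.reindex_bij_witness[of _ uminus uminus]) auto
  finally show ?thesis .
qed

text \<open>The star is a skew isometry, which is the antisymmetry of the wedge product on
  3-vectors; it produces the minus sign in \<open>lcontract_eq\<close>.\<close>

lemma pairing_star_left: "y \<in> ext3 \<Longrightarrow> pairing (star x) y = - pairing x (star y)"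
  using pairing_star_star[of x "star y"] by (simp add: star_star pairing_minus_right minus_equation_iff[of "pairing x (star y)"] eq_commute)

lemma pairing_star_anticommute: "x \<in> ext3 \<Longrightarrow> pairing y (star x) = - pairing x (star y)"
  using pairing_star_left[of x y] by (simp add: pairing_commute)

lemma pairing_ext3_eqI:
  assumes "h \<in> ext3" "h' \<in> ext3" "\<And>w. w \<in> ext3 \<Longrightarrow> pairing w h = pairing w (h' :: 'f::comm_ring_1 ext6)"
  shows "h = h'"
proof -
  have "h $ S = h' $ S" for S
  proof (cases "card S = 3")
    case True
    then show ?thesis using assms(3)[of "axis S 1"] by (simp add: axis_ext_pow pairing_axis_left)
  qed (use assms in \<open>simp add: ext3_nth\<close>)
  then show ?thesis by (simp add: vec_eq_iff)
qed

text \<open>The pairing is perfect on 3-vectors, so exhibiting one vector with the defining property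
  evaluates the \<open>THE\<close>.\<close>

lemma rcontract_eq:
  assumes "u \<in> ext3"
  shows "rcontract u g' = g' $ UNIV *s star u"
proof -
  have *: "pairing (wedge w u) g' = pairing w (g' $ UNIV *s star u)" if "w \<in> ext3" for w
    using that assms by (simp add: wedge_ext3 pairing_axis_left pairing_scale_right mult.commute)
  show ?thesis unfolding rcontract_def
  proof (rule the_equality)
    show "g' $ UNIV *s star u \<in> ext3 \<and>
        (\<forall>w\<in>ext3. pairing w (g' $ UNIV *s star u) = pairing (wedge w u) g')"
      using assms * by (simp add: ext_pow_scale star_ext3)
    fix h assume "h \<in> ext3 \<and> (\<forall>w\<in>ext3. pairing w h = pairing (wedge w u) g')"
    then show "h = g' $ UNIV *s star u"
      using assms * by (intro pairing_ext3_eqI) (auto simp: ext_pow_scale star_ext3)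
  qed
qed

lemma lcontract_eq:
  assumes "f \<in> ext3"
  shows "lcontract u' f = - (u' $ UNIV *s star f)"
proof -
  have *: "pairing u' (wedge f h) = pairing (- (u' $ UNIV *s star f)) h" if "h \<in> ext3" for h
    using that assms by (simp add: wedge_ext3 pairing_axis_right pairing_scale_left
        pairing_minus_left pairing_star_left)
  show ?thesis unfolding lcontract_def
  proof (rule the_equality)
    show "- (u' $ UNIV *s star f) \<in> ext3 \<and>
        (\<forall>h\<in>ext3. pairing (- (u' $ UNIV *s star f)) h = pairing u' (wedge f h))"
      using assms * by (simp add: ext_pow_closed star_ext3)
    fix w assume w: "w \<in> ext3 \<and> (\<forall>h\<in>ext3. pairing w h = pairing u' (wedge f h))"
    show "w = - (u' $ UNIV *s star f)"
    proof (rule pairing_ext3_eqI)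
      show "pairing x w = pairing x (- (u' $ UNIV *s star f))" if "x \<in> ext3" for x
        using w *[OF that] that pairing_commute by metis
    qed (use w assms in \<open>simp_all add: ext_pow_closed star_ext3\<close>)
  qed
qed

section \<open>The trace form and the map \<open>psi\<close>\<close>

definition unit_mat :: "'n \<Rightarrow> 'n \<Rightarrow> 'f::zero_neq_one ^ 'n ^ 'n" where
  "unit_mat i j = (\<chi> a b. if a = i \<and> b = j then 1 else 0)"

lemma unit_mat_nth: "unit_mat i j $ a $ b = (if a = i \<and> b = j then 1 else 0)"
  by (simp add: unit_mat_def)

lemma trace_unit_mat_mult: "trace (unit_mat i j ** B) = (B $ j $ i :: 'f::comm_ring_1)"
proof -
  have "(unit_mat i j ** B) $ a $ a = (if a = i then B $ j $ i else 0)" for a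
  proof -
    have "(unit_mat i j ** B) $ a $ a = (\<Sum>k\<in>UNIV. if k = j then (if a = i then B $ j $ i else 0) else 0)"
      unfolding matrix_matrix_mult_def vec_lambda_beta unit_mat_nth by (rule sum.cong) auto
    then show ?thesis by simp
  qed
  then show ?thesis by (simp add: trace_def)
qed

lemma trace_unit_mat: "trace (unit_mat i j) = (if i = j then 1 else 0 :: 'f::comm_ring_1)"
proof -
  have "trace (unit_mat i j) = (\<Sum>a\<in>UNIV. if a = i then (if i = j then 1 else 0 :: 'f) else 0)"
    unfolding trace_def unit_mat_nth by (rule sum.cong) auto
  then show ?thesis by simp
qed

lemma mat_expansion: "A = (\<Sum>i\<in>UNIV. \<Sum>j\<in>UNIV. mat_scale (A $ i $ j) (unit_mat i j))"
  for A :: "'f::comm_ring_1 ^ 'n ^ 'n"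
proof -
  have "(\<Sum>i\<in>UNIV. \<Sum>j\<in>UNIV. mat_scale (A $ i $ j) (unit_mat i j)) $ a $ b = A $ a $ b" for a b
  proof -
    have "(\<Sum>j\<in>UNIV. mat_scale (A $ i $ j) (unit_mat i j) $ a $ b) = (if i = a then A $ a $ b else 0)" for i
    proof -
      have "(\<Sum>j\<in>UNIV. mat_scale (A $ i $ j) (unit_mat i j) $ a $ b)
          = (\<Sum>j\<in>UNIV. if j = b then (if i = a then A $ a $ b else 0) else 0)"
        by (rule sum.cong) (auto simp: mat_scale_def unit_mat_nth)
      then show ?thesis by simp
    qed
    then have "(\<Sum>i\<in>UNIV. \<Sum>j\<in>UNIV. mat_scale (A $ i $ j) (unit_mat i j)) $ a $ b
        = (\<Sum>i\<in>UNIV. if i = a then A $ a $ b else 0)"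
      by simp
    then show ?thesis by simp
  qed
  then show ?thesis by (simp add: vec_eq_iff)
qed

lemma mat_scale_nth: "mat_scale c A $ i $ j = c * A $ i $ j"
  by (simp add: mat_scale_def)

lemma mat_nth: "mat c $ i $ j = (if i = j then c else 0)"
  by (simp add: mat_def)

lemma trace_scale: "trace (mat_scale c A) = c * trace (A :: 'f::comm_ring_1 ^ 'n ^ 'n)"
  by (simp add: trace_def mat_scale_nth sum_distrib_left)

lemma trace_mat_6: "trace (mat c :: 'f::comm_ring_1 ^ 6 ^ 6) = 6 * c"
  by (simp add: trace_def mat_nth)

lemma trace_transpose: "trace (transpose A) = trace A"
  by (simp add: trace_def transpose_def)

lemma mat_scale_mult_left: "mat_scale c A ** B = mat_scale c (A ** B :: 'f::comm_ring_1 ^ 'n ^ 'n)"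
  by (simp add: vec_eq_iff matrix_matrix_mult_def mat_scale_def sum_distrib_left mult_ac)

lemma mat_scale_mult_right: "A ** mat_scale c B = mat_scale c (A ** B :: 'f::comm_ring_1 ^ 'n ^ 'n)"
  by (simp add: vec_eq_iff matrix_matrix_mult_def mat_scale_def sum_distrib_left mult_ac)

lemma matrix_add_simps:
  fixes A B C :: "'f::comm_ring_1 ^ 'n ^ 'n"
  shows "A ** (B + C) = A ** B + A ** C" "(A + B) ** C = A ** C + B ** C"
    "A ** (B - C) = A ** B - A ** C" "(A - B) ** C = A ** C - B ** C"
    "A ** (- B) = - (A ** B)" "(- A) ** B = - (A ** B)"
    "A ** 0 = 0" "0 ** A = 0"
  by (simp_all add: vec_eq_iff matrix_matrix_mult_def algebra_simps sum.distrib sum_subtractf sum_negf)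

text \<open>Matrix units test the off-diagonal entries and differences of diagonal units test the
  differences of diagonal entries. The remaining common difference is killed by the trace, because 6
  is invertible.\<close>

lemma traceless_eqI:
  fixes B C :: "'f::field_char_0 ^ 6 ^ 6"
  assumes tr: "trace B = 0" "trace C = 0"
    and eq: "\<And>g. trace g = 0 \<Longrightarrow> trace (g ** B) = trace (g ** C)"
  shows "B = C"
proof -
  have off: "B $ j $ i = C $ j $ i" if "i \<noteq> j" for i j
    using eq[of "unit_mat i j"] that by (simp add: trace_unit_mat_mult trace_unit_mat)
  have diff: "B $ i $ i - B $ 0 $ 0 = C $ i $ i - C $ 0 $ 0" for i
    using eq[of "unit_mat i i - unit_mat 0 0"]
    by (simp add: matrix_add_simps trace_sub trace_unit_mat_mult trace_unit_mat)
  have diag: "B $ i $ i - C $ i $ i = B $ 0 $ 0 - C $ 0 $ 0" for i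
  proof -
    have "B $ i $ i = C $ i $ i - C $ 0 $ 0 + B $ 0 $ 0"
      using diff[of i] by (simp add: diff_eq_eq)
    then show ?thesis by simp
  qed
  have "0 = (\<Sum>i\<in>UNIV. B $ i $ i - C $ i $ i)"
    using tr by (simp add: trace_def sum_subtractf)
  also have "\<dots> = (\<Sum>i\<in>(UNIV :: 6 set). B $ 0 $ 0 - C $ 0 $ 0)"
    by (rule sum.cong[OF refl diag])
  also have "\<dots> = 6 * (B $ 0 $ 0 - C $ 0 $ 0)" by simp
  finally have "B $ i $ i = C $ i $ i" for i
    using diag[of i] by simp
  then show ?thesis using off by (metis vec_eq_iff)
qed

text \<open>\<open>M\<close> represents the functional on all matrices through the trace form.
  Removing its scalar part makes it traceless without changing its product with a traceless
  \<open>g\<close>.\<close>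

lemma psi_exists:
  fixes u f :: "'f::field_char_0 ext6"
  shows "\<exists>B. trace B = 0 \<and> (\<forall>g. trace g = 0 \<longrightarrow> trace (g ** B) = pairing (ext_der g u) f)"
proof -
  define M :: "'f ^ 6 ^ 6" where "M = (\<chi> i j. pairing (ext_der (unit_mat j i) u) f)"
  define B where "B = M - mat (trace M / 6)"
  have lin: "pairing (ext_der g u) f = trace (g ** M)" for g
  proof -
    have "pairing (ext_der g u) f = (\<Sum>i\<in>UNIV. \<Sum>j\<in>UNIV. g $ i $ j * M $ j $ i)"
      by (subst mat_expansion[of g])
        (simp only: ext_der_sum_left ext_der_scale_left M_def vec_lambda_beta
          pairing_commute[of _ f],
         simp add: pairing_def sum_distrib_left sum.swap[of _ UNIV "UNIV :: 6 set set"] mult_ac)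
    then show ?thesis by (simp add: trace_def matrix_matrix_mult_def)
  qed
  have "trace (g ** B) = pairing (ext_der g u) f" if "trace g = 0" for g
  proof -
    have "g ** mat c = mat_scale c g" for c
      by (simp add: vec_eq_iff matrix_matrix_mult_def mat_def mat_scale_def if_distrib mult.commute
          cong: if_cong)
    then show ?thesis using that lin by (simp add: B_def matrix_add_simps trace_sub trace_scale)
  qed
  moreover have "trace B = 0" by (simp add: B_def trace_sub trace_mat_6)
  ultimately show ?thesis by blast
qed

lemma psi_unique_existence:
  fixes u f :: "'f::field_char_0 ext6"
  shows "\<exists>!B. trace B = 0 \<and> (\<forall>g. trace g = 0 \<longrightarrow> trace (g ** B) = pairing (ext_der g u) f)"
proof (rule ex_ex1I[OF psi_exists])
  fix B C
  assume "trace B = 0 \<and> (\<forall>g. trace g = 0 \<longrightarrow> trace (g ** B) = pairing (ext_der g u) f)"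
    and "trace C = 0 \<and> (\<forall>g. trace g = 0 \<longrightarrow> trace (g ** C) = pairing (ext_der g u) f)"
  then show "B = C" by (intro traceless_eqI) auto
qed

lemma trace_psi: "trace (psi f u :: 'f::field_char_0 ^ 6 ^ 6) = 0"
  and trace_mult_psi: "trace g = 0 \<Longrightarrow> trace (g ** psi f u) = pairing (ext_der g u) (f :: 'f ext6)"
  using theI'[OF psi_unique_existence, of u f] unfolding psi_def[symmetric] by auto

lemma psi_eqI:
  fixes u f :: "'f::field_char_0 ext6"
  assumes "trace B = 0" "\<And>g. trace g = 0 \<Longrightarrow> trace (g ** B) = pairing (ext_der g u) f"
  shows "psi f u = B"
  by (rule traceless_eqI) (simp_all add: assms trace_psi trace_mult_psi)

section \<open>Signs of permutations and the coordinate form of \<open>theta\<close>\<close>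

lemma ext_sign_prod:
  fixes S T :: "'n::{finite,linorder} set"
  shows "ext_sign S T = (\<Prod>s\<in>S. \<Prod>t\<in>T. if t < s then -1 else 1 :: 'f::comm_ring_1)"
proof -
  have "(\<Prod>s\<in>S. \<Prod>t\<in>T. if t < s then -1 else 1 :: 'f)
      = (\<Prod>p\<in>S \<times> T. if snd p < fst p then -1 else 1)"
    by (simp add: prod.cartesian_product split_def)
  also have "\<dots> = (-1) ^ card (S \<times> T \<inter> {p. snd p < fst p})"
    by (simp add: prod.If_cases)
  also have "S \<times> T \<inter> {p. snd p < fst p} = {(s, t). s \<in> S \<and> t \<in> T \<and> t < s}"
    by auto
  finally show ?thesis by (simp add: ext_sign_def)
qed

definition order_sign :: "6 \<Rightarrow> 6 \<Rightarrow> 'f::comm_ring_1" where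
  "order_sign a b = (if b < a then -1 else 1)"

lemma order_sign_sq: "order_sign a b * order_sign a b = 1"
  by (simp add: order_sign_def)

lemma order_sign_prod_sq:
  "(order_sign a b * order_sign c d * order_sign e f)
    * (order_sign a b * order_sign c d * order_sign e f) = (1 :: 'f::comm_ring_1)"
proof -
  have eq: "(x * y * z) * (x * y * z) = (x * x) * (y * y) * (z * z)" for x y z :: 'f
    by (simp only: mult_ac)
  show ?thesis by (subst eq) (simp add: order_sign_sq)
qed

lemma order_sign_swap: "a \<noteq> b \<Longrightarrow> order_sign b a = - order_sign a b"
  by (auto simp: order_sign_def)

lemma wedge_list_3:
  assumes "distinct [a, b, c]"
  shows "wedge_list [basis_vec a, basis_vec b, basis_vec c] =
    axis {a, b, c} (order_sign a b * order_sign a c * order_sign b c :: 'f::comm_ring_1)"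
proof -
  have "ext_sign {b} {c} = (order_sign b c :: 'f)"
    by (simp add: ext_sign_prod order_sign_def)
  moreover have "ext_sign {a} {b, c} = (order_sign a b * order_sign a c :: 'f)"
    using assms by (simp add: ext_sign_prod order_sign_def)
  moreover have "ext_sign {c} {} = (1 :: 'f)" by (simp add: ext_sign_prod)
  ultimately show ?thesis
    using assms by (simp add: wedge_list_Cons wedge_list_Nil ext_vec_axis wedge_axis insert_commute)
qed

lemma less_6:
  "(0::6) < 1" "(0::6) < 2" "(0::6) < 3" "(0::6) < 4" "(0::6) < 5"
  "(1::6) < 2" "(1::6) < 3" "(1::6) < 4" "(1::6) < 5"
  "(2::6) < 3" "(2::6) < 4" "(2::6) < 5" "(3::6) < 4" "(3::6) < 5" "(4::6) < 5"
  by (simp_all add: less_bit0_def bit0.Rep_numeral bit0.Rep_0 bit0.Rep_1)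

text \<open>The product of the signs over all inversions of a permutation, written for a general
  antisymmetric function in place of \<open>order_sign\<close>.\<close>

definition inversion_sign :: "(6 \<Rightarrow> 6 \<Rightarrow> 'f::comm_ring_1) \<Rightarrow> 'f" where
  "inversion_sign t = t 1 2 * t 1 3 * t 2 3 * (t 4 5 * t 4 0 * t 5 0)
     * (t 4 1 * t 4 2 * t 4 3 * (t 5 1 * t 5 2 * t 5 3) * (t 0 1 * t 0 2 * t 0 3))"

text \<open>The product has one factor for each of the fifteen pairs of indices, so exchanging two
  indices permutes the factors up to an odd number of sign changes. The generality in
  \<open>t\<close> lets the induction below insert \<open>order_sign\<close> composed with a
  permutation.\<close>

lemma inversion_sign_transpose:
  assumes "\<And>i j. i \<noteq> j \<Longrightarrow> t j i = - t i (j :: 6)" "a \<noteq> b"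
  shows "inversion_sign (\<lambda>i j. t (Transposition.transpose a b i) (Transposition.transpose a b j))
    = - inversion_sign (t :: 6 \<Rightarrow> 6 \<Rightarrow> 'f::comm_ring_1)"
proof -
  have rules: "t 1 0 = - t 0 1" "t 2 0 = - t 0 2" "t 3 0 = - t 0 3" "t 4 0 = - t 0 4" "t 5 0 = - t 0 5"
    "t 2 1 = - t 1 2" "t 3 1 = - t 1 3" "t 4 1 = - t 1 4" "t 5 1 = - t 1 5"
    "t 3 2 = - t 2 3" "t 4 2 = - t 2 4" "t 5 2 = - t 2 5"
    "t 4 3 = - t 3 4" "t 5 3 = - t 3 5" "t 5 4 = - t 4 5"
    by (rule assms(1); simp)+
  have "\<forall>a b. a \<noteq> b \<longrightarrow>
      inversion_sign (\<lambda>i j. t (Transposition.transpose a b i) (Transposition.transpose a b j))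
      = - inversion_sign t"
    unfolding forall_6 inversion_sign_def transpose_def
    by (simp add: rules mult_ac)
  then show ?thesis using assms(2) by blast
qed

lemma inversion_sign_permutation:
  assumes "\<sigma> permutes (UNIV :: 6 set)"
  shows "inversion_sign (\<lambda>i j. order_sign (\<sigma> i) (\<sigma> j)) = (of_int (sign \<sigma>) :: 'f::comm_ring_1)"
  using finite assms
proof (induction rule: permutes_rev_induct)
  \<comment> \<open>The index 0 stands for 6 but is the least of its type, so the identity has
    negative factors. There are eight of them: (4,0), (5,0) and the six pairs between {4,5} and
    {1,2,3}.\<close>
  case id
  note less_6[THEN less_not_sym]
  then show ?case by (simp add: inversion_sign_def order_sign_def less_6)
next
  case (swap a b p)
  have "inj p" using swap.hyps permutes_inj by blast
  then have "inversion_sign (\<lambda>i j. order_sign ((p \<circ> Transposition.transpose a b) i) ((p \<circ> Transposition.transpose a b) j))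
      = - (inversion_sign (\<lambda>i j. order_sign (p i) (p j)) :: 'f)"
    unfolding o_def
    by (intro inversion_sign_transpose order_sign_swap) (use swap.hyps \<open>inj p\<close> in \<open>auto dest: injD\<close>)
  moreover have "sign (p \<circ> Transposition.transpose a b) = - sign p"
  proof -
    have "permutation p" using swap.hyps permutation_permutes[of p] finite[of UNIV] by blast
    then show ?thesis
      using swap.hyps by (simp add: sign_compose permutation_swap_id sign_swap_id)
  qed
  ultimately show ?case using swap.IH by (simp add: o_def)
qed

lemma six_eq_zero: "(6::6) = 0" by simp

lemma star_axis: "star (axis S c) = axis (- S) (ext_sign (- S) S * c :: 'f::comm_ring_1)"
  by (auto simp: vec_eq_iff star_nth axis_def)

lemma star_wedge_list:
  assumes "\<sigma> permutes (UNIV :: 6 set)"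
  shows "star (wedge_list [basis_vec (\<sigma> 1), basis_vec (\<sigma> 2), basis_vec (\<sigma> 3)]) =
    of_int (sign \<sigma>) *s (wedge_list [basis_vec (\<sigma> 4), basis_vec (\<sigma> 5), basis_vec (\<sigma> 6)] :: 'f::comm_ring_1 ext6)"
proof -
  have inj: "\<sigma> i = \<sigma> j \<longleftrightarrow> i = j" for i j
    using assms permutes_inj[of \<sigma> UNIV] by (auto dest: injD)
  have "UNIV = \<sigma> ` UNIV" using assms permutes_surj by blast
  then have U: "UNIV = {\<sigma> 0, \<sigma> 1, \<sigma> 2, \<sigma> 3, \<sigma> 4, \<sigma> 5}" by (simp add: UNIV_6)
  have C: "- {\<sigma> 1, \<sigma> 2, \<sigma> 3} = {\<sigma> 4, \<sigma> 5, \<sigma> 0}"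
    unfolding Compl_eq_Diff_UNIV U by (auto simp: inj)
  let ?s = "\<lambda>i j. order_sign (\<sigma> i) (\<sigma> j) :: 'f"
  have "star (wedge_list [basis_vec (\<sigma> 1), basis_vec (\<sigma> 2), basis_vec (\<sigma> 3)]) =
     axis {\<sigma> 4, \<sigma> 5, \<sigma> 0} (?s 1 2 * ?s 1 3 * ?s 2 3
       * (?s 4 1 * ?s 4 2 * ?s 4 3 * (?s 5 1 * ?s 5 2 * ?s 5 3) * (?s 0 1 * ?s 0 2 * ?s 0 3)))"
    by (simp add: wedge_list_3 inj star_axis C ext_sign_prod order_sign_def[symmetric] mult_ac)
  \<comment> \<open>The sorting sign of the second triple squares to 1, so it can be inserted twice:
    once to complete the product over all pairs, once as the sign of the target vector.\<close>
  also have "\<dots> = axis {\<sigma> 4, \<sigma> 5, \<sigma> 0} (inversion_sign ?s * (?s 4 5 * ?s 4 0 * ?s 5 0))"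
  proof -
    have sq: "x * y = (x * z * y) * z" if "z * z = 1" for x y z :: 'f
    proof -
      have "(x * z * y) * z = x * y * (z * z)" by (simp only: mult_ac)
      then show ?thesis using that by simp
    qed
    show ?thesis unfolding inversion_sign_def by (subst sq[OF order_sign_prod_sq]) (rule refl)
  qed
  also have "\<dots> = of_int (sign \<sigma>) *s axis {\<sigma> 4, \<sigma> 5, \<sigma> 0} (?s 4 5 * ?s 4 0 * ?s 5 0)"
    by (simp add: inversion_sign_permutation[OF assms] axis_scale)
  finally show ?thesis by (simp add: wedge_list_3 inj six_eq_zero)
qed

text \<open>\<open>is_theta\<close> prescribes values only at wedges indexed by permutations; this
  reaches every basis 3-vector.\<close>

lemma obtain_permutation:
  fixes S :: "6 set"
  assumes "card S = 3"
  obtains \<sigma> where "\<sigma> permutes UNIV" "S = {\<sigma> 1, \<sigma> 2, \<sigma> 3}"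
proof -
  obtain a b c where S: "S = {a, b, c}" "distinct [a, b, c]"
    using assms by (auto simp: card_3_iff)
  have "card (- S) = 3" using assms by (simp add: card_Compl_6)
  then obtain d e f where T: "- S = {d, e, f}" "distinct [d, e, f]"
    by (auto simp: card_3_iff)
  define \<sigma> :: "6 \<Rightarrow> 6" where "\<sigma> i = (if i = 1 then a else if i = 2 then b else if i = 3 then c
    else if i = 4 then d else if i = 5 then e else f)" for i
  have "UNIV = {a, b, c} \<union> {d, e, f}" using S T by auto
  also have "\<dots> = {\<sigma> 1, \<sigma> 2, \<sigma> 3, \<sigma> 4, \<sigma> 5, \<sigma> 0}" by (simp add: \<sigma>_def) blast
  also have "\<dots> \<subseteq> range \<sigma>" by blast
  finally have "surj \<sigma>" by blast
  then have "\<sigma> permutes UNIV"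
    by (intro bij_imp_permutes) (auto simp: bij_def finite_UNIV_surj_inj)
  moreover have "S = {\<sigma> 1, \<sigma> 2, \<sigma> 3}" by (simp add: S \<sigma>_def)
  ultimately show ?thesis using that by blast
qed

lemma e6_carrier_iff:
  "(f', f, A, u, u') \<in> e6_carrier \<longleftrightarrow> f' \<in> ext6 \<and> f \<in> ext3 \<and> u \<in> ext3 \<and> u' \<in> ext6"
  by (simp add: e6_carrier_def)

text \<open>The scalar trace/3 arises from splitting \<open>A\<close> into the scalar part trace/6
  and a traceless part: negating and transposing only the latter gives trace/3 minus the transpose
  of \<open>A\<close>.\<close>

fun theta_coord :: "'f::field \<Rightarrow> 'f e6 \<Rightarrow> 'f e6" where
  "theta_coord \<iota> (f', f, A, u, u') =
     (- f', - (\<iota> *s star f), mat (trace A / 3) - transpose A, \<iota> *s star u, - u')"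

lemma theta_coord_carrier: "x \<in> e6_carrier \<Longrightarrow> theta_coord \<iota> x \<in> e6_carrier"
  by (cases x) (simp add: e6_carrier_iff ext_pow_closed star_ext3)

lemma transpose_simps:
  "transpose (A + B) = transpose A + transpose B" "transpose (A - B) = transpose A - transpose B"
  "transpose (- A) = - transpose A" "transpose (mat c) = mat c" "transpose 0 = 0"
  "transpose (mat_scale k C) = mat_scale k (transpose C)"
  for A B :: "'f::ab_group_add ^ 'n ^ 'n" and C :: "'h::times ^ 'n ^ 'n"
  by (auto simp: transpose_def vec_eq_iff mat_def mat_scale_def)

lemma mat_add: "mat (a + b) = mat a + mat (b :: 'f::ab_group_add)"
  and mat_diff: "mat (a - b) = mat a - mat b"
  and mat_minus: "mat (- a) = - mat a"
  and mat_scale_mat: "mat_scale c (mat d) = mat (c * d :: 'k::comm_ring_1)"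
  by (auto simp: vec_eq_iff mat_def mat_scale_def)

lemma mat_scale_simps:
  fixes A B :: "'f::comm_ring_1 ^ 'n ^ 'n"
  shows "mat_scale c (A + B) = mat_scale c A + mat_scale c B"
    "mat_scale c (A - B) = mat_scale c A - mat_scale c B"
    "mat_scale c (- A) = - mat_scale c A" "mat_scale c 0 = 0" "mat_scale 1 A = A"
    "mat_scale 0 A = 0" "mat_scale (-1) A = - A" "mat_scale a (mat_scale c A) = mat_scale (a * c) A"
  by (simp_all add: vec_eq_iff mat_scale_def algebra_simps)

lemma is_theta_coord:
  "is_theta \<iota> (restrict (theta_coord \<iota>) (e6_carrier :: 'f::field_char_0 e6 set))"
  unfolding is_theta_def
proof (intro conjI ballI allI impI)
  fix x y :: "'f e6" assume "x \<in> e6_carrier" "y \<in> e6_carrier"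
  then show "restrict (theta_coord \<iota>) e6_carrier (x + y)
      = restrict (theta_coord \<iota>) e6_carrier x + restrict (theta_coord \<iota>) e6_carrier y"
    by (cases x; cases y)
      (simp add: e6_carrier_iff ext_pow_closed star_add vec_eq_iff algebra_simps trace_add
        add_divide_distrib transpose_simps mat_nth)
next
  fix c and x :: "'f e6" assume "x \<in> e6_carrier"
  then show "restrict (theta_coord \<iota>) e6_carrier (e6_scale c x)
      = e6_scale c (restrict (theta_coord \<iota>) e6_carrier x)"
    by (cases x) (simp add: e6_carrier_iff ext_pow_closed star_scale vec_eq_iff algebra_simps
        trace_scale transpose_simps mat_nth mat_scale_nth)
next
  fix \<sigma> assume \<sigma>: "\<sigma> permutes (UNIV :: 6 set)"
  have inj: "\<sigma> i = \<sigma> j \<longleftrightarrow> i = j" for i j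
    using \<sigma> permutes_inj[of \<sigma> UNIV] by (auto dest: injD)
  have mem: "wedge_list [basis_vec (\<sigma> 1), basis_vec (\<sigma> 2), basis_vec (\<sigma> 3)] \<in> (ext3 :: 'f ext6 set)"
    by (simp add: wedge_list_3 inj axis_ext_pow)
  show "restrict (theta_coord \<iota>) e6_carrier
      (0, 0, 0, wedge_list [basis_vec (\<sigma> 1), basis_vec (\<sigma> 2), basis_vec (\<sigma> 3)], 0) =
      (0, 0, 0, (of_int (sign \<sigma>) * \<iota>) *s
         wedge_list [basis_vec (\<sigma> 4), basis_vec (\<sigma> 5), basis_vec (\<sigma> 6)], 0)"
    using mem star_wedge_list[OF \<sigma>, where 'f='f]
    by (simp add: e6_carrier_iff trace_def transpose_simps vec_eq_iff mat_nth mult_ac)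
  show "restrict (theta_coord \<iota>) e6_carrier
      (0, wedge_list [basis_vec (\<sigma> 1), basis_vec (\<sigma> 2), basis_vec (\<sigma> 3)], 0, 0, 0) =
      (0, (- of_int (sign \<sigma>) * \<iota>) *s
         wedge_list [basis_vec (\<sigma> 4), basis_vec (\<sigma> 5), basis_vec (\<sigma> 6)], 0, 0, 0)"
    using mem star_wedge_list[OF \<sigma>, where 'f='f]
    by (simp add: e6_carrier_iff trace_def transpose_simps vec_eq_iff mat_nth mult_ac)
next
  fix a and A :: "'f ^ 6 ^ 6" assume "trace A = 0"
  then show "restrict (theta_coord \<iota>) e6_carrier (0, 0, mat a + A, 0, 0) = (0, 0, mat a - transpose A, 0, 0)"
    by (simp add: e6_carrier_iff trace_add trace_mat_6 transpose_simps vec_eq_iff mat_nth)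
next
  fix f' u' :: "'f ext6" assume "f' \<in> ext6" "u' \<in> ext6"
  then show "restrict (theta_coord \<iota>) e6_carrier (f', 0, 0, 0, u') = (- f', 0, 0, 0, - u')"
    by (simp add: e6_carrier_iff trace_def transpose_simps vec_eq_iff mat_nth)
qed simp

text \<open>Additivity and homogeneity spread the prescribed values over the carrier, so together
  with \<open>is_theta_coord\<close> the \<open>THE\<close> in \<open>theta\<close> is
  evaluated.\<close>

lemma is_theta_unique:
  assumes "is_theta \<iota> \<theta>"
  shows "\<theta> = restrict (theta_coord \<iota>) (e6_carrier :: 'f::field_char_0 e6 set)"
proof -
  note \<theta> = assms[unfolded is_theta_def]
  have add: "\<theta> (x + y) = \<theta> x + \<theta> y" if "x \<in> e6_carrier" "y \<in> e6_carrier" for x y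
    using \<theta> that by blast
  have scale: "\<theta> (e6_scale c x) = e6_scale c (\<theta> x)" if "x \<in> e6_carrier" for c x
    using \<theta> that by blast
  have basis: "\<theta> (0, 0, 0, axis S c, 0) = (0, 0, 0, \<iota> *s star (axis S c), 0) \<and>
      \<theta> (0, axis S c, 0, 0, 0) = (0, - (\<iota> *s star (axis S c)), 0, 0, 0)" if S: "card S = 3" for S c
  proof -
    obtain \<sigma> where \<sigma>: "\<sigma> permutes UNIV" "S = {\<sigma> 1, \<sigma> 2, \<sigma> 3}"
      using obtain_permutation[OF S] by blast
    have inj: "\<sigma> i = \<sigma> j \<longleftrightarrow> i = j" for i j
      using \<sigma> permutes_inj[of \<sigma> UNIV] by (auto dest: injD)
    let ?s = "order_sign (\<sigma> 1) (\<sigma> 2) * order_sign (\<sigma> 1) (\<sigma> 3) * order_sign (\<sigma> 2) (\<sigma> 3) :: 'f"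
    let ?w = "wedge_list [basis_vec (\<sigma> 1), basis_vec (\<sigma> 2), basis_vec (\<sigma> 3)] :: 'f ext6"
    have w: "?w = axis S ?s" unfolding \<sigma>(2) by (rule wedge_list_3) (simp add: inj)
    have "?s * ?s = 1" by (rule order_sign_prod_sq)
    \<comment> \<open>The sorting sign \<open>?s\<close> is its own inverse, so the basis vector is
      a multiple of the unsorted wedge at which the value is prescribed.\<close>
    then have c: "axis S c = (c * ?s) *s ?w" by (simp only: w axis_scale mult.assoc mult_1_right)
    have mem: "(0, 0, 0, ?w, 0) \<in> e6_carrier" "(0, ?w, 0, 0, 0) \<in> e6_carrier"
      using S by (simp_all add: e6_carrier_iff w axis_ext_pow)
    have "\<theta> (0, 0, 0, axis S c, 0) = e6_scale (c * ?s) (\<theta> (0, 0, 0, ?w, 0))"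
      using scale[OF mem(1), of "c * ?s"] by (simp add: c mat_scale_simps del: order_sign_def)
    moreover have "\<theta> (0, axis S c, 0, 0, 0) = e6_scale (c * ?s) (\<theta> (0, ?w, 0, 0, 0))"
      using scale[OF mem(2), of "c * ?s"] by (simp add: c mat_scale_simps)
    moreover have "\<theta> (0, 0, 0, ?w, 0) = (0, 0, 0, \<iota> *s star ?w, 0)"
      "\<theta> (0, ?w, 0, 0, 0) = (0, - (\<iota> *s star ?w), 0, 0, 0)"
      using \<theta> \<sigma>(1) star_wedge_list[OF \<sigma>(1), where 'f='f] by (simp_all add: vec_eq_iff mult_ac)
    ultimately show ?thesis
      unfolding c by (simp add: star_scale mat_scale_simps vec_eq_iff mult_ac)
  qed
  have zero: "\<theta> 0 = 0" using add[of 0 0] by (simp add: e6_carrier_def zero_prod_def)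
  have up: "\<theta> (0, 0, 0, u, 0) = (0, 0, 0, \<iota> *s star u, 0)" if u: "u \<in> ext3" for u
  proof -
    have "\<theta> (0, 0, 0, \<Sum>S\<in>X. axis S (u $ S), 0) = (0, 0, 0, \<iota> *s star (\<Sum>S\<in>X. axis S (u $ S)), 0) \<and>
        (\<Sum>S\<in>X. axis S (u $ S)) \<in> ext3" if "finite X" for X
      using that
    proof induction
      case empty then show ?case using zero by (simp add: zero_prod_def)
    next
      case (insert S X)
      have S: "axis S (u $ S) \<in> ext3 \<and> \<theta> (0, 0, 0, axis S (u $ S), 0) = (0, 0, 0, \<iota> *s star (axis S (u $ S)), 0)"
        using u basis[of S "u $ S"] zero
        by (cases "card S = 3") (simp_all add: axis_ext_pow ext3_nth zero_prod_def)
      have "(0, 0, 0, \<Sum>S\<in>insert S X. axis S (u $ S), 0)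
          = ((0, 0, 0, axis S (u $ S), 0) + (0, 0, 0, \<Sum>S\<in>X. axis S (u $ S), 0) :: 'f e6)"
        using insert.hyps by simp
      then show ?case using insert S
        by (simp only: add e6_carrier_iff ext_pow_zero simp_thms)
          (simp add: star_add vec_eq_iff algebra_simps ext_pow_add)
    qed
    from this[of UNIV] show ?thesis by (simp add: axis_expansion)
  qed
  have dn: "\<theta> (0, u, 0, 0, 0) = (0, - (\<iota> *s star u), 0, 0, 0)" if u: "u \<in> ext3" for u
  proof -
    have "\<theta> (0, \<Sum>S\<in>X. axis S (u $ S), 0, 0, 0) = (0, - (\<iota> *s star (\<Sum>S\<in>X. axis S (u $ S))), 0, 0, 0) \<and>
        (\<Sum>S\<in>X. axis S (u $ S)) \<in> ext3" if "finite X" for X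
      using that
    proof induction
      case empty then show ?case using zero by (simp add: zero_prod_def)
    next
      case (insert S X)
      have S: "axis S (u $ S) \<in> ext3 \<and> \<theta> (0, axis S (u $ S), 0, 0, 0) = (0, - (\<iota> *s star (axis S (u $ S))), 0, 0, 0)"
        using u basis[of S "u $ S"] zero
        by (cases "card S = 3") (simp_all add: axis_ext_pow ext3_nth zero_prod_def)
      have "(0, \<Sum>S\<in>insert S X. axis S (u $ S), 0, 0, 0)
          = ((0, axis S (u $ S), 0, 0, 0) + (0, \<Sum>S\<in>X. axis S (u $ S), 0, 0, 0) :: 'f e6)"
        using insert.hyps by simp
      then show ?case using insert S
        by (simp only: add e6_carrier_iff ext_pow_zero simp_thms)
          (simp add: star_add vec_eq_iff algebra_simps ext_pow_add)
    qed
    from this[of UNIV] show ?thesis by (simp add: axis_expansion)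
  qed
  have mid: "\<theta> (0, 0, A, 0, 0) = (0, 0, mat (trace A / 3) - transpose A, 0, 0)" for A
  proof -
    let ?c = "trace A / 6"
    have "trace (A - mat ?c) = 0" by (simp add: trace_sub trace_mat_6)
    then have "\<theta> (0, 0, mat ?c + (A - mat ?c), 0, 0) = (0, 0, mat ?c - transpose (A - mat ?c), 0, 0)"
      using \<theta> by blast
    then show ?thesis by (simp add: transpose_simps algebra_simps mat_add[symmetric])
  qed
  show ?thesis
  proof (rule extensionalityI)
    show "\<theta> \<in> extensional e6_carrier" using \<theta> by blast
    fix x :: "'f e6" assume x: "x \<in> e6_carrier"
    obtain f' f A u u' where x_eq: "x = (f', f, A, u, u')" by (cases x)
    have c: "f' \<in> ext6" "f \<in> ext3" "u \<in> ext3" "u' \<in> ext6" using x by (simp_all add: x_eq e6_carrier_iff)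
    have "\<theta> x = \<theta> ((f', 0, 0, 0, u') + ((0, f, 0, 0, 0) + ((0, 0, A, 0, 0) + (0, 0, 0, u, 0))))"
      by (simp add: x_eq)
    moreover have "\<theta> ((f', 0, 0, 0, u') + ((0, f, 0, 0, 0) + ((0, 0, A, 0, 0) + (0, 0, 0, u, 0))))
        = \<theta> (f', 0, 0, 0, u') + \<theta> ((0, f, 0, 0, 0) + ((0, 0, A, 0, 0) + (0, 0, 0, u, 0)))"
      by (rule add) (simp_all add: e6_carrier_iff c)
    moreover have "\<theta> ((0, f, 0, 0, 0) + ((0, 0, A, 0, 0) + (0, 0, 0, u, 0)))
        = \<theta> (0, f, 0, 0, 0) + \<theta> ((0, 0, A, 0, 0) + (0, 0, 0, u, 0))"
      by (rule add) (simp_all add: e6_carrier_iff c)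
    moreover have "\<theta> ((0, 0, A, 0, 0) + (0, 0, 0, u, 0)) = \<theta> (0, 0, A, 0, 0) + \<theta> (0, 0, 0, u, 0)"
      by (rule add) (simp_all add: e6_carrier_iff c)
    moreover have "\<theta> (f', 0, 0, 0, u') = (- f', 0, 0, 0, - u')" using \<theta> c by blast
    ultimately show "\<theta> x = restrict (theta_coord \<iota>) e6_carrier x"
      using x by (simp add: x_eq up dn mid c)
  qed simp
qed

lemma theta_eq_theta_coord:
  fixes \<iota> :: "'f::field_char_0"
  shows "x \<in> e6_carrier \<Longrightarrow> theta \<iota> x = theta_coord \<iota> x"
proof -
  have "theta \<iota> = restrict (theta_coord \<iota>) (e6_carrier :: 'f e6 set)"
    unfolding theta_def by (rule the_equality) (fact is_theta_coord, fact is_theta_unique)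
  then show "x \<in> e6_carrier \<Longrightarrow> theta \<iota> x = theta_coord \<iota> x" by simp
qed

section \<open>The diagonal involutions in coordinates\<close>

definition flip :: "6 \<Rightarrow> 6 \<Rightarrow> 6 \<Rightarrow> 'f::comm_ring_1" where
  "flip i j a = (if a = i \<or> a = j then -1 else 1)"

lemma flip_sq: "flip i j a * flip i j a = 1"
  by (simp add: flip_def)

lemma f_diag_eq: "f_diag i j = diag_mat (flip i j)"
  by (simp add: f_diag_def diag_mat_def flip_def vec_eq_iff)

lemma diag_mat_nth: "diag_mat d $ a $ b = (if a = b then d a else 0)"
  by (simp add: diag_mat_def)

lemma diag_mat_mult_left: "(diag_mat d ** A) $ a $ b = d a * (A $ a $ b :: 'f::comm_ring_1)"
proof -
  have "(diag_mat d ** A) $ a $ b = (\<Sum>k\<in>UNIV. if k = a then d a * A $ a $ b else 0)"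
    unfolding matrix_matrix_mult_def diag_mat_def vec_lambda_beta by (rule sum.cong) auto
  then show ?thesis by simp
qed

lemma diag_mat_mult_right: "(A ** diag_mat d) $ a $ b = (A $ a $ b :: 'f::comm_ring_1) * d b"
proof -
  have "(A ** diag_mat d) $ a $ b = (\<Sum>k\<in>UNIV. if k = b then A $ a $ b * d b else 0)"
    unfolding matrix_matrix_mult_def diag_mat_def vec_lambda_beta by (rule sum.cong) auto
  then show ?thesis by simp
qed

lemma matrix_inv_f_diag: "matrix_inv (f_diag i j) = (f_diag i j :: 'f::field ^ 6 ^ 6)"
proof -
  have *: "f_diag i j ** f_diag i j = (mat 1 :: 'f ^ 6 ^ 6)"
    unfolding f_diag_eq
    by (simp add: vec_eq_iff diag_mat_mult_left mat_nth diag_mat_nth flip_sq)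
  then have "f_diag i j ** matrix_inv (f_diag i j) = (mat 1 :: 'f ^ 6 ^ 6)"
    unfolding matrix_inv_def by (metis (mono_tags, lifting) * someI_ex)
  then show ?thesis
    by (metis * matrix_mul_assoc matrix_mul_lid matrix_mul_rid)
qed

lemma tilde_f_diag:
  "tilde (f_diag i j) (f', f, A, u, u') =
    ((\<chi> S. (\<Prod>a\<in>S. flip i j a) * f' $ S), (\<chi> S. (\<Prod>a\<in>S. flip i j a) * f $ S),
     (\<chi> a b. flip i j a * A $ a $ b * flip i j b),
     (\<chi> S. (\<Prod>a\<in>S. flip i j a) * u $ S), (\<chi> S. (\<Prod>a\<in>S. flip i j a) * u' $ S))"
proof -
  have "transpose (f_diag i j) = f_diag i j" by (auto simp: f_diag_def transpose_def vec_eq_iff)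
  then have dual: "dual_map (f_diag i j) = (f_diag i j :: 'a ^ 6 ^ 6)" by (simp add: dual_map_def matrix_inv_f_diag)
  show ?thesis
    by (simp only: tilde.simps matrix_inv_f_diag dual)
      (simp add: f_diag_eq vec_eq_iff ext_map_diag diag_mat_mult_left diag_mat_mult_right)
qed

section \<open>Consequences of the Jacobi identity\<close>

text \<open>\<open>L_2\<close> and \<open>L_-2\<close> are lines. Recording their elements by
  scalars turns the outer components of every bracket into scalar identities.\<close>

definition el :: "'f::field \<Rightarrow> 'f ext6 \<Rightarrow> 'f ^ 6 ^ 6 \<Rightarrow> 'f ext6 \<Rightarrow> 'f \<Rightarrow> 'f e6" where
  "el p f A u q = (axis UNIV p, f, A, u, axis UNIV q)"

lemma axis_UNIV_ext6 [simp]: "axis UNIV c \<in> ext6"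
  by (simp add: axis_ext_pow)

lemma el_carrier: "el p f A u q \<in> e6_carrier \<longleftrightarrow> f \<in> ext3 \<and> u \<in> ext3"
  by (simp add: el_def e6_carrier_iff)

lemma el_cases:
  assumes "x \<in> e6_carrier"
  obtains p f A u q where "x = el p f A u q" "f \<in> ext3" "u \<in> ext3"
proof -
  obtain f' f A u u' where "x = (f', f, A, u, u')" by (cases x)
  then have "x = el (f' $ UNIV) f A u (u' $ UNIV)" "f \<in> ext3" "u \<in> ext3"
    using assms ext6_eq[of f'] ext6_eq[of u'] by (auto simp: el_def e6_carrier_iff)
  then show ?thesis by (rule that)
qed

lemma axis_nth_same [simp]: "axis S c $ S = c"
  by (simp add: axis_def)

lemma el_eq_iff: "el p f A u q = el p' f' A' u' q' \<longleftrightarrow> p = p' \<and> f = f' \<and> A = A' \<and> u = u' \<and> q = q'"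
  by (auto simp: el_def dest: arg_cong[of _ _ "\<lambda>x. x $ UNIV"])

lemma axis_add: "axis S a + axis S b = axis S (a + b :: 'f::comm_ring_1)"
  and axis_minus: "- axis S a = axis S (- a)"
  and axis_diff: "axis S a - axis S b = axis S (a - b)"
  by (simp_all add: vec_eq_iff axis_def)

lemma el_add: "el p f A u q + el p' f' A' u' q' = el (p + p') (f + f') (A + A') (u + u') (q + q')"
  by (simp add: el_def axis_add)

lemma el_zero: "0 = el 0 0 0 0 0"
  by (simp add: el_def zero_prod_def)

lemma el_scale: "e6_scale c (el p f A u q) = el (c * p) (c *s f) (mat_scale c A) (c *s u) (c * q)"
  by (simp add: el_def axis_scale)

lemma trace_zero [simp]: "trace 0 = 0"
  and trace_minus: "trace (- A) = - trace (A :: 'f::comm_ring_1 ^ 'n ^ 'n)"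
  by (simp_all add: trace_def sum_negf)

lemma trace_double: "trace (2 * A) = 2 * trace (A :: 'f::comm_ring_1 ^ 'n ^ 'n)"
  unfolding mult_2 by (rule trace_add)

lemma psi_zero_left [simp]: "psi 0 u = (0 :: 'f::field_char_0 ^ 6 ^ 6)"
  and psi_zero_right [simp]: "psi f 0 = (0 :: 'f ^ 6 ^ 6)"
  by (intro psi_eqI; simp add: matrix_add_simps)+

lemma rcontract_zero [simp]: "rcontract u 0 = 0"
  unfolding rcontract_def by (rule the_equality) (auto intro: pairing_ext3_eqI)

lemma lcontract_zero [simp]: "lcontract 0 f = 0"
  unfolding lcontract_def
proof (rule the_equality)
  fix w :: "'a ext6" assume "w \<in> ext3 \<and> (\<forall>h\<in>ext3. pairing w h = pairing 0 (wedge f h))"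
  then show "w = 0" by (intro pairing_ext3_eqI) (auto simp: pairing_commute[of _ w])
qed simp

lemma wedge_zero [simp]: "wedge 0 x = 0" "wedge x 0 = 0"
  by (simp_all add: wedge_def vec_eq_iff)

lemma mat_scale_zero [simp]: "mat_scale c (0 :: 'f::comm_ring_1 ^ 'n ^ 'm) = 0"
  by (simp add: vec_eq_iff mat_scale_def)

lemma dual_der_simps:
  "dual_der (A + B) = dual_der A + dual_der B" "dual_der (A - B) = dual_der A - dual_der B"
  "dual_der (- A) = - dual_der A" "dual_der 0 = 0" "dual_der (mat_scale c A) = mat_scale c (dual_der A)"
  "trace (dual_der A) = - trace A" "dual_der (dual_der A) = (A :: 'f::comm_ring_1 ^ 'n ^ 'n)"
  by (simp_all add: dual_der_def transpose_simps mat_scale_simps trace_minus trace_transpose transpose_transpose)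

lemma ext_der_mat: "ext_der (mat c) x $ S = of_nat (card S) * c * (x $ S :: 'f::comm_ring_1)"
proof -
  have eq: "mat c = diag_mat (\<lambda>_. c)" by (simp add: vec_eq_iff mat_nth diag_mat_nth)
  show ?thesis unfolding eq ext_der_diag by simp
qed

lemma ext_der_mat_ext3: "x \<in> ext3 \<Longrightarrow> ext_der (mat c) x = (3 * c) *s (x :: 'f::comm_ring_1 ext6)"
  by (auto simp: vec_eq_iff ext_der_mat) (metis ext3_nth mult_zero_right of_nat_numeral)

lemma unit_mat_diag: "unit_mat i i = diag_mat (\<lambda>a. if a = i then 1 else 0)"
  by (auto simp: vec_eq_iff unit_mat_nth diag_mat_nth)

lemma ext_der_unit_diag:
  "ext_der (unit_mat k k) x $ S = (if k \<in> S then x $ S else (0 :: 'f::comm_ring_1))"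
proof -
  have "(\<Sum>i\<in>S. if i = k then 1 else 0 :: 'f) = (if k \<in> S then 1 else 0)" by simp
  then show ?thesis by (simp add: unit_mat_diag ext_der_diag)
qed

lemma unit_mat_mult: "unit_mat i j ** unit_mat k l = (if j = k then unit_mat i l else (0 :: 'f::comm_ring_1 ^ 'n ^ 'n))"
proof -
  have "(unit_mat i j ** unit_mat k l) $ a $ b = ((if j = k then unit_mat i l else 0) :: 'f ^ 'n ^ 'n) $ a $ b" for a b
  proof -
    have "(unit_mat i j ** unit_mat k l) $ a $ b
        = (\<Sum>c\<in>UNIV. if c = j then (if j = k \<and> a = i \<and> b = l then 1 else 0 :: 'f) else 0)"
      unfolding matrix_matrix_mult_def vec_lambda_beta unit_mat_nth by (rule sum.cong) auto
    then show ?thesis by (simp add: unit_mat_nth)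
  qed
  then show ?thesis by (simp add: vec_eq_iff)
qed

locale e6_lie =
  fixes \<alpha> :: "int \<Rightarrow> int \<Rightarrow> 'f::field_char_0" and \<beta> :: "int \<Rightarrow> 'f" and \<iota> :: 'f
  assumes scalars: "e6_scalars \<alpha> \<beta>" and iota: "\<iota>\<^sup>2 = -1"
begin

abbreviation br :: "'f e6 \<Rightarrow> 'f e6 \<Rightarrow> 'f e6" where "br \<equiv> e6_bracket \<alpha> \<beta>"
abbreviation L :: "('f, 'f e6) alg" where "L \<equiv> e6_algebra \<alpha> \<beta>"

lemma nonzero: "\<alpha> 1 1 \<noteq> 0" "\<alpha> (-1) (-1) \<noteq> 0" "\<alpha> 1 (-2) \<noteq> 0" "\<alpha> (-1) 2 \<noteq> 0"
    "\<alpha> 1 (-1) \<noteq> 0" "\<alpha> 2 (-2) \<noteq> 0" "\<beta> 1 \<noteq> 0" "\<beta> 2 \<noteq> 0" "\<iota> \<noteq> 0"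
  using scalars iota by (auto simp: e6_scalars_def)

lemma iota_sq: "\<iota> * \<iota> = -1"
  using iota by (simp add: power2_eq_square)

lemma lie: "lie_algebra L"
  using scalars by (simp add: e6_scalars_def lie_algebra_of_type_E6_def simple_of_cartan_type_def
      simple_lie_algebra_def)

lemma L_simps [simp]: "acar L = e6_carrier" "ascl L = e6_scale" "aprd L = br"
  by (simp_all add: e6_algebra_def)

lemma vs: "vector_space (e6_scale :: 'f \<Rightarrow> 'f e6 \<Rightarrow> 'f e6)"
  and subspace_carrier: "module.subspace e6_scale (e6_carrier :: 'f e6 set)"
  and br_closed: "x \<in> e6_carrier \<Longrightarrow> y \<in> e6_carrier \<Longrightarrow> br x y \<in> e6_carrier"
  and br_self: "x \<in> e6_carrier \<Longrightarrow> br x x = 0"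
  and br_add_left: "x \<in> e6_carrier \<Longrightarrow> y \<in> e6_carrier \<Longrightarrow> z \<in> e6_carrier \<Longrightarrow> br (x + y) z = br x z + br y z"
  and br_add_right: "x \<in> e6_carrier \<Longrightarrow> y \<in> e6_carrier \<Longrightarrow> z \<in> e6_carrier \<Longrightarrow> br z (x + y) = br z x + br z y"
  and br_scale_left: "x \<in> e6_carrier \<Longrightarrow> y \<in> e6_carrier \<Longrightarrow> br (e6_scale c x) y = e6_scale c (br x y)"
  and br_scale_right: "x \<in> e6_carrier \<Longrightarrow> y \<in> e6_carrier \<Longrightarrow> br x (e6_scale c y) = e6_scale c (br x y)"
  and jacobi: "x \<in> e6_carrier \<Longrightarrow> y \<in> e6_carrier \<Longrightarrow> z \<in> e6_carrier \<Longrightarrow>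
    br x (br y z) + br y (br z x) + br z (br x y) = 0"
  using lie by (simp_all add: lie_algebra_def)

text \<open>Until the action of \<open>L\<^sub>0\<close> on \<open>L\<^sub>2\<close> and \<open>L\<^sub>-\<^sub>2\<close> is known to be through the trace,
  only brackets avoiding it can be put into \<open>el\<close> form.\<close>

lemma br_0_1: "br (el 0 0 A 0 0) (el 0 0 0 u 0) = el 0 0 0 (ext_der A u) 0"
  and br_1_0: "br (el 0 0 0 u 0) (el 0 0 A 0 0) = el 0 0 0 (- ext_der A u) 0"
  and br_0_m1: "br (el 0 0 A 0 0) (el 0 f 0 0 0) = el 0 (ext_der (dual_der A) f) 0 0 0"
  and br_m1_0: "br (el 0 f 0 0 0) (el 0 0 A 0 0) = el 0 (- ext_der (dual_der A) f) 0 0 0"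
  and br_0_0: "br (el 0 0 A 0 0) (el 0 0 B 0 0) = el 0 0 (A ** B - B ** A) 0 0"
  by (simp_all add: el_def rcontract_eq lcontract_eq dual_der_simps wedge_ext3 mat_scale_simps
      matrix_add_simps transpose_simps)

text \<open>Read off from the closure of the carrier under the bracket.\<close>

lemma ext_der_ext3 [simp]: "u \<in> ext3 \<Longrightarrow> ext_der A u \<in> (ext3 :: 'f ext6 set)"
  using br_closed[of "el 0 0 A 0 0" "el 0 0 0 u 0"] by (simp add: br_0_1 el_carrier)

text \<open>The Jacobi identity for two matrices and a 3-vector, read in \<open>L_1\<close>.\<close>

lemma ext_der_commutator:
  assumes "u \<in> ext3"
  shows "ext_der (A ** B - B ** A) u = ext_der A (ext_der B u) - ext_der B (ext_der A (u :: 'f ext6))"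
proof -
  have "br (el 0 0 A 0 0) (br (el 0 0 B 0 0) (el 0 0 0 u 0)) + br (el 0 0 B 0 0) (br (el 0 0 0 u 0) (el 0 0 A 0 0))
      + br (el 0 0 0 u 0) (br (el 0 0 A 0 0) (el 0 0 B 0 0)) = 0"
    by (rule jacobi) (use assms in \<open>simp_all add: el_carrier\<close>)
  then have "ext_der A (ext_der B u) - ext_der B (ext_der A u) - ext_der (A ** B - B ** A) u = 0"
    by (simp add: br_0_1 br_1_0 br_0_0 el_add el_zero el_eq_iff ext_der_minus_right)
  then show ?thesis by simp
qed

lemma br_0_2: "br (el 0 0 A 0 0) (0, 0, 0, 0, u') = (0, 0, 0, 0, ext_der A u')"
  and br_2_0: "br (0, 0, 0, 0, u') (el 0 0 A 0 0) = (0, 0, 0, 0, - ext_der A u')"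
  by (simp_all add: el_def rcontract_eq lcontract_eq dual_der_simps wedge_ext3 mat_scale_simps
      matrix_add_simps transpose_simps)

text \<open>The action on the top line is a linear form in the matrix. By the Jacobi identity it
  vanishes on commutators, hence on every off-diagonal unit, which is its own commutator with a
  diagonal unit. Diagonal units act on the full wedge with eigenvalue 1.\<close>

lemma ext_der_axis_UNIV: "ext_der A (axis UNIV c) = (axis UNIV (trace A * c) :: 'f ext6)"
proof -
  have mem: "ext_der A (axis UNIV c) \<in> ext6" for A :: "'f ^ 6 ^ 6" and c
    using br_closed[of "el 0 0 A 0 0" "(0, 0, 0, 0, axis UNIV c)"]
    by (simp add: br_0_2 el_carrier e6_carrier_iff)
  define l where "l A = ext_der A (axis UNIV 1) $ UNIV" for A :: "'f ^ 6 ^ 6"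
  have l: "ext_der A (axis UNIV c) = axis UNIV (l A * c)" for A c
  proof -
    have "ext_der A (axis UNIV c) = c *s ext_der A (axis UNIV 1)"
      by (simp add: ext_der_scale_right[symmetric] axis_scale)
    also have "ext_der A (axis UNIV 1) = axis UNIV (l A)"
      unfolding l_def using mem ext6_eq by blast
    finally show ?thesis by (simp add: axis_scale mult.commute)
  qed
  have comm: "l (A ** B - B ** A) = 0" for A B
  proof -
    have "br (el 0 0 A 0 0) (br (el 0 0 B 0 0) (0, 0, 0, 0, axis UNIV 1)) + br (el 0 0 B 0 0) (br (0, 0, 0, 0, axis UNIV 1) (el 0 0 A 0 0))
      + br (0, 0, 0, 0, axis UNIV 1) (br (el 0 0 A 0 0) (el 0 0 B 0 0)) = 0"
      by (rule jacobi) (simp_all add: el_carrier e6_carrier_iff)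
    then have "axis UNIV (l (A ** B - B ** A)) = (0 :: 'f ext6)"
      by (simp add: br_0_2 br_2_0 br_0_0 ext_der_minus_right l zero_prod_def axis_add axis_minus mult.commute)
    then show ?thesis by (metis axis_nth_same zero_index)
  qed
  have unit: "l (unit_mat i j) = (if i = j then 1 else 0)" for i j
  proof (cases "i = j")
    case True
    then show ?thesis by (simp add: l_def ext_der_unit_diag)
  next
    case False
    then show ?thesis using comm[of "unit_mat i i" "unit_mat i j"] by (simp add: unit_mat_mult)
  qed
  have "l A = (\<Sum>i\<in>UNIV. \<Sum>j\<in>UNIV. A $ i $ j * l (unit_mat i j))"
    unfolding l_def by (subst mat_expansion[of A]) (simp only: ext_der_sum_left ext_der_scale_left sum_component vector_smult_component)
  also have "\<dots> = trace A"
    by (simp add: unit trace_def if_distrib cong: if_cong)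
  finally show ?thesis by (simp add: l)
qed

lemma psi_top: "psi (axis UNIV p) (axis UNIV q) = (0 :: 'f ^ 6 ^ 6)"
  by (rule psi_eqI) (simp_all add: ext_der_axis_UNIV matrix_add_simps )

text \<open>With the action on the top lines known, the whole bracket can be put into
  \<open>el\<close> form; the later uses of the Jacobi identity compare single components of this
  expression.\<close>

lemma br_el:
  assumes "f \<in> ext3" "u \<in> ext3" "g \<in> ext3" "v \<in> ext3"
  shows "br (el p f A u q) (el p' g B v q') =
    el (trace B * p - trace A * p' + \<alpha> (-1) (-1) * pairing f (star g))
      (ext_der (dual_der A) g - ext_der (dual_der B) f + \<alpha> 1 (-2) *s (p' *s star u - p *s star v))
      (A ** B - B ** A + mat_scale (\<alpha> 1 (-1)) (psi g u - psi f v)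
         + mat (\<beta> 1 * (pairing u g - pairing v f)) + mat (\<beta> 2 * (q * p' - q' * p)))
      (ext_der A v - ext_der B u + \<alpha> (-1) 2 *s (q' *s star f - q *s star g))
      (trace A * q' - trace B * q + \<alpha> 1 1 * pairing u (star v))"
  using assms
  by (simp add: el_def ext_der_axis_UNIV rcontract_eq lcontract_eq wedge_ext3 psi_top axis_add axis_diff
      axis_minus axis_scale pairing_axis_left dual_der_simps mat_scale_simps algebra_simps)

text \<open>The \<open>L_0\<close> component of the Jacobi identity for a matrix, \<open>u\<close>
  and \<open>f\<close>. Taking traces removes the commutators and the traceless \<open>psi\<close>
  terms and leaves 6 times \<beta> 1 times the difference of the two sides.\<close>

lemma pairing_ext_der:
  assumes "u \<in> ext3" "f \<in> ext3"
  shows "pairing (ext_der A u) f = pairing u (ext_der (transpose A) (f :: 'f ext6))"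
proof -
  have "br (el 0 0 A 0 0) (br (el 0 0 0 u 0) (el 0 f 0 0 0)) + br (el 0 0 0 u 0) (br (el 0 f 0 0 0) (el 0 0 A 0 0))
      + br (el 0 f 0 0 0) (br (el 0 0 A 0 0) (el 0 0 0 u 0)) = 0"
    by (rule jacobi) (use assms in \<open>simp_all add: el_carrier\<close>)
  then have "trace (A ** mat_scale (\<alpha> 1 (-1)) (psi f u) + A ** mat (\<beta> 1 * pairing u f)
      - (mat_scale (\<alpha> 1 (-1)) (psi f u) ** A + mat (\<beta> 1 * pairing u f) ** A)
      + (mat_scale (\<alpha> 1 (-1)) (psi (- ext_der (dual_der A) f) u) + mat (\<beta> 1 * pairing u (- ext_der (dual_der A) f)))
      + (mat_scale (\<alpha> 1 (-1)) (- psi f (ext_der A u)) + mat (- (\<beta> 1 * pairing (ext_der A u) f)))) = 0"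
    using assms
    by (simp add: br_el ext_pow_closed el_add el_zero el_eq_iff matrix_add_simps  dual_der_simps transpose_simps mat_minus)
  then have "6 * (\<beta> 1 * (pairing u (ext_der (transpose A) f) - pairing (ext_der A u) f)) = 0"
    by (simp add: trace_add trace_sub trace_minus trace_scale trace_psi trace_mat_6 trace_mul_sym[of A]
        dual_der_def ext_der_minus_left pairing_minus_right algebra_simps)
  then show ?thesis using nonzero by simp
qed

text \<open>The \<open>L_2\<close> component of the Jacobi identity for a matrix and two 3-vectors;
  \<open>pairing_ext_der\<close> then moves the matrix to the other factor.\<close>

lemma star_ext_der:
  assumes "v \<in> ext3"
  shows "star (ext_der A v) = trace A *s star v - ext_der (transpose A) (star (v :: 'f ext6))"
proof (rule pairing_ext3_eqI)
  fix u :: "'f ext6" assume u: "u \<in> ext3"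
  have "br (el 0 0 A 0 0) (br (el 0 0 0 u 0) (el 0 0 0 v 0)) + br (el 0 0 0 u 0) (br (el 0 0 0 v 0) (el 0 0 A 0 0))
      + br (el 0 0 0 v 0) (br (el 0 0 A 0 0) (el 0 0 0 u 0)) = 0"
    by (rule jacobi) (use assms u in \<open>simp_all add: el_carrier\<close>)
  then have "\<alpha> 1 1 * (trace A * pairing u (star v) - pairing u (star (ext_der A v)) + pairing v (star (ext_der A u))) = 0"
    using assms u
    by (simp add: br_el ext_pow_closed el_add el_zero el_eq_iff matrix_add_simps  dual_der_simps
        transpose_simps ext_der_minus_right star_minus pairing_minus_right algebra_simps)
  then have "trace A * pairing u (star v) - pairing u (star (ext_der A v)) + pairing v (star (ext_der A u)) = 0"
    using nonzero by simp
  moreover have "pairing v (star (ext_der A u)) = - pairing (ext_der A u) (star v)"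
    using u by (intro pairing_star_anticommute) simp
  moreover have "pairing (ext_der A u) (star v) = pairing u (ext_der (transpose A) (star v))"
    using assms u by (intro pairing_ext_der star_ext3)
  ultimately show "pairing u (star (ext_der A v)) = pairing u (trace A *s star v - ext_der (transpose A) (star v))"
    by (simp add: pairing_diff_right pairing_scale_right algebra_simps)
qed (use assms in \<open>simp_all add: ext_pow_closed star_ext3\<close>)

text \<open>The Jacobi identity for two vectors of \<open>L_1\<close> and one of
  \<open>L_-2\<close>, and its mirror image, give after taking traces two relations involving
  \<beta> 1 and \<beta> 2. Eliminating these leaves the compatibility on which
  \<open>dualize\<close> depends.\<close>

lemma scalar_relation: "\<alpha> (-1) (-1) * \<alpha> 1 (-2) = \<alpha> 1 1 * \<alpha> (-1) 2"
proof -
  \<comment> \<open>\<open>v\<close> is chosen so that the wedge of \<open>u\<close> and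
    \<open>v\<close> is the top vector.\<close>
  define u v :: "'f ext6" where "u = axis {0, 1, 2} 1" and "v = - star u"
  have mem: "u \<in> ext3" "v \<in> ext3"
    by (simp_all add: u_def v_def ext_pow_closed star_ext3 axis_ext_pow)
  have p: "pairing u (star v) = 1"
    by (simp add: v_def star_minus star_star mem(1)) (simp add: u_def pairing_axis_left)
  then have p': "pairing v (star u) = -1"
    by (simp only: pairing_star_anticommute[OF mem(1)])
  have "br (el 0 0 0 u 0) (br (el 0 0 0 v 0) (el 1 0 0 0 0)) + br (el 0 0 0 v 0) (br (el 1 0 0 0 0) (el 0 0 0 u 0))
      + br (el 1 0 0 0 0) (br (el 0 0 0 u 0) (el 0 0 0 v 0)) = 0"
    by (rule jacobi) (simp_all add: el_carrier mem)
  then have "trace (mat_scale (\<alpha> 1 (-1)) (psi (\<alpha> 1 (-2) *s star v) u) + mat (\<beta> 1 * \<alpha> 1 (-2))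
     + (mat_scale (\<alpha> 1 (-1)) (psi (- (\<alpha> 1 (-2) *s star u)) v) + mat (\<beta> 1 * \<alpha> 1 (-2)))
     - mat (\<beta> 2 * \<alpha> 1 1)) = 0"
    using mem p p'
    by (simp add: br_el ext_pow_closed star_ext3 el_add el_zero el_eq_iff matrix_add_simps 
        dual_der_simps transpose_simps pairing_scale_right pairing_minus_right mat_minus)
  then have "6 * (2 * \<beta> 1 * \<alpha> 1 (-2) - \<beta> 2 * \<alpha> 1 1) = 0"
    by (simp add: trace_add trace_sub trace_minus trace_scale trace_psi trace_mat_6 trace_double algebra_simps)
  then have 1: "2 * \<beta> 1 * \<alpha> 1 (-2) = \<beta> 2 * \<alpha> 1 1" by (simp add: mult_ac)
  have "br (el 0 u 0 0 0) (br (el 0 v 0 0 0) (el 0 0 0 0 1)) + br (el 0 v 0 0 0) (br (el 0 0 0 0 1) (el 0 u 0 0 0))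
      + br (el 0 0 0 0 1) (br (el 0 u 0 0 0) (el 0 v 0 0 0)) = 0"
    by (rule jacobi) (simp_all add: el_carrier mem)
  then have "trace (mat_scale (\<alpha> 1 (-1)) (- psi u (\<alpha> (-1) 2 *s star v)) + mat (- (\<beta> 1 * \<alpha> (-1) 2))
     + (mat_scale (\<alpha> 1 (-1)) (- psi v (- (\<alpha> (-1) 2 *s star u))) + mat (- (\<beta> 1 * \<alpha> (-1) 2)))
     + mat (\<beta> 2 * \<alpha> (-1) (-1))) = 0"
    using mem p p'
    by (simp add: br_el ext_pow_closed star_ext3 el_add el_zero el_eq_iff matrix_add_simps 
        dual_der_simps transpose_simps pairing_scale_left pairing_minus_left mat_minus pairing_star_left)
  then have "6 * (\<beta> 2 * \<alpha> (-1) (-1) - 2 * \<beta> 1 * \<alpha> (-1) 2) = 0"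
    by (simp add: trace_add trace_sub trace_minus trace_scale trace_psi trace_mat_6 trace_double algebra_simps)
  then have 2: "\<beta> 2 * \<alpha> (-1) (-1) = 2 * \<beta> 1 * \<alpha> (-1) 2" by (simp add: mult_ac)
  have "\<beta> 2 * (\<alpha> (-1) (-1) * \<alpha> 1 (-2)) = \<alpha> (-1) 2 * (2 * \<beta> 1 * \<alpha> 1 (-2))"
    using 2 by (simp add: mult_ac)
  then have "\<beta> 2 * (\<alpha> (-1) (-1) * \<alpha> 1 (-2)) = \<beta> 2 * (\<alpha> 1 1 * \<alpha> (-1) 2)"
    unfolding 1 by (simp add: mult_ac)
  then show ?thesis using nonzero by simp
qed

section \<open>Matrix units and rotation generators on basis 3-vectors\<close>

lemma ext_der_unit_support:
  fixes i j :: 6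
  assumes "i \<noteq> j" "card S = 3" "ext_der (unit_mat i j) (axis S c) $ T \<noteq> (0::'f)"
  shows "i \<notin> S \<and> j \<in> S \<and> T = insert i (S - {j})"
proof -
  have x: "axis S c \<in> (ext3 :: 'f ext6 set)" using assms by (simp add: axis_ext_pow)
  let ?w = "ext_der (unit_mat i j) (axis S c) :: 'f ext6"
  \<comment> \<open>The diagonal unit at \<open>k\<close> detects weights: on the matrix unit it has
    weight [k = i] - [k = j], on \<open>e_S\<close> weight [k in S]. A nonzero coordinate at
    \<open>T\<close> forces the weights to add up.\<close>
  have *: "of_bool (k = i) - of_bool (k = j) = (of_bool (k \<in> T) - of_bool (k \<in> S) :: 'f)" for k
  proof -
    have "unit_mat k k ** unit_mat i j - unit_mat i j ** unit_mat k k
        = mat_scale (of_bool (k = i) - of_bool (k = j) :: 'f) (unit_mat i j)"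
      using assms(1) by (auto simp: unit_mat_mult mat_scale_simps of_bool_def)
    then have "(of_bool (k = i) - of_bool (k = j)) *s ?w
        = ext_der (unit_mat k k) ?w - ext_der (unit_mat i j) (ext_der (unit_mat k k) (axis S c))"
      using ext_der_commutator[OF x, of "unit_mat k k" "unit_mat i j"] by (simp add: ext_der_scale_left)
    moreover have "ext_der (unit_mat k k) (axis S c) = of_bool (k \<in> S) *s axis S (c :: 'f)"
      by (auto simp: vec_eq_iff ext_der_unit_diag axis_def)
    ultimately have "((of_bool (k = i) - of_bool (k = j)) *s ?w) $ T
        = (ext_der (unit_mat k k) ?w - of_bool (k \<in> S) *s ?w) $ T"
      by (simp add: ext_der_scale_right)
    then have "(of_bool (k = i) - of_bool (k = j)) * ?w $ T = (of_bool (k \<in> T) - of_bool (k \<in> S)) * ?w $ T"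
      by (auto simp: ext_der_unit_diag algebra_simps of_bool_def split: if_splits)
    then show ?thesis using assms(3) by simp
  qed
  have "k = i \<and> k \<noteq> j \<and> k \<in> T \<and> k \<notin> S \<or> k = j \<and> k \<noteq> i \<and> k \<notin> T \<and> k \<in> S
      \<or> k \<noteq> i \<and> k \<noteq> j \<and> (k \<in> T \<longleftrightarrow> k \<in> S)" for k
    using assms(1) *[of k] by (cases "k = i"; cases "k = j"; cases "k \<in> T"; cases "k \<in> S") simp_all
  then show ?thesis by blast
qed

text \<open>The sets separating \<open>i\<close> from \<open>j\<close>: a rotation in the plane of
  \<open>e_i\<close> and \<open>e_j\<close> moves \<open>e_S\<close> only for these, since the
  generator kills \<open>e_S\<close> when \<open>S\<close> contains both or neither.\<close>

definition crossing :: "6 \<Rightarrow> 6 \<Rightarrow> 6 set \<Rightarrow> bool" where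
  "crossing i j S \<longleftrightarrow> (i \<in> S) \<noteq> (j \<in> S)"

definition cross_part :: "6 \<Rightarrow> 6 \<Rightarrow> 'f ext6 \<Rightarrow> 'f ext6" where
  "cross_part i j x = (\<chi> S. if crossing i j S then x $ S else 0)"

text \<open>For \<open>ab = -1\<close> this matrix generates a rotation by a right angle in the plane of
  \<open>e\<^sub>i\<close> and \<open>e\<^sub>j\<close>.\<close>

definition rot_gen :: "6 \<Rightarrow> 6 \<Rightarrow> 'f \<Rightarrow> 'f \<Rightarrow> 'f ^ 6 ^ 6" where
  "rot_gen i j a b = mat_scale a (unit_mat i j) + mat_scale b (unit_mat j i)"

lemma ext_der_rot_gen:
  "ext_der (rot_gen i j a b) x = a *s ext_der (unit_mat i j) x + b *s ext_der (unit_mat j i) x"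
  by (simp add: rot_gen_def ext_der_add_left ext_der_scale_left)

lemma ext_der_unit_axis_zero:
  fixes i j :: 6
  assumes "i \<noteq> j" "card S = 3" "\<not> (i \<notin> S \<and> j \<in> S)"
  shows "ext_der (unit_mat i j) (axis S c) = (0 :: 'f ext6)"
  using ext_der_unit_support[OF assms(1,2)] assms(3) by (auto simp: vec_eq_iff)

lemma ext_der_unit_axis:
  fixes i j :: 6
  assumes "i \<noteq> j" "card S = 3"
  shows "ext_der (unit_mat i j) (axis S c) =
    axis (insert i (S - {j})) (ext_der (unit_mat i j) (axis S c) $ (insert i (S - {j})) :: 'f)"
  using ext_der_unit_support[OF assms] by (auto simp: vec_eq_iff axis_def)

text \<open>An sl2 relation: the commutator of opposite units is a difference of diagonal units,
  with eigenvalue 1 on \<open>e_S\<close>, and one of its two terms vanishes because a unit must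
  remove an index from the set and add one from outside.\<close>

lemma ext_der_unit_unit_axis:
  fixes i j :: 6
  assumes "i \<noteq> j" "card S = 3" "i \<notin> S" "j \<in> S"
  shows "ext_der (unit_mat j i) (ext_der (unit_mat i j) (axis S c)) = (axis S c :: 'f ext6)"
    and "ext_der (unit_mat i j) (ext_der (unit_mat i j) (axis S c)) = (0 :: 'f ext6)"
proof -
  have x: "axis S c \<in> (ext3 :: 'f ext6 set)" using assms by (simp add: axis_ext_pow)
  have "ext_der (unit_mat j i ** unit_mat i j - unit_mat i j ** unit_mat j i) (axis S c) = (axis S c :: 'f ext6)"
    using assms by (auto simp: unit_mat_mult ext_der_diff_left vec_eq_iff ext_der_unit_diag axis_def)
  then show "ext_der (unit_mat j i) (ext_der (unit_mat i j) (axis S c)) = (axis S c :: 'f ext6)"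
    using ext_der_commutator[OF x, of "unit_mat j i" "unit_mat i j"] ext_der_unit_axis_zero[of j i S c] assms
    by simp
  have "card (insert i (S - {j})) = 3" using assms by simp
  then show "ext_der (unit_mat i j) (ext_der (unit_mat i j) (axis S c)) = (0 :: 'f ext6)"
    by (subst ext_der_unit_axis[OF assms(1,2)], intro ext_der_unit_axis_zero) (use assms in auto)
qed

lemma ext_der_rot_gen_axis:
  assumes "i \<noteq> j" "card S = 3"
  shows "\<not> crossing i j S \<Longrightarrow> ext_der (rot_gen i j a b) (axis S c) = (0 :: 'f ext6)"
    and "crossing i j S \<Longrightarrow> a * b = -1 \<Longrightarrow>
      ext_der (rot_gen i j a b) (ext_der (rot_gen i j a b) (axis S c)) = (- axis S c :: 'f ext6)"
proof -
  show "\<not> crossing i j S \<Longrightarrow> ext_der (rot_gen i j a b) (axis S c) = (0 :: 'f ext6)"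
    using ext_der_unit_axis_zero[of i j S c] ext_der_unit_axis_zero[of j i S c] assms
    by (simp add: ext_der_rot_gen crossing_def)
  assume "crossing i j S" and ab: "a * b = -1"
  then consider "i \<notin> S" "j \<in> S" | "j \<notin> S" "i \<in> S" by (auto simp: crossing_def)
  then show "ext_der (rot_gen i j a b) (ext_der (rot_gen i j a b) (axis S c)) = (- axis S c :: 'f ext6)"
  proof cases
    case 1
    then show ?thesis
      using ext_der_unit_axis_zero[of j i S c] ext_der_unit_unit_axis[of i j S c] assms ab
      by (simp add: ext_der_rot_gen ext_der_scale_right axis_scale axis_minus mult.assoc[symmetric] mult.commute)
  next
    case 2
    then show ?thesis
      using ext_der_unit_axis_zero[of i j S c] ext_der_unit_unit_axis[of j i S c] assms ab
      by (simp add: ext_der_rot_gen ext_der_scale_right axis_scale axis_minus mult.assoc[symmetric] mult.commute)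
  qed
qed

lemma ext3_axis_expansion: "x \<in> ext3 \<Longrightarrow> x = (\<Sum>S | card S = 3. axis S (x $ S))"
proof -
  assume x: "x \<in> ext3"
  have "(\<Sum>S | card S = 3. axis S (x $ S)) = (\<Sum>S\<in>UNIV. axis S (x $ S))"
    by (rule sum.mono_neutral_left) (use x in \<open>auto simp: ext3_nth\<close>)
  then show ?thesis by (simp add: axis_expansion)
qed

text \<open>Expansion in basis vectors and the sl2 relation. In the square, the signs with which the
  matrix units act cancel.\<close>

lemma ext_der_rot_gen_sq:
  assumes "i \<noteq> j" "a * b = -1" "x \<in> ext3"
  shows "ext_der (rot_gen i j a b) (ext_der (rot_gen i j a b) x) = - cross_part i j x"
proof -
  let ?D = "ext_der (rot_gen i j a b) :: 'f ext6 \<Rightarrow> 'f ext6"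
  have "?D (?D x) = (\<Sum>S | card S = 3. ?D (?D (axis S (x $ S))))"
    by (subst ext3_axis_expansion[OF assms(3)]) (simp only: ext_der_sum_right)
  also have "\<dots> = (\<Sum>S | card S = 3. axis S (- cross_part i j x $ S))"
    using ext_der_rot_gen_axis[OF assms(1)] assms(2)
    by (intro sum.cong refl) (auto simp: cross_part_def axis_minus)
  also have "\<dots> = - cross_part i j x"
  proof -
    have "- cross_part i j x \<in> ext3"
      using assms(3) by (auto simp: ext_pow_iff cross_part_def)
    from ext3_axis_expansion[OF this] show ?thesis by (simp del: ext_pow_iff)
  qed
  finally show ?thesis .
qed

lemma ext_der_rot_gen_cross_part:
  assumes "i \<noteq> j" "x \<in> ext3"
  shows "ext_der (rot_gen i j a b) (cross_part i j x) = ext_der (rot_gen i j a b) x"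
proof -
  have c: "cross_part i j x \<in> ext3"
    using assms(2) by (auto simp: ext_pow_iff cross_part_def)
  have "ext_der (rot_gen i j a b) (cross_part i j x)
      = (\<Sum>S | card S = 3. ext_der (rot_gen i j a b) (axis S (cross_part i j x $ S)))"
    by (subst ext3_axis_expansion[OF c]) (simp only: ext_der_sum_right)
  also have "\<dots> = (\<Sum>S | card S = 3. ext_der (rot_gen i j a b) (axis S (x $ S)))"
    using ext_der_rot_gen_axis(1)[OF assms(1)]
    by (intro sum.cong refl) (auto simp: cross_part_def)
  also have "\<dots> = ext_der (rot_gen i j a b) x"
    by (subst (2) ext3_axis_expansion[OF assms(2)]) (simp only: ext_der_sum_right)
  finally show ?thesis .
qed

text \<open>The square is minus the projection to the crossing part, and the generator only sees
  that part. Thus X^3 = -X holds on 3-vectors as it does on V.\<close>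

lemma ext_der_rot_gen_cube:
  assumes "i \<noteq> j" "a * b = -1" "x \<in> ext3"
  shows "ext_der (rot_gen i j a b) (ext_der (rot_gen i j a b) (ext_der (rot_gen i j a b) x))
    = - ext_der (rot_gen i j a b) x"
  unfolding ext_der_rot_gen_sq[OF assms] ext_der_minus_right ext_der_rot_gen_cross_part[OF assms(1,3)] ..

end

section \<open>Automorphisms\<close>

text \<open>The common shape of the degree-preserving automorphisms below: \<open>s = -1\<close> for
  \<theta> and \<open>s = 1\<close> for rotations.\<close>

fun graded_map :: "'f::field \<Rightarrow> ('f ext6 \<Rightarrow> 'f ext6) \<Rightarrow> ('f ^ 6 ^ 6 \<Rightarrow> 'f ^ 6 ^ 6) \<Rightarrow>
    ('f ext6 \<Rightarrow> 'f ext6) \<Rightarrow> 'f e6 \<Rightarrow> 'f e6" where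
  "graded_map s N P M (f', f, A, u, u') = (s *s f', N f, P A, M u, s *s u')"

lemma graded_map_el: "graded_map s N P M (el p f A u q) = el (s * p) (N f) (P A) (M u) (s * q)"
  by (simp add: el_def axis_scale)

text \<open>If X^3 = -X, then exp(t X) = 1 + sin(t) X + (1 - cos(t)) X^2; this is the value at a
  quarter turn. \<open>vrot\<close> is the same expression for the action on exterior
  vectors.\<close>

definition qrot :: "'f::comm_ring_1 ^ 'n ^ 'n \<Rightarrow> 'f ^ 'n ^ 'n" where
  "qrot X = mat 1 + X + X ** X"

definition vrot :: "'f::comm_ring_1 ^ 6 ^ 6 \<Rightarrow> 'f ext6 \<Rightarrow> 'f ext6" where
  "vrot X x = x + ext_der X x + ext_der X (ext_der X x)"

lemma vrot_minus: "vrot (- X) x = x - ext_der X x + ext_der X (ext_der X x)"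
  by (simp add: vrot_def ext_der_minus_left ext_der_minus_right)

lemma vrot_add: "vrot X (x + y) = vrot X x + vrot X y"
  and vrot_scale: "vrot X (c *s x) = c *s vrot X x"
  by (simp_all add: vrot_def ext_der_add_right ext_der_scale_right vec_eq_iff algebra_simps)

definition rotation :: "'f::field ^ 6 ^ 6 \<Rightarrow> 'f e6 \<Rightarrow> 'f e6" where
  "rotation X = graded_map 1 (vrot (dual_der X)) (\<lambda>A. qrot X ** A ** qrot (- X)) (vrot X)"

lemma rotation_el: "rotation X (el p f A u q) =
    el p (vrot (dual_der X) f) (qrot X ** A ** qrot (- X)) (vrot X u) q"
  by (simp add: rotation_def graded_map_el)

definition ad_mat :: "'f::comm_ring_1 ^ 'n ^ 'n \<Rightarrow> 'f ^ 'n ^ 'n \<Rightarrow> 'f ^ 'n ^ 'n" where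
  "ad_mat X A = X ** A - A ** X"

lemma matrix_numeral_mult: "(numeral k * A) ** B = numeral k * (A ** B)" "A ** (numeral k * B) = numeral k * (A ** B)"
  for A B :: "'f::comm_ring_1 ^ 'n ^ 'n"
  by (simp_all add: vec_eq_iff matrix_matrix_mult_def sum_distrib_left mult_ac)

lemma qrot_inverse:
  assumes "X ** X ** X = - (X :: 'f::comm_ring_1 ^ 'n ^ 'n)"
  shows "qrot X ** qrot (- X) = mat 1" "qrot (- X) ** qrot X = mat 1"
  using assms by (simp_all add: qrot_def matrix_add_simps matrix_mul_assoc)

text \<open>The polynomial in \<open>ad X\<close> takes the value \<open>exp (\<pi> t / 2)\<close> at the eigenvalues
  \<open>t \<in> {0, \<plusminus>\<i>, \<plusminus>2\<i>}\<close> of \<open>ad X\<close>.\<close>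

lemma qrot_conj_ad:
  fixes X A :: "'f::field_char_0 ^ 'n ^ 'n"
  assumes X: "X ** X ** X = - X"
  shows "qrot X ** A ** qrot (- X) = A + mat_scale (4/3) (ad_mat X A) + mat_scale (7/6) (ad_mat X (ad_mat X A))
    + mat_scale (1/3) (ad_mat X (ad_mat X (ad_mat X A)))
    + mat_scale (1/6) (ad_mat X (ad_mat X (ad_mat X (ad_mat X A))))"
proof -
  \<comment> \<open>The cubic relation behind a left factor, the shape in which it occurs once all
    products associate to the left.\<close>
  have X': "Y ** X ** X ** X = - (Y ** X)" for Y :: "'f ^ 'n ^ 'n"
    using arg_cong[OF X, of "\<lambda>Z. Y ** Z"] by (simp add: matrix_mul_assoc matrix_add_simps)
  have q: "qrot X ** A ** qrot (- X) = A - A ** X + A ** X ** X + X ** A - X ** A ** X + X ** A ** X ** X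
      + X ** X ** A - X ** X ** A ** X + X ** X ** A ** X ** X"
    by (simp add: qrot_def matrix_add_simps matrix_mul_assoc algebra_simps)
  have c2: "ad_mat X (ad_mat X A) = X ** X ** A - X ** A ** X - X ** A ** X + A ** X ** X"
    by (simp add: ad_mat_def matrix_add_simps matrix_numeral_mult matrix_mul_assoc algebra_simps)
  have c3: "ad_mat X (ad_mat X (ad_mat X A)) =
      X ** A ** X ** X + X ** A ** X ** X + X ** A ** X ** X - X ** X ** A ** X - X ** X ** A ** X - X ** X ** A ** X
      - X ** A + A ** X"
    unfolding c2 by (simp add: ad_mat_def matrix_add_simps matrix_numeral_mult matrix_mul_assoc X X' algebra_simps)
  have c4: "ad_mat X (ad_mat X (ad_mat X (ad_mat X A))) =
      (X ** X ** A ** X ** X + X ** X ** A ** X ** X + X ** X ** A ** X ** X)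
      + (X ** X ** A ** X ** X + X ** X ** A ** X ** X + X ** X ** A ** X ** X)
      + (X ** A ** X + X ** A ** X + X ** A ** X + X ** A ** X)
      + (X ** A ** X + X ** A ** X + X ** A ** X + X ** A ** X) - X ** X ** A - A ** X ** X"
    unfolding c3 by (simp add: ad_mat_def matrix_add_simps matrix_numeral_mult matrix_mul_assoc X X' algebra_simps)
  have c1: "ad_mat X A = X ** A - A ** X" by (simp add: ad_mat_def)
  show ?thesis
    unfolding q unfolding c4 unfolding c3 unfolding c2 unfolding c1
    by (simp add: vec_eq_iff mat_scale_nth field_simps)
qed

lemma dual_der_mult: "dual_der (A ** B) = - (dual_der B ** dual_der (A :: 'f::comm_ring_1 ^ 'n ^ 'n))"
  by (simp add: dual_der_def matrix_transpose_mul matrix_add_simps)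

lemma transpose_qrot: "transpose (qrot X) = qrot (- dual_der (X :: 'f::comm_ring_1 ^ 'n ^ 'n))"
  by (simp add: qrot_def transpose_simps matrix_transpose_mul dual_der_def matrix_add_simps)

text \<open>Transposition turns \<open>qrot (- X)\<close> into \<open>qrot (dual_der X)\<close>, so
  the contragredient of a conjugation by a quarter turn is again one.\<close>

lemma dual_der_conj:
  "dual_der (qrot X ** A ** qrot (- X)) = qrot (dual_der X) ** dual_der A ** qrot (- dual_der (X :: 'f::comm_ring_1 ^ 'n ^ 'n))"
proof -
  have "dual_der (qrot X ** A ** qrot (- X)) = - (transpose (qrot (- X)) ** transpose A ** transpose (qrot X))"
    by (simp add: dual_der_def matrix_transpose_mul matrix_mul_assoc)
  then show ?thesis
    by (simp add: transpose_qrot dual_der_simps) (simp add: dual_der_def matrix_add_simps)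
qed

lemma mat_mult: "mat c ** A = mat_scale c A" "A ** mat c = mat_scale c (A :: 'f::comm_ring_1 ^ 'n ^ 'n)"
proof -
  have c: "mat c = (diag_mat (\<lambda>_. c) :: 'f ^ 'n ^ 'n)" by (simp add: vec_eq_iff mat_nth diag_mat_nth)
  show "mat c ** A = mat_scale c A" "A ** mat c = mat_scale c A"
    unfolding c by (simp_all add: vec_eq_iff diag_mat_mult_left diag_mat_mult_right mat_scale_nth)
qed

context e6_lie
begin

text \<open>\<open>alg_aut\<close> without extensionality, so that composites of total functions
  qualify as they stand; \<open>lie_aut_restrict\<close> returns to \<open>alg_aut\<close>.\<close>

definition lie_aut :: "('f e6 \<Rightarrow> 'f e6) \<Rightarrow> bool" where
  "lie_aut F \<longleftrightarrow> bij_betw F e6_carrier e6_carrier \<and>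
     (\<forall>x\<in>e6_carrier. \<forall>y\<in>e6_carrier. F (x + y) = F x + F y) \<and>
     (\<forall>c. \<forall>x\<in>e6_carrier. F (e6_scale c x) = e6_scale c (F x)) \<and>
     (\<forall>x\<in>e6_carrier. \<forall>y\<in>e6_carrier. F (br x y) = br (F x) (F y))"

lemma lie_aut_restrict: "lie_aut F \<Longrightarrow> restrict F e6_carrier \<in> alg_aut L"
proof -
  assume F: "lie_aut F"
  interpret vector_space "e6_scale :: 'f \<Rightarrow> 'f e6 \<Rightarrow> 'f e6" by (rule vs)
  have "bij_betw (restrict F e6_carrier) e6_carrier e6_carrier"
    using F bij_betw_cong[of e6_carrier "restrict F e6_carrier" F] by (simp add: lie_aut_def)
  then show ?thesis
    using F by (simp add: alg_aut_def Bij_def lie_aut_def br_closed subspace_add[OF subspace_carrier]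
        subspace_scale[OF subspace_carrier])
qed

lemma lie_aut_comp:
  assumes "lie_aut F" "lie_aut G"
  shows "lie_aut (\<lambda>x. F (G x))"
proof -
  have "G x \<in> e6_carrier" if "x \<in> e6_carrier" for x
    using assms(2) that by (auto simp: lie_aut_def bij_betw_def)
  then show ?thesis
    using assms bij_betw_trans[of G e6_carrier e6_carrier F e6_carrier]
    by (auto simp: lie_aut_def o_def)
qed

lemma lie_aut_cong:
  assumes "lie_aut F" "\<And>x. x \<in> e6_carrier \<Longrightarrow> G x = F x"
  shows "lie_aut G"
proof -
  interpret vector_space "e6_scale :: 'f \<Rightarrow> 'f e6 \<Rightarrow> 'f e6" by (rule vs)
  show ?thesis
    using assms bij_betw_cong[of e6_carrier G F]
    by (simp add: lie_aut_def br_closed subspace_add[OF subspace_carrier] subspace_scale[OF subspace_carrier])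
qed

text \<open>The bracket is built from the pairing, the star, the derivations and \<open>psi\<close>.
  Compatibility with the first three is assumed; for \<open>psi\<close> it follows from its
  characterization by traces, which \<open>P\<close> preserves.\<close>

lemma lie_aut_graded_map:
  assumes s: "s * s = 1"
    and M: "bij_betw M ext3 ext3" "\<And>u v. M (u + v) = M u + M v" "\<And>c u. M (c *s u) = c *s M u"
    and N: "bij_betw N ext3 ext3" "\<And>u v. N (u + v) = N u + N v" "\<And>c u. N (c *s u) = c *s N u"
    and P: "bij P" "\<And>A B. P (A + B) = P A + P B" "\<And>c A. P (mat_scale c A) = mat_scale c (P A)"
      "\<And>A B. P (A ** B - B ** A) = P A ** P B - P B ** P A" "\<And>c. P (mat c) = mat c"
      "\<And>A. trace (P A) = trace A"
      "\<And>A B. trace A = 0 \<Longrightarrow> trace B = 0 \<Longrightarrow> trace (P A ** P B) = trace (A ** B)"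
    and MN: "\<And>u f. u \<in> ext3 \<Longrightarrow> f \<in> ext3 \<Longrightarrow> pairing (M u) (N f) = pairing u f"
    and der: "\<And>A u. u \<in> ext3 \<Longrightarrow> M (ext_der A u) = ext_der (P A) (M u)"
      "\<And>A f. f \<in> ext3 \<Longrightarrow> N (ext_der (dual_der A) f) = ext_der (dual_der (P A)) (N f)"
    and star: "\<And>u. u \<in> ext3 \<Longrightarrow> N (star u) = s *s star (M u)"
      "\<And>f. f \<in> ext3 \<Longrightarrow> M (star f) = s *s star (N f)"
  shows "lie_aut (graded_map s N P M)"
proof -
  have mem: "M u \<in> ext3" "N u \<in> ext3" if "u \<in> ext3" for u
    using that M(1) N(1) by (auto simp: bij_betw_def)
  have M0: "M 0 = 0" and N0: "N 0 = 0" using M(3)[of 0 0] N(3)[of 0 0] by simp_all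
  have Mm: "M (- u) = - M u" and Nm: "N (- u) = - N u" for u
    using M(3)[of "-1" u] N(3)[of "-1" u] by (simp_all add: vector_sneg_minus1[symmetric])
  have Md: "M (u - v) = M u - M v" and Nd: "N (u - v) = N u - N v" for u v
    using M(2)[of u "- v"] N(2)[of u "- v"] by (simp_all add: Mm Nm)
  have P0: "P 0 = 0" using P(3)[of 0 0] by (simp add: mat_scale_simps)
  have Pm: "P (- A) = - P A" for A using P(3)[of "-1" A] by (simp add: mat_scale_simps)
  have Pd: "P (A - B) = P A - P B" for A B using P(2)[of A "- B"] by (simp add: Pm)
  have psi: "psi (N f) (M u) = P (psi f u)" if "f \<in> ext3" "u \<in> ext3" for f u
  proof (rule psi_eqI)
    show "trace (P (psi f u)) = 0" by (simp add: P trace_psi)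
    fix g :: "'f ^ 6 ^ 6" assume g: "trace g = 0"
    \<comment> \<open>Every test matrix is an image under \<open>P\<close>, so the defining identity
      of \<open>psi\<close> can be pulled back.\<close>
    obtain h where h: "g = P h" using P(1) by (metis bij_pointE)
    then have "trace h = 0" using g P(6) by simp
    then have "trace (g ** P (psi f u)) = pairing (ext_der h u) f"
      by (simp add: h P(7) trace_psi trace_mult_psi)
    also have "\<dots> = pairing (ext_der g (M u)) (N f)"
      using that MN[of "ext_der h u" f] by (simp add: h der)
    finally show "trace (g ** P (psi f u)) = pairing (ext_der g (M u)) (N f)" .
  qed
  have wM: "s * pairing u (star v) = pairing (M u) (star (M v))" if "u \<in> ext3" "v \<in> ext3" for u v
  proof -
    have "pairing u (star v) = pairing (M u) (N (star v))"
      using that by (simp add: MN star_ext3)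
    then show ?thesis using that s by (simp add: star pairing_scale_right mult.assoc[symmetric])
  qed
  have wN: "s * pairing f (star g) = pairing (N f) (star (N g))" if "f \<in> ext3" "g \<in> ext3" for f g
  proof -
    have "pairing (star g) f = pairing (M (star g)) (N f)"
      using that by (simp add: MN star_ext3)
    then show ?thesis using that s
      by (simp add: star pairing_scale_left mult.assoc[symmetric] pairing_commute[of _ "star _"])
  qed
  let ?F = "graded_map s N P M"
  have "bij_betw ?F e6_carrier e6_carrier"
  proof (rule bij_betwI')
    fix x y :: "'f e6" assume xy: "x \<in> e6_carrier" "y \<in> e6_carrier"
    have "s \<noteq> 0" using s by auto
    then show "?F x = ?F y \<longleftrightarrow> x = y"
      using xy M(1) N(1) P(1)
      by (elim el_cases) (auto simp: graded_map_el el_eq_iff bij_betw_def inj_on_def)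
  next
    fix x :: "'f e6" assume "x \<in> e6_carrier"
    then show "?F x \<in> e6_carrier" by (elim el_cases) (simp add: graded_map_el el_carrier mem)
  next
    fix y :: "'f e6" assume "y \<in> e6_carrier"
    then obtain p f A u q where y: "y = el p f A u q" "f \<in> ext3" "u \<in> ext3" by (rule el_cases)
    obtain f1 where f1: "f1 \<in> ext3" "N f1 = f" using N(1) y(2) unfolding bij_betw_def by (metis imageE)
    obtain u1 where u1: "u1 \<in> ext3" "M u1 = u" using M(1) y(3) unfolding bij_betw_def by (metis imageE)
    obtain A1 where A1: "P A1 = A" using P(1) by (metis bij_pointE)
    have "y = ?F (el (s * p) f1 A1 u1 (s * q))"
      using s by (simp add: y graded_map_el f1 u1 A1 mult.assoc[symmetric])
    then show "\<exists>x\<in>e6_carrier. y = ?F x" using f1 u1 by (auto simp: el_carrier)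
  qed
  moreover have "?F (x + y) = ?F x + ?F y" if "x \<in> e6_carrier" "y \<in> e6_carrier" for x y
    using that by (elim el_cases) (simp add: el_add graded_map_el M N P algebra_simps)
  moreover have "?F (e6_scale c x) = e6_scale c (?F x)" if "x \<in> e6_carrier" for c x
    using that by (elim el_cases) (simp add: el_scale graded_map_el M N P algebra_simps)
  moreover have "?F (br x y) = br (?F x) (?F y)" if "x \<in> e6_carrier" "y \<in> e6_carrier" for x y
  proof -
    obtain p f A u q where x: "x = el p f A u q" "f \<in> ext3" "u \<in> ext3" using \<open>x \<in> e6_carrier\<close> by (rule el_cases)
    obtain p' g B v q' where y: "y = el p' g B v q'" "g \<in> ext3" "v \<in> ext3" using \<open>y \<in> e6_carrier\<close> by (rule el_cases)
    have [simp]: "s * (s * c) = c" for c using s by (simp add: mult.assoc[symmetric])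
    have "?F (br x y) = el (s * (trace B * p - trace A * p' + \<alpha> (-1) (-1) * pairing f (star g)))
      (ext_der (dual_der (P A)) (N g) - ext_der (dual_der (P B)) (N f)
         + \<alpha> 1 (-2) *s (p' *s (s *s star (M u)) - p *s (s *s star (M v))))
      (P A ** P B - P B ** P A + mat_scale (\<alpha> 1 (-1)) (psi (N g) (M u) - psi (N f) (M v))
         + mat (\<beta> 1 * (pairing u g - pairing v f)) + mat (\<beta> 2 * (q * p' - q' * p)))
      (ext_der (P A) (M v) - ext_der (P B) (M u) + \<alpha> (-1) 2 *s (q' *s (s *s star (N f)) - q *s (s *s star (N g))))
      (s * (trace A * q' - trace B * q + \<alpha> 1 1 * pairing u (star v)))"
      using x y by (simp add: br_el graded_map_el M N P P(4)[unfolded Pd] Md Nd Pd der star psi)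
    also have "\<dots> = br (?F x) (?F y)"
      using x y by (simp add: br_el graded_map_el mem P MN el_eq_iff wM[symmetric] wN[symmetric] algebra_simps)
    finally show ?thesis .
  qed
  ultimately show ?thesis by (auto simp: lie_aut_def)
qed

text \<open>A scalar matrix \<open>c\<close> acts on 3-vectors by 3c, so the trace term becomes a
  derivation too. The resulting matrix is exactly the image of \<open>A\<close> under
  \<theta>.\<close>

lemma star_ext_der_scalar:
  "v \<in> ext3 \<Longrightarrow> star (ext_der A v) = ext_der (mat (trace A / 3) - transpose A) (star (v :: 'f ext6))"
  by (simp add: star_ext_der ext_der_diff_left ext_der_mat_ext3 star_ext3)

lemma bij_betw_star: "c \<noteq> 0 \<Longrightarrow> bij_betw (\<lambda>u. c *s star u) ext3 (ext3 :: 'f ext6 set)"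
proof (rule bij_betw_byWitness[where f' = "\<lambda>u. - (inverse c *s star u)"])
  assume c: "c \<noteq> 0"
  show "\<forall>a\<in>ext3. - (inverse c *s star (c *s star a)) = (a :: 'f ext6)"
    using c by (simp add: star_scale star_star vec_eq_iff)
  show "\<forall>a'\<in>ext3. c *s star (- (inverse c *s star a')) = (a' :: 'f ext6)"
    using c by (simp add: star_scale star_star star_minus vec_eq_iff)
qed (auto intro!: ext_pow_closed star_ext3)

lemma lie_aut_theta: "lie_aut (theta \<iota>)"
proof (rule lie_aut_cong)
  let ?P = "\<lambda>A :: 'f ^ 6 ^ 6. mat (trace A / 3) - transpose A"
  show "theta \<iota> x = graded_map (-1) (\<lambda>f. (- \<iota>) *s star f) ?P (\<lambda>u. \<iota> *s star u) x" if "x \<in> e6_carrier" for x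
    using that by (cases x) (simp add: theta_eq_theta_coord vec_eq_iff)
  have trP: "trace (?P A) = trace A" for A
    by (simp add: trace_sub trace_mat_6 trace_transpose)
  have PP: "?P (?P A) = A" for A
    by (simp only: trP) (simp add: transpose_simps transpose_transpose)
  show "lie_aut (graded_map (-1) (\<lambda>f. (- \<iota>) *s star f) ?P (\<lambda>u. \<iota> *s star u))"
  proof (rule lie_aut_graded_map)
    show "bij_betw (\<lambda>f. (- \<iota>) *s star f) ext3 ext3" "bij_betw (\<lambda>f. \<iota> *s star f) ext3 ext3"
      using nonzero by (simp_all only: bij_betw_star neg_equal_0_iff_equal simp_thms)
    show "bij ?P" by (rule o_bij[of ?P]) (auto simp: fun_eq_iff PP)
    show "?P (A ** B - B ** A) = ?P A ** ?P B - ?P B ** ?P A" for A B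
      using trace_mul_sym[of A B]
      by (simp add: trace_sub transpose_simps matrix_transpose_mul matrix_add_simps mat_mult mat_scale_mat mat_scale_simps algebra_simps)
    show "trace (?P A ** ?P B) = trace (A ** B)" if "trace A = 0" "trace B = 0" for A B
      using that trace_transpose[of "B ** A"] trace_mul_sym[of A B]
      by (simp add: matrix_add_simps matrix_transpose_mul)
    show "?P (mat c) = mat c" for c
      by (simp add: trace_mat_6 transpose_simps mat_diff[symmetric])
    show "pairing (\<iota> *s star u) (- \<iota> *s star f) = pairing u f" for u f
      by (simp add: pairing_scale_left pairing_scale_right pairing_star_star pairing_minus_right
          vector_sneg_minus1[symmetric] mult.assoc[symmetric] iota_sq)
    show "\<iota> *s star (ext_der A u) = ext_der (?P A) (\<iota> *s star u)" if "u \<in> ext3" for A u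
      using that by (simp add: star_ext_der_scalar ext_der_scale_right)
    show "- \<iota> *s star (ext_der (dual_der A) f) = ext_der (dual_der (?P A)) (- \<iota> *s star f)"
      if "f \<in> ext3" for A f
    proof -
      have "mat (trace (dual_der A) / 3) - transpose (dual_der A) = dual_der (?P A)"
        by (simp add: dual_der_simps) (simp add: dual_der_def transpose_simps transpose_transpose mat_minus)
      then show ?thesis using that by (simp only: star_ext_der_scalar ext_der_scale_right)
    qed
    show "- \<iota> *s star (star u) = -1 *s star (\<iota> *s star u)" if "u \<in> ext3" for u
      using that by (simp add: star_star star_scale star_minus vec_eq_iff)
    show "\<iota> *s star (star u) = -1 *s star (- \<iota> *s star u)" if "u \<in> ext3" for u
      using that by (simp add: star_star star_scale star_minus vec_eq_iff)
  qed (simp_all add: star_add star_scale trace_add trace_scale transpose_simps trace_sub trace_mat_6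
      trace_transpose vec_eq_iff mat_nth mat_scale_nth algebra_simps add_divide_distrib)
qed

section \<open>Quarter turns as automorphisms\<close>

lemma ext_der_numeral: "ext_der A (numeral k * x) = numeral k * ext_der A (x :: 'f ext6)"
proof -
  have "numeral k * y = (numeral k :: 'f) *s y" for y :: "'f ext6"
    by (simp add: vec_eq_iff)
  then show ?thesis by (simp only: ext_der_scale_right)
qed

text \<open>The two cubic relations make \<open>qrot X\<close> and \<open>vrot X\<close> invertible,
  with inverses given by \<open>- X\<close>; trace zero makes the quarter turn compatible with the
  star.\<close>

definition quarter :: "'f ^ 6 ^ 6 \<Rightarrow> bool" where
  "quarter X \<longleftrightarrow> trace X = 0 \<and> X ** X ** X = - X \<and>
     (\<forall>x\<in>ext3. ext_der X (ext_der X (ext_der X x)) = - ext_der X x)"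

lemma vrot_ext3: "x \<in> ext3 \<Longrightarrow> vrot X x \<in> (ext3 :: 'f ext6 set)"
  by (simp add: vrot_def ext_pow_closed)

lemma vrot_inverse:
  assumes "quarter X" "x \<in> ext3"
  shows "vrot (- X) (vrot X x) = x"
  using assms by (simp add: quarter_def vrot_minus)
    (simp add: vrot_def ext_der_add_right ext_der_minus_right)

lemma quarter_minus: "quarter X \<Longrightarrow> quarter (- X)"
  by (simp add: quarter_def trace_minus matrix_add_simps ext_der_minus_left ext_der_minus_right)

lemma bij_betw_vrot: "quarter X \<Longrightarrow> bij_betw (vrot X) ext3 ext3"
  by (rule bij_betw_byWitness[where f' = "vrot (- X)"])
    (use vrot_inverse[of X] vrot_inverse[of "- X"] quarter_minus[of X] in \<open>auto simp: vrot_ext3\<close>)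

lemma ext_der_ad: "x \<in> ext3 \<Longrightarrow>
    ext_der (ad_mat X A) x = ext_der X (ext_der A x) - ext_der A (ext_der X (x :: 'f ext6))"
  by (simp add: ad_mat_def ext_der_commutator)

text \<open>By \<open>qrot_conj_ad\<close> the conjugated matrix is a polynomial in ad X, and
  \<open>ext_der\<close> turns ad X into a commutator of operators. These operators satisfy the same
  cubic relation, so the polynomial sums up to a conjugation again.\<close>

lemma ext_der_conj:
  assumes X: "quarter X" and x: "x \<in> ext3"
  shows "ext_der (qrot X ** A ** qrot (- X)) x = vrot X (ext_der A (vrot (- X) x))"
proof -
  have cube: "ext_der X (ext_der X (ext_der X y)) = - ext_der X y" if "y \<in> ext3" for y
    using X that by (simp add: quarter_def)
  let ?D = "ext_der X" and ?A = "ext_der A"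
  note mems = x ext_der_ext3 ext_pow_closed
  note lin = ext_der_numeral ext_der_add_right ext_der_minus_right ext_der_diff_right
  have c2: "ext_der (ad_mat X (ad_mat X A)) y = ?D (?D (?A y)) - ?D (?A (?D y)) - ?D (?A (?D y)) + ?A (?D (?D y))"
    if "y \<in> ext3" for y
    using that by (simp add: ext_der_ad mems lin algebra_simps)
  have c3: "ext_der (ad_mat X (ad_mat X (ad_mat X A))) y = ?D (?A (?D (?D y))) + ?D (?A (?D (?D y))) + ?D (?A (?D (?D y)))
     - ?D (?D (?A (?D y))) - ?D (?D (?A (?D y))) - ?D (?D (?A (?D y))) - ?D (?A y) + ?A (?D y)"
    if "y \<in> ext3" for y
    using that by (subst ext_der_ad) (simp_all add: c2 mems lin cube algebra_simps)
  have c4: "ext_der (ad_mat X (ad_mat X (ad_mat X (ad_mat X A)))) y =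
     (?D (?D (?A (?D (?D y)))) + ?D (?D (?A (?D (?D y)))) + ?D (?D (?A (?D (?D y)))))
     + (?D (?D (?A (?D (?D y)))) + ?D (?D (?A (?D (?D y)))) + ?D (?D (?A (?D (?D y)))))
     + (?D (?A (?D y)) + ?D (?A (?D y)) + ?D (?A (?D y)) + ?D (?A (?D y)))
     + (?D (?A (?D y)) + ?D (?A (?D y)) + ?D (?A (?D y)) + ?D (?A (?D y))) - ?D (?D (?A y)) - ?A (?D (?D y))"
    if "y \<in> ext3" for y
    using that by (subst ext_der_ad) (simp_all add: c3 mems lin cube algebra_simps)
  have m3: "X ** X ** X = - X" using X by (simp add: quarter_def)
  have "vrot X (?A (vrot (- X) x)) = ?A x - ?A (?D x) + ?A (?D (?D x)) + ?D (?A x) - ?D (?A (?D x)) + ?D (?A (?D (?D x)))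
      + ?D (?D (?A x)) - ?D (?D (?A (?D x))) + ?D (?D (?A (?D (?D x))))"
    by (simp add: vrot_minus) (simp add: vrot_def lin algebra_simps)
  then show ?thesis
    using x by (simp add: qrot_conj_ad[OF m3] ext_der_add_left ext_der_scale_left ext_der_ad[OF x, of X A] c2[OF x] c3[OF x] c4[OF x])
      (simp add: vec_eq_iff field_simps)
qed

lemma vrot_ext_der:
  assumes X: "quarter X" and x: "x \<in> ext3"
  shows "vrot X (ext_der A x) = ext_der (qrot X ** A ** qrot (- X)) (vrot X x)"
  using assms by (simp add: ext_der_conj vrot_ext3 vrot_inverse)

lemma star_ext_der_traceless:
  "v \<in> ext3 \<Longrightarrow> trace X = 0 \<Longrightarrow> star (ext_der X v) = ext_der (dual_der X) (star (v :: 'f ext6))"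
  by (simp add: star_ext_der dual_der_def ext_der_minus_left)

lemma star_vrot: "x \<in> ext3 \<Longrightarrow> trace X = 0 \<Longrightarrow> star (vrot X x) = vrot (dual_der X) (star (x :: 'f ext6))"
  by (simp add: vrot_def star_add star_ext_der_traceless)

text \<open>The star intertwines a traceless \<open>X\<close> with \<open>dual_der X\<close> and is
  onto the 3-vectors, so it carries the cubic relation to the dual.\<close>

lemma quarter_dual:
  assumes X: "quarter X"
  shows "quarter (dual_der X)"
proof -
  have "ext_der (dual_der X) (ext_der (dual_der X) (ext_der (dual_der X) x)) = - ext_der (dual_der X) x"
    if x: "x \<in> ext3" for x
  proof -
    define y where "y = - star x"
    have y: "y \<in> ext3" "x = star y"
      using x by (simp_all add: y_def ext_pow_closed star_ext3 star_minus star_star)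
    have X: "trace X = 0" "ext_der X (ext_der X (ext_der X y)) = - ext_der X y"
      using X y by (simp_all add: quarter_def)
    show ?thesis using y(1) X(1) unfolding y(2)
      by (simp add: star_ext_der_traceless[symmetric] X(2) star_minus)
  qed
  moreover have "dual_der X ** dual_der X ** dual_der X = - dual_der X"
  proof -
    have "dual_der X ** dual_der X ** dual_der X = dual_der (X ** X ** X)"
      by (simp add: dual_der_mult matrix_add_simps matrix_mul_assoc)
    also have "X ** X ** X = - X" using X by (simp add: quarter_def)
    finally show ?thesis by (simp add: dual_der_simps)
  qed
  ultimately show ?thesis using X by (simp add: quarter_def dual_der_simps)
qed

lemma pairing_ext_der_dual: "u \<in> ext3 \<Longrightarrow> f \<in> ext3 \<Longrightarrow>
    pairing (ext_der X u) f = - pairing u (ext_der (dual_der X) (f :: 'f ext6))"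
  by (simp add: pairing_ext_der dual_der_def ext_der_minus_left pairing_minus_right)

text \<open>Moving the operators from \<open>u\<close> to \<open>f\<close> changes the sign of
  \<open>D = ext_der (dual_der X)\<close>, and (1 - D + D^2)(1 + D + D^2) = 1 by the cubic
  relation.\<close>

lemma pairing_vrot:
  assumes X: "quarter X" and u: "u \<in> ext3" and f: "f \<in> ext3"
  shows "pairing (vrot X u) (vrot (dual_der X) f) = pairing u f"
proof -
  let ?E = "ext_der (dual_der X)"
  have "?E (?E (?E f)) = - ?E f" using quarter_dual[OF X] f by (simp add: quarter_def)
  then show ?thesis
    using u f by (simp add: vrot_def pairing_add_left pairing_add_right pairing_ext_der_dual
        pairing_minus_right ext_der_minus_right)
qed

lemma lie_aut_rotation:
  assumes X: "quarter X"
  shows "lie_aut (rotation X)"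
  unfolding rotation_def
proof (rule lie_aut_graded_map)
  have X3: "X ** X ** X = - X" and tr: "trace X = 0" using X by (simp_all add: quarter_def)
  let ?P = "\<lambda>A. qrot X ** A ** qrot (- X)"
  note inv = qrot_inverse[OF X3]
  have conj: "?P A ** ?P B = ?P (A ** B)" for A B
  proof -
    have "?P A ** ?P B = qrot X ** A ** (qrot (- X) ** qrot X) ** B ** qrot (- X)"
      by (simp only: matrix_mul_assoc)
    then show ?thesis by (simp add: inv matrix_mul_assoc)
  qed
  show trP: "trace (?P A) = trace A" for A
  proof -
    have "trace (?P A) = trace (qrot (- X) ** (qrot X ** A))" by (rule trace_mul_sym)
    then show ?thesis by (simp add: matrix_mul_assoc inv)
  qed
  show "bij ?P"
  proof (rule o_bij)
    have "qrot (- X) ** (qrot X ** A ** qrot (- X)) ** qrot X = (qrot (- X) ** qrot X) ** A ** (qrot (- X) ** qrot X)" for A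
      by (simp only: matrix_mul_assoc)
    then show "(\<lambda>A. qrot (- X) ** A ** qrot X) \<circ> ?P = id" by (simp add: fun_eq_iff inv)
    have "qrot X ** (qrot (- X) ** A ** qrot X) ** qrot (- X) = (qrot X ** qrot (- X)) ** A ** (qrot X ** qrot (- X))" for A
      by (simp only: matrix_mul_assoc)
    then show "?P \<circ> (\<lambda>A. qrot (- X) ** A ** qrot X) = id" by (simp add: fun_eq_iff inv)
  qed
  show "?P (A ** B - B ** A) = ?P A ** ?P B - ?P B ** ?P A" for A B
    by (simp only: conj) (simp add: matrix_add_simps)
  show "trace (?P A ** ?P B) = trace (A ** B)" for A B by (simp only: conj trP)
  show "?P (mat c) = mat c" for c
    by (simp add: mat_mult mat_scale_mult_left inv mat_scale_mat)
  show "vrot (dual_der X) (ext_der (dual_der A) f) = ext_der (dual_der (?P A)) (vrot (dual_der X) f)"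
    if "f \<in> ext3" for A f
    using vrot_ext_der[OF quarter_dual[OF X] that, of "dual_der A"] by (simp only: dual_der_conj)
  show "vrot (dual_der X) (star u) = 1 *s star (vrot X u)" if "u \<in> ext3" for u
    using that tr by (simp add: star_vrot)
  show "vrot X (star f) = 1 *s star (vrot (dual_der X) f)" if "f \<in> ext3" for f
    using that tr by (simp add: star_vrot dual_der_simps)
  show "vrot X (ext_der A u) = ext_der (?P A) (vrot X u)" if "u \<in> ext3" for A u
    using X that by (rule vrot_ext_der)
  show "pairing (vrot X u) (vrot (dual_der X) f) = pairing u f" if "u \<in> ext3" "f \<in> ext3" for u f
    using X that by (rule pairing_vrot)
  show "bij_betw (vrot X) ext3 ext3" "bij_betw (vrot (dual_der X)) ext3 ext3"
    using X quarter_dual[OF X] by (simp_all only: bij_betw_vrot)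
qed (simp_all only: vrot_add vrot_scale matrix_add_simps mat_scale_mult_left mat_scale_mult_right mult_1)

lemma rot_gen_dual: "dual_der (rot_gen i j a b) = rot_gen i j (- b) (- a)"
proof -
  have unit: "dual_der (unit_mat i j) = (- unit_mat j i :: 'f ^ 6 ^ 6)" for i j
    by (simp add: dual_der_def vec_eq_iff transpose_def unit_mat_nth)
  have "mat_scale c (- A) = mat_scale (- c) A" for c and A :: "'f ^ 6 ^ 6"
    by (simp add: vec_eq_iff mat_scale_nth)
  then show ?thesis by (simp only: rot_gen_def dual_der_simps unit) (simp only: add.commute)
qed

lemma rot_gen_minus: "- rot_gen i j a b = rot_gen i j (- a) (- b)"
  by (simp add: rot_gen_def vec_eq_iff mat_scale_nth)

lemma rot_gen_sq:
  assumes "i \<noteq> j" "a * b = -1"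
  shows "rot_gen i j a b ** rot_gen i j a b = - (unit_mat i i + unit_mat j j)"
  using assms by (simp add: rot_gen_def matrix_add_simps mat_scale_mult_left mat_scale_mult_right unit_mat_mult
      mat_scale_simps mult.commute[of b a])

lemma quarter_rot_gen:
  assumes "i \<noteq> j" "a * b = -1"
  shows "quarter (rot_gen i j a b)"
proof -
  have "- (unit_mat i i + unit_mat j j) ** rot_gen i j a b = - rot_gen i j a b"
    using assms(1) by (simp add: rot_gen_def matrix_add_simps mat_scale_mult_right unit_mat_mult mat_scale_simps)
  then show ?thesis
    using assms by (simp add: quarter_def rot_gen_sq ext_der_rot_gen_cube)
      (simp add: rot_gen_def trace_add trace_scale trace_unit_mat)
qed

lemma prod_flip:
  fixes S :: "6 set"
  assumes "i \<noteq> j"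
  shows "(\<Prod>a\<in>S. flip i j a) = (if crossing i j S then -1 else 1 :: 'f)"
proof -
  have "(\<Prod>a\<in>S. flip i j a :: 'f) = (\<Prod>a\<in>S. (if a = i then -1 else 1) * (if a = j then -1 else 1))"
    using assms by (intro prod.cong) (auto simp: flip_def)
  then show ?thesis by (simp add: prod.distrib crossing_def)
qed

lemma qrot_rot_gen_sq:
  assumes "i \<noteq> j" "a * b = -1"
  shows "qrot (rot_gen i j a b) ** qrot (rot_gen i j a b) = f_diag i j"
proof -
  let ?X = "rot_gen i j a b"
  have X: "?X ** ?X ** ?X = - ?X" using quarter_rot_gen[OF assms] by (simp add: quarter_def)
  have X': "?X ** (?X ** ?X) = - ?X" using X by (simp add: matrix_mul_assoc)
  have "qrot ?X ** qrot ?X = mat 1 + ?X ** ?X + ?X ** ?X"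
    by (simp add: qrot_def matrix_add_simps matrix_mul_assoc X)
  then show ?thesis
    using assms by (auto simp: rot_gen_sq vec_eq_iff mat_nth unit_mat_nth f_diag_def)
qed

text \<open>A half turn is the square of a quarter turn and has the matrix
  \<open>f_diag i j\<close>. Through \<open>lie_aut_rotation\<close> this shows that the involutions
  defining the grading are automorphisms.\<close>

lemma tilde_eq_rotation:
  assumes "i \<noteq> j" "a * b = -1" "x \<in> e6_carrier"
  shows "tilde (f_diag i j) x = rotation (rot_gen i j a b) (rotation (rot_gen i j a b) x)"
proof -
  have v: "vrot (rot_gen i j c d) (vrot (rot_gen i j c d) y) = (\<chi> S. (\<Prod>a\<in>S. flip i j a) * y $ S)"
    if "c * d = -1" "y \<in> ext3" for c d y
  proof -
    let ?D = "ext_der (rot_gen i j c d)"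
    have "?D (?D (?D y)) = - ?D y" using that assms(1) by (simp add: ext_der_rot_gen_cube)
    then have "vrot (rot_gen i j c d) (vrot (rot_gen i j c d) y) = y + (?D (?D y) + ?D (?D y))"
      by (simp add: vrot_def ext_der_add_right ext_der_minus_right)
    then show ?thesis
      using that assms(1) by (simp add: ext_der_rot_gen_sq vec_eq_iff cross_part_def prod_flip)
  qed
  have m: "- rot_gen i j a b = rot_gen i j (- a) (- b)" by (rule rot_gen_minus)
  let ?X = "rot_gen i j a b"
  obtain p f A u q where x: "x = el p f A u q" "f \<in> ext3" "u \<in> ext3" using assms(3) by (rule el_cases)
  have q: "qrot ?X ** (qrot ?X ** A ** qrot (- ?X)) ** qrot (- ?X) = (\<chi> k l. flip i j k * A $ k $ l * flip i j l)"
  proof -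
    have "qrot ?X ** (qrot ?X ** A ** qrot (- ?X)) ** qrot (- ?X) = (qrot ?X ** qrot ?X) ** A ** (qrot (- ?X) ** qrot (- ?X))"
      by (simp only: matrix_mul_assoc)
    also have "\<dots> = f_diag i j ** A ** f_diag i j"
      using assms by (simp only: m qrot_rot_gen_sq) (simp add: qrot_rot_gen_sq)
    finally show ?thesis by (simp add: f_diag_eq vec_eq_iff diag_mat_mult_left diag_mat_mult_right)
  qed
  have top: "(\<chi> S. (\<Prod>a\<in>S. flip i j a) * axis UNIV c $ S) = axis UNIV (c :: 'f)" for c
    using assms(1) by (simp add: vec_eq_iff prod_flip axis_def crossing_def)
  show ?thesis
    unfolding x(1) rotation_el q
    using assms x v[of a b u] v[of "- b" "- a" f]
    by (simp add: rot_gen_dual mult.commute[of b a]) (simp add: el_def tilde_f_diag top del: tilde.simps)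
qed

lemma lie_aut_tilde: "i \<noteq> j \<Longrightarrow> lie_aut (tilde (f_diag i j))"
  by (rule lie_aut_cong[OF lie_aut_comp[OF lie_aut_rotation lie_aut_rotation]])
    (rule quarter_rot_gen[of i j 1 "-1"] tilde_eq_rotation[of i j 1 "-1"]; simp)+

section \<open>The exchange of \<open>L_n\<close> with \<open>L_-n\<close>\<close>

lemma psi_transpose: "f \<in> ext3 \<Longrightarrow> u \<in> ext3 \<Longrightarrow> psi u f = transpose (psi f (u :: 'f ext6))"
proof (rule psi_eqI)
  assume fu: "f \<in> ext3" "u \<in> ext3"
  show "trace (transpose (psi f u)) = 0" by (simp add: trace_transpose trace_psi)
  fix g :: "'f ^ 6 ^ 6" assume g: "trace g = 0"
  have "trace (g ** transpose (psi f u)) = trace (transpose (psi f u ** transpose g))"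
    by (simp add: matrix_transpose_mul transpose_transpose)
  also have "\<dots> = trace (transpose g ** psi f u)"
    by (subst trace_transpose) (rule trace_mul_sym)
  also have "\<dots> = pairing (ext_der g f) u"
    unfolding trace_mult_psi[OF g[folded trace_transpose[of g]]] pairing_ext_der[OF fu(2,1)] transpose_transpose
    by (rule pairing_commute)
  finally show "trace (g ** transpose (psi f u)) = pairing (ext_der g f) u" .
qed

text \<open>V and its dual share coordinates, so the exchange swaps tuple entries and takes
  contragredients of matrices. The factors at the two ends convert between \<alpha> 1 1 and \<alpha>
  (-1) (-1).\<close>

fun dualize :: "'f e6 \<Rightarrow> 'f e6" where
  "dualize (f', f, A, u, u') =
     ((\<alpha> (-1) (-1) / \<alpha> 1 1) *s u', u, dual_der A, f, (\<alpha> 1 1 / \<alpha> (-1) (-1)) *s f')"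

lemma dualize_el: "dualize (el p f A u q) =
    el (\<alpha> (-1) (-1) / \<alpha> 1 1 * q) u (dual_der A) f (\<alpha> 1 1 / \<alpha> (-1) (-1) * p)"
  by (simp add: el_def axis_scale)

lemma lie_aut_dualize: "lie_aut dualize"
proof -
  have mem: "dualize x \<in> e6_carrier" if "x \<in> e6_carrier" for x
    using that by (elim el_cases) (simp add: dualize_el el_carrier)
  have inv: "dualize (dualize x) = x" if "x \<in> e6_carrier" for x
    using that nonzero by (elim el_cases) (simp add: dualize_el dual_der_simps)
  have "bij_betw dualize e6_carrier e6_carrier"
    by (rule bij_betw_byWitness[where f' = dualize]) (auto simp: mem inv simp del: dualize.simps)
  moreover have "dualize (x + y) = dualize x + dualize y" if "x \<in> e6_carrier" "y \<in> e6_carrier" for x y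
    using that by (elim el_cases) (simp add: el_add dualize_el dual_der_simps el_eq_iff add_divide_distrib algebra_simps)
  moreover have "dualize (e6_scale c x) = e6_scale c (dualize x)" if "x \<in> e6_carrier" for c x
    using that by (elim el_cases) (simp add: el_scale dualize_el dual_der_simps el_eq_iff algebra_simps)
  moreover have "dualize (br x y) = br (dualize x) (dualize y)" if "x \<in> e6_carrier" "y \<in> e6_carrier" for x y
  proof -
    obtain p f A u q where x: "x = el p f A u q" "f \<in> ext3" "u \<in> ext3" using \<open>x \<in> e6_carrier\<close> by (rule el_cases)
    obtain p' g B v q' where y: "y = el p' g B v q'" "g \<in> ext3" "v \<in> ext3" using \<open>y \<in> e6_carrier\<close> by (rule el_cases)
    \<comment> \<open>Here \<open>scalar_relation\<close> enters: the two contraction brackets are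
      exchanged with exactly the ratio chosen at the ends.\<close>
    have r: "\<alpha> 1 (-2) = \<alpha> (-1) 2 * (\<alpha> 1 1 / \<alpha> (-1) (-1))" "\<alpha> (-1) 2 = \<alpha> 1 (-2) * (\<alpha> (-1) (-1) / \<alpha> 1 1)"
      using scalar_relation nonzero by (simp_all add: field_simps)
    define k where "k = \<alpha> 1 1 / \<alpha> (-1) (-1)"
    have k: "\<alpha> 1 1 / \<alpha> (-1) (-1) = k" "\<alpha> (-1) (-1) / \<alpha> 1 1 = inverse k" "k \<noteq> 0"
      "\<alpha> 1 1 = k * \<alpha> (-1) (-1)"
      using nonzero by (simp_all add: k_def)
    have r': "\<alpha> 1 (-2) = \<alpha> (-1) 2 * k" using r(1) by (simp only: k_def)
    have d0: "dual_der (A ** B - B ** A + mat_scale (\<alpha> 1 (-1)) (psi g u - psi f v)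
         + mat (\<beta> 1 * (pairing u g - pairing v f)) + mat (\<beta> 2 * (q * p' - q' * p))) =
       dual_der A ** dual_der B - dual_der B ** dual_der A + mat_scale (\<alpha> 1 (-1)) (psi v f - psi u g)
         + mat (\<beta> 1 * (pairing f v - pairing g u)) + mat (\<beta> 2 * (q' * p - q * p'))"
      using x y psi_transpose[of g u] psi_transpose[of f v]
      by (simp add: dual_der_simps dual_der_mult pairing_commute[of f] pairing_commute[of g])
        (simp add: dual_der_def transpose_simps mat_scale_simps mat_diff algebra_simps)
    show ?thesis
      using x y k(3) by (simp add: br_el dualize_el k(1,2) d0 el_eq_iff dual_der_simps(6,7) r')
       (simp add: k(4) field_simps vec_eq_iff)
  qed
  ultimately show ?thesis by (auto simp: lie_aut_def)
qed

end

section \<open>The grading\<close>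

declare add_bit_eq_xor [simp del] mult_bit_eq_and [simp del]

lemma UNIV_bit: "(UNIV :: bit set) = {0, 1}"
  by auto

instance bit :: finite
  by standard (simp add: UNIV_bit)

lemma bit_add_self [simp]: "x + x = (0::bit)"
  by (cases x) simp_all

lemma bit_vec_add_self [simp]: "x + x = (0 :: bit ^ 'n)"
  by (simp add: vec_eq_iff)

lemma bit_add_eq_0_iff: "a + b = 0 \<longleftrightarrow> a = (b::bit)"
  by (cases a; cases b) simp_all

lemma bit_vec_add_eq_0_iff: "a + b = 0 \<longleftrightarrow> a = (b :: bit ^ 'n)"
  by (simp add: vec_eq_iff bit_add_eq_0_iff)

lemma bit_sign_add: "bit_sign (a + b) = (bit_sign a * bit_sign b :: 'f::field)"
  by (cases a; cases b) (simp_all add: bit_sign_def)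

lemma bit_sign_simps [simp]: "bit_sign 0 = (1::'f::field)" "bit_sign 1 = (-1::'f)"
  "bit_sign a * bit_sign a = (1::'f)"
  by (cases a; simp add: bit_sign_def)+

lemma bit_sign_eq_iff [simp]: "bit_sign a = (bit_sign b :: 'f::field_char_0) \<longleftrightarrow> a = b"
  by (cases a; cases b) (simp_all add: bit_sign_def)

lemma bit_sign_nonzero [simp]: "bit_sign a \<noteq> (0::'f::field)"
  by (simp add: bit_sign_def)

text \<open>Coordinate \<open>l\<close> of the class belongs to the involution
  \<open>f_diag 1 (idx l)\<close>. The last clause serves 4, which is 0 in the type
  \<open>4\<close>.\<close>

definition idx :: "4 \<Rightarrow> 6" where
  "idx l = (if l = 1 then 2 else if l = 2 then 3 else if l = 3 then 4 else 5)"

lemma idx_simps [simp]: "idx 1 = 2" "idx 2 = 3" "idx 3 = 4" "idx 4 = 5" "idx 0 = 5" "idx l \<noteq> 1" "idx l \<noteq> 0"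
  by (simp_all add: idx_def)

text \<open>The exponents of the signs by which the involutions act on \<open>e_S\<close>.
  Membership of 0, that is of the index 6, leaves no trace, and complementing \<open>S\<close> adds
  1 twice.\<close>

definition cls :: "6 set \<Rightarrow> bit ^ 4" where
  "cls S = (\<chi> l. of_bool (1 \<in> S) + of_bool (idx l \<in> S))"

abbreviation cl :: "6 \<Rightarrow> bit ^ 4" where "cl i \<equiv> cls {i}"

lemma cls_nth: "cls S $ l = of_bool (1 \<in> S) + of_bool (idx l \<in> S)"
  by (simp add: cls_def)

lemma cls_UNIV [simp]: "cls UNIV = 0" and cls_0 [simp]: "cls {0} = 0" and cls_empty [simp]: "cls {} = 0"
  by (simp_all add: vec_eq_iff cls_nth)

lemma cls_Un: "S \<inter> T = {} \<Longrightarrow> cls (S \<union> T) = cls S + cls T"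
  by (auto simp: vec_eq_iff cls_nth of_bool_def)

lemma cls_Compl [simp]: "cls (- S) = cls S"
  by (auto simp: vec_eq_iff cls_nth of_bool_def)

lemma cls_insert: "i \<notin> S \<Longrightarrow> cls (insert i S) = cl i + cls S"
  using cls_Un[of "{i}" S] by simp

lemma prod_flip_cls: "(\<Prod>a\<in>S. flip 1 (idx l) a) = (bit_sign (cls S $ l) :: 'f::field_char_0)"
proof -
  have "(\<Prod>a\<in>S. flip 1 (idx l) a :: 'f) = (\<Prod>a\<in>S. (if a = 1 then -1 else 1) * (if a = idx l then -1 else 1))"
    using idx_simps(6)[of l] by (intro prod.cong) (auto simp: flip_def)
  then show ?thesis by (simp add: prod.distrib cls_nth of_bool_def)
qed

lemma flip_cl: "flip 1 (idx l) a = (bit_sign (cl a $ l) :: 'f::field_char_0)"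
  using prod_flip_cls[of l "{a}"] by simp

section \<open>Projections onto the homogeneous components\<close>

fun filt :: "bit ^ 4 \<Rightarrow> int \<Rightarrow> 'f::field e6 \<Rightarrow> 'f e6" where
  "filt k n (f', f, A, u, u') =
    (if n = -2 \<and> k = 0 then f' else 0, (\<chi> S. if n = -1 \<and> cls S = k then f $ S else 0),
     (\<chi> a b. if n = 0 \<and> cl a + cl b = k then A $ a $ b else 0),
     (\<chi> S. if n = 1 \<and> cls S = k then u $ S else 0), if n = 2 \<and> k = 0 then u' else 0)"

lemma filt_carrier: "x \<in> e6_carrier \<Longrightarrow> filt k n x \<in> e6_carrier"
  by (cases x) (auto simp: e6_carrier_iff ext_pow_iff)

lemma filt_add: "filt k n (x + y) = filt k n x + filt k n y"
  by (cases x; cases y) (auto simp: vec_eq_iff)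

lemma filt_scale: "filt k n (e6_scale c x) = e6_scale c (filt k n x)"
  by (cases x) (auto simp: vec_eq_iff mat_scale_nth)

lemma filt_filt: "filt k n (filt k' n' x) = (if k = k' \<and> n = n' then filt k n x else 0)"
  by (cases x) (auto simp: vec_eq_iff zero_prod_def)

lemma theta_coord_add: "theta_coord \<iota> (x + y) = theta_coord \<iota> x + theta_coord \<iota> (y :: 'f::field_char_0 e6)"
  by (cases x; cases y) (simp add: star_add vec_eq_iff algebra_simps trace_add add_divide_distrib transpose_simps mat_nth)

lemma theta_coord_scale: "theta_coord \<iota> (e6_scale c x) = e6_scale c (theta_coord \<iota> (x :: 'f::field_char_0 e6))"
  by (cases x) (simp add: star_scale vec_eq_iff algebra_simps trace_scale transpose_simps mat_nth mat_scale_nth)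

lemma theta_coord_theta_coord:
  assumes "\<iota> * \<iota> = -1" "x \<in> e6_carrier"
  shows "theta_coord \<iota> (theta_coord \<iota> x) = (x :: 'f::field_char_0 e6)"
proof -
  show ?thesis using assms(2)
    by (cases x) (simp add: assms(1) e6_carrier_iff star_scale star_minus star_star trace_sub trace_mat_6 trace_transpose
        transpose_simps transpose_transpose vec_eq_iff)
qed

text \<open>\<theta> respects classes: the star passes to complements, which have the same class,
  and transposition preserves \<open>cl a + cl b\<close>.\<close>

lemma filt_theta_coord: "filt k n (theta_coord \<iota> x) = theta_coord \<iota> (filt k n (x :: 'f::field_char_0 e6))"
proof -
  obtain f' f A u u' where x: "x = (f', f, A, u, u')" by (cases x)
  have tr: "trace (\<chi> a b. if n = 0 \<and> cl a + cl b = k then A $ a $ b else 0) = (if n = 0 \<and> k = 0 then trace A else 0)"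
    by (auto simp: trace_def)
  have st: "star (\<chi> S. if P \<and> cls S = k then f $ S else 0) = (\<chi> S. if P \<and> cls S = k then star f $ S else 0)"
    for P and f :: "'f ext6"
    by (simp add: vec_eq_iff[where 'a = 'f] star_nth)
  have mt: "(\<chi> a b. if n = 0 \<and> cl a + cl b = k then (mat (trace A / 3) - transpose A) $ a $ b else 0)
      = mat ((if n = 0 \<and> k = 0 then trace A else 0) / 3)
        - transpose (\<chi> a b. if n = 0 \<and> cl a + cl b = k then A $ a $ b else 0)"
  proof -
    have "(if n = 0 \<and> cl a + cl b = k then (mat (trace A / 3) - transpose A) $ a $ b else 0)
      = (mat ((if n = 0 \<and> k = 0 then trace A else 0) / 3)
        - transpose (\<chi> a b. if n = 0 \<and> cl a + cl b = k then A $ a $ b else 0)) $ a $ b" for a b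
      by (cases "a = b") (auto simp: mat_nth transpose_def add.commute[of "cl b"])
    then show ?thesis
      unfolding vec_eq_iff[where 'a = 'f] vec_eq_iff[where 'a = "'f ^ 6"] vec_lambda_beta by blast
  qed
  show ?thesis
    unfolding x filt.simps theta_coord.simps tr st mt[symmetric]
    by (simp add: vec_eq_iff[where 'a = 'f])
qed

context e6_lie
begin

lemma scale_simps:
  "e6_scale a (x + y) = e6_scale a x + e6_scale a y" "e6_scale (a + b) x = e6_scale a x + e6_scale b x"
  "e6_scale a (e6_scale b x) = e6_scale (a * b) x" "e6_scale 1 x = x" "e6_scale 0 x = 0" "e6_scale a 0 = (0 :: 'f e6)"
proof -
  interpret V: vector_space "e6_scale :: 'f \<Rightarrow> 'f e6 \<Rightarrow> 'f e6" by (rule vs)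
  show "e6_scale a (x + y) = e6_scale a x + e6_scale a y" "e6_scale (a + b) x = e6_scale a x + e6_scale b x"
    "e6_scale a (e6_scale b x) = e6_scale (a * b) x" "e6_scale 1 x = x" "e6_scale 0 x = 0" "e6_scale a 0 = (0 :: 'f e6)"
    by (simp_all add: V.scale_right_distrib V.scale_left_distrib)
qed

lemma carrier_add: "x \<in> e6_carrier \<Longrightarrow> y \<in> e6_carrier \<Longrightarrow> x + y \<in> (e6_carrier :: 'f e6 set)"
  and carrier_scale: "x \<in> e6_carrier \<Longrightarrow> e6_scale c x \<in> (e6_carrier :: 'f e6 set)"
  and carrier_zero: "0 \<in> (e6_carrier :: 'f e6 set)"
proof -
  interpret V: vector_space "e6_scale :: 'f \<Rightarrow> 'f e6 \<Rightarrow> 'f e6" by (rule vs)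
  show "x \<in> e6_carrier \<Longrightarrow> y \<in> e6_carrier \<Longrightarrow> x + y \<in> (e6_carrier :: 'f e6 set)"
    "x \<in> e6_carrier \<Longrightarrow> e6_scale c x \<in> (e6_carrier :: 'f e6 set)" "0 \<in> (e6_carrier :: 'f e6 set)"
    using V.subspace_add[OF subspace_carrier] V.subspace_scale[OF subspace_carrier] V.subspace_0[OF subspace_carrier]
    by auto
qed

abbreviation \<Gamma> :: "g5 \<Rightarrow> 'f e6 set" where "\<Gamma> \<equiv> Gamma5 \<iota>"

lemma tilde_eigen_iff:
  "tilde (f_diag 1 (idx l)) (el p f A u q) = e6_scale (bit_sign b) (el p f A u q :: 'f e6) \<longleftrightarrow>
    (p = 0 \<or> b = 0) \<and> (\<forall>S. f $ S = 0 \<or> cls S $ l = b) \<and> (\<forall>i j. A $ i $ j = 0 \<or> (cl i + cl j) $ l = b)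
    \<and> (\<forall>S. u $ S = 0 \<or> cls S $ l = b) \<and> (q = 0 \<or> b = (0 :: bit))" (is "?l \<longleftrightarrow> ?r")
proof -
  have top: "(\<forall>S. axis UNIV c $ S = 0 \<or> cls S $ l = b) \<longleftrightarrow> c = 0 \<or> b = 0" for c :: 'f
    by (auto simp: axis_def split: if_splits)
  have ext: "(\<chi> S. bit_sign (cls S $ l) * f $ S) = bit_sign b *s f \<longleftrightarrow> (\<forall>S. f $ S = 0 \<or> cls S $ l = b)"
    for f :: "'f ext6"
    by (auto simp: vec_eq_iff)
  have mat: "(\<chi> i j. bit_sign (cl i $ l) * A $ i $ j * bit_sign (cl j $ l)) = mat_scale (bit_sign b) A \<longleftrightarrow>
      (\<forall>i j. A $ i $ j = 0 \<or> (cl i + cl j) $ l = b)"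
  proof -
    have "bit_sign (cl i $ l) * A $ i $ j * bit_sign (cl j $ l) = bit_sign ((cl i + cl j) $ l) * A $ i $ j" for i j
      by (simp add: bit_sign_add mult_ac)
    note eq = this
    show ?thesis
      unfolding vec_eq_iff vec_lambda_beta mat_scale_nth eq mult_cancel_right bit_sign_eq_iff by blast
  qed
  show ?thesis
    by (simp add: el_def tilde_f_diag flip_cl prod_flip_cls[unfolded flip_cl] top ext mat del: tilde.simps)
qed

lemma filt_el: "filt k n (el p f A u q) =
   el (if n = -2 \<and> k = 0 then p else 0) (\<chi> S. if n = -1 \<and> cls S = k then f $ S else 0)
     (\<chi> a b. if n = 0 \<and> cl a + cl b = k then A $ a $ b else 0)
     (\<chi> S. if n = 1 \<and> cls S = k then u $ S else 0) (if n = 2 \<and> k = 0 then q else 0)"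
  by (simp add: el_def)

text \<open>The involutions act on coordinates by signs, so their eigenvector conditions become a
  condition on supports. Only the condition for \<theta> relates different coordinates.\<close>

lemma mem_Gamma5:
  "x \<in> \<Gamma> (k0, k, n) \<longleftrightarrow> x \<in> e6_carrier \<and> filt k n x = x \<and> theta_coord \<iota> x = e6_scale (bit_sign k0) x"
proof (cases "x \<in> e6_carrier")
  case True
  then obtain p f A u q where x: "x = el p f A u q" "f \<in> ext3" "u \<in> ext3" by (rule el_cases)
  have part: "x \<in> e6_part n \<longleftrightarrow> (p = 0 \<or> n = -2) \<and> (f = 0 \<or> n = -1) \<and> (A = 0 \<or> n = 0) \<and> (u = 0 \<or> n = 1) \<and> (q = 0 \<or> n = 2)"
  proof -
    have "axis UNIV c = (0 :: 'f ext6) \<longleftrightarrow> c = 0" for c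
      by (auto dest: arg_cong[of _ _ "\<lambda>x. x $ UNIV"])
    then show ?thesis using True unfolding x(1) el_def e6_part_def by auto
  qed
  have til: "(tilde (f_diag 1 2) x = e6_scale (bit_sign (k $ 1)) x \<and> tilde (f_diag 1 3) x = e6_scale (bit_sign (k $ 2)) x \<and>
       tilde (f_diag 1 4) x = e6_scale (bit_sign (k $ 3)) x \<and> tilde (f_diag 1 5) x = e6_scale (bit_sign (k $ 4)) x)
     \<longleftrightarrow> (p = 0 \<or> k = 0) \<and> (\<forall>S. f $ S = 0 \<or> cls S = k) \<and> (\<forall>i j. A $ i $ j = 0 \<or> cl i + cl j = k)
       \<and> (\<forall>S. u $ S = 0 \<or> cls S = k) \<and> (q = 0 \<or> k = 0)" (is "?t \<longleftrightarrow> ?c")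
  proof -
    have "?t \<longleftrightarrow> (\<forall>l. tilde (f_diag 1 (idx l)) x = e6_scale (bit_sign (k $ l)) x)"
      unfolding forall_4 by simp
    also have "\<dots> \<longleftrightarrow> ?c"
    proof -
      have gen: "(\<forall>l. P1 l \<and> (\<forall>S. P2 S l) \<and> (\<forall>i j. P3 i j l) \<and> (\<forall>S. P4 S l) \<and> P5 l) \<longleftrightarrow>
          (\<forall>l. P1 l) \<and> (\<forall>S l. P2 S l) \<and> (\<forall>i j l. P3 i j l) \<and> (\<forall>S l. P4 S l) \<and> (\<forall>l. P5 l)"
        for P1 P5 :: "4 \<Rightarrow> bool" and P2 P4 :: "6 set \<Rightarrow> 4 \<Rightarrow> bool" and P3 :: "6 \<Rightarrow> 6 \<Rightarrow> 4 \<Rightarrow> bool"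
        by blast
      have "(\<forall>l. P \<or> v $ l = w $ l) \<longleftrightarrow> P \<or> v = w" for P and v w :: "bit ^ 4"
        by (auto simp: vec_eq_iff)
      note disj = this this[of _ _ 0, unfolded zero_index]
      have "(\<forall>l. (p = 0 \<or> k $ l = 0) \<and> (\<forall>S. f $ S = 0 \<or> cls S $ l = k $ l) \<and> (\<forall>i j. A $ i $ j = 0 \<or> (cl i + cl j) $ l = k $ l)
          \<and> (\<forall>S. u $ S = 0 \<or> cls S $ l = k $ l) \<and> (q = 0 \<or> k $ l = 0)) \<longleftrightarrow>
        (\<forall>l. p = 0 \<or> k $ l = 0) \<and> (\<forall>S l. f $ S = 0 \<or> cls S $ l = k $ l) \<and> (\<forall>i j l. A $ i $ j = 0 \<or> (cl i + cl j) $ l = k $ l)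
          \<and> (\<forall>S l. u $ S = 0 \<or> cls S $ l = k $ l) \<and> (\<forall>l. q = 0 \<or> k $ l = 0)"
        by (rule gen)
      then show ?thesis unfolding x(1) tilde_eigen_iff disj .
    qed
    finally show ?thesis .
  qed
  have "filt k n x = x \<longleftrightarrow> x \<in> e6_part n \<and> (p = 0 \<or> k = 0) \<and> (\<forall>S. f $ S = 0 \<or> cls S = k)
      \<and> (\<forall>i j. A $ i $ j = 0 \<or> cl i + cl j = k) \<and> (\<forall>S. u $ S = 0 \<or> cls S = k) \<and> (q = 0 \<or> k = 0)"
  proof -
    have c: "(if n = m \<and> k = 0 then r else 0) = r \<longleftrightarrow> (r = 0 \<or> n = m) \<and> (r = 0 \<or> k = 0)" for m and r :: 'f
      by auto
    have e: "(\<chi> S. if n = m \<and> cls S = k then g $ S else 0) = g \<longleftrightarrow> (g = 0 \<or> n = m) \<and> (\<forall>S. g $ S = 0 \<or> cls S = k)"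
      for m and g :: "'f ext6"
      unfolding vec_eq_iff[where 'a = 'f] vec_lambda_beta zero_index by (cases "n = m") (simp; metis)+
    have m: "(\<chi> i j. if n = 0 \<and> cl i + cl j = k then A $ i $ j else 0) = A \<longleftrightarrow>
        (A = 0 \<or> n = 0) \<and> (\<forall>i j. A $ i $ j = 0 \<or> cl i + cl j = k)"
      unfolding vec_eq_iff[where 'a = 'f] vec_eq_iff[where 'a = "'f ^ 6"] vec_lambda_beta zero_index
      by (cases "n = 0") (simp; metis)+
    show ?thesis unfolding part unfolding x(1) filt_el el_eq_iff c e m by blast
  qed
  then show ?thesis
    using True by (auto simp: til theta_eq_theta_coord)
next
  case False
  then show ?thesis by (auto simp: e6_part_def)
qed

text \<open>The usual idempotent of an involution, half of the identity plus or minus \<theta>, on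
  the part of class \<open>k\<close> and integer degree \<open>n\<close>.\<close>

definition proj :: "g5 \<Rightarrow> 'f e6 \<Rightarrow> 'f e6" where
  "proj g x = (case g of (k0, k, n) \<Rightarrow>
     e6_scale (1/2) (filt k n x + e6_scale (bit_sign k0) (theta_coord \<iota> (filt k n x))))"

lemma proj_add: "proj g (x + y) = proj g x + proj g y"
  by (cases g) (simp add: proj_def filt_add theta_coord_add scale_simps algebra_simps)

lemma proj_scale: "proj g (e6_scale c x) = e6_scale c (proj g x)"
  by (cases g) (simp add: proj_def filt_scale theta_coord_scale scale_simps mult.commute)

lemma proj_zero: "proj g 0 = 0"
  using proj_scale[of g 0 0] by (simp add: scale_simps)

lemma proj_sum: "proj g (\<Sum>i\<in>I. F i) = (\<Sum>i\<in>I. proj g (F i))"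
  by (induction I rule: infinite_finite_induct) (simp_all add: proj_zero proj_add)

lemma proj_mem: "x \<in> e6_carrier \<Longrightarrow> proj g x \<in> \<Gamma> g"
proof -
  assume x: "x \<in> e6_carrier"
  obtain k0 k n where g: "g = (k0, k, n)" by (cases g)
  have c: "filt k n x \<in> e6_carrier" "theta_coord \<iota> (filt k n x) \<in> e6_carrier"
    using x by (simp_all add: filt_carrier theta_coord_carrier)
  then show ?thesis unfolding g mem_Gamma5 proj_def
    by (simp add: carrier_scale carrier_add filt_scale filt_add filt_theta_coord filt_filt theta_coord_scale
        theta_coord_add theta_coord_theta_coord iota_sq scale_simps mult.commute add.commute)
qed

lemma proj_Gamma: "x \<in> \<Gamma> h \<Longrightarrow> proj g x = (if g = h then x else 0)"
proof -
  assume x: "x \<in> \<Gamma> h"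
  obtain k0 k n where g: "g = (k0, k, n)" by (cases g)
  obtain h0 l m where h: "h = (h0, l, m)" by (cases h)
  have x': "filt l m x = x" "theta_coord \<iota> x = e6_scale (bit_sign h0) x"
    using x by (simp_all add: h mem_Gamma5 del: Gamma5.simps)
  have f: "filt k n x = (if k = l \<and> n = m then x else 0)"
    using filt_filt[of k n l m x] x' by (auto split: if_splits)
  have th0: "theta_coord \<iota> 0 = 0" using theta_coord_scale[of \<iota> 0 0] by (simp add: scale_simps)
  have "e6_scale (1/2) (x + e6_scale (bit_sign k0) (e6_scale (bit_sign h0) x)) = (if k0 = h0 then x else 0)"
  proof -
    have "e6_scale (1/2) (x + e6_scale (bit_sign k0) (e6_scale (bit_sign h0) x))
        = e6_scale (1/2 + 1/2 * (bit_sign k0 * bit_sign h0)) x"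
      by (simp add: scale_simps)
    also have "1/2 + 1/2 * (bit_sign k0 * bit_sign h0) = (if k0 = h0 then 1 else 0 :: 'f)"
      by (cases k0; cases h0) simp_all
    finally show ?thesis by (simp add: scale_simps)
  qed
  then show ?thesis using x' by (auto simp: g h proj_def f th0 scale_simps)
qed

lemma Gamma_iff_proj: "x \<in> \<Gamma> g \<longleftrightarrow> x \<in> e6_carrier \<and> proj g x = x"
proof -
  have "x \<in> \<Gamma> g \<Longrightarrow> x \<in> e6_carrier" by (cases g) (simp add: mem_Gamma5 del: Gamma5.simps)
  then show ?thesis using proj_mem[of x g] proj_Gamma[of x g g] by auto
qed

lemma Gamma_carrier: "x \<in> \<Gamma> g \<Longrightarrow> x \<in> e6_carrier"
  by (simp add: Gamma_iff_proj)

lemma Gamma_add: "x \<in> \<Gamma> g \<Longrightarrow> y \<in> \<Gamma> g \<Longrightarrow> x + y \<in> \<Gamma> g"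
  and Gamma_scale: "x \<in> \<Gamma> g \<Longrightarrow> e6_scale c x \<in> \<Gamma> g"
  and Gamma_zero: "0 \<in> \<Gamma> g"
  by (simp_all add: Gamma_iff_proj carrier_add carrier_scale carrier_zero proj_add proj_scale proj_zero)

lemma subspace_Gamma: "module.subspace e6_scale (\<Gamma> g)"
proof -
  interpret V: vector_space "e6_scale :: 'f \<Rightarrow> 'f e6 \<Rightarrow> 'f e6" by (rule vs)
  show ?thesis by (rule V.subspaceI) (auto simp: Gamma_add Gamma_scale Gamma_zero)
qed

lemma Gamma_disjoint: "x \<in> \<Gamma> g \<Longrightarrow> x \<in> \<Gamma> h \<Longrightarrow> x \<noteq> 0 \<Longrightarrow> g = h"
  using proj_Gamma[of x g g] proj_Gamma[of x h g] by (auto split: if_splits)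

definition degrees :: "g5 set" where "degrees = UNIV \<times> UNIV \<times> {-2..2}"

lemma finite_degrees: "finite degrees"
  by (simp add: degrees_def)

lemma proj_outside: "g \<notin> degrees \<Longrightarrow> proj g x = 0"
proof -
  assume "g \<notin> degrees"
  then obtain k0 k n where g: "g = (k0, k, n)" and n: "n \<notin> {-2..2}" by (cases g) (auto simp: degrees_def)
  have "n \<noteq> -2" "n \<noteq> -1" "n \<noteq> 0" "n \<noteq> 1" "n \<noteq> 2" using n by auto
  then have "filt k n x = 0" by (cases x) (simp add: zero_prod_def vec_eq_iff)
  moreover have "theta_coord \<iota> 0 = 0" using theta_coord_scale[of \<iota> 0 0] by (simp add: scale_simps)
  ultimately show ?thesis by (simp add: g proj_def scale_simps)
qed

text \<open>Summing over the two signs cancels the contribution of \<theta>; summing over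
  \<open>k\<close> and \<open>n\<close> then recovers every coordinate once.\<close>

lemma sum_proj: "(\<Sum>g\<in>degrees. proj g x) = x"
proof -
  have "(\<Sum>k0\<in>UNIV. proj (k0, k, n) x) = filt k n x" for k n
  proof -
    have "(\<Sum>k0\<in>UNIV. proj (k0, k, n) x) = e6_scale (1/2 + 1/2) (filt k n x)
        + e6_scale (1/2 + - (1/2)) (theta_coord \<iota> (filt k n x))"
      unfolding scale_simps(2) by (simp add: UNIV_bit proj_def scale_simps add_ac)
    then show ?thesis by (simp add: scale_simps)
  qed
  note k0 = this
  have "(\<Sum>g\<in>degrees. proj g x) = (\<Sum>k0\<in>UNIV. \<Sum>p\<in>UNIV \<times> {-2..2}. proj (k0, p) x)"
    unfolding degrees_def by (simp add: sum.cartesian_product case_prod_unfold)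
  also have "\<dots> = (\<Sum>p\<in>UNIV \<times> {-2..2}. \<Sum>k0\<in>UNIV. proj (k0, p) x)"
    by (rule sum.swap)
  also have "\<dots> = (\<Sum>(k, n)\<in>UNIV \<times> {-2..2}. filt k n x)"
    by (intro sum.cong) (auto simp: k0)
  also have "\<dots> = x"
  proof -
    have I: "{-2..2} = {-2, -1, 0, 1, 2 :: int}" by auto
    obtain f' f A u u' where x: "x = (f', f, A, u, u')" by (cases x)
    note comp = vec_eq_iff[where 'a = 'f] vec_eq_iff[where 'a = "'f ^ 6"]
    have "(\<Sum>n\<in>{-2..2}. filt k n x) = (if k = 0 then f' else 0, (\<chi> S. if cls S = k then f $ S else 0),
     (\<chi> a b. if cl a + cl b = k then A $ a $ b else 0), (\<chi> S. if cls S = k then u $ S else 0), if k = 0 then u' else 0)" for k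
      unfolding I x by (simp add: comp)
    then have "(\<Sum>(k, n)\<in>UNIV \<times> {-2..2}. filt k n x) = (\<Sum>k\<in>UNIV.
        (if k = 0 then f' else 0, (\<chi> S. if cls S = k then f $ S else 0),
     (\<chi> a b. if cl a + cl b = k then A $ a $ b else 0), (\<chi> S. if cls S = k then u $ S else 0), if k = 0 then u' else 0))"
      by (simp add: sum.cartesian_product[symmetric])
    also have "\<dots> = x"
      unfolding x by (simp add: prod_eq_iff fst_sum snd_sum comp)
    finally show ?thesis .
  qed
  finally show ?thesis .
qed

lemma e6_part_br:
  assumes "x \<in> e6_part n" "y \<in> e6_part m"
  shows "br x y \<in> e6_part (n + m)"
proof -
  have c: "x \<in> e6_carrier" "y \<in> e6_carrier" using assms by (auto simp: e6_part_def)
  obtain p f A u q where x: "x = el p f A u q" "f \<in> ext3" "u \<in> ext3" using c(1) by (rule el_cases)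
  obtain p' g B v q' where y: "y = el p' g B v q'" "g \<in> ext3" "v \<in> ext3" using c(2) by (rule el_cases)
  have ax: "axis UNIV c = (0 :: 'f ext6) \<longleftrightarrow> c = 0" for c
    by (auto dest: arg_cong[of _ _ "\<lambda>x. x $ UNIV"])
  have part: "el p f A u q \<in> e6_part n \<longleftrightarrow> el p f A u q \<in> e6_carrier \<and>
     (p = 0 \<or> n = -2) \<and> (f = 0 \<or> n = -1) \<and> (A = 0 \<or> n = 0) \<and> (u = 0 \<or> n = 1) \<and> (q = 0 \<or> n = 2)" for p q f u n and A :: "'f ^ 6 ^ 6"
    unfolding el_def e6_part_def by (auto simp: ax)
  have 1: "br x y \<in> e6_carrier" using br_closed c by blast
  have "(trace B * p - trace A * p' + \<alpha> (-1) (-1) * pairing f (star g) = 0 \<or> n + m = -2) \<and>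
      (ext_der (dual_der A) g - ext_der (dual_der B) f + \<alpha> 1 (-2) *s (p' *s star u - p *s star v) = 0 \<or> n + m = -1) \<and>
      (A ** B - B ** A + mat_scale (\<alpha> 1 (-1)) (psi g u - psi f v)
         + mat (\<beta> 1 * (pairing u g - pairing v f)) + mat (\<beta> 2 * (q * p' - q' * p)) = 0 \<or> n + m = 0) \<and>
      (ext_der A v - ext_der B u + \<alpha> (-1) 2 *s (q' *s star f - q *s star g) = 0 \<or> n + m = 1) \<and>
      (trace A * q' - trace B * q + \<alpha> 1 1 * pairing u (star v) = 0 \<or> n + m = 2)"
  proof -
    have nx: "p = 0 \<or> n = -2" "f = 0 \<or> n = -1" "A = 0 \<or> n = 0" "u = 0 \<or> n = 1" "q = 0 \<or> n = 2"
      using assms(1) unfolding x(1) part by blast+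
    have ny: "p' = 0 \<or> m = -2" "g = 0 \<or> m = -1" "B = 0 \<or> m = 0" "v = 0 \<or> m = 1" "q' = 0 \<or> m = 2"
      using assms(2) unfolding y(1) part by blast+
    show ?thesis
    proof (intro conjI)
      show "trace B * p - trace A * p' + \<alpha> (-1) (-1) * pairing f (star g) = 0 \<or> n + m = -2"
      proof (cases "n + m = -2")
        case False
        have "B = 0 \<or> p = 0" using False ny(3) nx(1) by auto
        moreover
        have "A = 0 \<or> p' = 0" using False nx(3) ny(1) by auto
        moreover
        have "f = 0 \<or> g = 0" using False nx(2) ny(2) by auto
        ultimately show ?thesis by (elim disjE) (simp_all add: dual_der_simps matrix_add_simps)
      qed simp
      show "ext_der (dual_der A) g - ext_der (dual_der B) f + \<alpha> 1 (-2) *s (p' *s star u - p *s star v) = 0 \<or> n + m = -1"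
      proof (cases "n + m = -1")
        case False
        have "A = 0 \<or> g = 0" using False nx(3) ny(2) by auto
        moreover
        have "B = 0 \<or> f = 0" using False ny(3) nx(2) by auto
        moreover
        have "p' = 0 \<or> u = 0" using False ny(1) nx(4) by auto
        moreover
        have "p = 0 \<or> v = 0" using False nx(1) ny(4) by auto
        ultimately show ?thesis by (elim disjE) (simp_all add: dual_der_simps matrix_add_simps)
      qed simp
      show "A ** B - B ** A + mat_scale (\<alpha> 1 (-1)) (psi g u - psi f v)
         + mat (\<beta> 1 * (pairing u g - pairing v f)) + mat (\<beta> 2 * (q * p' - q' * p)) = 0 \<or> n + m = 0"
      proof (cases "n + m = 0")
        case False
        have "A = 0 \<or> B = 0" using False nx(3) ny(3) by auto
        moreover
        have "g = 0 \<or> u = 0" using False ny(2) nx(4) by auto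
        moreover
        have "f = 0 \<or> v = 0" using False nx(2) ny(4) by auto
        moreover
        have "q = 0 \<or> p' = 0" using False nx(5) ny(1) by auto
        moreover
        have "q' = 0 \<or> p = 0" using False ny(5) nx(1) by auto
        ultimately show ?thesis by (elim disjE) (simp_all add: dual_der_simps matrix_add_simps)
      qed simp
      show "ext_der A v - ext_der B u + \<alpha> (-1) 2 *s (q' *s star f - q *s star g) = 0 \<or> n + m = 1"
      proof (cases "n + m = 1")
        case False
        have "A = 0 \<or> v = 0" using False nx(3) ny(4) by auto
        moreover
        have "B = 0 \<or> u = 0" using False ny(3) nx(4) by auto
        moreover
        have "q' = 0 \<or> f = 0" using False ny(5) nx(2) by auto
        moreover
        have "q = 0 \<or> g = 0" using False nx(5) ny(2) by auto
        ultimately show ?thesis by (elim disjE) (simp_all add: dual_der_simps matrix_add_simps)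
      qed simp
      show "trace A * q' - trace B * q + \<alpha> 1 1 * pairing u (star v) = 0 \<or> n + m = 2"
      proof (cases "n + m = 2")
        case False
        have "A = 0 \<or> q' = 0" using False nx(3) ny(5) by auto
        moreover
        have "B = 0 \<or> q = 0" using False ny(3) nx(5) by auto
        moreover
        have "u = 0 \<or> v = 0" using False nx(4) ny(4) by auto
        ultimately show ?thesis by (elim disjE) (simp_all add: dual_der_simps matrix_add_simps)
      qed simp
    qed
  qed
  then show ?thesis using 1 x y by (simp only: br_el part simp_thms)
qed

lemma lie_aut_eigen:
  assumes F: "lie_aut F" and xy: "x \<in> e6_carrier" "y \<in> e6_carrier"
    and "F x = e6_scale (bit_sign a) x" "F y = e6_scale (bit_sign b) y"
  shows "F (br x y) = e6_scale (bit_sign (a + b)) (br x y)"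
proof -
  have "F (br x y) = br (e6_scale (bit_sign a) x) (e6_scale (bit_sign b) y)"
    using assms by (simp add: lie_aut_def)
  then show ?thesis
    using xy by (simp add: br_scale_left br_scale_right carrier_scale bit_sign_add scale_simps mult.commute)
qed

text \<open>Eigenvalues multiply because \<theta> and the involutions are automorphisms; the integer
  degree is additive by the shape of the bracket.\<close>

lemma Gamma_br:
  assumes "x \<in> \<Gamma> g" "y \<in> \<Gamma> h"
  shows "br x y \<in> \<Gamma> (g + h)"
proof -
  obtain k0 k n where g: "g = (k0, k, n)" by (cases g)
  obtain h0 l m where h: "h = (h0, l, m)" by (cases h)
  have c: "x \<in> e6_carrier" "y \<in> e6_carrier" using assms Gamma_carrier by auto
  have *: "(1::6) \<noteq> 2" "(1::6) \<noteq> 3" "(1::6) \<noteq> 4" "(1::6) \<noteq> 5" by simp_all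
  show ?thesis
    using assms c unfolding g h
    by (simp add: e6_part_br lie_aut_eigen[OF lie_aut_theta] lie_aut_eigen[OF lie_aut_tilde[OF *(1)]]
        lie_aut_eigen[OF lie_aut_tilde[OF *(2)]] lie_aut_eigen[OF lie_aut_tilde[OF *(3)]]
        lie_aut_eigen[OF lie_aut_tilde[OF *(4)]] del: tilde.simps)
qed

end

lemma additive_group_simps [simp]: "carrier additive_group = UNIV" "x \<otimes>\<^bsub>additive_group\<^esub> y = x + y"
  "\<one>\<^bsub>additive_group\<^esub> = 0"
  by (simp_all add: additive_group_def)

lemma comm_group_additive_group: "comm_group (additive_group :: 'a::ab_group_add monoid)"
proof (rule comm_groupI)
  fix x :: 'a
  show "\<exists>y\<in>carrier additive_group. y \<otimes>\<^bsub>additive_group\<^esub> x = \<one>\<^bsub>additive_group\<^esub>"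
    by (rule bexI[of _ "- x"]) simp_all
qed (simp_all add: add_ac)

context e6_lie
begin

lemma is_grading_Gamma: "is_grading G5 L \<Gamma>"
proof -
  have "\<exists>!c. (\<forall>g\<in>carrier G5. c g \<in> \<Gamma> g) \<and> (\<forall>g. g \<notin> carrier G5 \<longrightarrow> c g = 0) \<and>
        finite {g. c g \<noteq> 0} \<and> x = (\<Sum>g | c g \<noteq> 0. c g)" if x: "x \<in> e6_carrier" for x
  proof (rule ex1I[of _ "\<lambda>g. proj g x"])
    have sub: "{g. proj g x \<noteq> 0} \<subseteq> degrees" using proj_outside by blast
    have "(\<Sum>g | proj g x \<noteq> 0. proj g x) = (\<Sum>g\<in>degrees. proj g x)"
      by (rule sum.mono_neutral_left) (use sub finite_degrees in auto)
    then show "(\<forall>g\<in>carrier G5. proj g x \<in> \<Gamma> g) \<and> (\<forall>g. g \<notin> carrier G5 \<longrightarrow> proj g x = 0) \<and>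
        finite {g. proj g x \<noteq> 0} \<and> x = (\<Sum>g | proj g x \<noteq> 0. proj g x)"
      using x finite_subset[OF sub finite_degrees] by (simp add: proj_mem sum_proj)
    fix c assume c: "(\<forall>g\<in>carrier G5. c g \<in> \<Gamma> g) \<and> (\<forall>g. g \<notin> carrier G5 \<longrightarrow> c g = 0) \<and>
        finite {g. c g \<noteq> 0} \<and> x = (\<Sum>g | c g \<noteq> 0. c g)"
    show "c = (\<lambda>g. proj g x)"
    proof
      fix h
      \<comment> \<open>A projection applied to an arbitrary decomposition isolates one of its
        components, whence uniqueness.\<close>
      have "proj h x = (\<Sum>g | c g \<noteq> 0. proj h (c g))" using c proj_sum by metis
      also have "\<dots> = (\<Sum>g | c g \<noteq> 0. if g = h then c h else 0)"
      proof (rule sum.cong[OF refl])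
        fix g
        have "c g \<in> \<Gamma> g" using c additive_group_simps(1) by blast
        then show "proj h (c g) = (if g = h then c h else 0)" using proj_Gamma[of "c g" g h] by auto
      qed
      also have "\<dots> = c h" using c by (auto simp: sum.delta)
      finally show "c h = proj h x" by simp
    qed
  qed
  then show ?thesis
    unfolding is_grading_def
    using comm_group_additive_group subspace_Gamma Gamma_carrier Gamma_br by (auto simp del: Gamma5.simps)
qed

end

section \<open>Homogeneous components\<close>

lemma nonzero_index_cases: "i \<noteq> 0 \<Longrightarrow> i \<noteq> 1 \<Longrightarrow> \<exists>l. i = idx l"
proof -
  have "\<forall>i. i \<noteq> 0 \<longrightarrow> i \<noteq> 1 \<longrightarrow> (\<exists>l. i = idx l)"
    unfolding forall_6 by (metis idx_simps(1-4))
  then show "i \<noteq> 0 \<Longrightarrow> i \<noteq> 1 \<Longrightarrow> \<exists>l. i = idx l" by blast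
qed

text \<open>The coordinates compare each of 2, 3, 4, 5 with 1, so they determine a set away from 0
  up to complement; the parity of its size then decides about 0.\<close>

lemma cls_eqD:
  assumes "cls S = cls T" "even (card S) = even (card T)"
  shows "S = T \<or> S = - T"
proof -
  have *: "S = T" if agree: "\<And>i. i \<noteq> 0 \<Longrightarrow> i \<in> S \<longleftrightarrow> i \<in> T" and par: "even (card S) = even (card T)" for S T :: "6 set"
  proof (rule ccontr)
    assume "S \<noteq> T"
    moreover have D: "S - {0} = T - {0}" using agree by blast
    ultimately have "(0 \<in> S) \<noteq> (0 \<in> T)" by blast
    then consider "S = insert 0 T" "0 \<notin> T" | "T = insert 0 S" "0 \<notin> S" using D by blast
    then show False using par by cases auto
  qed
  have bits: "(1 \<in> S \<longleftrightarrow> 1 \<in> T) \<longleftrightarrow> (idx l \<in> S \<longleftrightarrow> idx l \<in> T)" for l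
    using arg_cong[OF assms(1), of "\<lambda>v. v $ l"] by (auto simp: cls_nth of_bool_def split: if_splits)
  show ?thesis
  proof (cases "1 \<in> S \<longleftrightarrow> 1 \<in> T")
    case True
    then have "S = T" using assms(2) bits by (intro *) (metis nonzero_index_cases)+
    then show ?thesis ..
  next
    case False
    have "even (card (- T)) = even (card T)"
      using card_mono[of UNIV T] by (simp add: card_Compl_6)
    then have "S = - T"
      using assms(2) bits False by (intro *) (metis nonzero_index_cases Compl_iff)+
    then show ?thesis ..
  qed
qed

lemma cls_card3_eqD: "cls S = cls T \<Longrightarrow> card S = 3 \<Longrightarrow> card T = 3 \<Longrightarrow> S = T \<or> S = - T"
  by (rule cls_eqD) simp_all

lemma cl_eq_iff [simp]: "cl i = cl j \<longleftrightarrow> i = j"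
proof
  assume "cl i = cl j"
  then have "{i} = {j} \<or> {i} = - {j}" by (rule cls_eqD) simp
  moreover have "card {i} \<noteq> card (- {j})" by (simp add: card_Compl_6)
  ultimately show "i = j" by (metis singleton_inject)
qed simp

lemma cls_pair: "i \<noteq> j \<Longrightarrow> cls {i, j} = cl i + cl j"
  using cls_insert[of i "{j}"] by simp

text \<open>The second alternative of \<open>cls_eqD\<close> would identify a pair with the
  complement of a pair, which has four elements.\<close>

lemma cl_pair_eqD:
  assumes "cl i + cl j = cl a + cl b" "i \<noteq> j"
  shows "a = i \<and> b = j \<or> a = j \<and> b = i"
proof -
  have "a \<noteq> b" using assms by (auto simp: bit_vec_add_eq_0_iff)
  then have "cls {i, j} = cls {a, b}" using assms by (simp add: cls_pair)
  then have "{i, j} = {a, b} \<or> {i, j} = - {a, b}" using assms \<open>a \<noteq> b\<close> by (intro cls_eqD) simp_all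
  moreover have "card {i, j} \<noteq> card (- {a, b})" using assms \<open>a \<noteq> b\<close> by (simp add: card_Compl_6)
  ultimately show ?thesis by (metis doubleton_eq_iff)
qed

lemma cl_idx: "cl (idx l) = axis l 1"
proof -
  have "idx m = idx l \<longleftrightarrow> m = l" for m
  proof -
    have "\<forall>m l. idx m = idx l \<longrightarrow> m = l" unfolding forall_4 by simp
    then show ?thesis by blast
  qed
  then show ?thesis using idx_simps(6) by (auto simp: vec_eq_iff cls_nth axis_def) 
qed

lemma cl_1: "cl 1 = (\<chi> l. 1)"
  using idx_simps(6) by (simp add: vec_eq_iff cls_nth)

lemma cls_exchange: "j \<in> S \<Longrightarrow> i \<notin> S \<Longrightarrow> cls (insert i (S - {j})) = cl i + cl j + cls S"
proof -
  assume "j \<in> S" "i \<notin> S"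
  then have "cls S = cl j + cls (S - {j})" "cls (insert i (S - {j})) = cl i + cls (S - {j})"
    using cls_insert[of j "S - {j}"] cls_insert[of i "S - {j}"] by (simp_all add: insert_absorb)
  moreover have "cl j + (cl j + x) = x" for x by (simp add: add.assoc[symmetric])
  ultimately show ?thesis by (simp add: add.assoc)
qed

lemma axis_nth: "axis S c $ T = (if T = S then c else 0)"
  by (simp add: axis_def)

lemma grading_unique_degree:
  assumes "is_grading H A \<Delta>" "vector_space (ascl A)" "g \<in> carrier H" "h \<in> carrier H" "x \<in> \<Delta> g" "x \<in> \<Delta> h" "x \<noteq> 0"
  shows "g = h"
proof -
  interpret V: vector_space "ascl A" by fact
  have zero: "0 \<in> \<Delta> k" if "k \<in> carrier H" for k
    using assms(1) that V.subspace_0 unfolding is_grading_def by blast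
  have mem: "x \<in> acar A" using assms unfolding is_grading_def by blast
  let ?P = "\<lambda>c. (\<forall>g\<in>carrier H. c g \<in> \<Delta> g) \<and> (\<forall>g. g \<notin> carrier H \<longrightarrow> c g = 0) \<and>
        finite {g. c g \<noteq> 0} \<and> x = (\<Sum>g | c g \<noteq> 0. c g)"
  have P: "?P (\<lambda>k. if k = m then x else 0)" if "m \<in> carrier H" "x \<in> \<Delta> m" for m
  proof -
    have "{k. (if k = m then x else 0) \<noteq> 0} = {m}" using assms(7) by auto
    then show ?thesis using that zero by auto
  qed
  have "\<exists>!c. ?P c" using assms(1) mem unfolding is_grading_def by blast
  note the = the1_equality[OF this]
  have "(\<lambda>k. if k = g then x else 0) = (\<lambda>k. if k = h then x else 0)"
    using the[OF P[OF assms(3,5)]] the[OF P[OF assms(4,6)]] by (rule trans[OF sym])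
  then show ?thesis using assms(7) by (metis (full_types))
qed

context e6_lie
begin

lemma theta_coord_el: "theta_coord \<iota> (el p f A u q) =
    el (- p) (- (\<iota> *s star f)) (mat (trace A / 3) - transpose A) (\<iota> *s star u) (- q)"
  by (simp add: el_def axis_minus)

lemma el_mem_Gamma:
  assumes "f \<in> ext3" "u \<in> ext3"
  shows "el p f A u q \<in> \<Gamma> (k0, k, n) \<longleftrightarrow>
    (p \<noteq> 0 \<longrightarrow> n = -2 \<and> k = 0) \<and> (\<forall>S. f $ S \<noteq> 0 \<longrightarrow> n = -1 \<and> cls S = k) \<and>
    (\<forall>a b. A $ a $ b \<noteq> 0 \<longrightarrow> n = 0 \<and> cl a + cl b = k) \<and> (\<forall>S. u $ S \<noteq> 0 \<longrightarrow> n = 1 \<and> cls S = k) \<and>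
    (q \<noteq> 0 \<longrightarrow> n = 2 \<and> k = 0) \<and>
    - p = bit_sign k0 * p \<and> - (\<iota> *s star f) = bit_sign k0 *s f \<and>
    mat (trace A / 3) - transpose A = mat_scale (bit_sign k0) A \<and> \<iota> *s star u = bit_sign k0 *s u \<and> - q = bit_sign k0 * q"
proof -
  have c: "(if n = m \<and> k = 0 then r else 0) = r \<longleftrightarrow> (r \<noteq> 0 \<longrightarrow> n = m \<and> k = 0)" for m and r :: 'f by auto
  have e: "(\<chi> S. if n = m \<and> cls S = k then g $ S else 0) = g \<longleftrightarrow> (\<forall>S. g $ S \<noteq> 0 \<longrightarrow> n = m \<and> cls S = k)"
    for m and g :: "'f ext6"
    unfolding vec_eq_iff[where 'a = 'f] vec_lambda_beta by metis
  have m: "(\<chi> i j. if n = 0 \<and> cl i + cl j = k then A $ i $ j else 0) = A \<longleftrightarrow>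
      (\<forall>a b. A $ a $ b \<noteq> 0 \<longrightarrow> n = 0 \<and> cl a + cl b = k)"
    unfolding vec_eq_iff[where 'a = 'f] vec_eq_iff[where 'a = "'f ^ 6"] vec_lambda_beta by metis
  show ?thesis
    unfolding mem_Gamma5 filt_el theta_coord_el el_scale el_eq_iff c e m el_carrier using assms by blast
qed

section \<open>Explicit homogeneous elements\<close>

abbreviation mt :: "'f ^ 6 ^ 6 \<Rightarrow> 'f e6" where "mt A \<equiv> el 0 0 A 0 0"

lemma mt_mem: "mt A \<in> \<Gamma> (k0, k, n) \<longleftrightarrow> (\<forall>a b. A $ a $ b \<noteq> 0 \<longrightarrow> n = 0 \<and> cl a + cl b = k) \<and>
    mat (trace A / 3) - transpose A = mat_scale (bit_sign k0) A"
  by (subst el_mem_Gamma) auto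

lemma up_mem: "u \<in> ext3 \<Longrightarrow> el 0 0 0 u 0 \<in> \<Gamma> (k0, k, n) \<longleftrightarrow>
    (\<forall>S. u $ S \<noteq> 0 \<longrightarrow> n = 1 \<and> cls S = k) \<and> \<iota> *s star u = bit_sign k0 *s u"
  by (subst el_mem_Gamma) (auto simp: transpose_simps)

lemma dn_mem: "f \<in> ext3 \<Longrightarrow> el 0 f 0 0 0 \<in> \<Gamma> (k0, k, n) \<longleftrightarrow>
    (\<forall>S. f $ S \<noteq> 0 \<longrightarrow> n = -1 \<and> cls S = k) \<and> - (\<iota> *s star f) = bit_sign k0 *s f"
  by (subst el_mem_Gamma) (auto simp: transpose_simps)

lemma transpose_unit_mat: "transpose (unit_mat i j) = unit_mat j i"
  by (simp add: vec_eq_iff transpose_def unit_mat_nth conj_commute)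

text \<open>Skew-symmetric for \<open>e = 0\<close> and symmetric for \<open>e = 1\<close>: on
  traceless matrices \<theta> is minus transposition, so \<open>e\<close> is the first bit of the
  degree.\<close>

definition sk :: "bit \<Rightarrow> 6 \<Rightarrow> 6 \<Rightarrow> 'f ^ 6 ^ 6" where
  "sk e i j = unit_mat i j - mat_scale (bit_sign e) (unit_mat j i)"

lemma mt_sk_mem: "i \<noteq> j \<Longrightarrow> mt (sk e i j) \<in> \<Gamma> (e, cl i + cl j, 0)"
proof -
  assume ij: "i \<noteq> j"
  have "trace (sk e i j) = 0" using ij by (simp add: sk_def trace_sub trace_scale trace_unit_mat)
  moreover have "- transpose (sk e i j) = mat_scale (bit_sign e) (sk e i j)"
    by (simp add: sk_def transpose_simps transpose_unit_mat mat_scale_simps)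
  moreover have "\<forall>a b. sk e i j $ a $ b \<noteq> 0 \<longrightarrow> cl a + cl b = cl i + cl j"
    by (auto simp: sk_def unit_mat_nth mat_scale_nth add.commute split: if_splits)
  ultimately show ?thesis unfolding mt_mem by (simp add: mat_0)
qed

lemma mt_diag_mem: "mt (unit_mat i i - unit_mat j j) \<in> \<Gamma> (1, 0, 0)"
proof -
  have "trace (unit_mat i i - unit_mat j j) = (0 :: 'f)" by (simp add: trace_sub trace_unit_mat)
  moreover have "- transpose (unit_mat i i - unit_mat j j) = mat_scale (-1) (unit_mat i i - unit_mat j j :: 'f ^ 6 ^ 6)"
    by (simp add: transpose_simps transpose_unit_mat mat_scale_simps)
  ultimately show ?thesis unfolding mt_mem by (auto simp: mat_0 unit_mat_nth split: if_splits)
qed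

lemma mt_one_mem: "mt (mat 1) \<in> \<Gamma> (0, 0, 0)"
  unfolding mt_mem by (auto simp: trace_mat_6 transpose_simps mat_nth mat_scale_simps mat_diff[symmetric] split: if_splits)

text \<open>On 3-vectors \<iota> times the star squares to 1; this is twice the projection of
  \<open>e_S\<close> to its eigenspace for \<open>bit_sign e\<close>.\<close>

definition ev :: "bit \<Rightarrow> 6 set \<Rightarrow> 'f ext6" where
  "ev e S = axis S 1 + (bit_sign e * \<iota>) *s star (axis S 1)"

lemma ev_ext3: "card S = 3 \<Longrightarrow> ev e S \<in> ext3"
  by (simp add: ev_def ext_pow_closed star_ext3 axis_ext_pow)

lemma star_ev: "card S = 3 \<Longrightarrow> \<iota> *s star (ev e S) = bit_sign e *s ev e S"
proof -
  assume S: "card S = 3"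
  have "(axis S 1 :: 'f ext6) \<in> ext3" using S by (rule axis_ext_pow)
  moreover have "\<iota> * (\<iota> * c) = - c" for c
    by (simp add: mult.assoc[symmetric] iota_sq)
  ultimately show ?thesis
    by (cases e) (simp_all add: ev_def star_add star_scale star_minus star_diff star_star vec_eq_iff distrib_left right_diff_distrib)
qed

lemma ev_support: "ev e S $ T \<noteq> 0 \<Longrightarrow> cls T = cls S"
proof -
  assume "ev e S $ T \<noteq> 0"
  then have "T = S \<or> T = - S" by (auto simp: ev_def star_axis axis_nth split: if_splits)
  then show ?thesis by auto
qed

lemma up_ev_mem: "card S = 3 \<Longrightarrow> el 0 0 0 (ev e S) 0 \<in> \<Gamma> (e, cls S, 1)"
  using ev_support star_ev by (simp add: up_mem ev_ext3 del: Gamma5.simps)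

text \<open>On \<open>L_-1\<close> the map \<theta> is minus \<iota> times the star, which accounts
  for the shift \<open>1 + e\<close>.\<close>

lemma dn_ev_mem: "card S = 3 \<Longrightarrow> el 0 (ev (1 + e) S) 0 0 0 \<in> \<Gamma> (e, cls S, -1)"
proof -
  assume S: "card S = 3"
  have "- (bit_sign (1 + e) *s v) = bit_sign e *s (v :: 'f ext6)" for v
    by (simp add: bit_sign_add vec_eq_iff)
  then show ?thesis using ev_support[of "1 + e" S] S by (simp add: dn_mem ev_ext3 star_ev del: Gamma5.simps)
qed

lemma ev_nth_same: "S \<noteq> - S \<Longrightarrow> ev e S $ S = 1"
  by (auto simp: ev_def star_axis axis_nth)

lemma neq_Compl: "S \<noteq> - (S :: 'a set)"
  by blast

lemma ev_nonzero: "ev e S \<noteq> 0"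
  using ev_nth_same[of S e] neq_Compl[of S] by auto

lemma ext_sign_nonzero: "ext_sign S T \<noteq> (0 :: 'f)"
  using ext_sign_sq[of S T] by (metis mult_zero_left zero_neq_one)

lemma pairing_ev: "card S = 3 \<Longrightarrow> pairing (ev e S) (ev (1 + e) S) = 2"
proof -
  assume S: "card S = 3"
  have "pairing (axis S 1) (star (axis S 1)) = (0 :: 'f)"
    using neq_Compl[of S] by (simp add: pairing_axis_left star_axis axis_nth)
  moreover have "pairing (star (axis S 1)) (axis S 1) = (0 :: 'f)"
    using neq_Compl[of S] by (simp add: pairing_axis_right star_axis axis_nth)
  moreover have "bit_sign e * \<iota> * (bit_sign e * \<iota>) = -1"
  proof -
    have "bit_sign e * \<iota> * (bit_sign e * \<iota>) = (bit_sign e * bit_sign e) * (\<iota> * \<iota>)" by (simp only: mult_ac)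
    then show ?thesis by (simp add: iota_sq)
  qed
  ultimately show ?thesis
    by (simp add: ev_def pairing_add_left pairing_add_right pairing_scale_left pairing_scale_right pairing_star_star
        pairing_diff_right pairing_minus_right pairing_axis_left bit_sign_add)
qed

text \<open>A nonzero product forces deg(s + t) = deg(s) deg(t) in every group realizing the same
  components. The lemmas on \<open>rel\<close> collect enough such relations to present
  \<open>G5\<close>.\<close>

definition rel :: "g5 \<Rightarrow> g5 \<Rightarrow> bool" where
  "rel s t \<longleftrightarrow> (\<exists>x\<in>\<Gamma> s. \<exists>y\<in>\<Gamma> t. br x y \<noteq> 0)"

lemma relI: "x \<in> \<Gamma> s \<Longrightarrow> y \<in> \<Gamma> t \<Longrightarrow> br x y \<noteq> 0 \<Longrightarrow> rel s t"
  unfolding rel_def by blast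

lemma Supp_iff: "s \<in> Supp G5 \<Gamma> \<longleftrightarrow> (\<exists>x\<in>\<Gamma> s. x \<noteq> 0)"
  using Gamma_zero[of s] by (auto simp: Supp_def simp del: Gamma5.simps)

lemma rel_Supp:
  assumes "rel s t"
  shows "s \<in> Supp G5 \<Gamma>" "t \<in> Supp G5 \<Gamma>" "s + t \<in> Supp G5 \<Gamma>"
proof -
  obtain x y where xy: "x \<in> \<Gamma> s" "y \<in> \<Gamma> t" "br x y \<noteq> 0" using assms unfolding rel_def by blast
  have c: "x \<in> e6_carrier" "y \<in> e6_carrier" using xy Gamma_carrier by auto
  have "br 0 y = 0" using br_scale_left[OF c, of 0] by (simp add: scale_simps)
  moreover have "br x 0 = 0" using br_scale_right[OF c, of 0] by (simp add: scale_simps)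
  ultimately show "s \<in> Supp G5 \<Gamma>" "t \<in> Supp G5 \<Gamma>" "s + t \<in> Supp G5 \<Gamma>"
    using xy Gamma_br[OF xy(1,2)] unfolding Supp_iff by metis+
qed

lemma mt_eq_0_iff: "mt A = 0 \<longleftrightarrow> A = 0" and up_eq_0_iff: "el 0 0 0 u 0 = 0 \<longleftrightarrow> u = 0"
  by (simp_all add: el_zero el_eq_iff)

lemma rel_sk_sk:
  assumes "i \<noteq> j" "j \<noteq> k" "i \<noteq> k"
  shows "rel (0, cl i + cl j, 0) (e, cl j + cl k, 0)"
proof (rule relI[OF mt_sk_mem[OF assms(1)] mt_sk_mem[OF assms(2)]])
  have "(sk 0 i j ** sk e j k - sk e j k ** sk 0 i j) $ i $ k = 1"
    using assms by (simp add: sk_def matrix_add_simps mat_scale_mult_left mat_scale_mult_right unit_mat_mult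
        mat_scale_simps) (simp add: unit_mat_nth mat_scale_nth)
  then show "br (mt (sk 0 i j)) (mt (sk e j k)) \<noteq> 0"
    unfolding br_0_0 mt_eq_0_iff by auto
qed

lemma br_sk_0_1: "i \<noteq> j \<Longrightarrow> br (mt (sk 0 i j)) (mt (sk 1 i j)) = e6_scale 2 (mt (unit_mat i i - unit_mat j j))"
  by (simp add: br_0_0 sk_def matrix_add_simps mat_scale_mult_left mat_scale_mult_right unit_mat_mult
        mat_scale_simps el_scale el_eq_iff) (simp add: vec_eq_iff mat_scale_nth)

lemma rel_diag_sk: "i \<noteq> j \<Longrightarrow> rel (1, 0, 0) (e, cl i + cl j, 0)"
proof (rule relI[OF mt_diag_mem[of i j] mt_sk_mem])
  assume ij: "i \<noteq> j"
  then have "((unit_mat i i - unit_mat j j) ** sk e i j - sk e i j ** (unit_mat i i - unit_mat j j)) $ i $ j = 2"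
    by (simp add: sk_def matrix_add_simps mat_scale_mult_left mat_scale_mult_right unit_mat_mult mat_scale_simps)
      (simp add: unit_mat_nth mat_scale_nth)
  then show "br (mt (unit_mat i i - unit_mat j j)) (mt (sk e i j)) \<noteq> 0"
    unfolding br_0_0 mt_eq_0_iff by auto
qed

text \<open>A second application of the generator returns minus the crossing part, whose entry at
  \<open>S\<close> is not 0.\<close>

lemma ext_der_rot_gen_ev_nonzero:
  assumes "i \<noteq> j" "crossing i j S" "card S = 3" "a * b = -1"
  shows "ext_der (rot_gen i j a b) (ev e S) \<noteq> 0"
proof
  assume *: "ext_der (rot_gen i j a b) (ev e S) = 0"
  have "- cross_part i j (ev e S) = ext_der (rot_gen i j a b) (ext_der (rot_gen i j a b) (ev e S))"
    using assms by (simp add: ext_der_rot_gen_sq ev_ext3)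
  then have "cross_part i j (ev e S) $ S = 0" using * by simp
  then show False using assms(2) ev_nth_same[OF neq_Compl, of e S] by (simp add: cross_part_def)
qed

lemma sk_0_eq: "sk 0 i j = rot_gen i j 1 (-1)"
  by (simp add: sk_def rot_gen_def vec_eq_iff mat_scale_nth)

lemma rel_sk_up:
  assumes "i \<noteq> j" "crossing i j S" "card S = 3"
  shows "rel (0, cl i + cl j, 0) (e, cls S, 1)"
proof (rule relI[OF mt_sk_mem[OF assms(1)] up_ev_mem[OF assms(3)]])
  show "br (mt (sk 0 i j)) (el 0 0 0 (ev e S) 0) \<noteq> 0"
    using ext_der_rot_gen_ev_nonzero[OF assms, of 1 "-1" e]
    by (simp add: br_0_1 up_eq_0_iff sk_0_eq)
qed

lemma rel_diag_up:
  assumes "card S = 3"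
  shows "rel (1, 0, 0) (e, cls S, 1)"
proof -
  have "S \<noteq> {}" "S \<noteq> UNIV" using assms by auto
  then obtain i j where i: "i \<in> S" and j: "j \<in> - S" by blast
  show ?thesis
  proof (rule relI[OF mt_diag_mem[of i j] up_ev_mem[OF assms]])
    have "ext_der (unit_mat i i - unit_mat j j) (ev e S) $ S = 1"
      using i j ev_nth_same[OF neq_Compl, of e S] by (simp add: ext_der_diff_left ext_der_unit_diag)
    then show "br (mt (unit_mat i i - unit_mat j j)) (el 0 0 0 (ev e S) 0) \<noteq> 0"
      unfolding br_0_1 up_eq_0_iff by auto
  qed
qed

lemma rel_one_up: "card S = 3 \<Longrightarrow> rel (0, 0, 0) (e, cls S, 1)"
  by (rule relI[OF mt_one_mem up_ev_mem])
    (simp_all add: br_0_1 up_eq_0_iff ext_der_mat_ext3 ev_ext3 ev_nonzero)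

text \<open>\<open>psi\<close> is traceless, so the bracket of the two explicit elements has trace
  12 times \<beta> 1.\<close>

lemma rel_up_dn: "card S = 3 \<Longrightarrow> rel (e, cls S, 1) (e, cls S, -1)"
proof (rule relI[OF up_ev_mem dn_ev_mem])
  assume S: "card S = 3"
  have "br (el 0 0 0 (ev e S) 0) (el 0 (ev (1 + e) S) 0 0 0)
      = mt (mat_scale (\<alpha> 1 (-1)) (psi (ev (1 + e) S) (ev e S)) + mat (\<beta> 1 * 2))"
    using S by (simp add: br_el ev_ext3 pairing_ev dual_der_simps matrix_add_simps)
  moreover have "trace (mat_scale (\<alpha> 1 (-1)) (psi (ev (1 + e) S) (ev e S)) + mat (\<beta> 1 * 2)) \<noteq> 0"
    using nonzero by (simp add: trace_add trace_scale trace_psi trace_mat_6)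
  ultimately show "br (el 0 0 0 (ev e S) 0) (el 0 (ev (1 + e) S) 0 0 0) \<noteq> 0"
    unfolding mt_eq_0_iff by (metis mt_eq_0_iff trace_zero)
qed

lemma pairing_star_ev: "card S = 3 \<Longrightarrow> \<iota> * pairing (ev 0 S) (star (ev 1 S)) = -2"
proof -
  assume S: "card S = 3"
  have "\<iota> * pairing (ev 0 S) (star (ev 1 S)) = pairing (ev 0 S) (\<iota> *s star (ev 1 S))"
    by (simp add: pairing_scale_right)
  then show ?thesis
    using S pairing_ev[OF S, of 0] by (simp add: star_ev pairing_minus_right pairing_scale_right)
qed

lemma rel_up_up: "card S = 3 \<Longrightarrow> rel (0, cls S, 1) (1, cls S, 1)"
proof (rule relI[OF up_ev_mem up_ev_mem])
  assume S: "card S = 3"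
  then have "pairing (ev 0 S) (star (ev 1 S)) \<noteq> 0" using pairing_star_ev[OF S] by auto
  then show "br (el 0 0 0 (ev 0 S) 0) (el 0 0 0 (ev 1 S) 0) \<noteq> 0"
    using S nonzero by (simp add: br_el ev_ext3 el_zero el_eq_iff)
qed

lemma rel_dn_dn: "card S = 3 \<Longrightarrow> rel (1, cls S, -1) (0, cls S, -1)"
proof (rule relI[OF dn_ev_mem dn_ev_mem])
  assume S: "card S = 3"
  then have "pairing (ev 0 S) (star (ev 1 S)) \<noteq> 0" using pairing_star_ev[OF S] by auto
  then show "br (el 0 (ev (1 + 1) S) 0 0 0) (el 0 (ev (1 + 0) S) 0 0 0) \<noteq> 0"
    using S nonzero by (simp add: br_el ev_ext3 el_zero el_eq_iff)
qed

text \<open>Any nonzero coordinate of a homogeneous element reveals its degree. On the top lines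
  \<theta> is -1, so their first bit is 1.\<close>

lemma Supp_cases:
  assumes "s \<in> Supp G5 \<Gamma>"
  obtains (one) "s = (0, 0, 0)" | (diag) "s = (1, 0, 0)"
    | (mat) e i j where "s = (e, cl i + cl j, 0)" "i \<noteq> j"
    | (up) e S where "s = (e, cls S, 1)" "card S = 3"
    | (dn) e S where "s = (e, cls S, -1)" "card S = 3"
    | (top) "s = (1, 0, 2)" | (bot) "s = (1, 0, -2)"
proof -
  obtain k0 k n where s: "s = (k0, k, n)" by (cases s)
  obtain x where x: "x \<in> \<Gamma> s" "x \<noteq> 0" using assms unfolding Supp_iff by blast
  then have "x \<in> e6_carrier" using Gamma_carrier by blast
  then obtain p f A u q where el: "x = el p f A u q" and fu: "f \<in> ext3" "u \<in> ext3" by (rule el_cases)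
  note mem = x(1)[unfolded s el el_mem_Gamma[OF fu]]
  have sgn: "c \<noteq> 0 \<Longrightarrow> - c = bit_sign k0 * c \<Longrightarrow> k0 = 1" for c :: 'f
    by (cases k0) (auto simp: eq_neg_iff_add_eq_0)
  consider "p \<noteq> 0" | "q \<noteq> 0" | "f \<noteq> 0" | "u \<noteq> 0" | "A \<noteq> 0"
    using x(2) by (auto simp: el el_zero)
  then show ?thesis
  proof cases
    case 1
    then show ?thesis using mem sgn bot by (auto simp: s)
  next
    case 2
    then show ?thesis using mem sgn top by (auto simp: s)
  next
    case 3
    then obtain S where S: "f $ S \<noteq> 0" by (metis vec_eq_iff zero_index)
    then have "card S = 3" using fu ext3_nth by blast
    moreover have "n = -1" "k = cls S" using mem S by auto
    ultimately show ?thesis using dn[of k0 S] by (simp add: s)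
  next
    case 4
    then obtain S where S: "u $ S \<noteq> 0" by (metis vec_eq_iff zero_index)
    then have "card S = 3" using fu ext3_nth by blast
    moreover have "n = 1" "k = cls S" using mem S by auto
    ultimately show ?thesis using up[of k0 S] by (simp add: s)
  next
    case 5
    then obtain a b where ab: "A $ a $ b \<noteq> 0" by (metis vec_eq_iff zero_index)
    then have "n = 0" "k = cl a + cl b" using mem by auto
    then show ?thesis using mat one diag by (cases "a = b"; cases k0) (auto simp: s)
  qed
qed

lemma Gamma_line:
  assumes s: "s \<noteq> (1, 0, 0)" and x: "x \<in> \<Gamma> s" "x \<noteq> 0" and y: "y \<in> \<Gamma> s"
  shows "\<exists>c. y = e6_scale c x"
proof -
  \<comment> \<open>A linear form vanishing only at 0 makes the component at most one-dimensional.
    In each case the form is a single coordinate, or the trace in degree (0, 0, 0).\<close>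
  have key: "\<exists>l. (\<forall>c z w. l (z + e6_scale c w) = l z + c * l w) \<and> (\<forall>z\<in>\<Gamma> s. l z = (0::'f) \<longrightarrow> z = 0)"
  proof -
    have "s \<in> Supp G5 \<Gamma>" using x unfolding Supp_iff by blast
    then show ?thesis
    proof (cases rule: Supp_cases)
      case one
      define l :: "'f e6 \<Rightarrow> 'f" where "l = (\<lambda>(f', f, A, u, u'). trace A)"
      have "l z = 0 \<longrightarrow> z = 0" if z: "z \<in> \<Gamma> s" for z
      proof
        assume l0: "l z = 0"
        obtain p f A u q where el: "z = el p f A u q" and fu: "f \<in> ext3" "u \<in> ext3"
          using Gamma_carrier[OF z] by (rule el_cases)
        note mem = z[unfolded one el el_mem_Gamma[OF fu]]
        have "trace A = 0" using l0 by (simp add: l_def el el_def)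
        moreover have "A $ a $ b = 0" if "a \<noteq> b" for a b using mem that by (auto simp: bit_vec_add_eq_0_iff)
        moreover have "A $ a $ a = 0" for a
        proof -
          \<comment> \<open>In degree (0, 0, 0) the diagonal entries satisfy trace/3 - x = x, so
            they vanish with the trace.\<close>
          have "(mat (trace A / 3) - transpose A) $ a $ a = mat_scale (bit_sign 0) A $ a $ a"
            using mem by (elim conjE) (simp only:)
          then have "- A $ a $ a = A $ a $ a"
            using \<open>trace A = 0\<close> by (simp add: mat_nth transpose_def mat_scale_nth)
          then show ?thesis by simp
        qed
        ultimately have "A = 0" by (metis vec_eq_iff zero_index)
        moreover have "f = 0" "u = 0" "p = 0" "q = 0" using mem by (auto simp: vec_eq_iff)
        ultimately show "z = 0" by (simp add: el el_zero)
      qed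
      moreover have "l (z + e6_scale c w) = l z + c * l w" for c z w
        by (cases z; cases w) (simp add: l_def trace_add trace_scale)
      ultimately show ?thesis by blast
    next
      case diag
      then show ?thesis using s by simp
    next
      case (mat e i j)
      define l :: "'f e6 \<Rightarrow> 'f" where "l = (\<lambda>(f', f, A, u, u'). A $ i $ j)"
      have "l z = 0 \<longrightarrow> z = 0" if z: "z \<in> \<Gamma> s" for z
      proof
        assume l0: "l z = 0"
        obtain p f A u q where el: "z = el p f A u q" and fu: "f \<in> ext3" "u \<in> ext3"
          using Gamma_carrier[OF z] by (rule el_cases)
        note mem = z[unfolded mat el el_mem_Gamma[OF fu]]
        have k: "cl i + cl j \<noteq> 0" using mat by (simp add: bit_vec_add_eq_0_iff)
        have ij: "A $ i $ j = 0" using l0 by (simp add: l_def el el_def)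
        have off: "A $ a $ b = 0" if "\<not> (a = i \<and> b = j \<or> a = j \<and> b = i)" for a b
          using mem that cl_pair_eqD[OF _ mat(2), of a b] by metis
        have "(mat (trace A / 3) - transpose A) $ i $ j = mat_scale (bit_sign e) A $ i $ j" using mem by simp
        then have "A $ j $ i = 0" using ij mat(2) by (simp add: mat_nth transpose_def mat_scale_nth)
        then have "A = 0" using ij off by (metis vec_eq_iff zero_index)
        moreover have "f = 0" "u = 0" "p = 0" "q = 0" using mem by (auto simp: vec_eq_iff)
        ultimately show "z = 0" by (simp add: el el_zero)
      qed
      moreover have "l (z + e6_scale c w) = l z + c * l w" for c z w
        by (cases z; cases w) (simp add: l_def mat_scale_nth)
      ultimately show ?thesis by blast
    next
      case (up e S)
      define l :: "'f e6 \<Rightarrow> 'f" where "l = (\<lambda>(f', f, A, u, u'). u $ S)"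
      have "l z = 0 \<longrightarrow> z = 0" if z: "z \<in> \<Gamma> s" for z
      proof
        assume l0: "l z = 0"
        obtain p f A u q where el: "z = el p f A u q" and fu: "f \<in> ext3" "u \<in> ext3"
          using Gamma_carrier[OF z] by (rule el_cases)
        note mem = z[unfolded up el el_mem_Gamma[OF fu]]
        have uS: "u $ S = 0" using l0 by (simp add: l_def el el_def)
        \<comment> \<open>The class leaves only the coordinates at \<open>S\<close> and its
          complement; the eigenvector equation for \<theta> ties one to the other.\<close>
        have "(\<iota> *s star u) $ S = (bit_sign e *s u) $ S" using mem by simp
        then have "u $ (- S) = 0"
          using uS nonzero ext_sign_nonzero[of S "- S"] by (auto simp: star_nth)
        moreover have "u $ T = 0" if "T \<noteq> S" "T \<noteq> - S" for T
          using mem that cls_card3_eqD[of T S] up(2) ext3_nth[OF fu(2)] by blast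
        ultimately have "u = 0" using uS by (metis vec_eq_iff zero_index)
        moreover have "f = 0" "A = 0" "p = 0" "q = 0" using mem by (auto simp: vec_eq_iff)
        ultimately show "z = 0" by (simp add: el el_zero)
      qed
      moreover have "l (z + e6_scale c w) = l z + c * l w" for c z w
        by (cases z; cases w) (simp add: l_def)
      ultimately show ?thesis by blast
    next
      case (dn e S)
      define l :: "'f e6 \<Rightarrow> 'f" where "l = (\<lambda>(f', f, A, u, u'). f $ S)"
      have "l z = 0 \<longrightarrow> z = 0" if z: "z \<in> \<Gamma> s" for z
      proof
        assume l0: "l z = 0"
        obtain p f A u q where el: "z = el p f A u q" and fu: "f \<in> ext3" "u \<in> ext3"
          using Gamma_carrier[OF z] by (rule el_cases)
        note mem = z[unfolded dn el el_mem_Gamma[OF fu]]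
        have uS: "f $ S = 0" using l0 by (simp add: l_def el el_def)
        have "(- (\<iota> *s star f)) $ S = (bit_sign e *s f) $ S" using mem by simp
        then have "f $ (- S) = 0"
          using uS nonzero ext_sign_nonzero[of S "- S"] by (auto simp: star_nth)
        moreover have "f $ T = 0" if "T \<noteq> S" "T \<noteq> - S" for T
          using mem that cls_card3_eqD[of T S] dn(2) ext3_nth[OF fu(1)] by blast
        ultimately have "f = 0" using uS by (metis vec_eq_iff zero_index)
        moreover have "u = 0" "A = 0" "p = 0" "q = 0" using mem by (auto simp: vec_eq_iff)
        ultimately show "z = 0" by (simp add: el el_zero)
      qed
      moreover have "l (z + e6_scale c w) = l z + c * l w" for c z w
        by (cases z; cases w) (simp add: l_def)
      ultimately show ?thesis by blast
    next
      case top
      define l :: "'f e6 \<Rightarrow> 'f" where "l = (\<lambda>(f', f, A, u, u'). u' $ UNIV)"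
      have "l z = 0 \<longrightarrow> z = 0" if z: "z \<in> \<Gamma> s" for z
      proof
        assume l0: "l z = 0"
        obtain p f A u q where el: "z = el p f A u q" and fu: "f \<in> ext3" "u \<in> ext3"
          using Gamma_carrier[OF z] by (rule el_cases)
        note mem = z[unfolded top el el_mem_Gamma[OF fu]]
        have "q = 0" using l0 by (simp add: l_def el el_def)
        moreover have "f = 0" "u = 0" "A = 0" "p = 0" using mem by (auto simp: vec_eq_iff)
        ultimately show "z = 0" by (simp add: el el_zero)
      qed
      moreover have "l (z + e6_scale c w) = l z + c * l w" for c z w
        by (cases z; cases w) (simp add: l_def)
      ultimately show ?thesis by blast
    next
      case bot
      define l :: "'f e6 \<Rightarrow> 'f" where "l = (\<lambda>(f', f, A, u, u'). f' $ UNIV)"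
      have "l z = 0 \<longrightarrow> z = 0" if z: "z \<in> \<Gamma> s" for z
      proof
        assume l0: "l z = 0"
        obtain p f A u q where el: "z = el p f A u q" and fu: "f \<in> ext3" "u \<in> ext3"
          using Gamma_carrier[OF z] by (rule el_cases)
        note mem = z[unfolded bot el el_mem_Gamma[OF fu]]
        have "p = 0" using l0 by (simp add: l_def el el_def)
        moreover have "f = 0" "u = 0" "A = 0" "q = 0" using mem by (auto simp: vec_eq_iff)
        ultimately show "z = 0" by (simp add: el el_zero)
      qed
      moreover have "l (z + e6_scale c w) = l z + c * l w" for c z w
        by (cases z; cases w) (simp add: l_def)
      ultimately show ?thesis by blast
    qed
  qed
  then obtain l where lin: "\<And>c z w. l (z + e6_scale c w) = l z + c * l w"
    and inj: "\<And>z. z \<in> \<Gamma> s \<Longrightarrow> l z = (0::'f) \<Longrightarrow> z = 0" by metis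
  have lx: "l x \<noteq> 0" using inj x by blast
  let ?c = "l y / l x"
  have "y + e6_scale (- ?c) x \<in> \<Gamma> s" using x y by (intro Gamma_add Gamma_scale)
  moreover have "l (y + e6_scale (- ?c) x) = 0" using lx by (simp add: lin)
  ultimately have "y + e6_scale (- ?c) x = 0" by (rule inj)
  moreover have "e6_scale (- ?c) x + e6_scale ?c x = 0"
    by (simp only: scale_simps(2)[symmetric]) (simp add: scale_simps)
  moreover have "y = (y + e6_scale (- ?c) x) + e6_scale ?c x"
    by (simp only: add.assoc calculation(2)) simp
  ultimately have "y = e6_scale ?c x" by simp
  then show ?thesis by blast
qed

end

lemma bit_vec_add_cancel: "x + (x + y) = (y :: bit ^ 'n)"
  by (simp add: add.assoc[symmetric])

section \<open>Fineness and the universal group\<close>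

definition bit_pow :: "('h, 'b) monoid_scheme \<Rightarrow> bit \<Rightarrow> 'h \<Rightarrow> 'h" where
  "bit_pow H b x = (if b = 1 then x else \<one>\<^bsub>H\<^esub>)"

lemma (in comm_group) bit_pow_closed: "x \<in> carrier G \<Longrightarrow> bit_pow G b x \<in> carrier G"
  by (simp add: bit_pow_def)

lemma (in comm_group) bit_pow_add:
  "x \<in> carrier G \<Longrightarrow> x \<otimes> x = \<one> \<Longrightarrow> bit_pow G (a + b) x = bit_pow G a x \<otimes> bit_pow G b x"
  by (cases a; cases b) (simp_all add: bit_pow_def)

lemma (in comm_group) mult_mult_interchange:
  "a \<in> carrier G \<Longrightarrow> b \<in> carrier G \<Longrightarrow> c \<in> carrier G \<Longrightarrow> d \<in> carrier G \<Longrightarrow>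
    (a \<otimes> b) \<otimes> (c \<otimes> d) = (a \<otimes> c) \<otimes> (b \<otimes> d)"
  by (simp add: m_ac)

text \<open>Exchanging an element of \<open>S - T\<close> for one of \<open>T - S\<close> shrinks
  the difference, so exchanges connect all 3-sets to \<open>T\<close>.\<close>

lemma card3_exchange_induct:
  fixes S T :: "6 set"
  assumes "card S = 3" "card T = 3" "P T"
    and step: "\<And>S i j. card S = 3 \<Longrightarrow> j \<in> S \<Longrightarrow> i \<notin> S \<Longrightarrow> P (insert i (S - {j})) \<Longrightarrow> P S"
  shows "P S"
  using assms(1)
proof (induction "card (S - T)" arbitrary: S rule: less_induct)
  case less
  show ?case
  proof (cases "S \<subseteq> T")
    case True
    then have "S = T" using less.prems assms(2) by (intro card_subset_eq) auto
    then show ?thesis using assms(3) by simp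
  next
    case False
    then obtain j where j: "j \<in> S" "j \<notin> T" by blast
    have "\<not> T \<subseteq> S" using less.prems assms(2) card_subset_eq[of S T] j by auto
    then obtain i where i: "i \<in> T" "i \<notin> S" by blast
    have "insert i (S - {j}) - T = (S - T) - {j}" using i by blast
    then have "card (insert i (S - {j}) - T) < card (S - T)"
      using j by (metis card_Diff1_less DiffI finite)
    moreover have "card (insert i (S - {j})) = 3" using i j less.prems by simp
    ultimately show ?thesis using less.hyps step[OF less.prems j(1) i(2)] by blast
  qed
qed

context e6_lie
begin

lemma sk_Supp: "i \<noteq> j \<Longrightarrow> (e, cl i + cl j, 0) \<in> Supp G5 \<Gamma>"
  using rel_Supp(2)[OF rel_diag_sk] by blast

lemma up_Supp: "card S = 3 \<Longrightarrow> (e, cls S, 1) \<in> Supp G5 \<Gamma>"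
  using rel_Supp(2)[OF rel_one_up] by blast

lemma one_Supp: "(0, 0, 0) \<in> Supp G5 \<Gamma>" and diag_Supp: "(1, 0, 0) \<in> Supp G5 \<Gamma>"
  using rel_Supp(1)[OF rel_one_up[of "{0, 1, 2}"]] rel_Supp(1)[OF rel_diag_up[of "{0, 1, 2}"]] by simp_all

lemma card_012: "card {0, 1, 2 :: 6} = 3" by simp

text \<open>The canonical basis is reached from the degrees of the matrices pairing an index with 0,
  from (1, 0, 0), and from one degree of \<open>L_1\<close> after its class has been
  removed.\<close>

lemma Supp_generates:
  assumes sub: "Supp G5 \<Gamma> \<subseteq> K" and add: "\<And>x y. x \<in> K \<Longrightarrow> y \<in> K \<Longrightarrow> x + y \<in> K"
    and minus: "\<And>x. x \<in> K \<Longrightarrow> - x \<in> K"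
  shows "g \<in> K"
proof -
  have zero: "(0, 0, 0) \<in> K" using one_Supp sub by blast
  have axis: "(0, axis l b, 0) \<in> K" for l and b :: bit
  proof (cases "b = 1")
    case True
    have "(0, cl (idx l) + cl 0, 0) \<in> Supp G5 \<Gamma>" by (rule sk_Supp) simp
    then show ?thesis using sub True by (auto simp: cl_idx)
  qed (use zero in simp)
  have k: "(0, k, 0) \<in> K" for k
  proof -
    have "(0, \<Sum>l\<in>X. axis l (k $ l), 0) \<in> K" if "finite X" for X
      using that
    proof induction
      case (insert l X)
      then show ?case using add[OF axis[of l "k $ l"] insert.IH] by simp
    qed (use zero in simp)
    from this[of UNIV] show ?thesis by (simp add: axis_expansion)
  qed
  have k0: "(k0, 0, 0) \<in> K" for k0 using zero diag_Supp sub by (cases k0) auto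
  have one: "(0, 0, 1) \<in> K"
    using add[OF _ k[of "cls {0, 1, 2}"], of "(0, cls {0, 1, 2}, 1)"] up_Supp[OF card_012] sub by auto
  have pos: "(0, 0, int n) \<in> K" for n
  proof (induction n)
    case (Suc n)
    then show ?case using add[OF one Suc] by simp
  qed (use zero in simp)
  have n: "(0, 0, n) \<in> K" for n
    using pos[of "nat n"] minus[OF pos[of "nat (- n)"]] by (cases "n \<ge> 0") simp_all
  obtain k0 l n where g: "g = (k0, l, n)" by (cases g)
  show ?thesis using add[OF add[OF k0[of k0] k[of l]] n[of n]] by (simp add: g)
qed

text \<open>The set \<open>D\<close> is a parameter because fineness controls degrees only away from
  (1, 0, 0), whereas universality controls them on the whole support.\<close>

lemma degree_rel:
  assumes \<Delta>: "is_grading H L \<Delta>" and d: "\<And>s. s \<in> D \<Longrightarrow> d s \<in> carrier H \<and> \<Gamma> s \<subseteq> \<Delta> (d s)"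
    and st: "rel s t" "s \<in> D" "t \<in> D" "s + t \<in> D"
  shows "d (s + t) = d s \<otimes>\<^bsub>H\<^esub> d t"
proof -
  interpret H: comm_group H using \<Delta> by (simp add: is_grading_def)
  obtain x y where xy: "x \<in> \<Gamma> s" "y \<in> \<Gamma> t" "br x y \<noteq> 0" using st unfolding rel_def by blast
  have "br x y \<in> \<Delta> (d (s + t))" using Gamma_br[OF xy(1,2)] d[OF st(4)] by blast
  moreover have "br x y \<in> \<Delta> (d s \<otimes>\<^bsub>H\<^esub> d t)"
    using \<Delta> xy d[OF st(2)] d[OF st(3)] unfolding is_grading_def L_simps by blast
  ultimately show ?thesis
    using grading_unique_degree[OF \<Delta>] vs xy(3) d st by simp
qed

lemma fine_Gamma: "fine_grading TYPE('h) G5 L \<Gamma>"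
  unfolding fine_grading_def
proof (intro conjI notI)
  show "is_grading G5 L \<Gamma>" by (rule is_grading_Gamma)
  assume "\<exists>(H::'h monoid) \<Delta>. is_grading H L \<Delta> \<and> (\<forall>D\<in>components H \<Delta>. \<exists>C\<in>components G5 \<Gamma>. D \<subseteq> C) \<and>
      (\<exists>D\<in>components H \<Delta>. \<exists>C\<in>components G5 \<Gamma>. D \<subset> C)"
  then obtain H :: "'h monoid" and \<Delta> where \<Delta>: "is_grading H L \<Delta>"
    and ref': "\<forall>D\<in>components H \<Delta>. \<exists>C\<in>components G5 \<Gamma>. D \<subseteq> C"
    and CD: "\<exists>D\<in>components H \<Delta>. \<exists>C\<in>components G5 \<Gamma>. D \<subset> C"
    by (elim exE conjE) (rule that)
  from CD obtain C D where CD: "D \<in> components H \<Delta>" "C \<in> components G5 \<Gamma>" "D \<subset> C"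
    by (elim bexE) (rule that)
  have ref: "\<exists>s\<in>Supp G5 \<Gamma>. \<Delta> h \<subseteq> \<Gamma> s" if "h \<in> Supp H \<Delta>" for h
  proof -
    have "\<Delta> h \<in> components H \<Delta>" using that unfolding components_def by (rule imageI)
    from bspec[OF ref' this] obtain C where C: "C \<in> components G5 \<Gamma>" "\<Delta> h \<subseteq> C" by (elim bexE) (rule that)
    obtain s where "s \<in> Supp G5 \<Gamma>" "C = \<Gamma> s" using C(1) unfolding components_def by (rule imageE)
    then show ?thesis using C(2) by (intro bexI[of _ s]) simp_all
  qed
  obtain h0 where h0: "h0 \<in> Supp H \<Delta>" "D = \<Delta> h0" using CD(1) unfolding components_def by (rule imageE)
  obtain s0 where s0: "s0 \<in> Supp G5 \<Gamma>" "C = \<Gamma> s0" using CD(2) unfolding components_def by (rule imageE)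
  note proper = CD(3)[unfolded h0(2) s0(2)]
  note h0 = h0(1) and s0 = s0(1)
  interpret H: comm_group H using \<Delta> by (simp add: is_grading_def)
  interpret V: vector_space "e6_scale :: 'f \<Rightarrow> 'f e6 \<Rightarrow> 'f e6" by (rule vs)
  have sub: "V.subspace (\<Delta> h)" if "h \<in> carrier H" for h
    using \<Delta> that unfolding is_grading_def by simp
  \<comment> \<open>A component of \<Gamma> that is a line lies in one component of \<Delta>: it is
    spanned by a homogeneous part of one of its own vectors.\<close>
  have "\<exists>h. h \<in> carrier H \<and> \<Gamma> s \<subseteq> \<Delta> h" if s: "s \<in> Supp G5 \<Gamma>" "s \<noteq> (1, 0, 0)" for s
  proof -
    obtain b where b: "b \<in> \<Gamma> s" "b \<noteq> 0" using s(1) unfolding Supp_iff by blast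
    then have "b \<in> acar L" using Gamma_carrier by simp
    then have ex1: "\<exists>!c. (\<forall>g\<in>carrier H. c g \<in> \<Delta> g) \<and> (\<forall>g. g \<notin> carrier H \<longrightarrow> c g = 0) \<and>
        finite {g. c g \<noteq> 0} \<and> b = (\<Sum>g | c g \<noteq> 0. c g)"
      using \<Delta> unfolding is_grading_def by (elim conjE) (erule (1) bspec)
    from ex1_implies_ex[OF ex1] obtain c where c: "\<forall>g\<in>carrier H. c g \<in> \<Delta> g" "\<forall>g. g \<notin> carrier H \<longrightarrow> c g = 0"
      "finite {g. c g \<noteq> 0}" "b = (\<Sum>g | c g \<noteq> 0. c g)"
      by blast
    have "\<exists>h. c h \<noteq> 0 \<and> c h \<in> \<Gamma> s"
    proof (rule ccontr)
      assume none: "\<not> (\<exists>h. c h \<noteq> 0 \<and> c h \<in> \<Gamma> s)"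
      \<comment> \<open>Each part of \<open>b\<close> lies in some component of \<Gamma> by
        refinement; if none lay in \<Gamma> s, the projection would kill \<open>b\<close>.\<close>
      have "proj s (c h) = 0" if h: "c h \<noteq> 0" for h
      proof -
        have hc: "h \<in> carrier H" "c h \<in> \<Delta> h" using c(1,2) h by blast+
        then have "h \<in> Supp H \<Delta>" using h by (auto simp: Supp_def)
        then obtain t where "c h \<in> \<Gamma> t" using ref hc(2) by blast
        then show ?thesis using none h proj_Gamma[of "c h" t s] by auto
      qed
      then have "proj s b = 0" by (subst c(4)) (simp add: proj_sum)
      then show False using b proj_Gamma[of b s s] by simp
    qed
    then obtain h where h: "c h \<noteq> 0" "c h \<in> \<Gamma> s" by blast
    then have hc: "h \<in> carrier H" "c h \<in> \<Delta> h" using c(1,2) by blast+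
    have "\<Gamma> s \<subseteq> \<Delta> h"
    proof
      fix y assume "y \<in> \<Gamma> s"
      then obtain k where "y = e6_scale k (c h)" using Gamma_line[OF s(2) h(2,1)] by blast
      then show "y \<in> \<Delta> h" using V.subspace_scale[OF sub[OF hc(1)] hc(2)] by simp
    qed
    then show ?thesis using hc(1) by blast
  qed
  then obtain d where d: "\<And>s. s \<in> Supp G5 \<Gamma> - {(1, 0, 0)} \<Longrightarrow> d s \<in> carrier H \<and> \<Gamma> s \<subseteq> \<Delta> (d s)"
    by (metis DiffD1 DiffD2 singletonI)
  have uniq: "g = h" if "g \<in> carrier H" "h \<in> carrier H" "x \<in> \<Delta> g" "x \<in> \<Delta> h" "x \<noteq> 0" for g h x
    using grading_unique_degree[OF \<Delta>] vs that by simp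
  have h0c: "h0 \<in> carrier H" using h0 by (simp add: Supp_def)
  obtain x0 where x0: "x0 \<in> \<Delta> h0" "x0 \<noteq> 0"
    using h0 V.subspace_0[OF sub[OF h0c]] unfolding Supp_def by blast
  show False
  proof (cases "s0 = (1, 0, 0)")
    case False
    then have "d s0 \<in> carrier H" "\<Gamma> s0 \<subseteq> \<Delta> (d s0)" using d s0 by blast+
    moreover from this have "d s0 = h0" using uniq h0c x0 proper by blast
    ultimately show False using proper by blast
  next
    case True
    have mem: "(e, cl i + cl j, 0) \<in> Supp G5 \<Gamma> - {(1, 0, 0)}" if "i \<noteq> j" for e i j
      using that sk_Supp[OF that] by (simp add: bit_vec_add_eq_0_iff)
    let ?z = "\<lambda>e i j. d (e, cl i + cl j, 0)"
    have zc: "?z e i j \<in> carrier H" if "i \<noteq> j" for e i j using d[OF mem[OF that]] by blast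
    have zz: "?z e i k = ?z 0 i j \<otimes>\<^bsub>H\<^esub> ?z e j k" if "i \<noteq> j" "j \<noteq> k" "i \<noteq> k" for e i j k
    proof -
      have eq: "(0, cl i + cl j, 0) + (e, cl j + cl k, 0 :: int) = (e, cl i + cl k, 0)"
        by (simp add: add.assoc bit_vec_add_cancel)
      have "d ((0, cl i + cl j, 0) + (e, cl j + cl k, 0)) = ?z 0 i j \<otimes>\<^bsub>H\<^esub> ?z e j k"
        by (rule degree_rel[where D = "Supp G5 \<Gamma> - {(1, 0, 0)}" and d = d, OF \<Delta> d rel_sk_sk[OF that] mem[OF that(1)] mem[OF that(2)]])
          (simp only: eq mem[OF that(3)])+
      then show ?thesis by (simp only: eq)
    qed
    \<comment> \<open>The degree of the bracket of \<open>sk 0 1 0\<close> and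
      \<open>sk 1 1 0\<close>, a diagonal matrix. The next step shows that every index
      \<open>i\<close> in place of 1 gives the same degree.\<close>
    define t where "t = ?z 0 1 0 \<otimes>\<^bsub>H\<^esub> ?z 1 1 0"
    have tc: "t \<in> carrier H" using zc[of 1 0 0] zc[of 1 0 1] by (simp add: t_def)
    have teq: "?z 0 i 0 \<otimes>\<^bsub>H\<^esub> ?z 1 i 0 = t" if i: "i \<noteq> 0" for i
    proof (cases "i = 1")
      case False
      let ?a = "?z 0 i 1"
      have ac: "?a \<in> carrier H" using zc False by blast
      have 1: "?z e i 0 = ?a \<otimes>\<^bsub>H\<^esub> ?z e 1 0" for e using zz[of i 1 0 e] False i by simp
      have 2: "?z 0 1 0 = ?a \<otimes>\<^bsub>H\<^esub> ?z 0 i 0" using zz[of 1 i 0 0] False i by (simp add: add.commute)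
      \<comment> \<open>Passing from \<open>i\<close> to 0 through 1 and from 1 to 0 through
        \<open>i\<close> shows that the square of \<open>?a\<close> is trivial.\<close>
      have "?z 0 1 0 = (?a \<otimes>\<^bsub>H\<^esub> ?a) \<otimes>\<^bsub>H\<^esub> ?z 0 1 0"
        using 2 unfolding 1[of 0] using ac zc[of 1 0 0] by (simp add: H.m_assoc)
      then have "?a \<otimes>\<^bsub>H\<^esub> ?a = \<one>\<^bsub>H\<^esub>" using H.r_cancel_one'[OF zc[of 1 0 0], of "?a \<otimes>\<^bsub>H\<^esub> ?a"] ac by simp
      moreover have "?z 0 i 0 \<otimes>\<^bsub>H\<^esub> ?z 1 i 0 = (?a \<otimes>\<^bsub>H\<^esub> ?a) \<otimes>\<^bsub>H\<^esub> t"
        unfolding 1 t_def using ac zc[of 1 0 0] zc[of 1 0 1] by (intro H.mult_mult_interchange) simp_all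
      ultimately show ?thesis using tc by simp
    qed (simp add: t_def)
    have dg: "mt (unit_mat i i - unit_mat 0 0) \<in> \<Delta> t" if i: "i \<noteq> 0" for i
    proof -
      have "br (mt (sk 0 i 0)) (mt (sk 1 i 0)) \<in> \<Delta> (?z 0 i 0 \<otimes>\<^bsub>H\<^esub> ?z 1 i 0)"
        using \<Delta> d[OF mem[OF i, of 0]] d[OF mem[OF i, of 1]] mt_sk_mem[OF i, of 0] mt_sk_mem[OF i, of 1]
        unfolding is_grading_def L_simps by blast
      then have "e6_scale (1/2) (e6_scale 2 (mt (unit_mat i i - unit_mat 0 0))) \<in> \<Delta> t"
        unfolding teq[OF i] br_sk_0_1[OF i] by (rule V.subspace_scale[OF sub[OF tc]])
      then show ?thesis by (simp add: scale_simps)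
    qed
    have "\<Gamma> (1, 0, 0) \<subseteq> \<Delta> t"
    proof
      fix x assume x: "x \<in> \<Gamma> (1, 0, 0)"
      obtain p f A u q where el: "x = el p f A u q" and fu: "f \<in> ext3" "u \<in> ext3"
        using Gamma_carrier[OF x] by (rule el_cases)
      note memx = x[unfolded el el_mem_Gamma[OF fu]]
      have z: "f = 0" "u = 0" "p = 0" "q = 0" using memx by (auto simp: vec_eq_iff)
      have off: "A $ a $ b = 0" if "a \<noteq> b" for a b using memx that by (auto simp: bit_vec_add_eq_0_iff)
      have "trace (mat (trace A / 3) - transpose A) = trace (mat_scale (bit_sign 1) A)"
        using memx by (elim conjE) (simp only:)
      then have tr: "trace A = 0" by (simp add: trace_sub trace_mat_6 trace_transpose trace_scale eq_neg_iff_add_eq_0)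
      have U: "UNIV = insert 0 (UNIV - {0 :: 6})" by blast
      \<comment> \<open>The matrices \<open>E_ii - E_00\<close> span the traceless diagonal ones;
        the entry at 0 is recovered from the trace.\<close>
      have "A = (\<Sum>i\<in>UNIV - {0}. mat_scale (A $ i $ i) (unit_mat i i - unit_mat 0 0))"
      proof -
        have "(\<Sum>i\<in>UNIV - {0}. mat_scale (A $ i $ i) (unit_mat i i - unit_mat 0 0)) $ a $ b = A $ a $ b" for a b
        proof -
          have A0: "A $ 0 $ 0 = - (\<Sum>i\<in>UNIV - {0}. A $ i $ i)"
            using tr unfolding trace_def by (subst (asm) U, subst (asm) sum.insert) (auto simp: eq_neg_iff_add_eq_0)
          have "(\<Sum>i\<in>UNIV - {0}. mat_scale (A $ i $ i) (unit_mat i i - unit_mat 0 0)) $ a $ b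
              = (\<Sum>i\<in>UNIV - {0}. if i = a then (if a = b then A $ a $ a else 0) else 0)
                + (\<Sum>i\<in>UNIV - {0}. - (if a = 0 \<and> b = 0 then A $ i $ i else 0))"
            unfolding sum_component sum.distrib[symmetric]
            by (rule sum.cong) (auto simp: mat_scale_nth unit_mat_nth)
          also have "\<dots> = A $ a $ b"
            using off[of a b] A0 by (cases "a = b"; cases "a = 0") (auto simp: sum_negf)
          finally show ?thesis .
        qed
        then show ?thesis by (simp add: vec_eq_iff)
      qed
      then have "mt A = (\<Sum>i\<in>UNIV - {0}. e6_scale (A $ i $ i) (mt (unit_mat i i - unit_mat 0 0)))"
      proof -
        have mt_add: "mt (A + B) = mt A + mt B" for A B by (simp add: el_add)
        have "mt (\<Sum>i\<in>X. F i) = (\<Sum>i\<in>X. mt (F i))" if "finite X" for X :: "6 set" and F :: "6 \<Rightarrow> 'f ^ 6 ^ 6"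
          using that by induction (simp_all add: mt_add el_zero[symmetric])
        then have "mt (\<Sum>i\<in>UNIV - {0}. mat_scale (A $ i $ i) (unit_mat i i - unit_mat 0 0))
            = (\<Sum>i\<in>UNIV - {0}. e6_scale (A $ i $ i) (mt (unit_mat i i - unit_mat 0 0)))"
          by (simp add: el_scale)
        then show ?thesis using \<open>A = _\<close> by metis
      qed
      also have "\<dots> \<in> \<Delta> t"
        using sub[OF tc] dg by (intro V.subspace_sum V.subspace_scale) auto
      finally show "x \<in> \<Delta> t" by (simp add: el z)
    qed
    then have "t = h0" "\<Gamma> s0 \<subseteq> \<Delta> t" using uniq[OF tc h0c] x0 proper True by blast+
    then show False using proper by blast
  qed
qed

text \<open>The relations from \<open>rel\<close> present \<open>G5\<close>. The homomorphism is
  assembled from values \<open>\<zeta> i\<close> at the classes \<open>cl i\<close>,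
  \<open>h0\<close> at (1, 0, 0) and \<open>w\<close> at (0, 0, 1), once these are shown to satisfy
  the relations of \<open>G5\<close>.\<close>

lemma rel_hom_extends:
  assumes "comm_group H" and dc: "\<And>s. s \<in> Supp G5 \<Gamma> \<Longrightarrow> d s \<in> carrier H"
    and dd: "\<And>s t. rel s t \<Longrightarrow> d (s + t) = d s \<otimes>\<^bsub>H\<^esub> d t"
  shows "\<exists>\<phi>. \<phi> \<in> hom G5 H \<and> (\<forall>s\<in>Supp G5 \<Gamma>. \<phi> s = d s)"
proof -
  interpret H: comm_group H by fact
  define \<zeta> where "\<zeta> i = (if i = 0 then \<one>\<^bsub>H\<^esub> else d (0, cl i, 0))" for i
  have zSupp: "(0, cl i, 0) \<in> Supp G5 \<Gamma>" if "i \<noteq> 0" for i using sk_Supp[OF that, of 0] by simp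
  have zc [simp]: "\<zeta> i \<in> carrier H" for i using dc zSupp by (simp add: \<zeta>_def)
  have zz: "d (0, cl i + cl j, 0) = \<zeta> i \<otimes>\<^bsub>H\<^esub> \<zeta> j" if "i \<noteq> j" for i j
  proof (cases "i = 0 \<or> j = 0")
    case True
    then show ?thesis using that dc zSupp by (auto simp: \<zeta>_def)
  next
    case False
    then have "rel (0, cl i + cl 0, 0) (0, cl 0 + cl j, 0)" using that by (intro rel_sk_sk) auto
    from dd[OF this] show ?thesis using False by (simp add: \<zeta>_def)
  qed
  \<comment> \<open>A line has zero bracket with itself, so this relation is reached through a third
    index \<open>j\<close>.\<close>
  have zsq: "\<zeta> i \<otimes>\<^bsub>H\<^esub> \<zeta> i = \<one>\<^bsub>H\<^esub>" for i
  proof (cases "i = 0")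
    case False
    obtain j where j: "j \<noteq> 0" "j \<noteq> i"
      by (cases "i = 1") (auto intro: that[of 2] that[of 1])
    have "rel (0, cl j + cl i, 0) (0, cl i + cl 0, 0)" using j False by (intro rel_sk_sk) auto
    from dd[OF this] have "d (0, cl j + cl i + cl i, 0) = (\<zeta> j \<otimes>\<^bsub>H\<^esub> \<zeta> i) \<otimes>\<^bsub>H\<^esub> \<zeta> i"
      using j False zz[of j i] by (simp add: \<zeta>_def)
    moreover have "d (0, cl j + cl i + cl i, 0) = \<zeta> j" using j by (simp add: add.assoc \<zeta>_def)
    ultimately have "\<zeta> j \<otimes>\<^bsub>H\<^esub> (\<zeta> i \<otimes>\<^bsub>H\<^esub> \<zeta> i) = \<zeta> j" by (simp add: H.m_assoc)
    then show ?thesis using H.l_cancel_one[of "\<zeta> j" "\<zeta> i \<otimes>\<^bsub>H\<^esub> \<zeta> i"] by simp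
  qed (simp add: \<zeta>_def)
  have zcancel: "\<zeta> i \<otimes>\<^bsub>H\<^esub> (\<zeta> i \<otimes>\<^bsub>H\<^esub> x) = x" if "x \<in> carrier H" for i x
    using that by (simp add: H.m_assoc[symmetric] zsq)
  define h0 where "h0 = d (1, 0, 0)"
  have hc [simp]: "h0 \<in> carrier H" using dc diag_Supp by (simp add: h0_def)
  have hz: "d (1 + e, cl i + cl j, 0) = h0 \<otimes>\<^bsub>H\<^esub> d (e, cl i + cl j, 0)" if "i \<noteq> j" for e i j
    using dd[OF rel_diag_sk[OF that, of e]] by (simp add: h0_def)
  have hsq: "h0 \<otimes>\<^bsub>H\<^esub> h0 = \<one>\<^bsub>H\<^esub>"
  proof -
    have "d (0, cl 0 + cl 1, 0) = h0 \<otimes>\<^bsub>H\<^esub> (h0 \<otimes>\<^bsub>H\<^esub> d (0, cl 0 + cl 1, 0))"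
      using hz[of 0 1 0] hz[of 0 1 1] by simp
    then have "(h0 \<otimes>\<^bsub>H\<^esub> h0) \<otimes>\<^bsub>H\<^esub> d (0, cl 0 + cl 1, 0) = d (0, cl 0 + cl 1, 0)"
      using dc[OF sk_Supp[of 0 1]] by (simp add: H.m_assoc)
    then show ?thesis using H.r_cancel_one[OF dc[OF sk_Supp[of 0 1 0]], of "h0 \<otimes>\<^bsub>H\<^esub> h0"] by simp
  qed
  have one: "d (0, 0, 0) = \<one>\<^bsub>H\<^esub>"
  proof -
    have "d (0, cls {0, 1, 2}, 1) = d (0, 0, 0) \<otimes>\<^bsub>H\<^esub> d (0, cls {0, 1, 2}, 1)"
      using dd[OF rel_one_up[OF card_012, of 0]] by simp
    then show ?thesis using H.r_cancel_one'[OF dc[OF up_Supp[OF card_012, of 0]] dc[OF one_Supp]] by simp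
  qed
  have up: "d (e, cl i + cl j + cls S, 1) = \<zeta> i \<otimes>\<^bsub>H\<^esub> \<zeta> j \<otimes>\<^bsub>H\<^esub> d (e, cls S, 1)"
    if "i \<noteq> j" "crossing i j S" "card S = 3" for e i j S
    using dd[OF rel_sk_up[OF that, of e]] zz[OF that(1)] by simp
  \<comment> \<open>The relation cl 1 + ... + cl 5 = 0 in multiplicative form. Three exchanges lead
    from {1, 2, 3} to its complement {4, 5, 0}, which has the same class and hence the same
    degree.\<close>
  have prod: "\<zeta> 1 \<otimes>\<^bsub>H\<^esub> (\<zeta> 2 \<otimes>\<^bsub>H\<^esub> (\<zeta> 3 \<otimes>\<^bsub>H\<^esub> (\<zeta> 4 \<otimes>\<^bsub>H\<^esub> \<zeta> 5))) = \<one>\<^bsub>H\<^esub>"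
  proof -
    let ?S = "{1, 2, 3 :: 6}" and ?D = "d (0, cls {1, 2, 3}, 1)"
    have S: "card {1, 2, 3 :: 6} = 3" "card {4, 2, 3 :: 6} = 3" "card {4, 5, 3 :: 6} = 3" by simp_all
    have cls: "cl 4 + cl 1 + cls {1, 2, 3} = cls {4, 2, 3}" "cl 5 + cl 2 + cls {4, 2, 3} = cls {4, 5, 3}"
      "cl 0 + cl 3 + cls {4, 5, 3} = cls {1, 2, 3}"
      by (simp_all add: vec_eq_iff forall_4 cls_nth)
    have cr: "crossing 4 1 {1, 2, 3}" "crossing 5 2 {4, 2, 3}" "crossing 0 3 {4, 5, 3}"
      by (simp_all add: crossing_def)
    have D: "?D \<in> carrier H" using dc[OF up_Supp[OF S(1)]] .
    have "?D = \<zeta> 0 \<otimes>\<^bsub>H\<^esub> \<zeta> 3 \<otimes>\<^bsub>H\<^esub> (\<zeta> 5 \<otimes>\<^bsub>H\<^esub> \<zeta> 2 \<otimes>\<^bsub>H\<^esub> (\<zeta> 4 \<otimes>\<^bsub>H\<^esub> \<zeta> 1 \<otimes>\<^bsub>H\<^esub> ?D))"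
      using up[OF _ cr(1) S(1), of 0] up[OF _ cr(2) S(2), of 0] up[OF _ cr(3) S(3), of 0] unfolding cls by simp
    also have "\<dots> = (\<zeta> 1 \<otimes>\<^bsub>H\<^esub> (\<zeta> 2 \<otimes>\<^bsub>H\<^esub> (\<zeta> 3 \<otimes>\<^bsub>H\<^esub> (\<zeta> 4 \<otimes>\<^bsub>H\<^esub> \<zeta> 5)))) \<otimes>\<^bsub>H\<^esub> ?D"
      using D by (simp add: \<zeta>_def[of 0] H.m_ac)
    finally show ?thesis using H.r_cancel_one'[OF D] by simp
  qed
  define \<xi> where "\<xi> k = bit_pow H (k $ 1) (\<zeta> 2) \<otimes>\<^bsub>H\<^esub> (bit_pow H (k $ 2) (\<zeta> 3) \<otimes>\<^bsub>H\<^esub>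
     (bit_pow H (k $ 3) (\<zeta> 4) \<otimes>\<^bsub>H\<^esub> bit_pow H (k $ 4) (\<zeta> 5)))" for k :: "bit ^ 4"
  have Xc [simp]: "\<xi> k \<in> carrier H" for k by (simp add: \<xi>_def H.bit_pow_closed)
  have Xadd: "\<xi> (a + b) = \<xi> a \<otimes>\<^bsub>H\<^esub> \<xi> b" for a b
    unfolding \<xi>_def vector_add_component H.bit_pow_add[OF zc zsq]
    by (simp add: H.bit_pow_closed H.mult_mult_interchange)
  have X0: "\<xi> 0 = \<one>\<^bsub>H\<^esub>" by (simp add: \<xi>_def bit_pow_def)
  have Xsq: "\<xi> a \<otimes>\<^bsub>H\<^esub> \<xi> a = \<one>\<^bsub>H\<^esub>" for a using Xadd[of a a] X0 by simp
  have Xcl: "\<xi> (cl i) = \<zeta> i" for i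
  proof -
    have "\<xi> (cl 1) = \<zeta> 1"
    proof -
      have "\<xi> (cl 1) = \<zeta> 1 \<otimes>\<^bsub>H\<^esub> (\<zeta> 1 \<otimes>\<^bsub>H\<^esub> (\<zeta> 2 \<otimes>\<^bsub>H\<^esub> (\<zeta> 3 \<otimes>\<^bsub>H\<^esub> (\<zeta> 4 \<otimes>\<^bsub>H\<^esub> \<zeta> 5))))"
        by (simp add: cl_1 \<xi>_def bit_pow_def zcancel)
      then show ?thesis by (simp add: prod)
    qed
    moreover have "\<forall>l. \<xi> (cl (idx l)) = \<zeta> (idx l)"
      unfolding forall_4 cl_idx \<xi>_def by (simp add: bit_pow_def axis_nth)
    moreover have "\<xi> (cl 0) = \<zeta> 0" by (simp add: X0 \<zeta>_def)
    ultimately show ?thesis using nonzero_index_cases[of i] by blast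
  qed
  \<comment> \<open>The intended image of (0, 0, 1): the degree of one 3-vector with its class
    removed, the class part being its own inverse.\<close>
  define w where "w = d (0, cls {0, 1, 2}, 1) \<otimes>\<^bsub>H\<^esub> \<xi> (cls {0, 1, 2})"
  have wc [simp]: "w \<in> carrier H" using dc[OF up_Supp[OF card_012]] by (simp add: w_def)
  have F: "d (0, cls S, 1) = w \<otimes>\<^bsub>H\<^esub> \<xi> (cls S)" if "card S = 3" for S
    using that card_012
  proof (rule card3_exchange_induct)
    have "w \<otimes>\<^bsub>H\<^esub> \<xi> (cls {0, 1, 2}) = d (0, cls {0, 1, 2}, 1)"
      using dc[OF up_Supp[OF card_012, of 0]] by (simp add: w_def H.m_assoc Xsq)
    then show "d (0, cls {0, 1, 2}, 1) = w \<otimes>\<^bsub>H\<^esub> \<xi> (cls {0, 1, 2})" ..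
    fix S :: "6 set" and i j assume S: "card S = 3" "j \<in> S" "i \<notin> S"
      and IH: "d (0, cls (insert i (S - {j})), 1) = w \<otimes>\<^bsub>H\<^esub> \<xi> (cls (insert i (S - {j})))"
    have ij: "i \<noteq> j" "crossing i j S" using S by (auto simp: crossing_def)
    have D: "d (0, cls S, 1) \<in> carrier H" using dc[OF up_Supp[OF S(1)]] .
    have "\<zeta> i \<otimes>\<^bsub>H\<^esub> \<zeta> j \<otimes>\<^bsub>H\<^esub> d (0, cls S, 1) = w \<otimes>\<^bsub>H\<^esub> (\<zeta> i \<otimes>\<^bsub>H\<^esub> \<zeta> j \<otimes>\<^bsub>H\<^esub> \<xi> (cls S))"
      using IH up[OF ij S(1), of 0] by (simp add: cls_exchange[OF S(2,3)] Xadd Xcl)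
    also have "\<dots> = \<zeta> i \<otimes>\<^bsub>H\<^esub> \<zeta> j \<otimes>\<^bsub>H\<^esub> (w \<otimes>\<^bsub>H\<^esub> \<xi> (cls S))" by (simp add: H.m_ac)
    finally show "d (0, cls S, 1) = w \<otimes>\<^bsub>H\<^esub> \<xi> (cls S)" using D by simp
  qed
  define \<phi> where "\<phi> g = (case g of (k0, k, n) \<Rightarrow> bit_pow H k0 h0 \<otimes>\<^bsub>H\<^esub> (\<xi> k \<otimes>\<^bsub>H\<^esub> w [^]\<^bsub>H\<^esub> (n :: int)))" for g :: g5
  have pc: "\<phi> g \<in> carrier H" for g by (cases g) (simp add: \<phi>_def H.bit_pow_closed)
  have padd: "\<phi> (g + h) = \<phi> g \<otimes>\<^bsub>H\<^esub> \<phi> h" for g h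
    by (cases g; cases h)
      (simp add: \<phi>_def H.bit_pow_add[OF hc hsq] Xadd H.int_pow_mult[symmetric] H.bit_pow_closed H.mult_mult_interchange)
  have p0: "\<phi> 0 = \<one>\<^bsub>H\<^esub>" by (simp add: \<phi>_def zero_prod_def bit_pow_def X0)
  have hup: "d (e, cls S, 1) = \<phi> (e, cls S, 1)" if "card S = 3" for e S
  proof (cases "e = 0")
    case True
    then show ?thesis using F[OF that] by (simp add: \<phi>_def bit_pow_def H.m_comm)
  next
    case False
    then show ?thesis using F[OF that] dd[OF rel_diag_up[OF that, of 0]]
      by (simp add: \<phi>_def bit_pow_def H.m_comm h0_def[symmetric])
  qed
  have hdn: "d (e, cls S, -1) = \<phi> (e, cls S, -1)" if "card S = 3" for e S
  proof -
    have dnc: "d (e, cls S, -1) \<in> carrier H" using dc[OF rel_Supp(2)[OF rel_up_dn[OF that]]] .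
    \<comment> \<open>Opposite degrees have a nonzero product in degree (0, 0, 0), so the values of
      \<open>d\<close> there are inverse to those already known.\<close>
    have "\<phi> (e, cls S, 1) \<otimes>\<^bsub>H\<^esub> d (e, cls S, -1) = \<one>\<^bsub>H\<^esub>"
      using dd[OF rel_up_dn[OF that, of e]] one hup[OF that] by simp
    moreover have "\<phi> (e, cls S, 1) \<otimes>\<^bsub>H\<^esub> \<phi> (e, cls S, -1) = \<one>\<^bsub>H\<^esub>"
      using padd[of "(e, cls S, 1)" "(e, cls S, -1)"] p0 by (simp add: zero_prod_def)
    ultimately show ?thesis
      using dnc pc H.inv_equality H.m_comm by metis
  qed
  have "d s = \<phi> s" if "s \<in> Supp G5 \<Gamma>" for s
    using that
  proof (cases rule: Supp_cases)
    case one
    then show ?thesis using \<open>d (0, 0, 0) = _\<close> p0 by (simp add: zero_prod_def)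
  next
    case diag
    then show ?thesis by (simp add: \<phi>_def bit_pow_def X0 h0_def[symmetric])
  next
    case (mat e i j)
    have "\<phi> (0, cl i + cl j, 0) = \<zeta> i \<otimes>\<^bsub>H\<^esub> \<zeta> j" by (simp add: \<phi>_def bit_pow_def Xadd Xcl)
    moreover have "\<phi> (1, cl i + cl j, 0) = h0 \<otimes>\<^bsub>H\<^esub> (\<zeta> i \<otimes>\<^bsub>H\<^esub> \<zeta> j)" by (simp add: \<phi>_def bit_pow_def Xadd Xcl)
    ultimately show ?thesis using zz[OF mat(2)] hz[OF mat(2), of 0] mat by (cases e) simp_all
  next
    case (up e S)
    then show ?thesis using hup by simp
  next
    case (dn e S)
    then show ?thesis using hdn by simp
  next
    case top
    have "d ((0, cls {0, 1, 2}, 1) + (1, cls {0, 1, 2}, 1)) = \<phi> ((0, cls {0, 1, 2}, 1) + (1, cls {0, 1, 2}, 1))"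
      unfolding dd[OF rel_up_up[OF card_012]] padd hup[OF card_012] ..
    then show ?thesis using top by simp
  next
    case bot
    have "d ((1, cls {0, 1, 2}, -1) + (0, cls {0, 1, 2}, -1)) = \<phi> ((1, cls {0, 1, 2}, -1) + (0, cls {0, 1, 2}, -1))"
      unfolding dd[OF rel_dn_dn[OF card_012]] padd hdn[OF card_012] ..
    then show ?thesis using bot by simp
  qed
  moreover have "\<phi> \<in> hom G5 H" using pc padd by (auto simp: hom_def)
  ultimately show ?thesis by (intro exI[of _ \<phi>]) auto
qed

lemma universal_hom_exists:
  assumes \<Delta>: "is_grading H L \<Delta>" and comp: "components H \<Delta> = components G5 \<Gamma>"
  shows "\<exists>\<phi>. \<phi> \<in> hom G5 H \<and> (\<forall>s\<in>Supp G5 \<Gamma>. \<Delta> (\<phi> s) = \<Gamma> s)"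
proof -
  have H: "comm_group H" using \<Delta> by (simp add: is_grading_def)
  have "\<exists>h. h \<in> carrier H \<and> \<Delta> h = \<Gamma> s" if "s \<in> Supp G5 \<Gamma>" for s
  proof -
    have "\<Gamma> s \<in> components G5 \<Gamma>" using that unfolding components_def by (rule imageI)
    then have "\<Gamma> s \<in> components H \<Delta>" by (simp only: comp)
    then obtain h where "h \<in> Supp H \<Delta>" "\<Gamma> s = \<Delta> h" unfolding components_def by (rule imageE)
    then show ?thesis unfolding Supp_def by (intro exI[of _ h]) simp
  qed
  then obtain d where d: "\<And>s. s \<in> Supp G5 \<Gamma> \<Longrightarrow> d s \<in> carrier H \<and> \<Delta> (d s) = \<Gamma> s" by metis
  have "d (s + t) = d s \<otimes>\<^bsub>H\<^esub> d t" if "rel s t" for s t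
    by (rule degree_rel[where D = "Supp G5 \<Gamma>" and d = d, OF \<Delta> _ that]) (use d rel_Supp[OF that] in auto)
  from rel_hom_extends[OF H _ this] d show ?thesis by metis
qed

lemma hom_eq_on_Supp:
  assumes "group H" "\<phi> \<in> hom G5 H" "\<psi> \<in> hom G5 H" "\<And>s. s \<in> Supp G5 \<Gamma> \<Longrightarrow> \<phi> s = \<psi> s"
  shows "\<phi> = \<psi>"
proof
  fix g
  interpret H: group H by fact
  interpret G: comm_group "G5" by (rule comm_group_additive_group)
  have inv: "inv\<^bsub>G5\<^esub> x = - x" for x :: g5 by (rule G.inv_equality) simp_all
  have *: "\<phi> (- x) = inv\<^bsub>H\<^esub> \<phi> x" if "\<phi> \<in> hom G5 H" for \<phi> x
  proof -
    interpret hm: group_hom G5 H \<phi> by unfold_locales (use that in simp)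
    show ?thesis using hm.hom_inv[of x] by (simp add: inv)
  qed
  have "g \<in> {g. \<phi> g = \<psi> g}"
  proof (rule Supp_generates)
    show "Supp G5 \<Gamma> \<subseteq> {g. \<phi> g = \<psi> g}" using assms(4) by blast
    show "x + y \<in> {g. \<phi> g = \<psi> g}" if "x \<in> {g. \<phi> g = \<psi> g}" "y \<in> {g. \<phi> g = \<psi> g}" for x y
      using that hom_mult[OF assms(2), of x y] hom_mult[OF assms(3), of x y] by simp
    show "- x \<in> {g. \<phi> g = \<psi> g}" if "x \<in> {g. \<phi> g = \<psi> g}" for x
      using that *[OF assms(2), of x] *[OF assms(3), of x] by simp
  qed
  then show "\<phi> g = \<psi> g" by simp
qed

lemma universal_Gamma: "is_universal_group TYPE('h) G5 L \<Gamma>"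
  unfolding is_universal_group_def
proof (intro conjI allI impI)
  show "is_grading G5 L \<Gamma>" by (rule is_grading_Gamma)
  fix H :: "'h monoid" and \<Delta>
  assume \<Delta>: "is_grading H L \<Delta>" "components H \<Delta> = components G5 \<Gamma>"
  interpret H: comm_group H using \<Delta> by (simp add: is_grading_def)
  obtain \<phi> where \<phi>: "\<phi> \<in> hom G5 H" "\<forall>s\<in>Supp G5 \<Gamma>. \<Delta> (\<phi> s) = \<Gamma> s"
    using universal_hom_exists[OF \<Delta>] by blast
  show "\<exists>!\<phi>. \<phi> \<in> extensional (carrier G5) \<and> \<phi> \<in> hom G5 H \<and> (\<forall>s\<in>Supp G5 \<Gamma>. \<Delta> (\<phi> s) = \<Gamma> s)"
  proof (rule ex1I)
    show "\<phi> \<in> extensional (carrier G5) \<and> \<phi> \<in> hom G5 H \<and> (\<forall>s\<in>Supp G5 \<Gamma>. \<Delta> (\<phi> s) = \<Gamma> s)"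
      using \<phi> by (simp add: extensional_def)
    fix \<psi> assume \<psi>: "\<psi> \<in> extensional (carrier G5) \<and> \<psi> \<in> hom G5 H \<and> (\<forall>s\<in>Supp G5 \<Gamma>. \<Delta> (\<psi> s) = \<Gamma> s)"
    have "\<psi> s = \<phi> s" if s: "s \<in> Supp G5 \<Gamma>" for s
    proof -
      obtain x where x: "x \<in> \<Gamma> s" "x \<noteq> 0" using s unfolding Supp_iff by blast
      have "\<psi> s \<in> carrier H" "\<phi> s \<in> carrier H"
        using \<psi> \<phi>(1) by (auto simp: hom_def)
      then show ?thesis using grading_unique_degree[OF \<Delta>(1)] vs x \<psi> \<phi>(2) s by simp
    qed
    then show "\<psi> = \<phi>" using hom_eq_on_Supp[OF H.group_axioms] \<psi> \<phi>(1) by blast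
  qed
qed

end

section \<open>The Weyl group as a group of automorphisms of the universal group\<close>

context e6_lie
begin

abbreviation A_gr :: "('f e6 \<Rightarrow> 'f e6) set" where "A_gr \<equiv> Aut_grading G5 L \<Gamma>"
abbreviation AG :: "('f e6 \<Rightarrow> 'f e6) monoid" where "AG \<equiv> BijGroup (e6_carrier) \<lparr>carrier := A_gr\<rparr>"

lemma alg_autD:
  assumes "f \<in> alg_aut L"
  shows "bij_betw f e6_carrier e6_carrier" "f \<in> extensional e6_carrier" "f \<in> Bij e6_carrier"
    "x \<in> e6_carrier \<Longrightarrow> y \<in> e6_carrier \<Longrightarrow> f (x + y) = f x + f y"
    "x \<in> e6_carrier \<Longrightarrow> f (e6_scale c x) = e6_scale c (f x)"
    "x \<in> e6_carrier \<Longrightarrow> y \<in> e6_carrier \<Longrightarrow> f (br x y) = br (f x) (f y)"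
    "x \<in> e6_carrier \<Longrightarrow> f x \<in> e6_carrier"
  using assms by (auto simp: alg_aut_def Bij_def bij_betw_def)

lemma alg_aut_zero: "f \<in> alg_aut L \<Longrightarrow> f 0 = 0"
  using alg_autD(5)[of f 0 0] carrier_zero by (simp add: scale_simps)

lemma alg_aut_eq_0_iff: "f \<in> alg_aut L \<Longrightarrow> x \<in> e6_carrier \<Longrightarrow> f x = 0 \<longleftrightarrow> x = 0"
  using alg_autD(1)[of f] alg_aut_zero[of f] carrier_zero by (metis bij_betw_inv_into_left)

lemma alg_aut_compose:
  assumes "f \<in> alg_aut L" "g \<in> alg_aut L"
  shows "compose e6_carrier f g \<in> alg_aut L"
proof -
  have "compose e6_carrier f g \<in> Bij e6_carrier" using alg_autD(3) assms by (intro compose_Bij)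
  then show ?thesis
    unfolding alg_aut_def[of L]
    by (simp add: compose_def carrier_add carrier_scale br_closed alg_autD(4-7)[OF assms(1)] alg_autD(4-7)[OF assms(2)])
qed

lemma alg_aut_inverse:
  assumes f: "f \<in> alg_aut L"
  shows "restrict (inv_into e6_carrier f) e6_carrier \<in> alg_aut L"
proof -
  let ?g = "inv_into e6_carrier f"
  have bij: "bij_betw f e6_carrier e6_carrier" using alg_autD[OF f] by blast
  have g: "x \<in> e6_carrier \<Longrightarrow> ?g x \<in> e6_carrier" "x \<in> e6_carrier \<Longrightarrow> f (?g x) = x" for x
    using bij by (auto simp: bij_betw_def inv_into_into f_inv_into_f)
  have inv: "?g y = x" if "x \<in> e6_carrier" "f x = y" for x y
    using that bij by (metis bij_betw_inv_into_left)
  have "?g (x + y) = ?g x + ?g y" if "x \<in> e6_carrier" "y \<in> e6_carrier" for x y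
    using that by (intro inv) (simp_all add: g carrier_add alg_autD[OF f])
  moreover have "?g (e6_scale c x) = e6_scale c (?g x)" if "x \<in> e6_carrier" for c x
    using that by (intro inv) (simp_all add: g carrier_scale alg_autD[OF f])
  moreover have "?g (br x y) = br (?g x) (?g y)" if "x \<in> e6_carrier" "y \<in> e6_carrier" for x y
    using that by (intro inv) (simp_all add: g br_closed alg_autD[OF f])
  ultimately show ?thesis
    using restrict_inv_into_Bij[OF alg_autD(3)[OF f]]
    by (simp add: alg_aut_def carrier_add carrier_scale br_closed)
qed

lemma Gamma_sub: "\<Gamma> s \<subseteq> e6_carrier"
  using Gamma_carrier by blast

lemma components_sub: "X \<in> components G5 \<Gamma> \<Longrightarrow> X \<subseteq> e6_carrier"
  unfolding components_def using Gamma_sub by (elim imageE) (simp del: Gamma5.simps)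

lemma compose_image: "X \<subseteq> S \<Longrightarrow> compose S f g ` X = f ` g ` X"
  unfolding image_image by (rule image_cong[OF refl]) (auto simp: compose_def)

lemma subgroup_Aut: "subgroup A_gr (BijGroup e6_carrier)"
proof (rule group.subgroupI[OF group_BijGroup])
  interpret B: group "BijGroup (e6_carrier :: 'f e6 set)" by (rule group_BijGroup)
  show "A_gr \<subseteq> carrier (BijGroup e6_carrier)"
    using alg_autD(3) by (auto simp: Aut_grading_def BijGroup_def)
  have id: "(\<lambda>x\<in>e6_carrier. x) ` X = X" if "X \<subseteq> e6_carrier" for X :: "'f e6 set"
    using that by force
  have "(\<lambda>x\<in>e6_carrier. x) \<in> alg_aut L"
    using id_Bij[of "e6_carrier :: 'f e6 set"] by (simp add: alg_aut_def carrier_add carrier_scale br_closed)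
  moreover have "(`) (\<lambda>x\<in>e6_carrier. x) ` components G5 \<Gamma> = components G5 \<Gamma>"
    using components_sub id by (force simp: image_iff)
  ultimately show "A_gr \<noteq> {}" unfolding Aut_grading_def by blast
  fix f assume f: "f \<in> A_gr"
  then have fa: "f \<in> alg_aut L" "(`) f ` components G5 \<Gamma> = components G5 \<Gamma>" by (auto simp: Aut_grading_def)
  let ?g = "restrict (inv_into e6_carrier f) e6_carrier"
  have gf: "?g ` f ` X = X" if "X \<subseteq> e6_carrier" for X
  proof -
    have "?g (f x) = x" if "x \<in> e6_carrier" for x
      using alg_autD(1,7)[OF fa(1)] that by (simp add: bij_betw_inv_into_left)
    then have "(\<lambda>x. ?g (f x)) ` X = (\<lambda>x. x) ` X" using that by (intro image_cong) blast+
    then show ?thesis by (simp only: image_image image_ident)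
  qed
  have "(`) ?g ` components G5 \<Gamma> = (\<lambda>X. ?g ` f ` X) ` components G5 \<Gamma>"
    by (subst fa(2)[symmetric]) (simp only: image_image)
  also have "\<dots> = (\<lambda>X. X) ` components G5 \<Gamma>"
    by (rule image_cong[OF refl]) (rule gf[OF components_sub])
  finally have "(`) ?g ` components G5 \<Gamma> = components G5 \<Gamma>" by simp
  then show "inv\<^bsub>BijGroup e6_carrier\<^esub> f \<in> A_gr"
    using alg_aut_inverse[OF fa(1)] inv_BijGroup[OF alg_autD(3)[OF fa(1)]] by (simp add: Aut_grading_def)
  fix h assume h: "h \<in> A_gr"
  then have ha: "h \<in> alg_aut L" "(`) h ` components G5 \<Gamma> = components G5 \<Gamma>" by (auto simp: Aut_grading_def)
  have "(`) (compose e6_carrier f h) ` components G5 \<Gamma> = (\<lambda>X. f ` h ` X) ` components G5 \<Gamma>"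
    by (rule image_cong[OF refl]) (rule compose_image[OF components_sub])
  also have "\<dots> = (`) f ` (`) h ` components G5 \<Gamma>" by (simp only: image_image)
  finally have "(`) (compose e6_carrier f h) ` components G5 \<Gamma> = components G5 \<Gamma>" by (simp only: fa(2) ha(2))
  then show "f \<otimes>\<^bsub>BijGroup e6_carrier\<^esub> h \<in> A_gr"
    using alg_aut_compose[OF fa(1) ha(1)] alg_autD(3)[OF fa(1)] alg_autD(3)[OF ha(1)]
    by (simp add: Aut_grading_def BijGroup_def)
qed

lemma group_AG: "group AG"
  using subgroup_Aut group_BijGroup by (rule subgroup.subgroup_is_group)

lemma AG_simps [simp]: "carrier AG = A_gr" "f \<in> A_gr \<Longrightarrow> g \<in> A_gr \<Longrightarrow> f \<otimes>\<^bsub>AG\<^esub> g = compose e6_carrier f g"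
  "\<one>\<^bsub>AG\<^esub> = (\<lambda>x\<in>e6_carrier. x)"
  using alg_autD(3) by (auto simp: BijGroup_def Aut_grading_def)

lemma A_gr_alg_aut: "f \<in> A_gr \<Longrightarrow> f \<in> alg_aut L"
  by (simp add: Aut_grading_def)

lemma alg_aut_image_Gamma_eq:
  assumes "f \<in> alg_aut L" "s \<in> Supp G5 \<Gamma>" "f ` \<Gamma> s = \<Gamma> t" "f ` \<Gamma> s = \<Gamma> t'"
  shows "t = t'"
proof -
  obtain x where x: "x \<in> \<Gamma> s" "x \<noteq> 0" using assms(2) unfolding Supp_iff by blast
  have "f x \<noteq> 0" using alg_aut_eq_0_iff[OF assms(1) Gamma_carrier[OF x(1)]] x(2) by simp
  moreover have "f x \<in> \<Gamma> t" "f x \<in> \<Gamma> t'" using x(1) unfolding assms(3,4)[symmetric] by blast+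
  ultimately show ?thesis by (intro Gamma_disjoint)
qed

lemma Aut_perm:
  assumes "f \<in> A_gr"
  shows "\<exists>d. \<forall>s\<in>Supp G5 \<Gamma>. d s \<in> Supp G5 \<Gamma> \<and> f ` \<Gamma> s = \<Gamma> (d s)"
proof -
  have "\<exists>t. t \<in> Supp G5 \<Gamma> \<and> f ` \<Gamma> s = \<Gamma> t" if "s \<in> Supp G5 \<Gamma>" for s
  proof -
    have "\<Gamma> s \<in> components G5 \<Gamma>" using that unfolding components_def by (rule imageI)
    then have "f ` \<Gamma> s \<in> components G5 \<Gamma>" using assms unfolding Aut_grading_def by blast
    then obtain t where "t \<in> Supp G5 \<Gamma>" "f ` \<Gamma> s = \<Gamma> t" unfolding components_def by (rule imageE)
    then show ?thesis by (intro exI[of _ t] conjI)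
  qed
  then show ?thesis by metis
qed

text \<open>An automorphism preserves nonvanishing of brackets, so its map on degrees respects
  \<open>rel\<close> and extends by \<open>rel_hom_extends\<close>, now with \<open>G5\<close>
  itself as target.\<close>

lemma Aut_hom:
  assumes "f \<in> A_gr"
  shows "\<exists>\<phi>. \<phi> \<in> hom G5 G5 \<and> (\<forall>s\<in>Supp G5 \<Gamma>. \<phi> s \<in> Supp G5 \<Gamma> \<and> f ` \<Gamma> s = \<Gamma> (\<phi> s))"
proof -
  note fa = A_gr_alg_aut[OF assms]
  obtain d where d: "\<forall>s\<in>Supp G5 \<Gamma>. d s \<in> Supp G5 \<Gamma> \<and> f ` \<Gamma> s = \<Gamma> (d s)"
    using Aut_perm[OF assms] by blast
  have "d (s + t) = d s \<otimes>\<^bsub>G5\<^esub> d t" if st: "rel s t" for s t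
  proof -
    obtain x y where xy: "x \<in> \<Gamma> s" "y \<in> \<Gamma> t" "br x y \<noteq> 0" using st unfolding rel_def by blast
    have c: "x \<in> e6_carrier" "y \<in> e6_carrier" using xy Gamma_carrier by auto
    have "f x \<in> \<Gamma> (d s)" "f y \<in> \<Gamma> (d t)" using xy d rel_Supp[OF st] by blast+
    then have "f (br x y) \<in> \<Gamma> (d s + d t)" using c by (simp add: alg_autD[OF fa] Gamma_br del: Gamma5.simps)
    moreover have "f (br x y) \<in> \<Gamma> (d (s + t))" using d rel_Supp(3)[OF st] Gamma_br[OF xy(1,2)] by blast
    moreover have "f (br x y) \<noteq> 0" using xy(3) c alg_aut_eq_0_iff[OF fa] by (simp add: br_closed)
    ultimately show ?thesis using Gamma_disjoint by simp
  qed
  from rel_hom_extends[OF comm_group_additive_group _ this] obtain \<phi> where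
    "\<phi> \<in> hom G5 G5" "\<forall>s\<in>Supp G5 \<Gamma>. \<phi> s = d s" by auto
  then show ?thesis using d by (intro exI[of _ \<phi>]) auto
qed

lemma hom_G5_additive: "\<phi> \<in> hom G5 G5 \<longleftrightarrow> (\<forall>x y. \<phi> (x + y) = \<phi> x + \<phi> y)"
  by (auto simp: hom_def)

lemma hom_G5_comp: "\<phi> \<in> hom G5 G5 \<Longrightarrow> \<psi> \<in> hom G5 G5 \<Longrightarrow> (\<lambda>g. \<psi> (\<phi> g)) \<in> hom G5 G5"
  unfolding hom_G5_additive by metis

lemma induces_Supp: "induces G5 \<Gamma> f \<phi> \<Longrightarrow> f \<in> alg_aut L \<Longrightarrow> s \<in> Supp G5 \<Gamma> \<Longrightarrow> \<phi> s \<in> Supp G5 \<Gamma>"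
proof -
  assume i: "induces G5 \<Gamma> f \<phi>" and f: "f \<in> alg_aut L" and s: "s \<in> Supp G5 \<Gamma>"
  obtain x where x: "x \<in> \<Gamma> s" "x \<noteq> 0" using s unfolding Supp_iff by blast
  have "f x \<in> \<Gamma> (\<phi> s)" using i s x unfolding induces_def by blast
  moreover have "f x \<noteq> 0" using alg_aut_eq_0_iff[OF f Gamma_carrier[OF x(1)]] x(2) by simp
  ultimately show ?thesis unfolding Supp_iff by blast
qed

lemma autoI:
  assumes "\<phi> \<in> hom G5 G5" "\<psi> \<in> hom G5 G5" "\<And>g. \<phi> (\<psi> g) = g" "\<And>g. \<psi> (\<phi> g) = g"
  shows "\<phi> \<in> auto G5"
proof -
  have "bij_betw \<phi> UNIV UNIV" by (rule bij_betw_byWitness[where f' = \<psi>]) (use assms in auto)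
  then show ?thesis using assms(1) by (simp add: auto_def Bij_def extensional_def)
qed

lemma induces_unique:
  assumes "f \<in> A_gr" "induces G5 \<Gamma> f \<phi>" "induces G5 \<Gamma> f \<psi>"
  shows "\<phi> = \<psi>"
proof (rule hom_eq_on_Supp[of G5])
  show "group G5" using comm_group_additive_group comm_group.axioms(2) by blast
  show "\<phi> \<in> hom G5 G5" "\<psi> \<in> hom G5 G5" using assms by (auto simp: induces_def auto_def)
  show "\<phi> s = \<psi> s" if "s \<in> Supp G5 \<Gamma>" for s
    by (rule alg_aut_image_Gamma_eq[OF A_gr_alg_aut[OF assms(1)] that])
      (use assms(2,3) that in \<open>simp_all add: induces_def del: Gamma5.simps\<close>)
qed

text \<open>The homomorphisms obtained from \<open>f\<close> and from its inverse compose to the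
  identity on the support, which generates \<open>G5\<close>.\<close>

lemma induces_exists:
  assumes f: "f \<in> A_gr"
  shows "\<exists>\<phi>. induces G5 \<Gamma> f \<phi>"
proof -
  note fa = A_gr_alg_aut[OF f]
  let ?g = "restrict (inv_into e6_carrier f) e6_carrier"
  have G: "group G5" using comm_group_additive_group comm_group.axioms(2) by blast
  have g: "?g \<in> A_gr"
    using subgroup.m_inv_closed[OF subgroup_Aut f] inv_BijGroup[OF alg_autD(3)[OF fa]] by simp
  have gf: "?g (f x) = x" and fg: "f (?g x) = x" if "x \<in> e6_carrier" for x
    using alg_autD(1,7)[OF fa] that by (auto simp: bij_betw_inv_into_left bij_betw_inv_into_right)
  obtain \<phi> where \<phi>: "\<phi> \<in> hom G5 G5" "\<forall>s\<in>Supp G5 \<Gamma>. \<phi> s \<in> Supp G5 \<Gamma> \<and> f ` \<Gamma> s = \<Gamma> (\<phi> s)"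
    using Aut_hom[OF f] by blast
  obtain \<psi> where \<psi>: "\<psi> \<in> hom G5 G5" "\<forall>s\<in>Supp G5 \<Gamma>. \<psi> s \<in> Supp G5 \<Gamma> \<and> ?g ` \<Gamma> s = \<Gamma> (\<psi> s)"
    using Aut_hom[OF g] by blast
  have id: "(\<lambda>g. g) \<in> hom G5 G5" by (simp add: hom_G5_additive)
  have c1: "(\<lambda>g. \<psi> (\<phi> g)) = (\<lambda>g. g)"
  proof (rule hom_eq_on_Supp[OF G _ id])
    show "(\<lambda>g. \<psi> (\<phi> g)) \<in> hom G5 G5" by (rule hom_G5_comp) (fact \<phi>(1) \<psi>(1))+
    fix s assume s: "s \<in> Supp G5 \<Gamma>"
    obtain x where x: "x \<in> \<Gamma> s" "x \<noteq> 0" using s unfolding Supp_iff by blast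
    have "?g (f x) \<in> \<Gamma> (\<psi> (\<phi> s))" using x(1) \<phi>(2) \<psi>(2) s by blast
    then show "\<psi> (\<phi> s) = s" using gf[OF Gamma_carrier[OF x(1)]] x Gamma_disjoint by metis
  qed
  have c2: "(\<lambda>g. \<phi> (\<psi> g)) = (\<lambda>g. g)"
  proof (rule hom_eq_on_Supp[OF G _ id])
    show "(\<lambda>g. \<phi> (\<psi> g)) \<in> hom G5 G5" by (rule hom_G5_comp) (fact \<phi>(1) \<psi>(1))+
    fix s assume s: "s \<in> Supp G5 \<Gamma>"
    obtain x where x: "x \<in> \<Gamma> s" "x \<noteq> 0" using s unfolding Supp_iff by blast
    have "f (?g x) \<in> \<Gamma> (\<phi> (\<psi> s))" using x(1) \<phi>(2) \<psi>(2) s by blast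
    then show "\<phi> (\<psi> s) = s" using fg[OF Gamma_carrier[OF x(1)]] x Gamma_disjoint by metis
  qed
  have "\<phi> \<in> auto G5" by (rule autoI[OF \<phi>(1) \<psi>(1) fun_cong[OF c2] fun_cong[OF c1]])
  then show ?thesis using \<phi>(2) unfolding induces_def by blast
qed

lemma induces_ex1: "f \<in> A_gr \<Longrightarrow> \<exists>!\<phi>. induces G5 \<Gamma> f \<phi>"
  using induces_exists induces_unique by blast

definition weyl_map :: "('f e6 \<Rightarrow> 'f e6) \<Rightarrow> g5 \<Rightarrow> g5" where
  "weyl_map f = (THE \<phi>. induces G5 \<Gamma> f \<phi>)"

lemma induces_weyl_map: "f \<in> A_gr \<Longrightarrow> induces G5 \<Gamma> f (weyl_map f)"
  unfolding weyl_map_def by (rule theI'[OF induces_ex1])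

lemma weyl_map_eqI: "f \<in> A_gr \<Longrightarrow> induces G5 \<Gamma> f \<phi> \<Longrightarrow> weyl_map f = \<phi>"
  using induces_unique induces_weyl_map by blast

lemma AutoGroup_G5_simps:
  "carrier (AutoGroup G5) = auto G5" "\<one>\<^bsub>AutoGroup G5\<^esub> = (\<lambda>x. x)"
  "\<phi> \<in> auto G5 \<Longrightarrow> \<psi> \<in> auto G5 \<Longrightarrow> \<phi> \<otimes>\<^bsub>AutoGroup G5\<^esub> \<psi> = (\<lambda>x. \<phi> (\<psi> x))"
  by (auto simp: AutoGroup_def BijGroup_def auto_def compose_def)

lemma group_AutoGroup_G5: "group (AutoGroup G5)"
  using comm_group_additive_group comm_group.axioms(2) group.AutoGroup by blast

lemma auto_comp: "\<phi> \<in> auto G5 \<Longrightarrow> \<psi> \<in> auto G5 \<Longrightarrow> (\<lambda>x. \<phi> (\<psi> x)) \<in> auto G5"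
  using group.is_monoid[OF group_AutoGroup_G5] monoid.m_closed[of "AutoGroup G5" \<phi> \<psi>]
  by (simp add: AutoGroup_G5_simps)

lemma weyl_map_hom: "weyl_map \<in> hom AG (AutoGroup G5)"
proof (rule homI)
  fix f g assume "f \<in> carrier AG" "g \<in> carrier AG"
  then have fg: "f \<in> A_gr" "g \<in> A_gr" by simp_all
  have comp: "compose e6_carrier f g \<in> A_gr"
    using subgroup.m_closed[OF subgroup_Aut fg] alg_autD(3)[OF A_gr_alg_aut[OF fg(1)]] alg_autD(3)[OF A_gr_alg_aut[OF fg(2)]]
    by (simp add: BijGroup_def)
  note i = induces_weyl_map[OF fg(1)] induces_weyl_map[OF fg(2)]
  have au: "weyl_map f \<in> auto G5" "weyl_map g \<in> auto G5" using i by (simp_all add: induces_def)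
  have "compose e6_carrier f g ` \<Gamma> s = \<Gamma> (weyl_map f (weyl_map g s))" if s: "s \<in> Supp G5 \<Gamma>" for s
  proof -
    have "g ` \<Gamma> s = \<Gamma> (weyl_map g s)" using i(2) s unfolding induces_def by blast
    moreover have "f ` \<Gamma> (weyl_map g s) = \<Gamma> (weyl_map f (weyl_map g s))"
      using i(1) induces_Supp[OF i(2) A_gr_alg_aut[OF fg(2)] s] unfolding induces_def by blast
    ultimately show ?thesis by (simp only: compose_image[OF Gamma_sub])
  qed
  then have "induces G5 \<Gamma> (compose e6_carrier f g) (\<lambda>x. weyl_map f (weyl_map g x))"
    using auto_comp[OF au] unfolding induces_def by blast
  then show "weyl_map (f \<otimes>\<^bsub>AG\<^esub> g) = weyl_map f \<otimes>\<^bsub>AutoGroup G5\<^esub> weyl_map g"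
    unfolding AG_simps(2)[OF fg] AutoGroup_G5_simps(3)[OF au] by (rule weyl_map_eqI[OF comp])
qed (use induces_weyl_map in \<open>simp add: induces_def AutoGroup_G5_simps\<close>)

lemma group_hom_weyl_map: "group_hom AG (AutoGroup G5) weyl_map"
  using group_AG group_AutoGroup_G5 weyl_map_hom by (simp add: group_hom_def group_hom_axioms_def)

lemma kernel_weyl_map: "kernel AG (AutoGroup G5) weyl_map = Stab_grading G5 L \<Gamma>"
proof -
  have stab: "f \<in> A_gr" if f: "f \<in> Stab_grading G5 L \<Gamma>" for f
  proof -
    have "(`) f ` components G5 \<Gamma> = (\<lambda>X. X) ` components G5 \<Gamma>"
      using f by (intro image_cong) (auto simp: Stab_grading_def)
    then show ?thesis using f by (simp add: Stab_grading_def Aut_grading_def)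
  qed
  have id: "(\<lambda>x. x) \<in> auto G5" by (rule autoI[of _ "\<lambda>x. x"]) (simp_all add: hom_G5_additive)
  have "weyl_map f = (\<lambda>x. x) \<longleftrightarrow> f \<in> Stab_grading G5 L \<Gamma>" if f: "f \<in> A_gr" for f
  proof
    assume w: "weyl_map f = (\<lambda>x. x)"
    have "f ` X = X" if X: "X \<in> components G5 \<Gamma>" for X
    proof -
      obtain s where "s \<in> Supp G5 \<Gamma>" "X = \<Gamma> s" using X unfolding components_def by (rule imageE)
      then show ?thesis using induces_weyl_map[OF f] unfolding w induces_def by blast
    qed
    then show "f \<in> Stab_grading G5 L \<Gamma>" using A_gr_alg_aut[OF f] by (simp add: Stab_grading_def)
  next
    assume st: "f \<in> Stab_grading G5 L \<Gamma>"
    have "f ` \<Gamma> s = \<Gamma> s" if "s \<in> Supp G5 \<Gamma>" for s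
    proof -
      have "\<Gamma> s \<in> components G5 \<Gamma>" using that unfolding components_def by (rule imageI)
      then show ?thesis using st unfolding Stab_grading_def by blast
    qed
    then have "induces G5 \<Gamma> f (\<lambda>x. x)" using id unfolding induces_def by blast
    then show "weyl_map f = (\<lambda>x. x)" by (rule weyl_map_eqI[OF f])
  qed
  then show ?thesis using stab by (auto simp: kernel_def AutoGroup_G5_simps)
qed

abbreviation WG :: "('f e6 \<Rightarrow> 'f e6) set monoid" where "WG \<equiv> weyl_group G5 L \<Gamma>"

lemma WG_eq: "WG = AG Mod kernel AG (AutoGroup G5) weyl_map"
  by (simp add: weyl_group_def kernel_weyl_map)

text \<open>All members of a coset of the kernel induce the same map, so the \<open>THE\<close> over
  the coset is the value at any representative.\<close>

lemma weyl_embedding_coset: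
  assumes "f \<in> A_gr"
  shows "weyl_embedding G5 \<Gamma> (kernel AG (AutoGroup G5) weyl_map #>\<^bsub>AG\<^esub> f) = weyl_map f"
    and "weyl_map ` (kernel AG (AutoGroup G5) weyl_map #>\<^bsub>AG\<^esub> f) = {weyl_map f}"
proof -
  interpret T: group_hom AG "AutoGroup G5" weyl_map by (rule group_hom_weyl_map)
  let ?w = "kernel AG (AutoGroup G5) weyl_map #>\<^bsub>AG\<^esub> f"
  have fc: "f \<in> carrier AG" using assms by simp
  have fw: "f \<in> ?w" by (rule group.rcos_self[OF group_AG fc T.subgroup_kernel])
  moreover have *: "g \<in> A_gr \<and> weyl_map g = weyl_map f" if gw: "g \<in> ?w" for g
  proof -
    obtain h where h: "h \<in> kernel AG (AutoGroup G5) weyl_map" "g = h \<otimes>\<^bsub>AG\<^esub> f"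
      using gw unfolding r_coset_def by blast
    then have hc: "h \<in> carrier AG" "weyl_map h = \<one>\<^bsub>AutoGroup G5\<^esub>" by (simp_all add: kernel_def)
    have "g \<in> carrier AG" unfolding h(2) by (rule monoid.m_closed[OF group.is_monoid[OF group_AG] hc(1) fc])
    moreover have "weyl_map g = weyl_map f"
      unfolding h(2) using T.hom_mult[OF hc(1) fc] T.hom_closed[OF fc] hc(2) by simp
    ultimately show ?thesis by simp
  qed
  ultimately show "weyl_map ` ?w = {weyl_map f}" by blast
  show "weyl_embedding G5 \<Gamma> ?w = weyl_map f"
    unfolding weyl_embedding_def
  proof (rule the_equality)
    show "\<forall>g\<in>?w. induces G5 \<Gamma> g (weyl_map f)" using * induces_weyl_map by metis
    show "\<phi> = weyl_map f" if "\<forall>g\<in>?w. induces G5 \<Gamma> g \<phi>" for \<phi>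
      using that fw weyl_map_eqI[OF assms] by blast
  qed
qed

lemma carrier_WG: "carrier WG = (\<lambda>f. kernel AG (AutoGroup G5) weyl_map #>\<^bsub>AG\<^esub> f) ` A_gr"
  unfolding WG_eq carrier_FactGroup by simp

lemma group_WG: "group WG"
proof -
  interpret T: group_hom AG "AutoGroup G5" weyl_map by (rule group_hom_weyl_map)
  show ?thesis unfolding WG_eq using T.normal_kernel normal.factorgroup_is_group by blast
qed

text \<open>The first isomorphism theorem for \<open>weyl_map\<close>, whose kernel is the
  stabilizer.\<close>

lemma weyl_embedding_mon: "weyl_embedding G5 \<Gamma> \<in> mon WG (AutoGroup G5)"
proof -
  interpret T: group_hom AG "AutoGroup G5" weyl_map by (rule group_hom_weyl_map)
  have eq: "weyl_embedding G5 \<Gamma> w = the_elem (weyl_map ` w)" if "w \<in> carrier WG" for w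
    using that weyl_embedding_coset unfolding carrier_WG by auto
  have hom: "(\<lambda>w. the_elem (weyl_map ` w)) \<in> hom WG (AutoGroup G5)"
    unfolding WG_eq by (rule T.FactGroup_hom)
  have inj: "inj_on (\<lambda>w. the_elem (weyl_map ` w)) (carrier WG)"
    unfolding WG_eq by (rule T.FactGroup_inj_on)
  interpret W: group WG by (rule group_WG)
  have "weyl_embedding G5 \<Gamma> \<in> hom WG (AutoGroup G5)"
    using hom eq by (auto simp: hom_def Pi_def)
  moreover have "inj_on (weyl_embedding G5 \<Gamma>) (carrier WG)"
    using inj eq by (simp cong: inj_on_cong)
  ultimately show ?thesis by (simp add: mon_def)
qed

section \<open>The image of the Weyl group in Aut(\<open>G5\<close>)\<close>

definition weyl_set :: "(g5 \<Rightarrow> g5) set" where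
  "weyl_set = weyl_map ` A_gr"

lemma weyl_embedding_image: "weyl_embedding G5 \<Gamma> ` carrier WG = weyl_set"
  using weyl_embedding_coset(1) by (auto simp: carrier_WG weyl_set_def image_image)

lemma weyl_set_auto: "weyl_set \<subseteq> auto G5"
  using induces_weyl_map by (auto simp: weyl_set_def induces_def)

lemma subgroup_weyl_set: "subgroup weyl_set (AutoGroup G5)"
proof -
  interpret T: group_hom AG "AutoGroup G5" weyl_map by (rule group_hom_weyl_map)
  show ?thesis using T.img_is_subgroup by (simp add: weyl_set_def)
qed

lemma weyl_set_comp: "\<phi> \<in> weyl_set \<Longrightarrow> \<psi> \<in> weyl_set \<Longrightarrow> (\<lambda>x. \<phi> (\<psi> x)) \<in> weyl_set"
proof -
  assume *: "\<phi> \<in> weyl_set" "\<psi> \<in> weyl_set"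
  then have "\<phi> \<in> auto G5" "\<psi> \<in> auto G5" using weyl_set_auto by blast+
  then show ?thesis using subgroup.m_closed[OF subgroup_weyl_set *] by (simp add: AutoGroup_G5_simps)
qed

lemma weyl_set_inverse:
  assumes "\<phi> \<in> weyl_set"
  obtains \<psi> where "\<psi> \<in> weyl_set" "\<And>g. \<phi> (\<psi> g) = g" "\<And>g. \<psi> (\<phi> g) = g"
proof -
  interpret A: group "AutoGroup G5" by (rule group_AutoGroup_G5)
  let ?\<psi> = "inv\<^bsub>AutoGroup G5\<^esub> \<phi>"
  have \<psi>: "?\<psi> \<in> weyl_set" using assms subgroup.m_inv_closed[OF subgroup_weyl_set] by blast
  have au: "\<phi> \<in> auto G5" "?\<psi> \<in> auto G5" using assms \<psi> weyl_set_auto by blast+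
  then have c: "\<phi> \<in> carrier (AutoGroup G5)" by (simp add: AutoGroup_G5_simps)
  have "(\<lambda>x. \<phi> (?\<psi> x)) = (\<lambda>x. x)" "(\<lambda>x. ?\<psi> (\<phi> x)) = (\<lambda>x. x)"
    using A.r_inv[OF c] A.l_inv[OF c] by (simp_all add: AutoGroup_G5_simps au)
  then show ?thesis using that[OF \<psi>] by (metis (no_types))
qed

lemma weyl_set_Supp:
  assumes "\<phi> \<in> weyl_set"
  shows "\<phi> s \<in> Supp G5 \<Gamma> \<longleftrightarrow> s \<in> Supp G5 \<Gamma>"
proof -
  have *: "\<phi> s \<in> Supp G5 \<Gamma>" if "\<phi> \<in> weyl_set" "s \<in> Supp G5 \<Gamma>" for \<phi> s
  proof -
    obtain f where f: "\<phi> = weyl_map f" "f \<in> A_gr" using \<open>\<phi> \<in> weyl_set\<close> unfolding weyl_set_def by (rule imageE)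
    show ?thesis unfolding f(1) using induces_Supp[OF induces_weyl_map[OF f(2)] A_gr_alg_aut[OF f(2)] \<open>s \<in> _\<close>] .
  qed
  obtain \<psi> where "\<psi> \<in> weyl_set" "\<And>g. \<phi> (\<psi> g) = g" "\<And>g. \<psi> (\<phi> g) = g"
    using weyl_set_inverse[OF assms] by blast
  then show ?thesis using *[OF assms] * by metis
qed

text \<open>\<open>(1, 0, 0)\<close> is the degree of the only component that is not a line.\<close>

lemma weyl_set_fixes_diag:
  assumes "\<phi> \<in> weyl_set"
  shows "\<phi> (1, 0, 0) = (1, 0, 0)"
proof (rule ccontr)
  assume ne: "\<phi> (1, 0, 0) \<noteq> (1, 0, 0)"
  obtain f where f: "f \<in> A_gr" "\<phi> = weyl_map f" using assms by (auto simp: weyl_set_def)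
  note fa = A_gr_alg_aut[OF f(1)]
  \<comment> \<open>Two independent elements: if the image component were a line, their images, and
    hence they themselves, would be proportional.\<close>
  let ?x = "mt (unit_mat 0 0 - unit_mat 1 1)" and ?y = "mt (unit_mat 0 0 - unit_mat 2 2)"
  have mem: "?x \<in> \<Gamma> (1, 0, 0)" "?y \<in> \<Gamma> (1, 0, 0)" by (rule mt_diag_mem)+
  have c: "?x \<in> e6_carrier" "?y \<in> e6_carrier" using Gamma_carrier[OF mem(1)] Gamma_carrier[OF mem(2)] by blast+
  have im: "f ` \<Gamma> (1, 0, 0) = \<Gamma> (\<phi> (1, 0, 0))"
    using induces_weyl_map[OF f(1)] diag_Supp unfolding f(2) induces_def by blast
  have xy: "f ?x \<in> \<Gamma> (\<phi> (1, 0, 0))" "f ?y \<in> \<Gamma> (\<phi> (1, 0, 0))"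
    using mem unfolding im[symmetric] by blast+
  have "(unit_mat 0 0 - unit_mat 1 1 :: 'f ^ 6 ^ 6) $ 0 $ 0 = 1" by (simp add: unit_mat_nth)
  then have "?x \<noteq> 0" unfolding mt_eq_0_iff by (metis zero_index zero_neq_one)
  then have "f ?x \<noteq> 0" using alg_aut_eq_0_iff[OF fa c(1)] by simp
  then obtain k where "f ?y = e6_scale k (f ?x)" using Gamma_line[OF ne xy(1) _ xy(2)] by blast
  then have "f ?y = f (e6_scale k ?x)" using c by (simp add: alg_autD[OF fa])
  then have "?y = e6_scale k ?x"
    using alg_autD(1)[OF fa] c by (metis bij_betw_inv_into_left carrier_scale)
  then have "unit_mat 0 0 - unit_mat 2 2 = mat_scale k (unit_mat 0 0 - unit_mat 1 1 :: 'f ^ 6 ^ 6)"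
    by (simp add: el_scale el_eq_iff)
  then have "(unit_mat 0 0 - unit_mat 2 2 :: 'f ^ 6 ^ 6) $ 2 $ 2 = mat_scale k (unit_mat 0 0 - unit_mat 1 1 :: 'f ^ 6 ^ 6) $ 2 $ 2"
    by simp
  then show False by (simp add: unit_mat_nth mat_scale_nth)
qed

text \<open>Inclusions suffice: as \<phi> is injective, the part of \<open>F x\<close> in degree
  \<open>\<phi> g\<close> is \<open>F\<close> of the part of \<open>x\<close> in degree
  \<open>g\<close>, so surjectivity of \<open>F\<close> turns them into equalities.\<close>

lemma weyl_setI:
  assumes F: "lie_aut F" and \<phi>: "\<phi> \<in> auto G5" and sub: "\<And>g x. x \<in> \<Gamma> g \<Longrightarrow> F x \<in> \<Gamma> (\<phi> g)"
  shows "\<phi> \<in> weyl_set"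
proof -
  let ?f = "restrict F e6_carrier"
  have fa: "?f \<in> alg_aut L" using F by (rule lie_aut_restrict)
  have hom: "\<phi> \<in> hom G5 G5" and bij: "bij \<phi>" using \<phi> by (auto simp: auto_def Bij_def)
  have Fsum: "F (\<Sum>i\<in>I. x i) = (\<Sum>i\<in>I. F (x i)) \<and> (\<Sum>i\<in>I. x i) \<in> e6_carrier"
    if "\<And>i. i \<in> I \<Longrightarrow> x i \<in> e6_carrier" "finite I" for I :: "g5 set" and x
    using that(2,1)
  proof induction
    case empty
    then show ?case using alg_aut_zero[OF fa] carrier_zero by simp
  next
    case (insert i I)
    then show ?case using F by (simp add: lie_aut_def carrier_add)
  qed
  have im: "?f ` \<Gamma> g = \<Gamma> (\<phi> g)" for g
  proof
    show "?f ` \<Gamma> g \<subseteq> \<Gamma> (\<phi> g)"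
    proof
      fix y assume "y \<in> ?f ` \<Gamma> g"
      then obtain x where "y = ?f x" "x \<in> \<Gamma> g" by (rule imageE)
      then show "y \<in> \<Gamma> (\<phi> g)" using sub[of x g] Gamma_carrier[of x g] by (simp del: Gamma5.simps)
    qed
    show "\<Gamma> (\<phi> g) \<subseteq> ?f ` \<Gamma> g"
    proof
      fix y assume y: "y \<in> \<Gamma> (\<phi> g)"
      have "F ` e6_carrier = e6_carrier" using F by (simp add: lie_aut_def bij_betw_def)
      then have "y \<in> F ` e6_carrier" using Gamma_carrier[OF y] by (simp only:)
      then obtain x where x: "y = F x" "x \<in> e6_carrier" by (rule imageE)
      note x = x(2) x(1)[symmetric]
      have pc: "proj h x \<in> e6_carrier" for h using Gamma_carrier[OF proj_mem[OF x(1)]] .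
      have "y = proj (\<phi> g) (F x)" using proj_Gamma[OF y, of "\<phi> g"] x by simp
      also have "F x = (\<Sum>h\<in>degrees. F (proj h x))"
        using Fsum[of degrees "\<lambda>h. proj h x"] pc finite_degrees by (simp add: sum_proj)
      also have "proj (\<phi> g) (\<Sum>h\<in>degrees. F (proj h x)) = (\<Sum>h\<in>degrees. if h = g then F (proj g x) else 0)"
        unfolding proj_sum
      proof (rule sum.cong[OF refl])
        fix h
        have "F (proj h x) \<in> \<Gamma> (\<phi> h)" by (rule sub[OF proj_mem[OF x(1)]])
        then show "proj (\<phi> g) (F (proj h x)) = (if h = g then F (proj g x) else 0)"
          using proj_Gamma[of "F (proj h x)" "\<phi> h" "\<phi> g"] bij by (auto simp: bij_def inj_eq)
      qed
      also have "\<dots> = F (proj g x)"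
      proof -
        have "F 0 = 0" using alg_aut_zero[OF fa] carrier_zero by simp
        then show ?thesis using finite_degrees proj_outside[of g x] by (auto simp: sum.delta)
      qed
      finally show "y \<in> ?f ` \<Gamma> g" using pc[of g] proj_mem[OF x(1), of g] by (auto simp: image_iff simp del: Gamma5.simps)
    qed
  qed
  have supp: "\<phi> s \<in> Supp G5 \<Gamma> \<longleftrightarrow> s \<in> Supp G5 \<Gamma>" for s
  proof -
    have "\<Gamma> (\<phi> s) = {0} \<longleftrightarrow> \<Gamma> s = {0}"
    proof
      assume *: "\<Gamma> (\<phi> s) = {0}"
      have "x = 0" if "x \<in> \<Gamma> s" for x
        using that im[of s] * alg_aut_eq_0_iff[OF fa Gamma_carrier[OF that]] by blast
      then show "\<Gamma> s = {0}" using Gamma_zero[of s] by blast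
    next
      assume "\<Gamma> s = {0}"
      then show "\<Gamma> (\<phi> s) = {0}" using im[of s] alg_aut_zero[OF fa] by (metis image_empty image_insert)
    qed
    then show ?thesis by (simp add: Supp_def del: Gamma5.simps)
  qed
  have "(`) ?f ` components G5 \<Gamma> = components G5 \<Gamma>"
  proof -
    have "(`) ?f ` components G5 \<Gamma> = (\<lambda>s. \<Gamma> (\<phi> s)) ` Supp G5 \<Gamma>"
      unfolding components_def image_image by (rule image_cong[OF refl]) (rule im)
    also have "\<dots> = \<Gamma> ` \<phi> ` Supp G5 \<Gamma>" by (simp only: image_image)
    also have "\<phi> ` Supp G5 \<Gamma> = Supp G5 \<Gamma>"
    proof
      show "\<phi> ` Supp G5 \<Gamma> \<subseteq> Supp G5 \<Gamma>" using supp by blast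
      show "Supp G5 \<Gamma> \<subseteq> \<phi> ` Supp G5 \<Gamma>"
      proof
        fix t assume t: "t \<in> Supp G5 \<Gamma>"
        obtain s where "t = \<phi> s" using bij by (metis bij_pointE)
        then show "t \<in> \<phi> ` Supp G5 \<Gamma>" using t supp by blast
      qed
    qed
    finally show ?thesis by (simp only: components_def)
  qed
  then have "?f \<in> A_gr" using fa by (simp add: Aut_grading_def)
  moreover have "induces G5 \<Gamma> ?f \<phi>" using \<phi> im unfolding induces_def by blast
  ultimately have "?f \<in> A_gr" "\<phi> = weyl_map ?f" using weyl_map_eqI[symmetric] by simp_all
  then show ?thesis unfolding weyl_set_def by (intro image_eqI)
qed

end

section \<open>The symplectic group over the field with two elements\<close>

lemma all_bit: "(\<forall>b::bit. P b) \<longleftrightarrow> P 0 \<and> P 1"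
  by (metis bit_not_zero_iff)

lemma ex_bit: "(\<exists>b::bit. P b) \<longleftrightarrow> P 0 \<or> P 1"
  by (metis bit_not_zero_iff)

text \<open>Tuple form of vectors, so that statements about all of them are settled by evaluation at
  sixteen tuples.\<close>

definition vec4 :: "bit \<Rightarrow> bit \<Rightarrow> bit \<Rightarrow> bit \<Rightarrow> bit ^ 4" where
  "vec4 a b c d = (\<chi> l. if l = 1 then a else if l = 2 then b else if l = 3 then c else d)"

lemma vec4_nth [simp]: "vec4 a b c d $ 1 = a" "vec4 a b c d $ 2 = b" "vec4 a b c d $ 3 = c"
    "vec4 a b c d $ 4 = d" "vec4 a b c d $ 0 = d"
  by (simp_all add: vec4_def)

lemma vec4_eq: "x = vec4 (x $ 1) (x $ 2) (x $ 3) (x $ 4)"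
  by (simp add: vec_eq_iff forall_4)

lemma all_bit_vec4: "(\<forall>x::bit ^ 4. P x) \<longleftrightarrow> (\<forall>a b c d. P (vec4 a b c d))"
  using vec4_eq by metis

lemma ex_bit_vec4: "(\<exists>x::bit ^ 4. P x) \<longleftrightarrow> (\<exists>a b c d. P (vec4 a b c d))"
  using vec4_eq by metis

lemma vec4_eq_iff [simp]: "vec4 a b c d = vec4 a' b' c' d' \<longleftrightarrow> a = a' \<and> b = b' \<and> c = c' \<and> d = d'"
  by (auto simp: vec_eq_iff forall_4)

lemma vec4_consts: "0 = vec4 0 0 0 0" "axis 1 1 = vec4 1 0 0 0" "axis 2 1 = vec4 0 1 0 0"
    "axis 3 1 = vec4 0 0 1 0" "axis 4 1 = vec4 0 0 0 1"
  by (simp_all add: vec_eq_iff forall_4 axis_nth)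

lemma vec4_add: "vec4 a b c d + vec4 a' b' c' d' = vec4 (a + a') (b + b') (c + c') (d + d')"
  by (simp add: vec_eq_iff forall_4)

text \<open>The bilinear form with matrix \<open>C4\<close>, written out for evaluation.\<close>

definition om :: "bit ^ 4 \<Rightarrow> bit ^ 4 \<Rightarrow> bit" where
  "om x y = x $ 1 * (y $ 2 + y $ 3 + y $ 4) + x $ 2 * (y $ 1 + y $ 3 + y $ 4)
     + x $ 3 * (y $ 1 + y $ 2 + y $ 4) + x $ 4 * (y $ 1 + y $ 2 + y $ 3)"

definition qf :: "bit ^ 4 \<Rightarrow> bit" where
  "qf k = k $ 1 * k $ 2 + k $ 1 * k $ 3 + k $ 1 * k $ 4 + k $ 2 * k $ 3 + k $ 2 * k $ 4 + k $ 3 * k $ 4"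

lemma om_vec4: "om (vec4 a b c d) (vec4 a' b' c' d') =
    a * (b' + c' + d') + b * (a' + c' + d') + c * (a' + b' + d') + d * (a' + b' + c')"
  by (simp add: om_def)

lemma qf_vec4: "qf (vec4 a b c d) = a * b + a * c + a * d + b * c + b * d + c * d"
  by (simp add: qf_def)

lemma om_add_left: "om (x + y) z = om x z + om y z"
  and om_add_right: "om z (x + y) = om z x + om z y"
  and om_scale_left: "om (a *s x) y = a * om x y"
  and om_scale_right: "om x (a *s y) = a * om x y"
  and om_commute: "om x y = om y x"
  and qf_add: "qf (x + y) = qf x + qf y + om x y"
  by (simp_all add: om_def qf_def algebra_simps)

lemma om_self [simp]: "om x x = 0"
proof -
  have "\<forall>x. om x x = 0" unfolding all_bit_vec4 om_vec4 all_bit by simp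
  then show ?thesis by blast
qed

lemma qf_zero [simp]: "qf 0 = 0"
  by (simp add: qf_def)

lemma om_rows: "(A ** C4 ** transpose A) $ i $ j = om (A $ i) (A $ j)"
  by (simp add: matrix_matrix_mult_def sum_4 C4_def transpose_def om_def algebra_simps)

lemma C4_nth: "C4 $ i $ j = (if i = j then 0 else 1)"
  by (simp add: C4_def)

lemma Sp4_iff_rows: "A \<in> Sp4 \<longleftrightarrow> (\<forall>i j. om (A $ i) (A $ j) = (if i = j then 0 else 1))"
  unfolding Sp4_def by (simp add: vec_eq_iff om_rows C4_nth)

text \<open>\<open>C4\<close> is the identity plus the all-ones matrix, and the latter has square 4
  times itself, which is 0.\<close>

lemma C4_sq: "C4 ** C4 = mat 1"
  by (simp add: vec_eq_iff matrix_matrix_mult_def sum_4 forall_4 C4_nth mat_nth)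

lemma transpose_C4: "transpose C4 = C4"
  by (auto simp: vec_eq_iff transpose_def C4_nth)

text \<open>As \<open>C4\<close> is an involution, the defining relation exhibits a right inverse of
  \<open>A\<close>. It is also a left inverse, which yields the relation for the transpose.\<close>

lemma Sp4_D:
  assumes "A \<in> Sp4"
  shows "A ** (C4 ** transpose A ** C4) = mat 1" "C4 ** transpose A ** C4 ** A = mat 1"
    "transpose A ** C4 ** A = C4"
proof -
  have "A ** (C4 ** transpose A ** C4) = (A ** C4 ** transpose A) ** C4" by (simp only: matrix_mul_assoc)
  also have "\<dots> = mat 1" using assms by (simp add: Sp4_def C4_sq)
  finally show 1: "A ** (C4 ** transpose A ** C4) = mat 1" .
  then show 2: "C4 ** transpose A ** C4 ** A = mat 1" by (simp only: matrix_left_right_inverse)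
  have "transpose A ** C4 ** A = (C4 ** C4) ** (transpose A ** C4 ** A)" by (simp add: C4_sq)
  also have "\<dots> = C4 ** (C4 ** transpose A ** C4 ** A)" by (simp only: matrix_mul_assoc)
  finally show "transpose A ** C4 ** A = C4" by (simp add: 2)
qed

lemma Sp4_transpose: "transpose A \<in> Sp4 \<longleftrightarrow> A \<in> Sp4"
  using Sp4_D(3)[of A] Sp4_D(3)[of "transpose A"] by (auto simp: Sp4_def transpose_transpose)

lemma Sp4_mult: "A \<in> Sp4 \<Longrightarrow> B \<in> Sp4 \<Longrightarrow> A ** B \<in> Sp4"
proof -
  assume A: "A \<in> Sp4" and B: "B \<in> Sp4"
  have "(A ** B) ** C4 ** transpose (A ** B) = A ** (B ** C4 ** transpose B) ** transpose A"
    by (simp only: matrix_transpose_mul matrix_mul_assoc)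
  then show ?thesis using A B by (simp add: Sp4_def)
qed

lemma Sp4_one: "mat 1 \<in> Sp4"
  by (simp add: Sp4_def transpose_simps)

lemma C4_Sp4: "C4 \<in> Sp4"
  by (simp add: Sp4_def C4_sq transpose_C4)

lemma Sp4_inverse: "A \<in> Sp4 \<Longrightarrow> C4 ** transpose A ** C4 \<in> Sp4"
  by (intro Sp4_mult C4_Sp4) (simp add: Sp4_transpose)

lemma group_Sp4: "group Sp4_group"
proof (rule groupI)
  fix A assume A: "A \<in> carrier Sp4_group"
  then have "C4 ** transpose A ** C4 \<in> carrier Sp4_group"
    using Sp4_inverse by (simp add: Sp4_group_def)
  moreover have "(C4 ** transpose A ** C4) \<otimes>\<^bsub>Sp4_group\<^esub> A = \<one>\<^bsub>Sp4_group\<^esub>"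
    using A Sp4_D(2) by (simp add: Sp4_group_def)
  ultimately show "\<exists>B\<in>carrier Sp4_group. B \<otimes>\<^bsub>Sp4_group\<^esub> A = \<one>\<^bsub>Sp4_group\<^esub>" by blast
qed (simp_all add: Sp4_group_def Sp4_mult Sp4_one matrix_mul_assoc)

definition dotp :: "bit ^ 4 \<Rightarrow> bit ^ 4 \<Rightarrow> bit" where
  "dotp x y = (\<Sum>i\<in>UNIV. x $ i * y $ i)"

lemma dotp_adjoint: "dotp (A *v x) y = dotp x (transpose A *v y)"
proof -
  have "dotp (A *v x) y = (\<Sum>i\<in>UNIV. \<Sum>j\<in>UNIV. x $ j * (A $ i $ j * y $ i))"
    by (simp add: dotp_def matrix_vector_mult_def sum_distrib_left sum_distrib_right mult_ac)
  also have "\<dots> = (\<Sum>j\<in>UNIV. \<Sum>i\<in>UNIV. x $ j * (A $ i $ j * y $ i))" by (rule sum.swap)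
  finally show ?thesis by (simp add: dotp_def matrix_vector_mult_def sum_distrib_left transpose_def)
qed

lemma om_dotp: "om x y = dotp x (C4 *v y)"
  by (simp add: om_def dotp_def matrix_vector_mult_def sum_4 C4_nth algebra_simps)

lemma om_C4: "om (C4 *v axis i 1) c = c $ i"
proof -
  have "om (C4 *v axis i 1) c = dotp (axis i 1) ((C4 ** C4) *v c)"
    by (simp add: om_dotp dotp_adjoint transpose_C4 matrix_vector_mul_assoc)
  then show ?thesis by (simp add: C4_sq dotp_def axis_def if_distrib if_distribR cong: if_cong)
qed

lemma matrix_axis: "A *v axis j (1 :: 'a::comm_ring_1) = column j A"
proof -
  have "(A *v axis j 1) $ i = (\<Sum>k\<in>UNIV. if k = j then A $ i $ j else 0)" for i
    unfolding matrix_vector_mult_def vec_lambda_beta axis_nth by (rule sum.cong) auto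
  then show ?thesis by (simp add: vec_eq_iff column_def)
qed

text \<open>The origin of \<open>kappa0\<close>: up to the constant 1 it is the quadratic form
  transported by \<open>C4\<close>. At 0 the dummy value does not fit this formula.\<close>

lemma kappa0_eq: "a \<noteq> 0 \<Longrightarrow> kappa0 a = qf (C4 *v a) + 1"
proof -
  have C: "C4 *v vec4 a b c d = vec4 (b + c + d) (a + c + d) (a + b + d) (a + b + c)" for a b c d
    by (simp add: vec_eq_iff forall_4 matrix_vector_mult_def sum_4 C4_nth)
  have card: "card {i. vec4 a b c d $ i = 1} = of_bool (a = 1) + of_bool (b = 1) + of_bool (c = 1) + of_bool (d = 1)" for a b c d
  proof -
    have "card {i. vec4 a b c d $ i = 1} = (\<Sum>i\<in>UNIV. of_bool (vec4 a b c d $ i = 1))"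
      unfolding card_eq_sum by (rule sum.mono_neutral_cong_left) auto
    then show ?thesis by (simp add: sum_4)
  qed
  have "\<forall>a. a \<noteq> 0 \<longrightarrow> kappa0 a = qf (C4 *v a) + 1"
    unfolding all_bit_vec4 vec4_consts(1) vec4_eq_iff C qf_vec4 kappa0_def card all_bit by simp
  then show "a \<noteq> 0 \<Longrightarrow> kappa0 a = qf (C4 *v a) + 1" by blast
qed

lemma qf_C4_axis: "qf (C4 *v axis i 1) = 1"
proof -
  have "\<forall>i. qf (C4 *v axis i 1) = 1"
    unfolding forall_4 by (simp add: qf_def matrix_vector_mult_def sum_4 C4_nth axis_nth)
  then show ?thesis by blast
qed

lemma om_axis: "om (axis i 1) (axis j 1) = (if i = j then 0 else 1)"
proof -
  have "\<forall>i j. om (axis i 1) (axis j 1) = (if i = j then 0 else 1)"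
    unfolding forall_4 by (simp add: om_def axis_nth)
  then show ?thesis by blast
qed

lemma Sp4_iff_columns: "A \<in> Sp4 \<longleftrightarrow> (\<forall>i j. om (column i A) (column j A) = (if i = j then 0 else 1))"
proof -
  have "column i A = transpose A $ i" for i by (simp add: column_def transpose_def vec_eq_iff)
  then show ?thesis using Sp4_transpose[of A] Sp4_iff_rows[of "transpose A"] by simp
qed

text \<open>Affine maps preserving \<open>qf\<close>: the linear part preserves the polarization \<open>om\<close>,
  and then \<open>om (A k) c = qf (A k) + qf k\<close> determines the translation part \<open>c\<close>.\<close>

lemma qf_preserving:
  assumes q: "\<And>k. qf (A *v k + c) = qf k"
  shows "A \<in> Sp4" "c = kappa A"
proof -
  have c0: "qf c = 0" using q[of 0] by simp
  have e: "qf (A *v k) + om (A *v k) c = qf k" for k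
    using q[of k] by (simp add: qf_add c0)
  have "om (A *v k) (A *v l) = om k l" for k l
  proof -
    have "qf (A *v k) + qf (A *v l) + om (A *v k) (A *v l) + (om (A *v k) c + om (A *v l) c) = qf k + qf l + om k l"
      using e[of "k + l"] by (simp add: matrix_vector_right_distrib qf_add om_add_left)
    then have "(qf (A *v k) + om (A *v k) c) + (qf (A *v l) + om (A *v l) c) + om (A *v k) (A *v l) = qf k + qf l + om k l"
      by (simp only: add_ac)
    then show ?thesis unfolding e by simp
  qed
  then have "om (column i A) (column j A) = (if i = j then 0 else 1)" for i j
    using om_axis by (metis matrix_axis)
  then show A: "A \<in> Sp4" by (simp add: Sp4_iff_columns)
  have "c $ i = kappa A $ i" for i
  proof -
    \<comment> \<open>The preimage of \<open>C4 *v axis i 1\<close> under \<open>A\<close>, since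
      the inverse of \<open>A\<close> is \<open>C4 ** transpose A ** C4\<close>. Pairing
      \<open>c\<close> with that vector picks out its coordinate \<open>i\<close>.\<close>
    let ?k = "C4 *v (A $ i)"
    have row: "A $ i = transpose A *v axis i 1"
      by (simp add: matrix_axis column_def transpose_def vec_eq_iff)
    have "A *v ?k = (A ** (C4 ** transpose A ** C4)) *v (C4 *v axis i 1)"
    proof -
      have "(A ** (C4 ** transpose A ** C4)) *v (C4 *v axis i 1) = A *v (C4 *v (transpose A *v ((C4 ** C4) *v axis i 1)))"
        by (simp only: matrix_vector_mul_assoc matrix_mul_assoc)
      then show ?thesis by (simp add: C4_sq row)
    qed
    then have k: "A *v ?k = C4 *v axis i 1" by (simp add: Sp4_D[OF A])
    have ci: "1 + c $ i = qf ?k" using e[of ?k] unfolding k by (simp add: qf_C4_axis om_C4)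
    \<comment> \<open>A second row pairs to 1 with row \<open>i\<close>, which is therefore nonzero
      as \<open>kappa0_eq\<close> requires.\<close>
    obtain j where "j \<noteq> i" by (cases "i = 1") (auto intro: that[of 2] that[of 1])
    then have "om (A $ i) (A $ j) = 1" using A by (simp add: Sp4_iff_rows)
    then have "A $ i \<noteq> 0" by (auto simp: om_def)
    then have "kappa A $ i = 1 + (1 + c $ i)" by (simp add: kappa_def kappa0_eq ci add.commute)
    then show ?thesis by (simp add: add.assoc[symmetric])
  qed
  then show "c = kappa A" by (simp add: vec_eq_iff)
qed

section \<open>Subsets of the six indices as vectors over two elements\<close>

lemma ex_6: "(\<exists>i::6. P i) \<longleftrightarrow> P 0 \<or> P 1 \<or> P 2 \<or> P 3 \<or> P 4 \<or> P 5"
  using forall_6[of "\<lambda>i. \<not> P i"] by blast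

lemma cls_vec4: "cls S = vec4 (of_bool (1 \<in> S) + of_bool (2 \<in> S)) (of_bool (1 \<in> S) + of_bool (3 \<in> S))
    (of_bool (1 \<in> S) + of_bool (4 \<in> S)) (of_bool (1 \<in> S) + of_bool (5 \<in> S))"
  by (simp add: vec_eq_iff forall_4 cls_nth)

lemma card_6: "card (S :: 6 set) = of_bool (0 \<in> S) + of_bool (1 \<in> S) + of_bool (2 \<in> S)
    + of_bool (3 \<in> S) + of_bool (4 \<in> S) + of_bool (5 \<in> S)"
proof -
  have "card S = (\<Sum>i\<in>UNIV. of_bool (i \<in> S))" unfolding card_eq_sum by (rule sum.mono_neutral_cong_left) auto
  also have "\<dots> = (\<Sum>i\<in>{0, 1, 2, 3, 4, 5}. of_bool (i \<in> S))" by (simp only: UNIV_6)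
  finally show ?thesis by simp
qed

lemma qf_cls: "card S = 3 \<Longrightarrow> qf (cls S) = 1"
  unfolding card_6 cls_vec4 qf_vec4
  by (cases "0 \<in> S"; cases "1 \<in> S"; cases "2 \<in> S"; cases "3 \<in> S"; cases "4 \<in> S"; cases "5 \<in> S") simp_all

text \<open>The form is 1 exactly at the ten vectors with two or three ones, and these match the ten
  complementary pairs of 3-sets.\<close>

lemma qf_eq_1_iff: "qf k = 1 \<longleftrightarrow> (\<exists>S. card S = 3 \<and> cls S = k)"
proof
  let ?Q = "\<lambda>k. \<exists>S. card S = 3 \<and> cls S = k"
  have ex: "?Q (vec4 a b c d)" if "card {x, y, z :: 6} = 3" "cls {x, y, z} = vec4 a b c d" for a b c d x y z
    using that by blast
  have "?Q (vec4 1 1 0 0)" by (rule ex[of 0 2 3]) (simp_all add: cls_vec4)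
  moreover have "?Q (vec4 1 0 1 0)" by (rule ex[of 0 2 4]) (simp_all add: cls_vec4)
  moreover have "?Q (vec4 1 0 0 1)" by (rule ex[of 0 2 5]) (simp_all add: cls_vec4)
  moreover have "?Q (vec4 0 1 1 0)" by (rule ex[of 0 3 4]) (simp_all add: cls_vec4)
  moreover have "?Q (vec4 0 1 0 1)" by (rule ex[of 0 3 5]) (simp_all add: cls_vec4)
  moreover have "?Q (vec4 0 0 1 1)" by (rule ex[of 0 4 5]) (simp_all add: cls_vec4)
  moreover have "?Q (vec4 1 1 1 0)" by (rule ex[of 2 3 4]) (simp_all add: cls_vec4)
  moreover have "?Q (vec4 1 1 0 1)" by (rule ex[of 2 3 5]) (simp_all add: cls_vec4)
  moreover have "?Q (vec4 1 0 1 1)" by (rule ex[of 2 4 5]) (simp_all add: cls_vec4)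
  moreover have "?Q (vec4 0 1 1 1)" by (rule ex[of 3 4 5]) (simp_all add: cls_vec4)
  ultimately have "\<forall>k. qf k = 1 \<longrightarrow> ?Q k"
    unfolding all_bit_vec4 all_bit qf_vec4 by simp
  then show "qf k = 1 \<Longrightarrow> ?Q k" by blast
qed (use qf_cls in auto)

text \<open>The fifteen pairs of indices match the fifteen nonzero vectors.\<close>

lemma nonzero_eq_cl_pair: "c \<noteq> 0 \<Longrightarrow> \<exists>i j. i \<noteq> j \<and> c = cl i + cl j"
proof -
  have "\<forall>c. c \<noteq> 0 \<longrightarrow> (\<exists>i j. i \<noteq> j \<and> c = cl i + cl j)"
    unfolding all_bit_vec4 all_bit vec4_consts(1) ex_6 cls_vec4 by (simp add: vec4_add)
  then show "c \<noteq> 0 \<Longrightarrow> \<exists>i j. i \<noteq> j \<and> c = cl i + cl j" by blast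
qed

section \<open>Transvections generate the symplectic group\<close>

definition transvection :: "bit ^ 4 \<Rightarrow> bit ^ 4 \<Rightarrow> bit ^ 4" where
  "transvection c v = v + om c v *s c"

definition transvection_mat :: "bit ^ 4 \<Rightarrow> bit ^ 4 ^ 4" where
  "transvection_mat c = (\<chi> i j. transvection c (axis j 1) $ i)"

lemma transvection_mat_vector: "transvection_mat c *v v = transvection c v"
proof -
  have "om c v = (\<Sum>j\<in>UNIV. om c (axis j 1) * v $ j)"
    by (simp add: om_def sum_4 axis_nth algebra_simps)
  then have "(transvection_mat c *v v) $ i = transvection c v $ i" for i
  proof -
    have "(transvection_mat c *v v) $ i = (\<Sum>j\<in>UNIV. (if j = i then v $ i else 0) + (om c (axis j 1) * v $ j) * c $ i)"
      unfolding matrix_vector_mult_def transvection_mat_def vec_lambda_beta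
      by (rule sum.cong) (auto simp: transvection_def axis_nth distrib_right distrib_left mult_ac)
    then show ?thesis by (simp add: sum.distrib transvection_def \<open>om c v = _\<close> sum_distrib_right[symmetric])
  qed
  then show ?thesis by (simp add: vec_eq_iff)
qed

lemma column_mult: "column j (A ** B) = A *v column j (B :: 'a::comm_ring_1 ^ 'n ^ 'n)"
  by (simp add: matrix_axis[symmetric] matrix_vector_mul_assoc)

lemma column_mat_1: "column j (mat 1) = axis j 1"
  by (simp add: vec_eq_iff column_def mat_nth axis_nth)

lemma transvection_transvection: "transvection c (transvection c v) = v"
  by (simp add: transvection_def om_add_right om_scale_right add.assoc)

lemma transvection_mat_sq: "transvection_mat c ** transvection_mat c = mat 1"
  unfolding matrix_eq
  by (simp add: matrix_vector_mul_assoc[symmetric] transvection_mat_vector transvection_transvection)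

lemma om_transvection: "om (transvection c x) (transvection c y) = om x y"
  by (cases "om c x"; cases "om c y")
    (simp_all add: transvection_def om_add_left om_add_right om_scale_left om_scale_right om_commute[of _ c] add.assoc)

text \<open>The second claim is what keeps columns that are already in place: they pair equally with
  the old and the new vector.\<close>

lemma transvection_move:
  assumes "om x y = 1"
  shows "transvection (x + y) x = y" "om x z = om y z \<Longrightarrow> transvection (x + y) z = z"
  using assms by (simp_all add: transvection_def om_add_left om_commute[of y x] bit_vec_add_cancel)

text \<open>Finite checks that at most one intermediate vector \<open>w\<close> is needed to reach a
  basis vector. In the third claim \<open>y\<close> stands for the fourth column; its existence
  excludes the sum of the first two basis vectors, the one candidate that would fail.\<close>

lemma transvection_search:
  "x \<noteq> 0 \<longrightarrow> x = axis 1 1 \<or> om x (axis 1 1) = 1 \<or> (\<exists>w. om x w = 1 \<and> om w (axis 1 1) = 1)"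
  "om x (axis 1 1) = 1 \<longrightarrow> x = axis 2 1 \<or> om x (axis 2 1) = 1 \<or>
     (\<exists>w. om w (axis 1 1) = 1 \<and> om x w = 1 \<and> om w (axis 2 1) = 1)"
  "om x (axis 1 1) = 1 \<and> om x (axis 2 1) = 1 \<and> (\<exists>y. om y x = 1 \<and> om y (axis 1 1) = 1 \<and> om y (axis 2 1) = 1)
     \<longrightarrow> x = axis 3 1 \<or> om x (axis 3 1) = 1"
  "om x (axis 1 1) = 1 \<and> om x (axis 2 1) = 1 \<and> om x (axis 3 1) = 1 \<longrightarrow> x = axis 4 1 \<or> om x (axis 4 1) = 1"
proof -
  have "\<forall>x. x \<noteq> 0 \<longrightarrow> x = axis 1 1 \<or> om x (axis 1 1) = 1 \<or> (\<exists>w. om x w = 1 \<and> om w (axis 1 1) = 1)"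
    unfolding vec4_consts all_bit_vec4 ex_bit_vec4 om_vec4 all_bit ex_bit vec4_eq_iff by simp
  then show "x \<noteq> 0 \<longrightarrow> x = axis 1 1 \<or> om x (axis 1 1) = 1 \<or> (\<exists>w. om x w = 1 \<and> om w (axis 1 1) = 1)" by blast
  have "\<forall>x. om x (axis 1 1) = 1 \<longrightarrow> x = axis 2 1 \<or> om x (axis 2 1) = 1 \<or>
     (\<exists>w. om w (axis 1 1) = 1 \<and> om x w = 1 \<and> om w (axis 2 1) = 1)"
    unfolding vec4_consts all_bit_vec4 ex_bit_vec4 om_vec4 all_bit ex_bit vec4_eq_iff by simp
  then show "om x (axis 1 1) = 1 \<longrightarrow> x = axis 2 1 \<or> om x (axis 2 1) = 1 \<or>
     (\<exists>w. om w (axis 1 1) = 1 \<and> om x w = 1 \<and> om w (axis 2 1) = 1)" by blast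
  have "\<forall>x. om x (axis 1 1) = 1 \<and> om x (axis 2 1) = 1 \<and> (\<exists>y. om y x = 1 \<and> om y (axis 1 1) = 1 \<and> om y (axis 2 1) = 1)
     \<longrightarrow> x = axis 3 1 \<or> om x (axis 3 1) = 1"
    unfolding vec4_consts all_bit_vec4 ex_bit_vec4 om_vec4 all_bit ex_bit vec4_eq_iff by simp
  then show "om x (axis 1 1) = 1 \<and> om x (axis 2 1) = 1 \<and> (\<exists>y. om y x = 1 \<and> om y (axis 1 1) = 1 \<and> om y (axis 2 1) = 1)
     \<longrightarrow> x = axis 3 1 \<or> om x (axis 3 1) = 1" by blast
  have "\<forall>x. om x (axis 1 1) = 1 \<and> om x (axis 2 1) = 1 \<and> om x (axis 3 1) = 1 \<longrightarrow> x = axis 4 1 \<or> om x (axis 4 1) = 1"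
    unfolding vec4_consts all_bit_vec4 om_vec4 all_bit vec4_eq_iff by simp
  then show "om x (axis 1 1) = 1 \<and> om x (axis 2 1) = 1 \<and> om x (axis 3 1) = 1 \<longrightarrow> x = axis 4 1 \<or> om x (axis 4 1) = 1"
    by blast
qed

text \<open>Transvections carry the columns of a symplectic matrix one after the other to the
  standard basis, so they generate the symplectic group.\<close>

lemma Sp4_transvection_induct:
  assumes "A \<in> Sp4" and one: "P (mat 1)" and step: "\<And>c A. P A \<Longrightarrow> P (transvection_mat c ** A)"
  shows "P A"
proof -
  define good where "good A \<longleftrightarrow> (\<forall>i j. om (column i A) (column j A) = (if i = j then 0 else 1 :: bit))" for A :: "bit ^ 4 ^ 4"
  let ?T = "\<lambda>c A. transvection_mat c ** A"
  have col: "column j (?T c A) = transvection c (column j A)" for c j and A :: "bit ^ 4 ^ 4"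
    by (simp add: column_mult transvection_mat_vector)
  have gd: "good (?T c A)" if "good A" for c A
    using that by (simp add: good_def col om_transvection)
  \<comment> \<open>Transvections are involutions, so the claim for the moved matrix yields the
    claim for \<open>A\<close>.\<close>
  have pull: "P A" if "P (?T c A)" for c A
    using step[OF that, of c] by (simp add: matrix_mul_assoc transvection_mat_sq)
  have omc: "om (column i A) (column j A) = 1" if "good A" "i \<noteq> j" for i j A
    using that by (simp add: good_def)
  have P4: "P A" if g: "good A" "column 1 A = axis 1 1" "column 2 A = axis 2 1" "column 3 A = axis 3 1" for A
  proof -
    have fin: "P A" if "column 1 A = axis 1 1" "column 2 A = axis 2 1" "column 3 A = axis 3 1" "column 4 A = axis 4 1" for A
    proof -
      have "\<forall>j. column j A = column j (mat 1)"
        unfolding forall_4 using that by (simp add: column_mat_1)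
      then have "A = mat 1" by (simp add: vec_eq_iff column_def)
      then show ?thesis using one by simp
    qed
    have o: "om (column 4 A) (axis 1 1) = 1" "om (column 4 A) (axis 2 1) = 1" "om (column 4 A) (axis 3 1) = 1"
      using omc[OF g(1), of 4 1] omc[OF g(1), of 4 2] omc[OF g(1), of 4 3] g(2-) by simp_all
    consider "column 4 A = axis 4 1" | "om (column 4 A) (axis 4 1) = 1" using transvection_search(4) o by blast
    then show ?thesis
    proof cases
      case 1
      then show ?thesis using fin g by blast
    next
      case 2
      let ?c = "column 4 A + axis 4 1"
      have "P (?T ?c A)"
        by (rule fin) (simp_all add: col g transvection_move[OF 2] o om_axis)
      then show ?thesis by (rule pull)
    qed
  qed
  have P3: "P A" if g: "good A" "column 1 A = axis 1 1" "column 2 A = axis 2 1" for A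
  proof -
    have o: "om (column 3 A) (axis 1 1) = 1" "om (column 3 A) (axis 2 1) = 1" "om (column 4 A) (axis 1 1) = 1"
      "om (column 4 A) (axis 2 1) = 1" "om (column 4 A) (column 3 A) = 1"
      using omc[OF g(1), of 3 1] omc[OF g(1), of 3 2] omc[OF g(1), of 4 1] omc[OF g(1), of 4 2] omc[OF g(1), of 4 3] g(2-)
      by simp_all
    consider "column 3 A = axis 3 1" | "om (column 3 A) (axis 3 1) = 1"
      using transvection_search(3)[of "column 3 A"] o by blast
    then show ?thesis
    proof cases
      case 1
      then show ?thesis using P4 g by blast
    next
      case 2
      let ?c = "column 3 A + axis 3 1"
      have "P (?T ?c A)"
        by (rule P4) (simp_all add: gd col g transvection_move[OF 2] o om_axis)
      then show ?thesis by (rule pull)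
    qed
  qed
  have P2: "P A" if g: "good A" "column 1 A = axis 1 1" for A
  proof -
    have one_step: "P A" if g: "good A" "column 1 A = axis 1 1" and 2: "om (column 2 A) (axis 2 1) = 1" for A
    proof -
      have o: "om (column 2 A) (axis 1 1) = 1" using omc[OF g(1), of 2 1] g(2) by simp
      let ?c = "column 2 A + axis 2 1"
      have "P (?T ?c A)"
        by (rule P3) (simp_all add: gd col g transvection_move[OF 2] o om_axis)
      then show ?thesis by (rule pull)
    qed
    have o: "om (column 2 A) (axis 1 1) = 1" using omc[OF g(1), of 2 1] g(2) by simp
    consider "column 2 A = axis 2 1" | "om (column 2 A) (axis 2 1) = 1"
      | w where "om w (axis 1 1) = 1" "om (column 2 A) w = 1" "om w (axis 2 1) = 1"
      using transvection_search(2)[of "column 2 A"] o by blast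
    then show ?thesis
    proof cases
      case 1
      then show ?thesis using P3 g by blast
    next
      case 2
      then show ?thesis using one_step g by blast
    next
      case (3 w)
      let ?c = "column 2 A + w"
      have "P (?T ?c A)"
        by (rule one_step) (simp_all add: gd col g transvection_move[OF 3(2)] o 3)
      then show ?thesis by (rule pull)
    qed
  qed
  have P1: "P A" if g: "good A" for A
  proof -
    have one_step: "P A" if g: "good A" and 2: "om (column 1 A) (axis 1 1) = 1" for A
    proof -
      let ?c = "column 1 A + axis 1 1"
      have "P (?T ?c A)"
        by (rule P2) (simp_all add: gd col g transvection_move[OF 2])
      then show ?thesis by (rule pull)
    qed
    have "om (column 1 A) (column 2 A) = 1" using omc[OF g, of 1 2] by simp
    then have "column 1 A \<noteq> 0" by (auto simp: om_def)
    then consider "column 1 A = axis 1 1" | "om (column 1 A) (axis 1 1) = 1"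
      | w where "om (column 1 A) w = 1" "om w (axis 1 1) = 1"
      using transvection_search(1)[of "column 1 A"] by blast
    then show ?thesis
    proof cases
      case 1
      then show ?thesis using P2 g by blast
    next
      case 2
      then show ?thesis using one_step g by blast
    next
      case (3 w)
      let ?c = "column 1 A + w"
      have "P (?T ?c A)"
        by (rule one_step) (simp_all add: gd col g transvection_move[OF 3(1)] 3)
      then show ?thesis by (rule pull)
    qed
  qed
  show ?thesis using P1 assms(1) by (simp add: Sp4_iff_columns good_def)
qed

section \<open>Matrices of the elements of the Weyl group\<close>

text \<open>The homomorphism with the matrix of the theorem; \<open>of_int n\<close> in the type
  \<open>bit\<close> is the parity of \<open>n\<close>.\<close>

definition block_map :: "bit ^ 4 ^ 4 \<Rightarrow> bit ^ 4 \<Rightarrow> bit \<Rightarrow> int \<Rightarrow> g5 \<Rightarrow> g5" where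
  "block_map A r e m = (\<lambda>(k0, k, n). (k0 + dotp r k + e * of_int n, A *v k + of_int n *s kappa A, m * n))"

lemma dotp_zero [simp]: "dotp r 0 = 0" "dotp 0 k = 0"
  by (simp_all add: dotp_def)

lemma dotp_add_left: "dotp (r + r') k = dotp r k + dotp r' k"
  and dotp_add_right: "dotp r (k + k') = dotp r k + dotp r k'"
  by (simp_all add: dotp_def algebra_simps sum.distrib)

lemma dotp_axis: "dotp r (axis j 1) = r $ j"
proof -
  have "dotp r (axis j 1) = (\<Sum>i\<in>UNIV. if i = j then r $ j else 0)"
    unfolding dotp_def axis_nth by (rule sum.cong) auto
  then show ?thesis by simp
qed

lemma block_matrix_block_map:
  "block_matrix (block_map A r e m) = ((1, r, e), (0, A, kappa A), (0, 0, m))"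
  by (simp add: block_matrix_def block_map_def Let_def dotp_axis matrix_axis vec_eq_iff column_def)

lemma additive_int:
  assumes "\<And>x y :: int. f (x + y) = f x + (f y :: 'a::ring_1)"
  shows "f n = of_int n * f 1"
proof -
  have z: "f 0 = 0" using assms[of 0 0] by simp
  show ?thesis
  proof (induction n rule: int_induct[of _ 0])
    case (step1 i)
    then show ?case using assms[of i 1] by (simp add: algebra_simps)
  next
    case (step2 i)
    then show ?case using assms[of "i - 1" 1] by (simp add: algebra_simps)
  qed (simp add: z)
qed

lemma additive_bit4:
  assumes "\<And>x y :: bit ^ 4. f (x + y) = f x + (f y :: bit)"
  shows "f k = (\<Sum>j\<in>UNIV. f (axis j 1) * k $ j)"
proof -
  have z: "f 0 = 0" using assms[of 0 0] by simp
  have ax: "f (axis j b) = f (axis j 1) * b" for j b by (cases "b = 0") (simp_all add: z)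
  have "k = axis 1 (k $ 1) + axis 2 (k $ 2) + axis 3 (k $ 3) + axis 4 (k $ 4)"
    by (simp add: vec_eq_iff forall_4 axis_nth)
  then have "f k = f (axis 1 (k $ 1) + axis 2 (k $ 2) + axis 3 (k $ 3) + axis 4 (k $ 4))" by simp
  also have "\<dots> = (\<Sum>j\<in>UNIV. f (axis j 1) * k $ j)"
    by (simp only: assms ax[of _ "k $ _"] sum_4)
  finally show ?thesis .
qed

context e6_lie
begin

lemma Supp_pm1:
  assumes "n = 1 \<or> n = -1"
  shows "(b, k, n) \<in> Supp G5 \<Gamma> \<longleftrightarrow> qf k = 1"
proof
  assume "(b, k, n) \<in> Supp G5 \<Gamma>"
  then show "qf k = 1"
    by (cases rule: Supp_cases) (use assms qf_cls in auto)
next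
  assume "qf k = 1"
  then obtain S where S: "card S = 3" "cls S = k" unfolding qf_eq_1_iff by blast
  show "(b, k, n) \<in> Supp G5 \<Gamma>"
    using assms up_Supp[OF S(1), of b] rel_Supp(2)[OF rel_up_dn[OF S(1), of b]] by (auto simp: S(2))
qed

lemma weyl_set_block_form:
  assumes \<phi>: "\<phi> \<in> weyl_set"
  obtains A r e m where "A \<in> Sp4" "m \<in> {1, -1}" "\<phi> = block_map A r e m"
proof -
  have add: "\<phi> (x + y) = \<phi> x + \<phi> y" if "\<phi> \<in> weyl_set" for \<phi> x y
    using that weyl_set_auto by (auto simp: auto_def hom_G5_additive simp del: split_paired_All)
  have third: "snd (snd (\<phi> (k0, k, n))) = n * snd (snd (\<phi> (0, 0, 1)))" if \<phi>: "\<phi> \<in> weyl_set" for \<phi> k0 k n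
  proof -
    \<comment> \<open>Elements with \<open>n = 0\<close> are 2-torsion, so the integer coordinate of
      their image is 0.\<close>
    have "\<phi> (k0, k, 0) + \<phi> (k0, k, 0) = \<phi> ((k0, k, 0) + (k0, k, 0))" by (simp only: add[OF \<phi>])
    also have "\<dots> = 0" using add[OF \<phi>, of 0 0] by (simp add: zero_prod_def)
    finally have "snd (snd (\<phi> (k0, k, 0) + \<phi> (k0, k, 0))) = 0" by simp
    then have z: "snd (snd (\<phi> (k0, k, 0))) = 0" by simp
    have "snd (snd (\<phi> (0, 0, x + y))) = snd (snd (\<phi> (0, 0, x))) + snd (snd (\<phi> (0, 0, y)))" for x y
      using add[OF \<phi>, of "(0, 0, x)" "(0, 0, y)"] by simp
    from additive_int[of "\<lambda>n. snd (snd (\<phi> (0, 0, n)))" n, OF this]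
    have "snd (snd (\<phi> (0, 0, n))) = n * snd (snd (\<phi> (0, 0, 1)))" by simp
    moreover have "\<phi> (k0, k, n) = \<phi> (k0, k, 0) + \<phi> (0, 0, n)"
      using add[OF \<phi>, of "(k0, k, 0)" "(0, 0, n)"] by simp
    ultimately show ?thesis using z by simp
  qed
  define m where "m = snd (snd (\<phi> (0, 0, 1)))"
  obtain \<psi> where \<psi>: "\<psi> \<in> weyl_set" "\<And>g. \<phi> (\<psi> g) = g" "\<And>g. \<psi> (\<phi> g) = g"
    using weyl_set_inverse[OF \<phi>] by blast
  have "snd (snd (\<phi> (\<psi> (0, 0, 1)))) = snd (snd (\<psi> (0, 0, 1))) * m"
    unfolding m_def using third[OF \<phi>, of "fst (\<psi> (0, 0, 1))" "fst (snd (\<psi> (0, 0, 1)))" "snd (snd (\<psi> (0, 0, 1)))"] by simp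
  then have "snd (snd (\<psi> (0, 0, 1))) * m = 1" by (simp add: \<psi>(2))
  then have m: "m \<in> {1, -1}" unfolding zmult_eq_1_iff by (elim disjE conjE) simp_all
  define A :: "bit ^ 4 ^ 4" where "A = (\<chi> i j. fst (snd (\<phi> (0, axis j 1, 0))) $ i)"
  define r :: "bit ^ 4" where "r = (\<chi> j. fst (\<phi> (0, axis j 1, 0)))"
  define e where "e = fst (\<phi> (0, 0, 1))"
  define c where "c = fst (snd (\<phi> (0, 0, 1)))"
  have a1: "\<phi> (k0, 0, 0) = (k0, 0, 0)" for k0
    using weyl_set_fixes_diag[OF \<phi>] add[OF \<phi>, of 0 0] by (cases "k0 = 0") (simp_all add: zero_prod_def)
  have a2: "\<phi> (0, k, 0) = (dotp r k, A *v k, 0)" for k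
  proof -
    have ak: "\<phi> (0, x + y, 0) = \<phi> (0, x, 0) + \<phi> (0, y, 0)" for x y
      using add[OF \<phi>, of "(0, x, 0)" "(0, y, 0)"] by simp
    have "fst (\<phi> (0, k, 0)) = (\<Sum>j\<in>UNIV. fst (\<phi> (0, axis j 1, 0)) * k $ j)"
      by (rule additive_bit4) (simp add: ak)
    moreover have "fst (snd (\<phi> (0, k, 0))) $ i = (\<Sum>j\<in>UNIV. fst (snd (\<phi> (0, axis j 1, 0))) $ i * k $ j)" for i
      by (rule additive_bit4[of "\<lambda>k. fst (snd (\<phi> (0, k, 0))) $ i"]) (simp add: ak)
    moreover have "snd (snd (\<phi> (0, k, 0))) = 0" using third[OF \<phi>, of 0 k 0] by simp
    ultimately show ?thesis
      by (simp add: prod_eq_iff r_def A_def dotp_def vec_eq_iff matrix_vector_mult_def)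
  qed
  have a3: "\<phi> (0, 0, n) = (e * of_int n, of_int n *s c, m * n)" for n
  proof -
    have an: "\<phi> (0, 0, x + y) = \<phi> (0, 0, x) + \<phi> (0, 0, y)" for x y
      using add[OF \<phi>, of "(0, 0, x)" "(0, 0, y)"] by simp
    have "fst (\<phi> (0, 0, n)) = of_int n * e" unfolding e_def
      by (rule additive_int) (simp add: an)
    moreover have "fst (snd (\<phi> (0, 0, n))) $ i = of_int n * c $ i" for i unfolding c_def
      by (rule additive_int[of "\<lambda>n. fst (snd (\<phi> (0, 0, n))) $ i"]) (simp add: an)
    moreover have "snd (snd (\<phi> (0, 0, n))) = n * m" using third[OF \<phi>, of 0 0 n] by (simp add: m_def)
    ultimately show ?thesis by (simp add: prod_eq_iff vec_eq_iff mult.commute)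
  qed
  have form: "\<phi> (k0, k, n) = (k0 + dotp r k + e * of_int n, A *v k + of_int n *s c, m * n)" for k0 k n
  proof -
    have "\<phi> (k0, k, n) = \<phi> ((k0, 0, 0) + (0, k, 0) + (0, 0, n))" by simp
    also have "\<dots> = \<phi> (k0, 0, 0) + \<phi> (0, k, 0) + \<phi> (0, 0, n)" by (simp only: add[OF \<phi>])
    finally show ?thesis by (simp add: a1 a2 a3)
  qed
  \<comment> \<open>In integer degrees 1 and -1 the support is described by \<open>qf\<close>, and
    \<phi> preserves the support.\<close>
  have q: "qf (A *v k + c) = qf k" for k
  proof -
    have "qf (A *v k + c) = 1 \<longleftrightarrow> \<phi> (0, k, 1) \<in> Supp G5 \<Gamma>"
      unfolding form using m by (simp add: Supp_pm1)
    also have "\<dots> \<longleftrightarrow> qf k = 1" by (simp add: weyl_set_Supp[OF \<phi>] Supp_pm1)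
    finally show ?thesis by (metis bit_not_one_iff)
  qed
  have "\<phi> = block_map A r e m"
    using form by (simp add: fun_eq_iff block_map_def qf_preserving(2)[OF q, symmetric])
  then show ?thesis using that qf_preserving(1)[OF q] m by blast
qed

section \<open>The effect of rotations on degrees\<close>

definition pairing_bit :: "6 \<Rightarrow> 6 \<Rightarrow> bit ^ 4 \<Rightarrow> int \<Rightarrow> bit" where
  "pairing_bit i j k n = om (cl i + cl j) k + of_bool (i = 0) * of_int n + of_bool (j = 0) * of_int n"

lemma om_cl_cls: "i \<noteq> 0 \<Longrightarrow> om (cl i) (cls S) = of_nat (card S) + of_bool (0 \<in> S) + of_bool (i \<in> S)"
proof -
  have "\<forall>i. i \<noteq> 0 \<longrightarrow> om (cl i) (cls S) = of_nat (card S) + of_bool (0 \<in> S) + of_bool (i \<in> S)"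
    unfolding forall_6 cls_vec4 om_vec4 card_6
    by (cases "0 \<in> S"; cases "1 \<in> S"; cases "2 \<in> S"; cases "3 \<in> S"; cases "4 \<in> S"; cases "5 \<in> S") simp_all
  then show "i \<noteq> 0 \<Longrightarrow> om (cl i) (cls S) = of_nat (card S) + of_bool (0 \<in> S) + of_bool (i \<in> S)" by blast
qed

text \<open>\<open>pairing_bit i j\<close> extends the form against \<open>cl i + cl j\<close> to a
  character of \<open>G5\<close> that counts, mod 2, how many of \<open>i\<close> and
  \<open>j\<close> lie in \<open>S\<close>. As \<open>cl 0 = 0\<close>, the contribution of the
  index 0 has to be supplied by the parity of \<open>n\<close>, which is that of
  \<open>card S\<close>.\<close>

lemma pairing_bit_cls:
  assumes "of_int n = (of_nat (card S) :: bit)"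
  shows "pairing_bit i j (cls S) n = of_bool (i \<in> S) + of_bool (j \<in> S)"
proof -
  have "om (cl i) (cls S) + of_bool (i = 0) * of_int n = of_nat (card S) + of_bool (0 \<in> S) + of_bool (i \<in> S)" for i
    using assms by (cases "i = 0") (simp_all add: om_cl_cls add.assoc, simp add: om_def)
  note om = this
  have "pairing_bit i j (cls S) n = (om (cl i) (cls S) + of_bool (i = 0) * of_int n)
      + (om (cl j) (cls S) + of_bool (j = 0) * of_int n)"
    by (simp only: pairing_bit_def om_add_left distrib_right add_ac)
  also have "\<dots> = (of_nat (card S) + of_bool (0 \<in> S) + of_bool (i \<in> S))
      + (of_nat (card S) + of_bool (0 \<in> S) + of_bool (j \<in> S))"
    by (simp only: om)
  also have "\<dots> = (of_nat (card S) + of_nat (card S)) + (of_bool (0 \<in> S) + of_bool (0 \<in> S)) + (of_bool (i \<in> S) + of_bool (j \<in> S))"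
    by (simp only: add_ac)
  finally show ?thesis by simp
qed

lemma pairing_bit_crossing: "card S = 3 \<Longrightarrow> n = 1 \<or> n = -1 \<Longrightarrow> pairing_bit i j (cls S) n = 1 \<longleftrightarrow> crossing i j S"
  by (subst pairing_bit_cls) (auto simp: crossing_def)

lemma flip_pairing_bit: "i \<noteq> j \<Longrightarrow> flip i j a = (bit_sign (pairing_bit i j (cl a) 1) :: 'f)"
  using pairing_bit_cls[of 1 "{a}" i j] by (auto simp: flip_def)

lemma pairing_bit_add: "pairing_bit i j (k + l) (n + m) = pairing_bit i j k n + pairing_bit i j l m"
  by (simp add: pairing_bit_def om_add_right distrib_left add_ac)

lemma pairing_bit_0: "pairing_bit i j k 0 = om (cl i + cl j) k"
  by (simp add: pairing_bit_def)

lemma pairing_bit_2: "pairing_bit i j 0 2 = 0" "pairing_bit i j 0 (-2) = 0"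
  by (simp_all add: pairing_bit_def om_def)

text \<open>The transvection of \<open>G5\<close> at the degree of the rotation generator.\<close>

definition rot_degree :: "6 \<Rightarrow> 6 \<Rightarrow> bit \<Rightarrow> g5 \<Rightarrow> g5" where
  "rot_degree i j e = (\<lambda>(k0, k, n). (k0 + e * pairing_bit i j k n, k + pairing_bit i j k n *s (cl i + cl j), n))"

lemma rot_degree_eq:
  "rot_degree i j e (k0, k, n) = (if pairing_bit i j k n = 1 then (e, cl i + cl j, 0) + (k0, k, n) else (k0, k, n))"
  by (cases "pairing_bit i j k n") (simp_all add: rot_degree_def add_ac)

lemma pairing_bit_shift: "pairing_bit i j (k + b *s (cl i + cl j)) n = pairing_bit i j k n"
  using pairing_bit_add[of i j k "b *s (cl i + cl j)" n 0]
  by (simp add: pairing_bit_0 om_scale_right)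

lemma rot_degree_auto: "rot_degree i j e \<in> auto G5"
proof (rule autoI)
  show "rot_degree i j e \<in> hom G5 G5" "rot_degree i j e \<in> hom G5 G5"
    by (simp_all add: hom_G5_additive rot_degree_def pairing_bit_add distrib_left vec_eq_iff algebra_simps)
  have "x + (e * b + e * b) = x" for x b :: bit by simp
  then show "rot_degree i j e (rot_degree i j e g) = g" "rot_degree i j e (rot_degree i j e g) = g" for g
    by (cases g; simp add: rot_degree_def pairing_bit_shift add.assoc)+
qed

lemma ad_mat_minus: "ad_mat (- X) A = - ad_mat X A" "ad_mat X (- A) = - ad_mat X A"
  by (simp_all add: ad_mat_def matrix_add_simps)

lemma mt_add: "mt (A + B) = mt A + mt B" and mt_scale: "mt (mat_scale c A) = e6_scale c (mt A)"
  by (simp_all add: el_add el_scale)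

text \<open>The conjugate of \<open>A\<close> is E + O1, where \<open>E\<close> is even and
  \<open>O1\<close> odd in ad X; reversing the rotation gives E - O1. The reversal is also
  conjugation by the half turn, which acts on \<open>A\<close> by a sign. Hence one part vanishes,
  and the other has the expected degree.\<close>

lemma rotation_mt_mem:
  assumes ij: "i \<noteq> j" and ab: "a * b = -1" and X: "mt (rot_gen i j a b) \<in> \<Gamma> (e, cl i + cl j, 0)"
    and A: "mt A \<in> \<Gamma> (k0, k, 0)"
  shows "mt (qrot (rot_gen i j a b) ** A ** qrot (- rot_gen i j a b)) \<in> \<Gamma> (rot_degree i j e (k0, k, 0))"
proof -
  let ?X = "rot_gen i j a b" and ?b = "pairing_bit i j k 0" and ?h = "(e, cl i + cl j, 0 :: int)" and ?g = "(k0, k, 0 :: int)"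
  let ?Q = "qrot ?X" and ?R = "qrot (- ?X)" and ?F = "f_diag i j :: 'f ^ 6 ^ 6"
  have X3: "?X ** ?X ** ?X = - ?X" using quarter_rot_gen[OF ij ab] by (simp add: quarter_def)
  have X3': "(- ?X) ** (- ?X) ** (- ?X) = - (- ?X)" by (simp add: matrix_add_simps X3)
  have QR: "?Q ** ?R = mat 1" "?R ** ?Q = mat 1" by (rule qrot_inverse[OF X3])+
  have QQ: "?Q ** ?Q = ?F" using ij ab by (rule qrot_rot_gen_sq)
  have RR: "?R ** ?R = ?F" unfolding rot_gen_minus using ij by (rule qrot_rot_gen_sq) (simp add: ab)
  have FAF: "?F ** A ** ?F = mat_scale (bit_sign ?b) A"
  proof -
    have "flip i j c * A $ c $ d * flip i j d = bit_sign ?b * A $ c $ d" for c d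
    proof (cases "A $ c $ d = 0")
      case False
      then have k: "k = cl c + cl d" using A unfolding mt_mem by auto
      have "pairing_bit i j k 2 = ?b" by (simp add: pairing_bit_def)
      then have "?b = pairing_bit i j (cl c) 1 + pairing_bit i j (cl d) 1"
        using pairing_bit_add[of i j "cl c" "cl d" 1 1] by (simp add: k)
      then show ?thesis by (simp add: flip_pairing_bit[OF ij] bit_sign_add mult_ac)
    qed simp
    then show ?thesis by (simp add: f_diag_eq vec_eq_iff diag_mat_mult_left diag_mat_mult_right mat_scale_nth)
  qed
  define E where "E = A + mat_scale (7/6) (ad_mat ?X (ad_mat ?X A)) + mat_scale (1/6) (ad_mat ?X (ad_mat ?X (ad_mat ?X (ad_mat ?X A))))"
  define O1 where "O1 = mat_scale (4/3) (ad_mat ?X A) + mat_scale (1/3) (ad_mat ?X (ad_mat ?X (ad_mat ?X A)))"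
  have Q1: "?Q ** A ** ?R = E + O1" unfolding qrot_conj_ad[OF X3] E_def O1_def by (simp only: add_ac)
  have Q2: "?R ** A ** ?Q = E - O1"
    using qrot_conj_ad[OF X3', of A] unfolding E_def O1_def
    by (simp add: ad_mat_minus mat_scale_simps algebra_simps)
  have "?R ** A ** ?Q = (?R ** ?R) ** (?Q ** A ** ?R) ** (?Q ** ?Q)"
  proof -
    have "(?R ** ?R) ** (?Q ** A ** ?R) ** (?Q ** ?Q) = ?R ** (?R ** ?Q) ** A ** (?R ** ?Q) ** ?Q"
      by (simp only: matrix_mul_assoc)
    then show ?thesis by (simp add: QR)
  qed
  also have "\<dots> = (?F ** ?Q) ** A ** (?R ** ?F)" unfolding RR QQ by (simp only: matrix_mul_assoc)
  also have "?F ** ?Q = ?Q ** ?F" unfolding QQ[symmetric] by (simp only: matrix_mul_assoc)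
  also have "?R ** ?F = ?F ** ?R" unfolding RR[symmetric] by (simp only: matrix_mul_assoc)
  also have "(?Q ** ?F) ** A ** (?F ** ?R) = ?Q ** (?F ** A ** ?F) ** ?R" by (simp only: matrix_mul_assoc)
  also have "\<dots> = mat_scale (bit_sign ?b) (?Q ** A ** ?R)"
    unfolding FAF by (simp only: mat_scale_mult_left mat_scale_mult_right)
  finally have key: "E - O1 = mat_scale (bit_sign ?b) (E + O1)" unfolding Q1 Q2 .
  have ad: "mt (ad_mat ?X B) \<in> \<Gamma> (?h + s)" if "mt B \<in> \<Gamma> s" for B s
    using Gamma_br[OF X that] by (simp only: br_0_0 ad_mat_def)
  have hh: "?h + (?h + s) = s" for s by (cases s) (simp add: add.assoc[symmetric])
  have c1: "mt (ad_mat ?X A) \<in> \<Gamma> (?h + ?g)" by (rule ad[OF A])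
  have c2: "mt (ad_mat ?X (ad_mat ?X A)) \<in> \<Gamma> ?g" using ad[OF c1] unfolding hh .
  have c3: "mt (ad_mat ?X (ad_mat ?X (ad_mat ?X A))) \<in> \<Gamma> (?h + ?g)" by (rule ad[OF c2])
  have c4: "mt (ad_mat ?X (ad_mat ?X (ad_mat ?X (ad_mat ?X A)))) \<in> \<Gamma> ?g" using ad[OF c3] unfolding hh .
  have E: "mt E \<in> \<Gamma> ?g" unfolding E_def mt_add mt_scale using A c2 c4 by (intro Gamma_add Gamma_scale)
  have O1: "mt O1 \<in> \<Gamma> (?h + ?g)" unfolding O1_def mt_add mt_scale using c1 c3 by (intro Gamma_add Gamma_scale)
  show ?thesis
  proof (cases "?b = 1")
    case True
    have "E = 0"
    proof -
      have "E $ c $ d = 0" for c d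
      proof -
        have "(E - O1) $ c $ d = mat_scale (bit_sign ?b) (E + O1) $ c $ d" using key by (simp only:)
        then show ?thesis using True by (simp add: mat_scale_nth eq_neg_iff_add_eq_0)
      qed
      then show ?thesis by (simp add: vec_eq_iff)
    qed
    then show ?thesis using O1 True unfolding Q1 rot_degree_eq by (simp del: Gamma5.simps)
  next
    case False
    have "O1 = 0"
    proof -
      have "O1 $ c $ d = 0" for c d
      proof -
        have "(E - O1) $ c $ d = mat_scale (bit_sign ?b) (E + O1) $ c $ d" using key by (simp only:)
        then show ?thesis using False by (simp add: mat_scale_nth diff_eq_eq add.assoc)
      qed
      then show ?thesis by (simp add: vec_eq_iff)
    qed
    then show ?thesis using E False unfolding Q1 rot_degree_eq by (simp del: Gamma5.simps)
  qed
qed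

text \<open>On the crossing part X^2 = -1, so 1 + X + X^2 reduces to X; off it X = 0 and only 1
  remains.\<close>

lemma vrot_cross_cases:
  assumes ij: "i \<noteq> j" and ab: "a * b = -1" and u: "u \<in> ext3"
    and cr: "\<And>T. u $ T \<noteq> 0 \<Longrightarrow> crossing i j T \<longleftrightarrow> P"
  shows "vrot (rot_gen i j a b) u = (if P then ext_der (rot_gen i j a b) u else u)"
proof (cases P)
  case True
  then have "cross_part i j u = u" using cr by (auto simp: cross_part_def vec_eq_iff)
  then show ?thesis using True ext_der_rot_gen_sq[OF ij ab u] by (simp add: vrot_def)
next
  case False
  then have "cross_part i j u = 0" using cr by (auto simp: cross_part_def vec_eq_iff)
  then have "ext_der (rot_gen i j a b) u = 0"
    using ext_der_rot_gen_cross_part[OF ij u, of a b] by simp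
  then show ?thesis using False by (simp add: vrot_def)
qed

text \<open>On \<open>L_1\<close> and \<open>L_-1\<close> the rotation either fixes a homogeneous
  element or is the bracket with its generator, so the degree moves by that of the generator or
  stays. \<open>L_0\<close> is \<open>rotation_mt_mem\<close>, and the top lines are fixed.\<close>

lemma rotation_Gamma:
  assumes ij: "i \<noteq> j" and ab: "a * b = -1" and X: "mt (rot_gen i j a b) \<in> \<Gamma> (e, cl i + cl j, 0)"
    and x: "x \<in> \<Gamma> g"
  shows "rotation (rot_gen i j a b) x \<in> \<Gamma> (rot_degree i j e g)"
proof (cases "x = 0")
  case True
  have "vrot Y 0 = 0" for Y :: "'f ^ 6 ^ 6" by (simp add: vrot_def)
  then have "rotation (rot_gen i j a b) x = 0"
    unfolding True el_zero rotation_el by (simp add: matrix_add_simps)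
  then show ?thesis by (simp only: Gamma_zero)
next
  case False
  let ?X = "rot_gen i j a b"
  have v0: "vrot Y 0 = 0" for Y :: "'f ^ 6 ^ 6" by (simp add: vrot_def)
  have "g \<in> Supp G5 \<Gamma>" using False x unfolding Supp_iff by blast
  obtain p f A u q where el: "x = el p f A u q" and fu: "f \<in> ext3" "u \<in> ext3"
    using Gamma_carrier[OF x] by (rule el_cases)
  have n0: ?thesis if g: "g = (k0, k, 0)" for k0 k
  proof -
    note mem = x[unfolded g el el_mem_Gamma[OF fu]]
    have z: "f = 0" "u = 0" "p = 0" "q = 0" using mem by (auto simp: vec_eq_iff)
    have "mt A \<in> \<Gamma> (k0, k, 0)" using x by (simp only: g el z)
    from rotation_mt_mem[OF ij ab X this] show ?thesis by (simp only: g el z rotation_el v0)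
  qed
  show ?thesis
    using \<open>g \<in> Supp G5 \<Gamma>\<close>
  proof (cases rule: Supp_cases)
    case (up e' S)
    note mem = x[unfolded up el el_mem_Gamma[OF fu]]
    have z: "f = 0" "A = 0" "p = 0" "q = 0" using mem by (auto simp: vec_eq_iff)
    have "crossing i j T \<longleftrightarrow> pairing_bit i j (cls S) 1 = 1" if "u $ T \<noteq> 0" for T
    proof -
      have "cls T = cls S" using mem that by blast
      moreover have "card T = 3" using that fu ext3_nth by blast
      ultimately show ?thesis using pairing_bit_crossing[of T 1 i j] by simp
    qed
    from vrot_cross_cases[OF ij ab fu(2) this]
    have v: "vrot ?X u = (if pairing_bit i j (cls S) 1 = 1 then ext_der ?X u else u)" .
    have "rotation ?X x = (if pairing_bit i j (cls S) 1 = 1 then br (mt ?X) x else x)"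
      unfolding el z rotation_el br_0_1 v by (simp add: v0 matrix_add_simps)
    then show ?thesis using x Gamma_br[OF X x] unfolding up rot_degree_eq by (simp del: Gamma5.simps)
  next
    case (dn e' S)
    note mem = x[unfolded dn el el_mem_Gamma[OF fu]]
    have z: "u = 0" "A = 0" "p = 0" "q = 0" using mem by (auto simp: vec_eq_iff)
    have "crossing i j T \<longleftrightarrow> pairing_bit i j (cls S) (-1) = 1" if "f $ T \<noteq> 0" for T
    proof -
      have "cls T = cls S" using mem that by blast
      moreover have "card T = 3" using that fu ext3_nth by blast
      ultimately show ?thesis using pairing_bit_crossing[of T "-1" i j] by simp
    qed
    moreover have "(- b) * (- a) = -1" using ab by (simp add: mult.commute)
    ultimately have "vrot (rot_gen i j (- b) (- a)) f
        = (if pairing_bit i j (cls S) (-1) = 1 then ext_der (rot_gen i j (- b) (- a)) f else f)"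
      using vrot_cross_cases[OF ij _ fu(1)] by blast
    then have v: "vrot (dual_der ?X) f = (if pairing_bit i j (cls S) (-1) = 1 then ext_der (dual_der ?X) f else f)"
      by (simp only: rot_gen_dual)
    have "rotation ?X x = (if pairing_bit i j (cls S) (-1) = 1 then br (mt ?X) x else x)"
      unfolding el z rotation_el br_0_m1 v by (simp add: v0 matrix_add_simps)
    then show ?thesis using x Gamma_br[OF X x] unfolding dn rot_degree_eq by (simp del: Gamma5.simps)
  next
    case top
    note mem = x[unfolded top el el_mem_Gamma[OF fu]]
    have z: "u = 0" "A = 0" "p = 0" "f = 0" using mem by (auto simp: vec_eq_iff)
    have "rotation ?X x = x" unfolding el z rotation_el by (simp add: v0 matrix_add_simps)
    then show ?thesis using x unfolding top rot_degree_eq by (simp add: pairing_bit_2 del: Gamma5.simps)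
  next
    case bot
    note mem = x[unfolded bot el el_mem_Gamma[OF fu]]
    have z: "u = 0" "A = 0" "q = 0" "f = 0" using mem by (auto simp: vec_eq_iff)
    have "rotation ?X x = x" unfolding el z rotation_el by (simp add: v0 matrix_add_simps)
    then show ?thesis using x unfolding bot rot_degree_eq by (simp add: pairing_bit_2 del: Gamma5.simps)
  qed (rule n0, assumption)+
qed

lemma rot_degree_weyl: "i \<noteq> j \<Longrightarrow> rot_degree i j e \<in> weyl_set"
proof -
  assume ij: "i \<noteq> j"
  \<comment> \<open>For \<open>e = 1\<close> the symmetric generator squares to plus the identity on
    the plane; scaling by \<iota> restores the sign required of a quarter turn.\<close>
  define t where "t = (if e = 1 then \<iota> else 1)"
  have ab: "t * (- (bit_sign e * t)) = -1" by (cases "e = 0") (simp_all add: t_def iota_sq)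
  have "rot_gen i j t (- (bit_sign e * t)) = mat_scale t (sk e i j)"
    by (simp add: rot_gen_def sk_def vec_eq_iff mat_scale_nth algebra_simps)
  then have X: "mt (rot_gen i j t (- (bit_sign e * t))) \<in> \<Gamma> (e, cl i + cl j, 0)"
    using Gamma_scale[OF mt_sk_mem[OF ij]] by (simp add: mt_scale del: Gamma5.simps)
  show ?thesis
    by (rule weyl_setI[OF lie_aut_rotation[OF quarter_rot_gen[OF ij ab]] rot_degree_auto])
      (rule rotation_Gamma[OF ij ab X])
qed

text \<open>\<theta> has opposite signs on \<open>L_1\<close> and \<open>L_-1\<close>, so the
  exchange shifts the first bit by the parity of \<open>n\<close>.\<close>

definition dual_degree :: "g5 \<Rightarrow> g5" where
  "dual_degree = (\<lambda>(k0, k, n). (k0 + of_int n, k, - n))"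

lemma dualize_Gamma: "x \<in> \<Gamma> g \<Longrightarrow> dualize x \<in> \<Gamma> (dual_degree g)"
proof -
  assume x: "x \<in> \<Gamma> g"
  obtain k0 k n where g: "g = (k0, k, n)" by (cases g)
  obtain p f A u q where el: "x = el p f A u q" and fu: "f \<in> ext3" "u \<in> ext3"
    using Gamma_carrier[OF x] by (rule el_cases)
  note mem = x[unfolded g el el_mem_Gamma[OF fu]]
  have star0: "- (\<iota> *s star u) = bit_sign (k0 + of_int n) *s u"
  proof (cases "u = 0")
    case False
    then have "n = 1" using mem by (metis vec_eq_iff zero_index)
    then show ?thesis using mem by (simp add: bit_sign_add)
  qed simp
  have star1: "\<iota> *s star f = bit_sign (k0 + of_int n) *s f"
  proof (cases "f = 0")
    case False
    then have "n = -1" using mem by (metis vec_eq_iff zero_index)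
    moreover have "- (\<iota> *s star f) = bit_sign k0 *s f" using mem by blast
    then have "\<iota> *s star f = - (bit_sign k0 *s f)" by (simp add: minus_equation_iff[of "\<iota> *s star f"] eq_commute)
    ultimately show ?thesis by (simp add: bit_sign_add)
  qed simp
  have mat: "mat (trace (dual_der A) / 3) - transpose (dual_der A) = mat_scale (bit_sign (k0 + of_int n)) (dual_der A)"
  proof (cases "A = 0")
    case False
    then have n: "n = 0" using mem by (metis vec_eq_iff zero_index)
    have "transpose (mat (trace A / 3) - transpose A) = transpose (mat_scale (bit_sign k0) A)"
      using mem by (elim conjE) (simp only:)
    then have "mat (trace A / 3) - A = mat_scale (bit_sign k0) (transpose A)"
      by (simp only: transpose_simps transpose_transpose)
    from this[symmetric] show ?thesis
      by (simp add: n dual_der_simps) (simp add: dual_der_def transpose_simps mat_scale_simps mat_minus transpose_transpose)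
  qed (simp add: dual_der_simps transpose_simps mat_scale_simps mat_0)
  have top: "- q = bit_sign (k0 + of_int n) * q" and bot: "- p = bit_sign (k0 + of_int n) * p"
    using mem by (cases "q = 0"; cases "p = 0"; auto)+
  have dA: "dual_der A $ a $ b = - A $ b $ a" for a b by (simp add: dual_der_def transpose_def)
  have "- (c * q / d) = bit_sign (k0 + of_int n) * (c * q / d)" "- (c * p / d) = bit_sign (k0 + of_int n) * (c * p / d)" for c d
    using top bot by (metis mult.left_commute mult_minus_right times_divide_eq_right minus_divide_left)+
  moreover have "A $ b $ a \<noteq> 0 \<Longrightarrow> cl a + cl b = k" for a b using mem by (metis add.commute)
  ultimately
  show ?thesis
    unfolding g el dualize_el dual_degree_def prod.case el_mem_Gamma[OF fu(2,1)] dA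
    using mem star0 star1 mat by auto
qed

lemma dual_degree_weyl: "dual_degree \<in> weyl_set"
proof (rule weyl_setI[OF lie_aut_dualize _ dualize_Gamma])
  show "dual_degree \<in> auto G5"
  proof (rule autoI)
    show "dual_degree \<in> hom G5 G5" "dual_degree \<in> hom G5 G5"
      by (simp_all add: hom_G5_additive dual_degree_def add_ac)
    show "dual_degree (dual_degree g) = g" "dual_degree (dual_degree g) = g" for g
      by (cases g; simp add: dual_degree_def add.assoc)+
  qed
qed

section \<open>Every matrix of the block form occurs\<close>

lemma kappa_one [simp]: "kappa (mat 1) = 0"
proof -
  have "{j. (mat 1 :: bit ^ 4 ^ 4) $ i $ j = 1} = {i}" for i by (auto simp: mat_nth)
  then show ?thesis by (simp add: kappa_def kappa0_def vec_eq_iff)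
qed

lemma block_map_one: "block_map (mat 1) r e 1 = (\<lambda>(k0, k, n). (k0 + dotp r k + e * of_int n, k, n))"
  by (simp add: block_map_def)

lemma shift_weyl: "block_map (mat 1) r e 1 \<in> weyl_set"
proof -
  have T: "(\<lambda>(k0, k, n). (k0 + pairing_bit i j k n, k, n)) \<in> weyl_set" if "i \<noteq> j" for i j
  proof -
    have "(\<lambda>g. rot_degree i j 1 (rot_degree i j 0 g)) = (\<lambda>(k0, k, n). (k0 + pairing_bit i j k n, k, n))"
      by (auto simp: fun_eq_iff rot_degree_def pairing_bit_shift add.assoc)
    then show ?thesis using weyl_set_comp[OF rot_degree_weyl[OF that] rot_degree_weyl[OF that]] by metis
  qed
  have comp: "block_map (mat 1) (r + r') (e + e') 1 \<in> weyl_set"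
    if "block_map (mat 1) r e 1 \<in> weyl_set" "block_map (mat 1) r' e' 1 \<in> weyl_set" for r r' e e'
  proof -
    have "(\<lambda>g. block_map (mat 1) r e 1 (block_map (mat 1) r' e' 1 g)) = block_map (mat 1) (r + r') (e + e') 1"
      by (auto simp: fun_eq_iff block_map_one dotp_add_left distrib_right add_ac)
    then show ?thesis using weyl_set_comp[OF that] by metis
  qed
  have id: "block_map (mat 1) 0 0 1 \<in> weyl_set"
  proof -
    have "block_map (mat 1) 0 0 1 = (\<lambda>g. dual_degree (dual_degree g))"
      by (simp add: fun_eq_iff block_map_one dual_degree_def add.assoc)
    then show ?thesis using weyl_set_comp[OF dual_degree_weyl dual_degree_weyl] by simp
  qed
  have e1: "block_map (mat 1) 0 1 1 \<in> weyl_set"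
  proof -
    \<comment> \<open>The planes {1,2}, {3,4}, {5,0} exhaust the indices. Their classes cancel, and
      only the parity of \<open>n\<close> contributed by the index 0 remains.\<close>
    have "cl 1 + cl 2 + (cl 3 + cl 4) + (cl 5 + cl 0) = 0" by (simp add: vec_eq_iff forall_4 cls_nth)
    then have "om (cl 1 + cl 2) k + om (cl 3 + cl 4) k + om (cl 5 + cl 0) k = 0" for k
      by (simp add: om_add_left[symmetric]) (simp add: om_def)
    then have s: "pairing_bit 1 2 k n + pairing_bit 3 4 k n + pairing_bit 5 0 k n = of_int n" for k n
      by (simp add: pairing_bit_def add.assoc[symmetric])
    have "block_map (mat 1) 0 1 1 = (\<lambda>g. (\<lambda>(k0, k, n). (k0 + pairing_bit 5 0 k n, k, n))
        ((\<lambda>(k0, k, n). (k0 + pairing_bit 3 4 k n, k, n)) ((\<lambda>(k0, k, n). (k0 + pairing_bit 1 2 k n, k, n)) g)))"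
      by (simp add: fun_eq_iff block_map_one add.assoc s[unfolded add.assoc])
    also have "\<dots> \<in> weyl_set"
      by (rule weyl_set_comp[OF T weyl_set_comp[OF T T]]) simp_all
    finally show ?thesis .
  qed
  have re: "\<exists>e. block_map (mat 1) r e 1 \<in> weyl_set"
  proof (cases "C4 *v r = 0")
    case True
    have "r = C4 *v (C4 *v r)" by (simp add: matrix_vector_mul_assoc C4_sq)
    then have "r = 0" using True by simp
    then show ?thesis using id by blast
  next
    case False
    \<comment> \<open>Every nonzero row is the form against some \<open>cl i + cl j\<close>; the bit
      that comes along with it is corrected by \<open>e1\<close>.\<close>
    then obtain i j where ij: "i \<noteq> j" "C4 *v r = cl i + cl j" using nonzero_eq_cl_pair by blast
    have "om (cl i + cl j) k = dotp r k" for k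
      unfolding ij(2)[symmetric] om_dotp by (simp add: dotp_adjoint transpose_C4 matrix_vector_mul_assoc C4_sq)
    then have "(\<lambda>(k0, k, n). (k0 + pairing_bit i j k n, k, n)) = block_map (mat 1) r (of_bool (i = 0) + of_bool (j = 0)) 1"
      by (auto simp: fun_eq_iff block_map_one pairing_bit_def distrib_right add_ac)
    then show ?thesis using T[OF ij(1)] by auto
  qed
  then obtain e' where W: "block_map (mat 1) r e' 1 \<in> weyl_set" by blast
  have bit_diff: "e' + 1 = e" if "e \<noteq> e'" using that by (cases e; cases e') simp_all
  from W show ?thesis using comp[OF W e1] by (cases "e = e'") (simp_all add: bit_diff)
qed

lemma block_map_weyl:
  assumes A: "A \<in> Sp4" and m: "m \<in> {1, -1}"
  shows "block_map A r e m \<in> weyl_set"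
proof -
  \<comment> \<open>The induction only tracks the linear part. The column \<open>kappa A\<close> is
    then forced by \<open>weyl_set_block_form\<close>, and sign, row and bit are adjusted
    afterwards.\<close>
  have "\<exists>\<phi>\<in>weyl_set. \<forall>k. fst (snd (\<phi> (0, k, 0))) = A *v k"
    using A
  proof (rule Sp4_transvection_induct)
    show "\<exists>\<phi>\<in>weyl_set. \<forall>k. fst (snd (\<phi> (0, k, 0))) = mat 1 *v k"
      by (rule bexI[OF _ shift_weyl[of 0 0]]) (simp add: block_map_one)
    fix c and A :: "bit ^ 4 ^ 4" assume "\<exists>\<phi>\<in>weyl_set. \<forall>k. fst (snd (\<phi> (0, k, 0))) = A *v k"
    then obtain \<phi> where \<phi>: "\<phi> \<in> weyl_set" "\<And>k. fst (snd (\<phi> (0, k, 0))) = A *v k" by blast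
    show "\<exists>\<phi>\<in>weyl_set. \<forall>k. fst (snd (\<phi> (0, k, 0))) = (transvection_mat c ** A) *v k"
    proof (cases "c = 0")
      case True
      then have "transvection_mat c *v v = v" for v
        by (simp add: transvection_mat_vector transvection_def)
      then show ?thesis using \<phi> by (auto simp: matrix_vector_mul_assoc[symmetric])
    next
      case False
      then obtain i j where ij: "i \<noteq> j" "c = cl i + cl j" using nonzero_eq_cl_pair by blast
      obtain A' r' e' m' where bf: "\<phi> = block_map A' r' e' m'" 
        by (rule weyl_set_block_form[OF \<phi>(1)]) (rule that, assumption)
      have "fst (snd (rot_degree i j 0 (\<phi> (0, k, 0)))) = (transvection_mat c ** A) *v k" for k
        using \<phi>(2)[of k] by (simp add: bf block_map_def rot_degree_def pairing_bit_0 ij(2)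
            matrix_vector_mul_assoc[symmetric] transvection_mat_vector transvection_def)
      then show ?thesis
        by (intro bexI[of _ "\<lambda>g. rot_degree i j 0 (\<phi> g)"] allI weyl_set_comp[OF rot_degree_weyl[OF ij(1), of 0] \<phi>(1)])
    qed
  qed
  then obtain \<phi> where \<phi>: "\<phi> \<in> weyl_set" "\<And>k. fst (snd (\<phi> (0, k, 0))) = A *v k" by blast
  obtain A' r' e' m' where bf: "\<phi> = block_map A' r' e' m'" and m': "m' \<in> {1, -1}"
    by (rule weyl_set_block_form[OF \<phi>(1)]) (rule that)
  have "A' *v k = A *v k" for k using \<phi>(2)[of k] by (simp add: bf block_map_def)
  then have "A' = A" by (simp add: matrix_eq)
  then have W: "block_map A r' e' m' \<in> weyl_set" using \<phi>(1) bf by simp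
  have "\<exists>e'. block_map A r' e' m \<in> weyl_set"
  proof (cases "m' = m")
    case False
    then have m'': "m' = - m" using m m' by auto
    have "(\<lambda>g. block_map A r' e' m' (dual_degree g)) = block_map A r' (e' + 1) m"
      by (auto simp: fun_eq_iff block_map_def dual_degree_def m'' distrib_right add_ac)
    then show ?thesis using weyl_set_comp[OF W dual_degree_weyl] by metis
  qed (use W in blast)
  then obtain e'' where W: "block_map A r' e'' m \<in> weyl_set" by blast
  \<comment> \<open>The shift on the right adds the desired row and bit and cancels the ones already
    present.\<close>
  have "(\<lambda>g. block_map A r' e'' m (block_map (mat 1) (r' + r) (e'' + e) 1 g)) = block_map A r e m"
  proof -
    have "x + (y + y) = x" for x y :: bit by simp
    have "k0 + dotp (r' + r) k + (e'' + e) * n + dotp r' k + e'' * n = k0 + dotp r k + e * n" for k0 k n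
    proof -
      have "k0 + dotp (r' + r) k + (e'' + e) * n + dotp r' k + e'' * n
          = k0 + dotp r k + e * n + (dotp r' k + dotp r' k) + (e'' * n + e'' * n)"
        by (simp only: dotp_add_left distrib_right add_ac)
      then show ?thesis by simp
    qed
    then show ?thesis by (auto simp: fun_eq_iff block_map_one) (simp_all add: block_map_def)
  qed
  then show ?thesis using weyl_set_comp[OF W shift_weyl[of "r' + r" "e'' + e"]] by metis
qed

lemma weyl_set_eq: "weyl_set = {block_map A r e m | A r e m. A \<in> Sp4 \<and> m \<in> {1, -1}}"
proof (intro equalityI subsetI)
  fix \<phi> assume "\<phi> \<in> weyl_set"
  then show "\<phi> \<in> {block_map A r e m | A r e m. A \<in> Sp4 \<and> m \<in> {1, -1}}"
  proof (rule weyl_set_block_form)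
    fix A r e m assume "A \<in> Sp4" "m \<in> {1, -1}" "\<phi> = block_map A r e m"
    then show "\<phi> \<in> {block_map A r e m | A r e m. A \<in> Sp4 \<and> m \<in> {1, -1}}" by (intro CollectI exI conjI)
  qed
qed (elim CollectE exE conjE, simp only: block_map_weyl)

end

section \<open>The Weyl group as a semidirect product\<close>

text \<open>A criterion by embedding: since \<open>nn\<close> is injective, the rule
  \<open>conj\<close> forces \<rho> to be an action of \<open>K\<close> by automorphisms of
  \<open>N\<close>, as derived below.\<close>

locale semidirect_factors = G: group G + K: group K + N: group N
  for G :: "('g, 'x) monoid_scheme" and K :: "('k, 'y) monoid_scheme" and N :: "('n, 'z) monoid_scheme" +
  fixes kk :: "'k \<Rightarrow> 'g" and nn :: "'n \<Rightarrow> 'g" and \<rho> :: "'k \<Rightarrow> 'n \<Rightarrow> 'n"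
  assumes kk: "kk \<in> hom K G" and nn: "nn \<in> hom N G" and inj_nn: "inj_on nn (carrier N)"
    and \<rho>_ext: "k \<in> carrier K \<Longrightarrow> \<rho> k \<in> extensional (carrier N)"
    and \<rho>_closed: "\<lbrakk>k \<in> carrier K; x \<in> carrier N\<rbrakk> \<Longrightarrow> \<rho> k x \<in> carrier N"
    and conj: "\<lbrakk>k \<in> carrier K; x \<in> carrier N\<rbrakk> \<Longrightarrow> nn (\<rho> k x) \<otimes>\<^bsub>G\<^esub> kk k = kk k \<otimes>\<^bsub>G\<^esub> nn x"
begin

lemma kk_simps: "k \<in> carrier K \<Longrightarrow> kk k \<in> carrier G"
    "\<lbrakk>k \<in> carrier K; l \<in> carrier K\<rbrakk> \<Longrightarrow> kk (k \<otimes>\<^bsub>K\<^esub> l) = kk k \<otimes>\<^bsub>G\<^esub> kk l"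
    "kk \<one>\<^bsub>K\<^esub> = \<one>\<^bsub>G\<^esub>"
  using kk hom_one[OF kk K.is_group G.is_group] by (auto simp: hom_def)

lemma nn_simps: "x \<in> carrier N \<Longrightarrow> nn x \<in> carrier G"
    "\<lbrakk>x \<in> carrier N; y \<in> carrier N\<rbrakk> \<Longrightarrow> nn (x \<otimes>\<^bsub>N\<^esub> y) = nn x \<otimes>\<^bsub>G\<^esub> nn y"
  using nn by (auto simp: hom_def)

lemma nn_cancel:
  assumes "x \<in> carrier N" "y \<in> carrier N" "k \<in> carrier K"
    "nn x \<otimes>\<^bsub>G\<^esub> kk k = nn y \<otimes>\<^bsub>G\<^esub> kk k"
  shows "x = y"
  using assms inj_nn by (simp add: nn_simps kk_simps inj_on_eq_iff)

lemma \<rho>_mult: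
  assumes k: "k \<in> carrier K" and xy: "x \<in> carrier N" "y \<in> carrier N"
  shows "\<rho> k (x \<otimes>\<^bsub>N\<^esub> y) = \<rho> k x \<otimes>\<^bsub>N\<^esub> \<rho> k y"
proof (rule nn_cancel[OF _ _ k])
  have "nn (\<rho> k (x \<otimes>\<^bsub>N\<^esub> y)) \<otimes>\<^bsub>G\<^esub> kk k = (kk k \<otimes>\<^bsub>G\<^esub> nn x) \<otimes>\<^bsub>G\<^esub> nn y"
    using k xy by (simp add: conj nn_simps kk_simps G.m_assoc)
  also have "\<dots> = nn (\<rho> k x) \<otimes>\<^bsub>G\<^esub> (kk k \<otimes>\<^bsub>G\<^esub> nn y)"
    using k xy by (simp add: conj[symmetric] \<rho>_closed nn_simps kk_simps G.m_assoc)
  also have "\<dots> = nn (\<rho> k x \<otimes>\<^bsub>N\<^esub> \<rho> k y) \<otimes>\<^bsub>G\<^esub> kk k"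
    using k xy by (simp add: conj[symmetric] \<rho>_closed nn_simps kk_simps G.m_assoc)
  finally show "nn (\<rho> k (x \<otimes>\<^bsub>N\<^esub> y)) \<otimes>\<^bsub>G\<^esub> kk k = nn (\<rho> k x \<otimes>\<^bsub>N\<^esub> \<rho> k y) \<otimes>\<^bsub>G\<^esub> kk k" .
qed (use assms in \<open>simp_all add: \<rho>_closed\<close>)

lemma \<rho>_comp:
  assumes kl: "k \<in> carrier K" "l \<in> carrier K" and x: "x \<in> carrier N"
  shows "\<rho> (k \<otimes>\<^bsub>K\<^esub> l) x = \<rho> k (\<rho> l x)"
proof (rule nn_cancel)
  have "nn (\<rho> (k \<otimes>\<^bsub>K\<^esub> l) x) \<otimes>\<^bsub>G\<^esub> kk (k \<otimes>\<^bsub>K\<^esub> l) = kk k \<otimes>\<^bsub>G\<^esub> (kk l \<otimes>\<^bsub>G\<^esub> nn x)"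
    using kl x by (simp only: conj K.m_closed) (simp add: nn_simps kk_simps G.m_assoc)
  also have "\<dots> = (kk k \<otimes>\<^bsub>G\<^esub> nn (\<rho> l x)) \<otimes>\<^bsub>G\<^esub> kk l"
    using kl x by (simp add: conj[OF kl(2) x, symmetric] \<rho>_closed nn_simps kk_simps G.m_assoc)
  also have "\<dots> = nn (\<rho> k (\<rho> l x)) \<otimes>\<^bsub>G\<^esub> kk (k \<otimes>\<^bsub>K\<^esub> l)"
    using kl x by (simp only: conj[OF kl(1) \<rho>_closed[OF kl(2) x], symmetric]) (simp add: \<rho>_closed nn_simps kk_simps G.m_assoc)
  finally show "nn (\<rho> (k \<otimes>\<^bsub>K\<^esub> l) x) \<otimes>\<^bsub>G\<^esub> kk (k \<otimes>\<^bsub>K\<^esub> l)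
      = nn (\<rho> k (\<rho> l x)) \<otimes>\<^bsub>G\<^esub> kk (k \<otimes>\<^bsub>K\<^esub> l)" .
qed (use assms in \<open>simp_all add: \<rho>_closed\<close>)

lemma \<rho>_one: "x \<in> carrier N \<Longrightarrow> \<rho> \<one>\<^bsub>K\<^esub> x = x"
  using conj[OF K.one_closed, of x] \<rho>_closed[OF K.one_closed, of x] inj_nn
  by (simp add: kk_simps nn_simps inj_on_eq_iff)

lemma \<rho>_auto:
  assumes k: "k \<in> carrier K"
  shows "\<rho> k \<in> auto N"
proof -
  have inverse: "\<rho> (inv\<^bsub>K\<^esub> k) (\<rho> k x) = x" "\<rho> k (\<rho> (inv\<^bsub>K\<^esub> k) x) = x" if "x \<in> carrier N" for x
    using k that by (simp_all add: \<rho>_comp[symmetric] \<rho>_one)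
  have "bij_betw (\<rho> k) (carrier N) (carrier N)"
    by (rule bij_betw_byWitness[where f' = "\<rho> (inv\<^bsub>K\<^esub> k)"])
      (use k inverse in \<open>auto simp: \<rho>_closed\<close>)
  then show ?thesis using k by (simp add: auto_def hom_def Bij_def \<rho>_ext \<rho>_mult \<rho>_closed)
qed

lemma \<rho>_hom: "\<rho> \<in> hom K (AutoGroup N)"
proof (rule homI)
  fix k l assume kl: "k \<in> carrier K" "l \<in> carrier K"
  have "\<rho> k \<in> Bij (carrier N)" "\<rho> l \<in> Bij (carrier N)" using \<rho>_auto kl by (auto simp: auto_def)
  moreover have "\<rho> (k \<otimes>\<^bsub>K\<^esub> l) = compose (carrier N) (\<rho> k) (\<rho> l)"
    by (rule extensionalityI[of _ "carrier N"]) (use kl in \<open>simp_all add: \<rho>_ext \<rho>_comp compose_def\<close>)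
  ultimately show "\<rho> (k \<otimes>\<^bsub>K\<^esub> l) = \<rho> k \<otimes>\<^bsub>AutoGroup N\<^esub> \<rho> l"
    by (simp add: AutoGroup_def BijGroup_def)
qed (simp add: AutoGroup_def \<rho>_auto)

lemma semidirect_hom: "(\<lambda>(k, x). nn x \<otimes>\<^bsub>G\<^esub> kk k) \<in> hom (semidirect_product K N \<rho>) G"
proof (rule homI)
  fix p q assume "p \<in> carrier (semidirect_product K N \<rho>)" "q \<in> carrier (semidirect_product K N \<rho>)"
  then obtain k x l y where p: "p = (k, x)" "k \<in> carrier K" "x \<in> carrier N"
    and q: "q = (l, y)" "l \<in> carrier K" "y \<in> carrier N"
    by (auto simp: semidirect_product_def)
  have "nn (x \<otimes>\<^bsub>N\<^esub> \<rho> k y) \<otimes>\<^bsub>G\<^esub> kk (k \<otimes>\<^bsub>K\<^esub> l) = nn x \<otimes>\<^bsub>G\<^esub> ((nn (\<rho> k y) \<otimes>\<^bsub>G\<^esub> kk k) \<otimes>\<^bsub>G\<^esub> kk l)"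
    using p q by (simp add: \<rho>_closed nn_simps kk_simps G.m_assoc)
  also have "\<dots> = (nn x \<otimes>\<^bsub>G\<^esub> kk k) \<otimes>\<^bsub>G\<^esub> (nn y \<otimes>\<^bsub>G\<^esub> kk l)"
    using p q by (simp add: conj nn_simps kk_simps G.m_assoc)
  finally show "(\<lambda>(k, x). nn x \<otimes>\<^bsub>G\<^esub> kk k) (p \<otimes>\<^bsub>semidirect_product K N \<rho>\<^esub> q)
      = (\<lambda>(k, x). nn x \<otimes>\<^bsub>G\<^esub> kk k) p \<otimes>\<^bsub>G\<^esub> (\<lambda>(k, x). nn x \<otimes>\<^bsub>G\<^esub> kk k) q"
    by (simp add: p q semidirect_product_def)
qed (auto simp: semidirect_product_def nn_simps kk_simps)

lemma semidirect_mult_closed: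
  "\<lbrakk>p \<in> carrier (semidirect_product K N \<rho>); q \<in> carrier (semidirect_product K N \<rho>)\<rbrakk>
    \<Longrightarrow> p \<otimes>\<^bsub>semidirect_product K N \<rho>\<^esub> q \<in> carrier (semidirect_product K N \<rho>)"
  by (auto simp: semidirect_product_def \<rho>_closed)

end

text \<open>Both sources are identified with the same subset of \<open>G\<close>, so
  \<open>f\<close> followed by the inverse of \<open>g\<close> is the isomorphism.\<close>

lemma iso_of_same_image:
  assumes f: "f \<in> mon W G" and g: "g \<in> mon S G" and im: "f ` carrier W = g ` carrier S"
    and closed: "\<And>p q. \<lbrakk>p \<in> carrier S; q \<in> carrier S\<rbrakk> \<Longrightarrow> p \<otimes>\<^bsub>S\<^esub> q \<in> carrier S"
  shows "W \<cong> S"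
proof (rule is_isoI)
  let ?h = "\<lambda>w. inv_into (carrier S) g (f w)"
  have h: "?h w \<in> carrier S" "g (?h w) = f w" if "w \<in> carrier W" for w
    using that im by (metis imageI inv_into_into, metis imageI f_inv_into_f)
  have fh: "f \<in> hom W G" "inj_on f (carrier W)" and gh: "g \<in> hom S G" "inj_on g (carrier S)"
    using f g by (auto simp: mon_def)
  have "?h (v \<otimes>\<^bsub>W\<^esub> w) = ?h v \<otimes>\<^bsub>S\<^esub> ?h w" if vw: "v \<in> carrier W" "w \<in> carrier W" for v w
  proof -
    have "f (v \<otimes>\<^bsub>W\<^esub> w) = g (?h v \<otimes>\<^bsub>S\<^esub> ?h w)"
      using vw h by (simp add: hom_mult[OF fh(1)] hom_mult[OF gh(1)])
    then show ?thesis using vw h closed by (simp add: inv_into_f_f[OF gh(2)])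
  qed
  moreover have "bij_betw ?h (carrier W) (carrier S)"
    using bij_betw_trans[OF inj_on_imp_bij_betw[OF fh(2)] bij_betw_inv_into[OF inj_on_imp_bij_betw[OF gh(2)], folded im]]
    by (simp add: comp_def)
  ultimately show "?h \<in> iso W S" using h by (simp add: iso_def hom_def)
qed

section \<open>The factors of the Weyl group in coordinates\<close>

lemma forall_5: "(\<forall>i::5. P i) \<longleftrightarrow> P 0 \<and> P 1 \<and> P 2 \<and> P 3 \<and> P 4"
proof -
  have "(\<forall>i::5. P i) \<longleftrightarrow> (\<forall>i\<in>UNIV. P i)" by simp
  also have "(UNIV :: 5 set) = {0, 1, 2, 3, 4}"
  proof (rule sym, rule card_subset_eq)
    show "card {0, 1, 2, 3, 4 :: 5} = card (UNIV :: 5 set)" by simp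
  qed simp_all
  finally show ?thesis by simp
qed

text \<open>A row and a bit as one vector. The last clause is the coordinate 5, which is 0 in the
  type \<open>5\<close>.\<close>

definition join5 :: "bit ^ 4 \<Rightarrow> bit \<Rightarrow> bit ^ 5" where
  "join5 r e = (\<chi> l. if l = 1 then r $ 1 else if l = 2 then r $ 2 else if l = 3 then r $ 3
     else if l = 4 then r $ 4 else e)"

definition front :: "bit ^ 5 \<Rightarrow> bit ^ 4" where
  "front v = vec4 (v $ 1) (v $ 2) (v $ 3) (v $ 4)"

lemma front_join5 [simp]: "front (join5 r e) = r" "join5 r e $ 0 = e"
  by (simp_all add: front_def join5_def vec4_eq[symmetric])

lemma join5_front: "join5 (front v) (v $ 0) = v"
  by (simp add: vec_eq_iff forall_5 front_def join5_def)

lemma front_add: "front (v + w) = front v + front w"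
  by (simp add: front_def vec4_add)

declare transpose_matrix_vector [simp del]

context e6_lie
begin

text \<open>The cocycle rule is forced: the composite of two realized maps is realized, hence of
  block form, and its column must be \<open>kappa\<close> of the product.\<close>

lemma kappa_mult:
  assumes "A \<in> Sp4" "B \<in> Sp4"
  shows "kappa (A ** B) = A *v kappa B + kappa A"
proof -
  have "(\<lambda>g. block_map A 0 0 1 (block_map B 0 0 1 g)) \<in> weyl_set"
    by (rule weyl_set_comp[OF block_map_weyl block_map_weyl]) (use assms in simp_all)
  then obtain M r e m where M: "(\<lambda>g. block_map A 0 0 1 (block_map B 0 0 1 g)) = block_map M r e m"
    by (rule weyl_set_block_form) (rule that)
  have "A *v (B *v k) = M *v k" for k
    using fun_cong[OF M, of "(0, k, 0)"] by (simp add: block_map_def)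
  then have "M = A ** B" by (simp add: matrix_eq matrix_vector_mul_assoc)
  then show ?thesis using fun_cong[OF M, of "(0, 0, 1)"] by (simp add: block_map_def)
qed

lemma block_map_comp:
  assumes "A \<in> Sp4" "B \<in> Sp4" "m' \<in> {1, -1}"
  shows "block_map A r e m (block_map B r' e' m' g)
    = block_map (A ** B) (r' + transpose B *v r) (e' + dotp r (kappa B) + e) (m * m') g"
proof -
  have par: "of_int (m' * n) = (of_int n :: bit)" for n using assms(3) by auto
  have adj: "dotp r (B *v k) = dotp (transpose B *v r) k" for k
    by (simp add: dotp_adjoint transpose_transpose)
  have scale: "dotp r (b *s w) = dotp r w * b" for w and b :: bit
    by (cases "b = 0") simp_all
  have lin: "A *v (B *v k + b *s w) + b *s z = (A ** B) *v k + b *s (A *v w + z)" for k w z and b :: bit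
    by (cases "b = 0") (simp_all add: matrix_vector_right_distrib matrix_vector_mul_assoc add.assoc)
  obtain k0 k n where g: "g = (k0, k, n)" by (cases g)
  show ?thesis
    unfolding g block_map_def prod.case par kappa_mult[OF assms(1,2)] lin dotp_add_right scale adj
    by (simp add: dotp_add_left distrib_right add_ac)
qed

lemma Sp4_dual_inverse:
  assumes "A \<in> Sp4"
  shows "transpose A *v ((C4 ** A ** C4) *v r) = r" "(C4 ** A ** C4) *v (transpose A *v r) = r"
proof -
  have "transpose A ** (C4 ** A ** C4) = mat 1" "C4 ** A ** C4 ** transpose A = mat 1"
    using Sp4_D(1,2)[of "transpose A"] assms by (simp_all add: Sp4_transpose transpose_transpose)
  then show "transpose A *v ((C4 ** A ** C4) *v r) = r" "(C4 ** A ** C4) *v (transpose A *v r) = r"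
    by (simp_all add: matrix_vector_mul_assoc)
qed

definition unit_of_bit :: "bit \<Rightarrow> int" where
  "unit_of_bit s = (if s = 1 then -1 else 1)"

lemma unit_of_bit: "unit_of_bit s \<in> {1, -1}" "unit_of_bit (s + t) = unit_of_bit s * unit_of_bit t"
    "unit_of_bit s = unit_of_bit t \<longleftrightarrow> s = t"
  by (cases s; cases t; simp add: unit_of_bit_def)+

definition kk5 :: "(bit ^ 4 ^ 4) \<times> bit \<Rightarrow> g5 \<Rightarrow> g5" where
  "kk5 = (\<lambda>(A, s). block_map A 0 0 (unit_of_bit s))"

definition nn5 :: "bit ^ 5 \<Rightarrow> g5 \<Rightarrow> g5" where
  "nn5 v = block_map (mat 1) (front v) (v $ 0) 1"

text \<open>\<open>C4 ** A ** C4\<close> is the inverse transpose of \<open>A\<close>, acting on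
  rows; the extra bit is the new row evaluated at \<open>kappa A\<close>. The sign acts trivially
  because only the parity of \<open>n\<close> enters the upper blocks.\<close>

definition rho5 :: "(bit ^ 4 ^ 4) \<times> bit \<Rightarrow> bit ^ 5 \<Rightarrow> bit ^ 5" where
  "rho5 = (\<lambda>(A, s) v. let r = (C4 ** A ** C4) *v front v in join5 r (v $ 0 + dotp r (kappa A)))"

lemma block_map_mult:
  assumes "A \<in> Sp4" "B \<in> Sp4" "m \<in> {1, -1}" "m' \<in> {1, -1}"
  shows "block_map A r e m \<otimes>\<^bsub>AutoGroup G5\<^esub> block_map B r' e' m'
    = block_map (A ** B) (r' + transpose B *v r) (e' + dotp r (kappa B) + e) (m * m')"
proof -
  have "block_map A r e m \<in> auto G5" "block_map B r' e' m' \<in> auto G5"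
    using assms block_map_weyl weyl_set_auto by blast+
  then show ?thesis using assms by (simp only: AutoGroup_G5_simps block_map_comp)
qed

lemma block_map_inj:
  "block_map A r e m = block_map B r' e' m' \<longleftrightarrow> A = B \<and> r = r' \<and> e = e' \<and> m = m'"
proof
  assume "block_map A r e m = block_map B r' e' m'"
  then have "block_matrix (block_map A r e m) = block_matrix (block_map B r' e' m')" by (simp only:)
  then show "A = B \<and> r = r' \<and> e = e' \<and> m = m'" by (simp add: block_matrix_block_map)
qed simp

sublocale semidirect_factors "AutoGroup G5" "Sp4_group \<times>\<times> (additive_group :: bit monoid)"
  "additive_group :: (bit ^ 5) monoid" kk5 nn5 rho5
proof (intro semidirect_factors.intro semidirect_factors_axioms.intro)
  let ?K = "Sp4_group \<times>\<times> (additive_group :: bit monoid)" and ?N = "additive_group :: (bit ^ 5) monoid"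
  have add: "group (additive_group :: 'z::ab_group_add monoid)"
    using comm_group_additive_group by (rule comm_group.axioms(2))
  show "group (AutoGroup G5)" "group ?K" "group ?N"
    using group_AutoGroup_G5 DirProd_group[OF group_Sp4 add] add by blast+
  have mem: "block_map A r e m \<in> carrier (AutoGroup G5)" if "A \<in> Sp4" "m \<in> {1, -1}" for A r e m
    using block_map_weyl[OF that] weyl_set_auto by (auto simp: AutoGroup_G5_simps(1))
  show "kk5 \<in> hom ?K (AutoGroup G5)"
  proof (rule homI)
    fix k l assume "k \<in> carrier ?K" "l \<in> carrier ?K"
    then show "kk5 (k \<otimes>\<^bsub>?K\<^esub> l) = kk5 k \<otimes>\<^bsub>AutoGroup G5\<^esub> kk5 l"
      by (cases k; cases l)
        (simp add: kk5_def block_map_mult unit_of_bit[simplified] DirProd_def Sp4_group_def)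
  next
    fix k assume "k \<in> carrier ?K"
    then show "kk5 k \<in> carrier (AutoGroup G5)"
      using mem[OF _ unit_of_bit(1)] by (cases k) (simp add: Sp4_group_def kk5_def)
  qed
  show "nn5 \<in> hom ?N (AutoGroup G5)"
    using mem[OF Sp4_one] by (intro homI)
      (simp_all add: nn5_def block_map_mult Sp4_one front_add transpose_simps add_ac)
  show "inj_on nn5 (carrier ?N)"
    by (rule inj_onI) (metis nn5_def block_map_inj join5_front)
  fix k assume k: "k \<in> carrier ?K"
  show "rho5 k \<in> extensional (carrier ?N)" by (simp add: additive_group_def)
  fix v :: "bit ^ 5"
  show "rho5 k v \<in> carrier ?N" by (simp add: additive_group_def)
  show "nn5 (rho5 k v) \<otimes>\<^bsub>AutoGroup G5\<^esub> kk5 k = kk5 k \<otimes>\<^bsub>AutoGroup G5\<^esub> nn5 v"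
    using k unit_of_bit(1)[of "snd k", simplified]
    by (cases k) (simp add: Sp4_group_def kk5_def nn5_def rho5_def Let_def block_map_mult Sp4_one
        Sp4_dual_inverse transpose_simps add.assoc)
qed

lemma semidirect_map:
  assumes "A \<in> Sp4"
  shows "nn5 v \<otimes>\<^bsub>AutoGroup G5\<^esub> kk5 (A, s)
    = block_map A (transpose A *v front v) (dotp (front v) (kappa A) + v $ 0) (unit_of_bit s)"
  using assms unit_of_bit(1)[of s, simplified] by (simp add: nn5_def kk5_def block_map_mult Sp4_one)

lemma weyl_group_semidirect:
  "WG \<cong> semidirect_product (Sp4_group \<times>\<times> (additive_group :: bit monoid))
    (additive_group :: (bit ^ 5) monoid) rho5"
proof (rule iso_of_same_image[OF weyl_embedding_mon _ _ semidirect_mult_closed])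
  let ?S = "semidirect_product (Sp4_group \<times>\<times> (additive_group :: bit monoid)) (additive_group :: (bit ^ 5) monoid) rho5"
  let ?g = "\<lambda>(k, x). nn5 x \<otimes>\<^bsub>AutoGroup G5\<^esub> kk5 k"
  have car: "carrier ?S = {((A, s), v) | A s v. A \<in> Sp4}"
    by (auto simp: semidirect_product_def DirProd_def Sp4_group_def)
  have "inj_on ?g (carrier ?S)"
  proof (rule inj_onI)
    fix p q assume "p \<in> carrier ?S" "q \<in> carrier ?S" and eq: "?g p = ?g q"
    then obtain A s v B t w where p: "p = ((A, s), v)" "A \<in> Sp4" and q: "q = ((B, t), w)" "B \<in> Sp4"
      unfolding car by blast
    from eq have AB: "A = B" "transpose A *v front v = transpose B *v front w"
      "dotp (front v) (kappa A) + v $ 0 = dotp (front w) (kappa B) + w $ 0" "s = t"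
      unfolding p(1) q(1) prod.case semidirect_map[OF p(2)] semidirect_map[OF q(2)] block_map_inj
        unit_of_bit(3) by blast+
    from AB(1,2) have fr: "front v = front w" by (metis Sp4_dual_inverse(2)[OF p(2)])
    then have "v $ 0 = w $ 0" using AB by simp
    with fr have "v = w" by (metis join5_front)
    then show "p = q" using p q AB by simp
  qed
  then show "?g \<in> mon ?S (AutoGroup G5)" using semidirect_hom by (simp add: mon_def)
  have "?g ` carrier ?S = weyl_set"
  proof (intro equalityI subsetI)
    fix \<phi> assume "\<phi> \<in> ?g ` carrier ?S"
    then obtain A s v where A: "A \<in> Sp4" and \<phi>: "\<phi> = ?g ((A, s), v)" unfolding car by blast
    show "\<phi> \<in> weyl_set" unfolding \<phi> prod.case semidirect_map[OF A] by (rule block_map_weyl[OF A unit_of_bit(1)])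
  next
    fix \<phi> assume "\<phi> \<in> weyl_set"
    then obtain A r e m where A: "A \<in> Sp4" and m: "m \<in> {1, -1}" and \<phi>: "\<phi> = block_map A r e m"
      by (rule weyl_set_block_form) (rule that)
    \<comment> \<open>Chosen so that \<open>transpose A\<close> returns \<open>r\<close>; the last
      bit of the witness compensates for the value at \<open>kappa A\<close>.\<close>
    let ?r = "(C4 ** A ** C4) *v r"
    have "m = unit_of_bit (of_bool (m = -1))" using m by (auto simp: unit_of_bit_def)
    moreover have "dotp ?r (kappa A) + (e + dotp ?r (kappa A)) = e" by (simp add: add.left_commute)
    ultimately have "\<phi> = ?g ((A, of_bool (m = -1)), join5 ?r (e + dotp ?r (kappa A)))"
      unfolding \<phi> prod.case semidirect_map[OF A] by (simp add: Sp4_dual_inverse(1)[OF A])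
    then show "\<phi> \<in> ?g ` carrier ?S" unfolding car using A by blast
  qed
  then show "weyl_embedding G5 \<Gamma> ` carrier WG = ?g ` carrier ?S" by (simp add: weyl_embedding_image)
qed

lemma weyl_matrices:
  "(\<lambda>w. block_matrix (weyl_embedding G5 \<Gamma> w)) ` carrier WG
    = {((1, r, e), (0, A, kappa A), (0, 0, m)) | A r e m. A \<in> Sp4 \<and> m \<in> {1, -1}}"
proof -
  have "(\<lambda>w. block_matrix (weyl_embedding G5 \<Gamma> w)) ` carrier WG = block_matrix ` weyl_set"
    by (simp add: image_image flip: weyl_embedding_image)
  also have "\<dots> = {block_matrix (block_map A r e m) | A r e m. A \<in> Sp4 \<and> m \<in> {1, -1}}"
    unfolding weyl_set_eq by blast
  finally show ?thesis by (simp only: block_matrix_block_map)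
qed

end

theorem proposition5p5:
  fixes \<alpha> :: "int \<Rightarrow> int \<Rightarrow> 'f :: {alg_closed_field, field_char_0}"
    and \<beta> :: "int \<Rightarrow> 'f"
    and \<iota> :: 'f
  assumes "e6_scalars \<alpha> \<beta>"
    and "\<iota>\<^sup>2 = -1"
  shows "fine_grading TYPE('h) G5 (e6_algebra \<alpha> \<beta>) (Gamma5 \<iota>)
    \<and> is_universal_group TYPE('h) G5 (e6_algebra \<alpha> \<beta>) (Gamma5 \<iota>)
    \<and> (\<forall>f \<in> Aut_grading G5 (e6_algebra \<alpha> \<beta>) (Gamma5 \<iota>). \<exists>!\<phi>. induces G5 (Gamma5 \<iota>) f \<phi>)
    \<and> weyl_embedding G5 (Gamma5 \<iota>)
        \<in> mon (weyl_group G5 (e6_algebra \<alpha> \<beta>) (Gamma5 \<iota>)) (AutoGroup G5)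
    \<and> (\<lambda>w. block_matrix (weyl_embedding G5 (Gamma5 \<iota>) w))
          ` carrier (weyl_group G5 (e6_algebra \<alpha> \<beta>) (Gamma5 \<iota>))
      = {((1, r, e), (0, A, kappa A), (0, 0, m)) | A r e m. A \<in> Sp4 \<and> m \<in> {1, -1}}
    \<and> (\<exists>\<rho> \<in> hom (Sp4_group \<times>\<times> (additive_group :: bit monoid))
                  (AutoGroup (additive_group :: (bit ^ 5) monoid)).
        weyl_group G5 (e6_algebra \<alpha> \<beta>) (Gamma5 \<iota>)
          \<cong> semidirect_product (Sp4_group \<times>\<times> (additive_group :: bit monoid))
              (additive_group :: (bit ^ 5) monoid) \<rho>)"
proof -
  interpret e6_lie \<alpha> \<beta> \<iota> using assms by unfold_locales
  show ?thesis
    by (intro conjI ballI fine_Gamma universal_Gamma induces_ex1 weyl_embedding_mon weyl_matrices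
        bexI[of _ rho5] weyl_group_semidirect \<rho>_hom)
qed

end
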